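(* Let $d,p,k\ge 1$ be integers. Let $F\in C^\infty(\mathbb{R}^d,\mathbb{R}^p)$ satisfy: $F(0)=0$; $JF(x)\neq 0$ for every $x\in F^{-1}(0)$; and there exist $\mathtt{m},\alpha>0$ and $R\ge 0$ such that $\|F(x)\|\ge \mathtt{m}\|x\|^{\alpha}$ for all $x\in\mathbb{R}^d$ with $\|x\|\ge R$. Let $\Psi\in C(\mathbb{R}^d,[0,+\infty))$ be such that there is $C_\Psi\ge 0$ with $\Psi(x)\le C_\Psi\exp[C_\Psi\|x\|^{\alpha k}]$ for all $x\in\mathbb{R}^d$, and $\Psi(x)>0$ for all $x\in F^{-1}(0)$. Then for any $\varepsilon\ge 0$, $\pi^\Psi_\varepsilon$ is well-defined. If in addition $\Psi$ is Lipschitz continuous, then there exist $A_2\ge 0$ and $\bar\varepsilon>0$ such that for every $\varepsilon\in(0,\bar\varepsilon)$ $$W_1(\pi^\Psi_\varepsilon,\pi^\Psi_0)\le A_2\,\varepsilon^{1/k}.$$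
   Context: For a differentiable map $F:\mathbb{R}^d\to\mathbb{R}^p$, $DF(x)$ is the $p\times d$ Jacobian matrix and the generalized Jacobian is $JF(x)=\det(DF(x)DF(x)^\top)^{1/2}$ if $d\ge p$ and $JF(x)=\det(DF(x)^\top DF(x))^{1/2}$ if $d\le p$; $JF(x)^{-1}$ denotes $1/JF(x)$. $\|\cdot\|$ is the Euclidean norm and $\mathcal{H}^r$ is the $r$-dimensional Hausdorff measure. For $\varepsilon>0$ and Borel $\mathsf{A}\subset\mathbb{R}^d$, $\pi^\Psi_\varepsilon(\mathsf{A})=\int_{\mathsf{A}}\Psi(x)\exp[-\|F(x)\|^k/\varepsilon]\,dx\big/\int_{\mathbb{R}^d}\Psi(x)\exp[-\|F(x)\|^k/\varepsilon]\,dx$, and $\pi^\Psi_0(\mathsf{A})=\int_{F^{-1}(0)\cap \mathsf{A}}\Psi(x)JF(x)^{-1}\,d\mathcal{H}^{d-\min(d,p)}(x)\big/\int_{F^{-1}(0)}\Psi(x)JF(x)^{-1}\,d\mathcal{H}^{d-\min(d,p)}(x)$. $W_1$ is the Wasserstein distance of order $1$ on $\mathbb{R}^d$ for the Euclidean distance.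
   Formalization: "For any ε ≥ 0, π_ε^Ψ is well-defined" fails for large ε (F(x)=x, k=2, Ψ=exp(x²), ε≥1: infinite normalizer); it is stated for ε ≥ 0 with ε·C_Ψ < m^k, and for all ε ≥ 0 when Ψ is Lipschitz. The W_1 bound is unchanged. *)

theory Defs
  imports "HOL-Probability.Probability"
begin

section \<open>Smooth maps and the generalized Jacobian\<close>

text \<open>In finite dimension, \<open>Ck_map n f\<close> holds iff all iterated partial derivatives of \<open>f\<close> of
  order at most \<open>n\<close> exist and are continuous: \<open>f\<close> is \<open>C\<^sup>n\<^sup>+\<^sup>1\<close> iff it is differentiable and every
  directional derivative \<open>\<lambda>x. Df(x) v\<close> is \<open>C\<^sup>n\<close>.\<close>

primrec Ck_map :: "nat \<Rightarrow> ('a::euclidean_space \<Rightarrow> 'b::euclidean_space) \<Rightarrow> bool" where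
  "Ck_map 0 f \<longleftrightarrow> continuous_on UNIV f"
| "Ck_map (Suc n) f \<longleftrightarrow>
     (\<forall>x. f differentiable (at x)) \<and> (\<forall>v. Ck_map n (\<lambda>x. frechet_derivative f (at x) v))"

definition smooth_map :: "('a::euclidean_space \<Rightarrow> 'b::euclidean_space) \<Rightarrow> bool" where
  "smooth_map f \<longleftrightarrow> (\<forall>n. Ck_map n f)"

text \<open>For \<open>F :: real ^ 'd \<Rightarrow> real ^ 'p\<close>, the library's \<open>jacobian F (at x)\<close> is the matrix with
  \<open>CARD('p)\<close> rows and \<open>CARD('d)\<close> columns.\<close>

definition gen_jacobian :: "(real ^ 'd \<Rightarrow> real ^ 'p) \<Rightarrow> real ^ 'd \<Rightarrow> real" where
  "gen_jacobian F x =
     (let D = jacobian F (at x) in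
      if CARD('d) \<ge> CARD('p) then sqrt (det (D ** transpose D))
      else sqrt (det (transpose D ** D)))"


section \<open>Hausdorff measure\<close>

text \<open>The empty set has size \<open>0\<close> also for \<open>r = 0\<close>, while \<open>0 ^ 0 = 1\<close> gives size \<open>1\<close> to a
  singleton, so that the measure for \<open>r = 0\<close> is the counting measure. Boundedness is required
  because \<^const>\<open>diameter\<close> is meaningful for bounded sets only.\<close>

definition hausdorff_size :: "nat \<Rightarrow> 'a::euclidean_space set \<Rightarrow> ennreal" where
  "hausdorff_size r U =
     (if U = {} then 0 else ennreal (unit_ball_vol (real r) * (diameter U / 2) ^ r))"

definition hausdorff_premeasure :: "nat \<Rightarrow> real \<Rightarrow> 'a::euclidean_space set \<Rightarrow> ennreal" where
  "hausdorff_premeasure r \<delta> A =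
     (INF U \<in> {U :: nat \<Rightarrow> 'a set. A \<subseteq> (\<Union>i. U i) \<and> (\<forall>i. bounded (U i) \<and> diameter (U i) \<le> \<delta>)}.
        (\<Sum>i. hausdorff_size r (U i)))"

definition hausdorff_outer :: "nat \<Rightarrow> 'a::euclidean_space set \<Rightarrow> ennreal" where
  "hausdorff_outer r A = (SUP \<delta> \<in> {0<..}. hausdorff_premeasure r \<delta> A)"

definition hausdorff_measure :: "nat \<Rightarrow> 'a::euclidean_space measure" where
  "hausdorff_measure r = measure_of UNIV (sets borel) (hausdorff_outer r)"

lemma sets_hausdorff_measure [simp, measurable_cong]: "sets (hausdorff_measure r) = sets borel"
  by (simp add: hausdorff_measure_def sets.sigma_sets_eq[of borel, unfolded space_borel])

lemma space_hausdorff_measure [simp]: "space (hausdorff_measure r) = UNIV"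
  by (simp add: hausdorff_measure_def)


section \<open>Normalized densities\<close>

definition normalizable :: "'a measure \<Rightarrow> ('a \<Rightarrow> ennreal) \<Rightarrow> bool" where
  "normalizable M f \<longleftrightarrow>
     f \<in> borel_measurable M \<and> 0 < (\<integral>\<^sup>+x. f x \<partial>M) \<and> (\<integral>\<^sup>+x. f x \<partial>M) < \<infinity>"

definition normalized :: "'a measure \<Rightarrow> ('a \<Rightarrow> ennreal) \<Rightarrow> 'a measure" where
  "normalized M f = scale_measure (1 / (\<integral>\<^sup>+x. f x \<partial>M)) (density M f)"

lemma emeasure_normalized:
  assumes "f \<in> borel_measurable M" "A \<in> sets M"
  shows "emeasure (normalized M f) A = (\<integral>\<^sup>+x\<in>A. f x \<partial>M) / (\<integral>\<^sup>+x. f x \<partial>M)"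
  using assms
  by (simp add: normalized_def emeasure_density divide_ennreal_def mult.commute)

lemma prob_space_normalized:
  assumes "normalizable M f"
  shows "prob_space (normalized M f)"
proof
  have f: "f \<in> borel_measurable M" and Z: "(\<integral>\<^sup>+x. f x \<partial>M) \<noteq> 0" "(\<integral>\<^sup>+x. f x \<partial>M) \<noteq> top"
    using assms by (auto simp: normalizable_def)
  have "(\<integral>\<^sup>+x\<in>space M. f x \<partial>M) = (\<integral>\<^sup>+x. f x \<partial>M)"
    by (intro nn_integral_cong) simp
  then show "emeasure (normalized M f) (space (normalized M f)) = 1"
    using Z emeasure_normalized[OF f sets.top]
    by (simp add: normalized_def space_scale_measure ennreal_divide_self top.not_eq_extremum)
qed


section \<open>The measures \<open>\<pi>\<close> with parameter \<open>\<epsilon>\<close>\<close>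

definition laplace_reference ::
    "(real ^ 'd \<Rightarrow> real ^ 'p) \<Rightarrow> real \<Rightarrow> (real ^ 'd) measure" where
  "laplace_reference F \<epsilon> =
     (if \<epsilon> = 0 then hausdorff_measure (CARD('d) - min CARD('d) CARD('p)) else lborel)"

definition laplace_weight ::
    "(real ^ 'd \<Rightarrow> real ^ 'p) \<Rightarrow> (real ^ 'd \<Rightarrow> real) \<Rightarrow> nat \<Rightarrow> real \<Rightarrow> real ^ 'd \<Rightarrow> ennreal" where
  "laplace_weight F \<Psi> k \<epsilon> x =
     (if \<epsilon> = 0 then ennreal (\<Psi> x * (1 / gen_jacobian F x)) * indicator (F -` {0}) x
      else ennreal (\<Psi> x * exp (- (norm (F x) ^ k / \<epsilon>))))"

definition laplace_measure ::
    "(real ^ 'd \<Rightarrow> real ^ 'p) \<Rightarrow> (real ^ 'd \<Rightarrow> real) \<Rightarrow> nat \<Rightarrow> real \<Rightarrow> (real ^ 'd) measure" where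
  "laplace_measure F \<Psi> k \<epsilon> = normalized (laplace_reference F \<epsilon>) (laplace_weight F \<Psi> k \<epsilon>)"

definition laplace_well_defined ::
    "(real ^ 'd \<Rightarrow> real ^ 'p) \<Rightarrow> (real ^ 'd \<Rightarrow> real) \<Rightarrow> nat \<Rightarrow> real \<Rightarrow> bool" where
  "laplace_well_defined F \<Psi> k \<epsilon> \<longleftrightarrow>
     normalizable (laplace_reference F \<epsilon>) (laplace_weight F \<Psi> k \<epsilon>)"


section \<open>Wasserstein distance of order one\<close>

definition couplings :: "'a measure \<Rightarrow> 'a measure \<Rightarrow> ('a \<times> 'a) measure set" where
  "couplings \<mu> \<nu> =
     {\<gamma>. prob_space \<gamma> \<and> sets \<gamma> = sets (\<mu> \<Otimes>\<^sub>M \<nu>) \<and> distr \<gamma> \<mu> fst = \<mu> \<and> distr \<gamma> \<nu> snd = \<nu>}"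

definition wasserstein1 :: "'a::metric_space measure \<Rightarrow> 'a measure \<Rightarrow> ennreal" where
  "wasserstein1 \<mu> \<nu> = (INF \<gamma> \<in> couplings \<mu> \<nu>. \<integral>\<^sup>+z. ennreal (dist (fst z) (snd z)) \<partial>\<gamma>)"

end

theory Submission
  imports Defs "HOL-Real_Asymp.Real_Asymp"
begin

text \<open>Write \<open>s = \<epsilon> powr (1 / k)\<close>, so that the weight is \<open>\<Psi> x * exp (- (norm (F x) / s) ^ k)\<close>,
  and let \<open>Z\<close> be the zero set of \<open>F\<close>, which the growth condition makes compact. As \<open>s\<close> tends to
  \<open>0\<close> the mass concentrates on a layer of width of order \<open>s\<close> around \<open>Z\<close>; the theorem says that moving
  this layer onto \<open>Z\<close> costs of order \<open>s\<close> and produces the surface measure with density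
  \<open>\<Psi> / gen_jacobian F\<close>.

  Near a point of \<open>Z\<close> there is a chart \<open>G\<close> whose coordinates indexed by a set \<open>J\<close> with
  \<open>min CARD('d) CARD('p)\<close> elements carry the value of \<open>F\<close> (exactly, or up to a quadratic error if
  \<open>CARD('p) > CARD('d)\<close>), while the remaining coordinates parametrize \<open>Z\<close>; the Jacobian determinant
  of \<open>G\<close> at its base point is the generalized Jacobian (\<open>adapted_frame_wide\<close>, \<open>adapted_frame_tall\<close>,
  \<open>level_chart_exists\<close>). In these coordinates the weighted Lebesgue measure has a density close to
  \<open>f (u) * exp (- norm (y / s) ^ k)\<close> with \<open>u\<close> tangent and \<open>y\<close> normal, and the Lipschitz bounds
  control the difference by a function of integral of order \<open>s ^ (card J + 1)\<close>. Projecting \<open>(u, y)\<close> to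
  \<open>(u, 0)\<close> therefore couples all but this much mass with a multiple of \<open>f (u) du\<close>, and the
  total transport cost is of the same order (\<open>local_coupling\<close>). The area formula identifies \<open>f (u) du\<close>
  with the surface measure of density \<open>\<Psi> / gen_jacobian F\<close> (\<open>nn_integral_surface\<close>).

  The area formula starts from the fact that \<open>r\<close>-dimensional Hausdorff measure on a coordinate plane
  is translation invariant, hence a constant multiple of Lebesgue measure
  (\<open>hausdorff_outer_coord_plane\<close>); it is transferred to \<open>Z\<close> by noting that on small pieces the chart
  followed by a suitable linear map is almost an isometry (\<open>hausdorff_image_comparison\<close>). This
  constant, like the factor \<open>normal_mass\<close> from the integration over normal directions, multiplies the whole limit
  measure and cancels in the normalization.

  Cutting \<open>\<Psi>\<close> into finitely many pieces supported in charts and adding the local couplings covers a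
  neighbourhood of \<open>Z\<close> (\<open>couplable_near_zero_set\<close>). Outside it \<open>norm (F x)\<close> is bounded
  below, so that the remaining mass and first moment are exponentially small in \<open>1 / s\<close>. The result is a
  partial coupling of two measures of mass of order \<open>s ^ card J\<close> that misses mass, moment and cost
  of order \<open>s ^ (card J + 1)\<close>; completing it by an independent coupling of the residuals and normalizing
  yields a Wasserstein distance of order \<open>s\<close> (\<open>wasserstein1_le_of_subcoupling\<close>).\<close>

section \<open>Hausdorff outer measure restricted to Borel sets\<close>

lemma hausdorff_premeasure_le:
  assumes "A \<subseteq> (\<Union>i. U i)" "\<And>i. bounded (U i)" "\<And>i. diameter (U i) \<le> \<delta>"
  shows "hausdorff_premeasure r \<delta> A \<le> (\<Sum>i. hausdorff_size r (U i))"
  unfolding hausdorff_premeasure_def using assms by (intro INF_lower) auto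

lemma hausdorff_premeasure_mono:
  "A \<subseteq> B \<Longrightarrow> hausdorff_premeasure r \<delta> A \<le> hausdorff_premeasure r \<delta> B"
  unfolding hausdorff_premeasure_def by (rule INF_superset_mono) auto

lemma hausdorff_premeasure_antimono:
  "\<delta> \<le> \<delta>' \<Longrightarrow> hausdorff_premeasure r \<delta>' A \<le> hausdorff_premeasure r \<delta> A"
  unfolding hausdorff_premeasure_def by (rule INF_superset_mono) (auto intro: order_trans)

lemma hausdorff_premeasure_le_outer:
  "\<delta> > 0 \<Longrightarrow> hausdorff_premeasure r \<delta> A \<le> hausdorff_outer r A"
  unfolding hausdorff_outer_def by (rule SUP_upper) auto

lemma hausdorff_outer_leI:
  "(\<And>\<delta>. \<delta> > 0 \<Longrightarrow> hausdorff_premeasure r \<delta> A \<le> C) \<Longrightarrow> hausdorff_outer r A \<le> C"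
  unfolding hausdorff_outer_def by (rule SUP_least) auto

lemma hausdorff_outer_mono: "A \<subseteq> B \<Longrightarrow> hausdorff_outer r A \<le> hausdorff_outer r B"
  by (meson hausdorff_outer_leI hausdorff_premeasure_le_outer hausdorff_premeasure_mono order_trans)

lemma hausdorff_size_empty [simp]: "hausdorff_size r {} = 0"
  by (simp add: hausdorff_size_def)

lemma hausdorff_size_mono:
  assumes "A \<subseteq> B" "bounded B" shows "hausdorff_size r A \<le> hausdorff_size r B"
  using assms diameter_subset[OF assms] diameter_ge_0[of A] bounded_subset[OF assms(2,1)]
  by (auto simp: hausdorff_size_def intro!: ennreal_leI mult_left_mono power_mono divide_right_mono)

lemma hausdorff_outer_empty [simp]: "hausdorff_outer r {} = 0"
proof -
  have "hausdorff_premeasure r \<delta> {} = 0" if "\<delta> > 0" for \<delta> and r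
    using hausdorff_premeasure_le[of "{}" "\<lambda>_. {}" \<delta> r] that by simp
  then show ?thesis using hausdorff_outer_leI[of r "{}" 0] by auto
qed

lemma hausdorff_premeasure_countable_Union:
  fixes A :: "nat \<Rightarrow> 'a::euclidean_space set"
  shows "hausdorff_premeasure r \<delta> (\<Union>i. A i) \<le> (\<Sum>i. hausdorff_premeasure r \<delta> (A i))"
proof (rule ennreal_le_epsilon)
  fix e :: real assume fin: "(\<Sum>i. hausdorff_premeasure r \<delta> (A i)) < top" and e: "0 < e"
  have fin': "hausdorff_premeasure r \<delta> (A i) < top" for i
    using fin by (metis ennreal_suminf_lessD)
  have "\<exists>U. A i \<subseteq> (\<Union>j. U j) \<and> (\<forall>j. bounded (U j) \<and> diameter (U j) \<le> \<delta>) \<and>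
      (\<Sum>j. hausdorff_size r (U j)) \<le> hausdorff_premeasure r \<delta> (A i) + ennreal (e * (1/2)^Suc i)"
    for i
  proof -
    have "hausdorff_premeasure r \<delta> (A i) < hausdorff_premeasure r \<delta> (A i) + ennreal (e * (1/2)^Suc i)"
    proof -
      have "0 < ennreal (e * (1/2)^Suc i)"
        using e by simp
      then show ?thesis using fin'[of i]
        by (metis add.right_neutral ennreal_add_left_cancel_less infinity_ennreal_def less_irrefl)
    qed
    then show ?thesis
      unfolding hausdorff_premeasure_def INF_less_iff by (auto intro: less_imp_le)
  qed
  then obtain U where U: "\<And>i. A i \<subseteq> (\<Union>j. U i j)" "\<And>i j. bounded (U i j)"
      "\<And>i j. diameter (U i j) \<le> \<delta>"
      "\<And>i. (\<Sum>j. hausdorff_size r (U i j)) \<le> hausdorff_premeasure r \<delta> (A i) + ennreal (e * (1/2)^Suc i)"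
    by metis
  define V where "V n = (case prod_decode n of (i, j) \<Rightarrow> U i j)" for n
  have "hausdorff_premeasure r \<delta> (\<Union>i. A i) \<le> (\<Sum>n. hausdorff_size r (V n))"
  proof (rule hausdorff_premeasure_le)
    show "(\<Union>i. A i) \<subseteq> (\<Union>n. V n)"
    proof
      fix x assume "x \<in> (\<Union>i. A i)"
      then obtain i j where "x \<in> U i j" using U(1) by blast
      then have "x \<in> V (prod_encode (i, j))" by (simp add: V_def)
      then show "x \<in> (\<Union>n. V n)" by blast
    qed
  qed (auto simp: V_def U split: prod.split)
  also have "\<dots> = (\<Sum>i. \<Sum>j. hausdorff_size r (U i j))"
    using suminf_ennreal_2dimen[of "\<lambda>i. \<Sum>j. hausdorff_size r (U i j)"
        "\<lambda>(i,j). hausdorff_size r (U i j)"]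
    by (simp add: V_def comp_def case_prod_unfold)
  also have "\<dots> \<le> (\<Sum>i. hausdorff_premeasure r \<delta> (A i) + ennreal (e * (1/2)^Suc i))"
    by (intro suminf_le U summableI)
  also have "\<dots> = (\<Sum>i. hausdorff_premeasure r \<delta> (A i)) + (\<Sum>i. ennreal (e * (1/2)^Suc i))"
    by (intro suminf_add[symmetric] summableI)
  also have "(\<Sum>i. ennreal (e * (1/2)^Suc i)) = ennreal e"
    using e sums_mult[OF power_half_series, of e] by (intro suminf_ennreal_eq) auto
  finally show "hausdorff_premeasure r \<delta> (\<Union>i. A i) \<le> (\<Sum>i. hausdorff_premeasure r \<delta> (A i)) + ennreal e"
    by simp
qed

lemma hausdorff_outer_countable_Union:
  "hausdorff_outer r (\<Union>i::nat. A i) \<le> (\<Sum>i. hausdorff_outer r (A i))"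
proof (rule hausdorff_outer_leI)
  fix \<delta> :: real assume "\<delta> > 0"
  then have "(\<Sum>i. hausdorff_premeasure r \<delta> (A i)) \<le> (\<Sum>i. hausdorff_outer r (A i))"
    by (intro suminf_le hausdorff_premeasure_le_outer summableI)
  with hausdorff_premeasure_countable_Union[of r \<delta> A]
  show "hausdorff_premeasure r \<delta> (\<Union>i. A i) \<le> (\<Sum>i. hausdorff_outer r (A i))" by simp
qed

lemma outer_measure_space_hausdorff:
  "outer_measure_space (Pow UNIV) (hausdorff_outer r)"
  unfolding outer_measure_space_def positive_def increasing_def countably_subadditive_def
  using hausdorff_outer_mono hausdorff_outer_countable_Union by auto

lemma hausdorff_outer_Un: "hausdorff_outer r (A \<union> B) \<le> hausdorff_outer r A + hausdorff_outer r B"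
proof -
  define C :: "nat \<Rightarrow> 'a set" where "C i = (if i = 0 then A else if i = 1 then B else {})" for i
  have "A \<union> B = (\<Union>i. C i)" by (auto simp: C_def split: if_splits)
  moreover have "(\<Sum>i. hausdorff_outer r (C i)) = (\<Sum>i<2. hausdorff_outer r (C i))"
    by (rule suminf_finite) (auto simp: C_def)
  ultimately show ?thesis
    using hausdorff_outer_countable_Union[of r C] by (simp add: C_def numeral_2_eq_2)
qed

text \<open>Covering sets of diameter less than \<open>d\<close> meet at most one of \<open>A\<close> and \<open>B\<close>. This is the metric
  property from which Caratheodory's criterion derives the measurability of closed sets.\<close>

lemma hausdorff_outer_Un_separated:
  assumes d: "d > 0" and sep: "\<And>x y. x \<in> A \<Longrightarrow> y \<in> B \<Longrightarrow> dist x y \<ge> d"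
  shows "hausdorff_outer r A + hausdorff_outer r B \<le> hausdorff_outer r (A \<union> B)"
proof -
  have pre: "hausdorff_premeasure r \<delta> A + hausdorff_premeasure r \<delta> B \<le> hausdorff_premeasure r \<delta> (A \<union> B)"
    if \<delta>: "\<delta> < d" for \<delta>
    unfolding hausdorff_premeasure_def[of r \<delta> "A \<union> B"]
  proof (rule INF_greatest, clarify)
    fix U :: "nat \<Rightarrow> 'a set"
    assume cov: "A \<union> B \<subseteq> \<Union> (range U)" and U: "\<forall>i. bounded (U i) \<and> diameter (U i) \<le> \<delta>"
    have *: "diameter (U i \<inter> C) \<le> \<delta>" "bounded (U i \<inter> C)" for i C
      using U diameter_subset[of "U i \<inter> C" "U i"] by (auto intro: bounded_subset order_trans)
    have "hausdorff_premeasure r \<delta> A + hausdorff_premeasure r \<delta> B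
        \<le> (\<Sum>i. hausdorff_size r (U i \<inter> A)) + (\<Sum>i. hausdorff_size r (U i \<inter> B))"
      using cov by (intro add_mono hausdorff_premeasure_le *) auto
    also have "\<dots> = (\<Sum>i. hausdorff_size r (U i \<inter> A) + hausdorff_size r (U i \<inter> B))"
      by (intro suminf_add summableI)
    also have "\<dots> \<le> (\<Sum>i. hausdorff_size r (U i))"
    proof (intro suminf_le summableI)
      fix i
      have "U i \<inter> A = {} \<or> U i \<inter> B = {}"
      proof (rule ccontr)
        assume "\<not> ?thesis"
        then obtain x y where "x \<in> U i" "x \<in> A" "y \<in> U i" "y \<in> B" by auto
        then have "d \<le> \<delta>" using sep[of x y] U diameter_bounded_bound[of "U i" x y] by (meson order_trans)
        with \<delta> show False by simp
      qed
      then show "hausdorff_size r (U i \<inter> A) + hausdorff_size r (U i \<inter> B) \<le> hausdorff_size r (U i)"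
        using hausdorff_size_mono[of "U i \<inter> A" "U i"] hausdorff_size_mono[of "U i \<inter> B" "U i"] U by auto
    qed
    finally show "hausdorff_premeasure r \<delta> A + hausdorff_premeasure r \<delta> B \<le> (\<Sum>i. hausdorff_size r (U i))" .
  qed
  have "hausdorff_premeasure r \<delta>\<^sub>1 A + hausdorff_premeasure r \<delta>\<^sub>2 B \<le> hausdorff_outer r (A \<union> B)"
    if "\<delta>\<^sub>1 > 0" "\<delta>\<^sub>2 > 0" for \<delta>\<^sub>1 \<delta>\<^sub>2
  proof -
    define \<delta> where "\<delta> = min (min \<delta>\<^sub>1 \<delta>\<^sub>2) (d/2)"
    have "\<delta> > 0" "\<delta> < d" "\<delta> \<le> \<delta>\<^sub>1" "\<delta> \<le> \<delta>\<^sub>2" using that d by (auto simp: \<delta>_def)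
    then show ?thesis
      by (meson add_mono hausdorff_premeasure_antimono hausdorff_premeasure_le_outer pre order_trans)
  qed
  then show ?thesis
    unfolding hausdorff_outer_def[of r A] hausdorff_outer_def[of r B]
    by (auto simp: ennreal_SUP_add_left[symmetric] ennreal_SUP_add_right intro!: SUP_least)
qed

text \<open>The points of \<open>X - C\<close> are sorted into annuli \<open>R n\<close> according to their distance from
  \<open>C\<close>. Annuli of the same parity are separated from each other, so the series of their outer measures converges;
  its tail bounds the part of \<open>X - C\<close> that is not at positive distance from \<open>C\<close>.\<close>

lemma hausdorff_outer_closed_split:
  fixes C :: "'a::euclidean_space set"
  assumes C: "closed C"
  shows "hausdorff_outer r (X \<inter> C) + hausdorff_outer r (X - C) \<le> hausdorff_outer r X"
proof (cases "C = {} \<or> hausdorff_outer r X = top")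
  case True then show ?thesis by auto
next
  case False
  then have ne: "C \<noteq> {}" and fin: "hausdorff_outer r X < top" by (auto simp: less_top)
  let ?H = "hausdorff_outer r" and ?d = "\<lambda>x. infdist x C"
  define S where "S n = {x \<in> X. 1 / real n \<le> ?d x}" for n
  define R where "R n = {x \<in> X. 1 / (real n + 1) \<le> ?d x \<and> ?d x < 1 / real n}" for n
  have sep: "?H A + ?H B \<le> ?H (A \<union> B)"
    if "b < a" "\<And>x. x \<in> A \<Longrightarrow> a \<le> ?d x" "\<And>y. y \<in> B \<Longrightarrow> ?d y \<le> b" for a b A B
  proof (rule hausdorff_outer_Un_separated[of "a - b"])
    fix x y assume "x \<in> A" "y \<in> B"
    then have "a \<le> ?d x" "?d y \<le> b" using that by auto
    then show "a - b \<le> dist x y"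
      using infdist_triangle[of x C y] by linarith
  qed (use that in auto)
  (* Separation is applied one annulus at a time: S (2N + j - 1) lies strictly farther from C than R (2N + j). *)
  have odd_even: "(\<Sum>k<N. ?H (R (2*k+j))) \<le> ?H (S (2*N+j-1))"
    if "j \<ge> 2" for N j :: nat
  proof (induction N)
    case (Suc N)
    have "(\<Sum>k<Suc N. ?H (R (2*k+j))) \<le> ?H (S (2*N+j-1)) + ?H (R (2*N+j))"
      using Suc by (auto intro: add_right_mono)
    also have "\<dots> \<le> ?H (S (2*N+j-1) \<union> R (2*N+j))"
      using that
      by (intro sep[of "1 / (real (2*N+j))" "1 / (real (2*N+j-1))"])
         (auto simp: S_def R_def of_nat_diff intro!: divide_strict_left_mono)
    also have "\<dots> \<le> ?H (S (2*Suc N+j-1))"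
    proof (rule hausdorff_outer_mono, rule subsetI)
      fix x assume x: "x \<in> S (2*N+j-1) \<union> R (2*N+j)"
      have "1 / (real (2*Suc N+j-1)) \<le> 1 / (real (2*N+j-1))"
        using that by (intro divide_left_mono) auto
      moreover have "2*Suc N+j-1 = Suc (2*N+j)" using that by simp
      ultimately show "x \<in> S (2*Suc N+j-1)"
        using x by (auto simp: S_def R_def add_ac)
    qed
    finally show ?case .
  qed simp
  have odd_even': "(\<Sum>k<N. ?H (R (2*k+j))) \<le> ?H X" if "j \<ge> 2" for N j :: nat
    using odd_even[OF that, of N] hausdorff_outer_mono[of "S (2*N+j-1)" X r] by (auto simp: S_def)
  define f where "f k = ?H (R (k + 2))" for k
  have "(\<Sum>k<2*N. f k) = (\<Sum>k<N. ?H (R (2*k+2))) + (\<Sum>k<N. ?H (R (2*k+3)))" for N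
    by (induction N) (simp_all add: f_def ac_simps eval_nat_numeral)
  then have two: "(\<Sum>k<2*N. f k) \<le> ?H X + ?H X" for N
    using add_mono[OF odd_even'[of 2 N] odd_even'[of 3 N]] by simp
  have f_sum: "suminf f \<le> ?H X + ?H X"
  proof (rule suminf_le_const[OF summableI])
    fix n have "sum f {..<n} \<le> sum f {..<2*n}" by (intro sum_mono2) auto
    also note two finally show "sum f {..<n} \<le> ?H X + ?H X" .
  qed
  then have f_fin: "suminf f < top" using fin by (auto simp: order_le_less_trans)
  then have f_fin': "f k < top" for k by (rule ennreal_suminf_lessD)
  define g where "g k = enn2real (f k)" for k
  have fg: "f k = ennreal (g k)" and g0: "g k \<ge> 0" for k using f_fin'[of k] by (auto simp: g_def)
  have "summable g"
    using f_fin g0 unfolding fg[abs_def] by (intro summable_suminf_not_top) auto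
  show ?thesis
  proof (rule ennreal_le_epsilon)
    fix e :: real assume "0 < e"
    obtain N where N: "\<And>n. n \<ge> N \<Longrightarrow> norm (\<Sum>i. g (i + n)) < e"
      using suminf_exist_split[OF \<open>0 < e\<close> \<open>summable g\<close>] by auto
    have tail: "(\<Sum>i. f (i + N)) \<le> ennreal e"
    proof -
      have "(\<Sum>i. f (i + N)) = ennreal (\<Sum>i. g (i + N))"
        unfolding fg using g0 \<open>summable g\<close> by (intro suminf_ennreal2) auto
      then show ?thesis using N[of N] by (auto intro!: ennreal_leI)
    qed
    have cover: "X - C \<subseteq> S (N + 2) \<union> (\<Union>i. R (i + N + 2))"
    proof
      fix x assume x: "x \<in> X - C"
      then have pos: "?d x > 0"
        using C ne by (metis DiffE in_closed_iff_infdist_zero infdist_nonneg less_eq_real_def)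
      show "x \<in> S (N + 2) \<union> (\<Union>i. R (i + N + 2))"
      proof (cases "x \<in> S (N + 2)")
        case False
        then have less: "?d x < 1 / real (N + 2)" using x by (auto simp: S_def)
        define n where "n = nat (\<lceil>1 / ?d x\<rceil> - 1)"
        have gt: "1 / ?d x > real (N + 2)" using less pos by (simp add: field_simps)
        have n: "real n < 1 / ?d x" "1 / ?d x \<le> real n + 1" "n \<ge> N + 2"
          using gt unfolding n_def by linarith+
        have "n > 0" using n(3) by simp
        have "1 / (real n + 1) \<le> ?d x" "?d x < 1 / real n"
          using n(1,2) pos \<open>n > 0\<close> by (simp_all add: field_simps)
        then have "x \<in> R n" using x by (auto simp: R_def)
        moreover have "n = (n - (N + 2)) + N + 2" using n(3) by simp
        ultimately show ?thesis by (metis UN_I UNIV_I UnI2)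
      qed simp
    qed
    have "?H (X \<inter> C) + ?H (X - C) \<le> ?H (X \<inter> C) + (?H (S (N+2)) + ?H (\<Union>i. R (i + N + 2)))"
      by (intro add_left_mono order_trans[OF hausdorff_outer_mono[OF cover]] hausdorff_outer_Un)
    also have "\<dots> = (?H (S (N+2)) + ?H (X \<inter> C)) + ?H (\<Union>i. R (i + N + 2))"
      by (simp add: ac_simps)
    also have "\<dots> \<le> ?H (S (N+2) \<union> (X \<inter> C)) + ?H (\<Union>i. R (i + N + 2))"
      by (intro add_right_mono sep[of 0 "1 / real (N+2)"]) (auto simp: S_def)
    also have "\<dots> \<le> ?H X + (\<Sum>i. ?H (R (i + N + 2)))"
      by (intro add_mono hausdorff_outer_mono hausdorff_outer_countable_Union) (auto simp: S_def)
    also have "\<dots> \<le> ?H X + ennreal e"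
      using tail by (intro add_left_mono) (simp add: f_def)
    finally show "?H (X \<inter> C) + ?H (X - C) \<le> ?H X + ennreal e" .
  qed
qed

lemma measure_space_hausdorff_outer:
  "measure_space UNIV (sets (borel :: 'a::euclidean_space measure)) (hausdorff_outer r)"
proof -
  interpret sigma_algebra "UNIV :: 'a set" "Pow UNIV" by (rule sigma_algebra_Pow)
  let ?L = "lambda_system (UNIV :: 'a set) (Pow UNIV) (hausdorff_outer r)"
  have ms: "measure_space UNIV ?L (hausdorff_outer r)"
    by (rule caratheodory_lemma[OF outer_measure_space_hausdorff])
  then have L: "sigma_algebra UNIV ?L" by (simp add: measure_space_def)
  have "{C. closed C} \<subseteq> ?L"
  proof clarify
    fix C :: "'a set" assume C: "closed C"
    have "hausdorff_outer r (X \<inter> C) + hausdorff_outer r (X - C) = hausdorff_outer r X" for X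
      using hausdorff_outer_closed_split[OF C, of r X] hausdorff_outer_Un[of r "X \<inter> C" "X - C"]
      by (simp add: Int_Diff_Un antisym)
    then show "C \<in> ?L" unfolding lambda_system_eq by simp
  qed
  then have "sets (borel :: 'a measure) \<subseteq> ?L"
    unfolding borel_eq_closed using sigma_algebra.sigma_sets_subset[OF L]
    by (simp add: sets_measure_of)
  then show ?thesis
    using ms sets.sigma_algebra_axioms[of "borel :: 'a measure"]
    unfolding measure_space_def positive_def countably_additive_def by auto
qed

lemma emeasure_hausdorff_measure:
  assumes "A \<in> sets (borel :: 'a::euclidean_space measure)"
  shows "emeasure (hausdorff_measure r) A = hausdorff_outer r A"
proof (rule emeasure_measure_of[OF hausdorff_measure_def])
  show "A \<in> sets (hausdorff_measure r)" using assms by simp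
  show "positive (sets (hausdorff_measure r)) (hausdorff_outer r :: 'a set \<Rightarrow> ennreal)"
    and "countably_additive (sets (hausdorff_measure r)) (hausdorff_outer r :: 'a set \<Rightarrow> ennreal)"
    using measure_space_hausdorff_outer[of r, where 'a='a] by (auto simp: measure_space_def positive_def countably_additive_def)
qed simp

lemma hausdorff_size_lipschitz_image:
  assumes "L > 0" and lip: "\<And>x y. x \<in> U \<Longrightarrow> y \<in> U \<Longrightarrow> dist (f x) (f y) \<le> L * dist x y"
    and "bounded U"
  shows "bounded (f ` U)" "diameter (f ` U) \<le> L * diameter U"
    "hausdorff_size r (f ` U) \<le> ennreal (L ^ r) * hausdorff_size r U"
proof -
  have *: "dist (f x) (f y) \<le> L * diameter U" if "x \<in> U" "y \<in> U" for x y
    using lip[OF that] diameter_bounded_bound[OF assms(3) that] \<open>L > 0\<close>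
    by (meson mult_left_mono less_imp_le order_trans)
  show "bounded (f ` U)"
    unfolding bounded_two_points using * by auto
  show d: "diameter (f ` U) \<le> L * diameter U"
  proof (rule diameter_le)
    show "f ` U \<noteq> {} \<or> 0 \<le> L * diameter U" using \<open>L > 0\<close> diameter_ge_0[OF assms(3)] by simp
    show "\<And>x y. x \<in> f ` U \<Longrightarrow> y \<in> f ` U \<Longrightarrow> norm (x - y) \<le> L * diameter U"
      using * by (auto simp: dist_norm)
  qed
  have "(diameter (f ` U) / 2) ^ r \<le> (L * (diameter U / 2)) ^ r"
    using d diameter_ge_0[OF \<open>bounded (f ` U)\<close>] by (intro power_mono) auto
  then have "unit_ball_vol (real r) * (diameter (f ` U) / 2) ^ r
      \<le> L ^ r * (unit_ball_vol (real r) * (diameter U / 2) ^ r)"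

    using mult_left_mono[of "(diameter (f ` U) / 2) ^ r" "L ^ r * (diameter U / 2) ^ r" "unit_ball_vol (real r)"]
    by (simp add: power_mult_distrib power_divide mult.left_commute)
  then show "hausdorff_size r (f ` U) \<le> ennreal (L ^ r) * hausdorff_size r U"
    using \<open>L > 0\<close> by (auto simp: hausdorff_size_def ennreal_mult'[symmetric] intro!: ennreal_leI)
qed

text \<open>A cover of \<open>E\<close> by small sets is mapped to a cover of \<open>f ` E\<close>, with diameters multiplied by at most \<open>L\<close>.\<close>

lemma hausdorff_outer_lipschitz_image:
  assumes "L > 0" and lip: "\<And>x y. x \<in> E \<Longrightarrow> y \<in> E \<Longrightarrow> dist (f x) (f y) \<le> L * dist x y"
  shows "hausdorff_outer r (f ` E) \<le> ennreal (L ^ r) * hausdorff_outer r E"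
proof (rule hausdorff_outer_leI)
  fix \<delta> :: real assume "\<delta> > 0"
  have "ennreal (1 / L ^ r) * hausdorff_premeasure r \<delta> (f ` E) \<le> hausdorff_premeasure r (\<delta> / L) E"
    unfolding hausdorff_premeasure_def[of r "\<delta> / L"]
  proof (rule INF_greatest, clarify)
    fix U :: "nat \<Rightarrow> 'a set"
    assume cov: "E \<subseteq> \<Union> (range U)" and U: "\<forall>i. bounded (U i) \<and> diameter (U i) \<le> \<delta> / L"
    have b: "bounded (U i \<inter> E)" "diameter (U i \<inter> E) \<le> \<delta> / L" for i
      using U diameter_subset[of "U i \<inter> E" "U i"] by (auto intro: bounded_subset order_trans)
    have l: "dist (f x) (f y) \<le> L * dist x y" if "x \<in> U i \<inter> E" "y \<in> U i \<inter> E" for i x y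
      using lip that by auto
    have "hausdorff_premeasure r \<delta> (f ` E) \<le> (\<Sum>i. hausdorff_size r (f ` (U i \<inter> E)))"
    proof (rule hausdorff_premeasure_le)
      show "bounded (f ` (U i \<inter> E))" for i
        using hausdorff_size_lipschitz_image(1)[OF \<open>L > 0\<close> l b(1)] .
      show "diameter (f ` (U i \<inter> E)) \<le> \<delta>" for i
        using hausdorff_size_lipschitz_image(2)[OF \<open>L > 0\<close> l b(1), of i] b(2)[of i] \<open>L > 0\<close>
        by (simp add: field_simps) (meson mult.commute order_trans)
      show "f ` E \<subseteq> (\<Union>i. f ` (U i \<inter> E))"
      proof
        fix y assume "y \<in> f ` E"
        then obtain x where x: "x \<in> E" "y = f x" by auto
        then obtain i where "x \<in> U i" using cov by auto
        with x show "y \<in> (\<Union>i. f ` (U i \<inter> E))" by auto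
      qed
    qed
    also have "\<dots> \<le> (\<Sum>i. ennreal (L ^ r) * hausdorff_size r (U i))"
      using U by (intro suminf_le summableI order_trans[OF hausdorff_size_lipschitz_image(3)[OF \<open>L > 0\<close> l b(1)]]
         mult_left_mono hausdorff_size_mono) auto
    finally have "ennreal (1 / L ^ r) * hausdorff_premeasure r \<delta> (f ` E)
        \<le> ennreal (1 / L ^ r) * (ennreal (L ^ r) * (\<Sum>i. hausdorff_size r (U i)))"
      by (intro mult_left_mono) auto
    also have "\<dots> = (\<Sum>i. hausdorff_size r (U i))"
      using \<open>L > 0\<close> by (simp add: mult.assoc[symmetric] ennreal_mult'[symmetric])
    finally show "ennreal (1 / L ^ r) * hausdorff_premeasure r \<delta> (f ` E) \<le> (\<Sum>i. hausdorff_size r (U i))" .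
  qed
  then have "ennreal (L ^ r) * (ennreal (1 / L ^ r) * hausdorff_premeasure r \<delta> (f ` E))
      \<le> ennreal (L ^ r) * hausdorff_premeasure r (\<delta> / L) E"
    by (intro mult_left_mono) auto
  moreover have "ennreal (L ^ r) * (ennreal (1 / L ^ r) * hausdorff_premeasure r \<delta> (f ` E))
      = hausdorff_premeasure r \<delta> (f ` E)"
    using \<open>L > 0\<close> by (simp add: mult.assoc[symmetric] ennreal_mult'[symmetric])
  ultimately have "hausdorff_premeasure r \<delta> (f ` E) \<le> ennreal (L ^ r) * hausdorff_premeasure r (\<delta> / L) E"
    by simp
  also have "\<dots> \<le> ennreal (L ^ r) * hausdorff_outer r E"
    using \<open>\<delta> > 0\<close> \<open>L > 0\<close> by (intro mult_left_mono hausdorff_premeasure_le_outer) auto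
  finally show "hausdorff_premeasure r \<delta> (f ` E) \<le> ennreal (L ^ r) * hausdorff_outer r E" .
qed

lemma hausdorff_outer_isometric_image:
  assumes "\<And>x y. x \<in> E \<Longrightarrow> y \<in> E \<Longrightarrow> dist (f x) (f y) = dist x y"
  shows "hausdorff_outer r (f ` E) = hausdorff_outer r E"
proof (rule antisym)
  show "hausdorff_outer r (f ` E) \<le> hausdorff_outer r E"
    using hausdorff_outer_lipschitz_image[of 1 E f r] assms by simp
  have inj: "inj_on f E" using assms by (metis dist_eq_0_iff inj_onI)
  have "hausdorff_outer r (the_inv_into E f ` f ` E) \<le> ennreal (1 ^ r) * hausdorff_outer r (f ` E)"
  proof (rule hausdorff_outer_lipschitz_image)
    fix x y assume "x \<in> f ` E" "y \<in> f ` E"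
    then show "dist (the_inv_into E f x) (the_inv_into E f y) \<le> 1 * dist x y"
      using assms inj by (auto simp: the_inv_into_f_f)
  qed simp
  moreover have "the_inv_into E f ` f ` E = E" using inj by (force simp: the_inv_into_f_f image_image)
  ultimately show "hausdorff_outer r E \<le> hausdorff_outer r (f ` E)" by simp
qed

section \<open>Lebesgue measure on coordinate planes\<close>

definition coord_proj :: "'n set \<Rightarrow> real ^ 'n \<Rightarrow> real ^ 'n" where
  "coord_proj I x = (\<chi> i. if i \<in> I then x $ i else 0)"

lemma coord_proj_nth [simp]: "coord_proj I x $ i = (if i \<in> I then x $ i else 0)"
  by (simp add: coord_proj_def)

lemma linear_coord_proj: "linear (coord_proj I)"
  by (rule linearI) (auto simp: vec_eq_iff)

lemma bounded_linear_coord_proj: "bounded_linear (coord_proj I)"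
  using linear_coord_proj linear_conv_bounded_linear by blast

lemma borel_measurable_coord_proj [measurable]: "coord_proj I \<in> borel_measurable borel"
  by (intro borel_measurable_continuous_onI linear_continuous_on bounded_linear_coord_proj)

lemma continuous_on_coord_proj [continuous_intros]:
  "continuous_on S f \<Longrightarrow> continuous_on S (\<lambda>x. coord_proj I (f x))"
  using bounded_linear.continuous_on[OF bounded_linear_coord_proj] by blast

lemma coord_proj_simps [simp]:
  "coord_proj I 0 = 0"
  "coord_proj I (x + y) = coord_proj I x + coord_proj I y"
  "coord_proj I (x - y) = coord_proj I x - coord_proj I y"
  "coord_proj I (- x) = - coord_proj I x"
  "coord_proj I (c *\<^sub>R x) = c *\<^sub>R coord_proj I x"
  "coord_proj I (coord_proj I x) = coord_proj I x"
  "coord_proj I (coord_proj (- I) x) = 0"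
  "coord_proj (- I) (coord_proj I x) = 0"
  by (auto simp: vec_eq_iff)

lemma coord_proj_add_compl [simp]:
  "coord_proj I x + coord_proj (- I) x = x" "coord_proj (- I) x + coord_proj I x = x"
  by (auto simp: vec_eq_iff)

lemma coord_proj_zero_iff: "coord_proj (- I) x = 0 \<longleftrightarrow> coord_proj I x = x"
  by (auto simp: vec_eq_iff)

lemma norm_coord_proj_le: "norm (coord_proj I x) \<le> norm x"
  unfolding norm_vec_def by (rule L2_set_mono) auto

text \<open>Fixing the coordinates outside \<open>I\<close> in unit intervals makes the projection to the plane of the \<open>I\<close>-coordinates
  send Lebesgue measure of the slab to Lebesgue measure of the plane. In this way all planes of dimension at most
  \<open>CARD('n)\<close> live in the single type \<open>real ^ 'n\<close>, which is what dimensions depending on \<open>'d\<close> and \<open>'p\<close> require.\<close>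

definition slab :: "'n set \<Rightarrow> (real ^ 'n) set" where
  "slab I = {z. \<forall>j\<in>- I. 0 < z $ j \<and> z $ j < 1}"

lemma slab_measurable [measurable]: "slab I \<in> sets borel"
  unfolding slab_def by measurable

definition coord_lborel :: "'n set \<Rightarrow> (real ^ 'n) measure" where
  "coord_lborel I = distr (density lborel (indicator (slab I))) borel (coord_proj I)"

lemma sets_coord_lborel [simp, measurable_cong]: "sets (coord_lborel I) = sets borel"
  and space_coord_lborel [simp]: "space (coord_lborel I) = UNIV"
  by (simp_all add: coord_lborel_def)

lemma nn_integral_coord_lborel:
  assumes [measurable]: "f \<in> borel_measurable borel"
  shows "(\<integral>\<^sup>+u. f u \<partial>coord_lborel I) = (\<integral>\<^sup>+z. f (coord_proj I z) * indicator (slab I) z \<partial>lborel)"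
  unfolding coord_lborel_def
  by (subst nn_integral_distr, simp, simp, subst nn_integral_density) (auto simp: mult.commute)

lemma nn_integral_coord_lborel_proj:
  assumes [measurable]: "f \<in> borel_measurable borel"
  shows "(\<integral>\<^sup>+u. f (coord_proj I u) \<partial>coord_lborel I) = (\<integral>\<^sup>+u. f u \<partial>coord_lborel I)"
  by (simp add: nn_integral_coord_lborel)

lemma emeasure_coord_lborel:
  assumes [measurable]: "A \<in> sets borel"
  shows "emeasure (coord_lborel I) A = emeasure lborel {z \<in> slab I. coord_proj I z \<in> A}"
proof -
  have "emeasure (coord_lborel I) A = (\<integral>\<^sup>+u. indicator A u \<partial>coord_lborel I)" by simp
  also have "\<dots> = (\<integral>\<^sup>+z. indicator {z \<in> slab I. coord_proj I z \<in> A} z \<partial>lborel)"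
    by (subst nn_integral_coord_lborel, simp, intro nn_integral_cong) (auto split: split_indicator)
  also have "\<dots> = emeasure lborel {z \<in> slab I. coord_proj I z \<in> A}"
    by (rule nn_integral_indicator) measurable
  finally show ?thesis .
qed

lemma emeasure_coord_lborel_proj:
  assumes [measurable]: "A \<in> sets borel"
  shows "emeasure (coord_lborel I) (coord_proj I -` A) = emeasure (coord_lborel I) A"
proof -
  have "coord_proj I -` A \<in> sets borel"
    using measurable_sets[OF borel_measurable_coord_proj assms, of I] by simp
  then show ?thesis by (simp add: emeasure_coord_lborel)
qed

lemma prod_Basis_cart:
  fixes f :: "real ^ 'n \<Rightarrow> 'c::comm_monoid_mult"
  shows "(\<Prod>b\<in>Basis. f b) = (\<Prod>i\<in>UNIV. f (axis i 1))"
proof -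
  have B: "Basis = range (\<lambda>i::'n. axis i (1::real))" by (auto simp: Basis_vec_def)
  have "inj (\<lambda>i::'n. axis i (1::real))" by (auto simp: inj_on_def axis_eq_axis)
  from prod.reindex[OF this, of f] show ?thesis unfolding B by (simp add: o_def)
qed

lemma emeasure_coord_lborel_box:
  assumes "\<And>i. i \<in> I \<Longrightarrow> a i \<le> b i"
  shows "emeasure (coord_lborel I) {z. \<forall>i\<in>I. a i < z $ i \<and> z $ i < b i} = ennreal (\<Prod>i\<in>I. b i - a i)"
proof -
  let ?l = "(\<chi> i. if i \<in> I then a i else 0) :: real ^ 'a"
  let ?u = "(\<chi> i. if i \<in> I then b i else 1) :: real ^ 'a"
  have "{z \<in> slab I. coord_proj I z \<in> {z. \<forall>i\<in>I. a i < z $ i \<and> z $ i < b i}} = box ?l ?u"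
  proof (rule set_eqI)
    fix z
    have "z \<in> box ?l ?u \<longleftrightarrow> (\<forall>i. (i \<in> I \<longrightarrow> a i < z $ i \<and> z $ i < b i) \<and> (i \<notin> I \<longrightarrow> 0 < z $ i \<and> z $ i < 1))"
      unfolding mem_box_cart by (intro iff_allI) simp
    then show "z \<in> {z \<in> slab I. coord_proj I z \<in> {z. \<forall>i\<in>I. a i < z $ i \<and> z $ i < b i}} \<longleftrightarrow> z \<in> box ?l ?u"
      unfolding slab_def by (auto simp del: all_simps)
  qed
  moreover have "{z :: real ^ 'a. \<forall>i\<in>I. a i < z $ i \<and> z $ i < b i} \<in> sets borel" by measurable
  ultimately have "emeasure (coord_lborel I) {z. \<forall>i\<in>I. a i < z $ i \<and> z $ i < b i} = emeasure lborel (box ?l ?u)"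
    by (simp only: emeasure_coord_lborel)
  also have "\<dots> = ennreal (\<Prod>b\<in>Basis. (?u - ?l) \<bullet> b)"
    using assms by (intro emeasure_lborel_box) (auto simp: Basis_vec_def inner_axis)
  also have "(\<Prod>b\<in>Basis. (?u - ?l) \<bullet> b) = (\<Prod>i\<in>UNIV. (?u - ?l) $ i)"
    by (subst prod_Basis_cart) (simp add: inner_axis)
  also have "(\<Prod>i\<in>UNIV. (?u - ?l) $ i) = (\<Prod>i\<in>I. b i - a i)"
    by (rule prod.mono_neutral_cong_right) auto
  finally show ?thesis .
qed

lemma emeasure_coord_lborel_cube:
  "a \<ge> 0 \<Longrightarrow> emeasure (coord_lborel I) {z. \<forall>i\<in>I. - a < z $ i \<and> z $ i < a} = ennreal ((2 * a) ^ card I)"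
  by (subst emeasure_coord_lborel_box) auto

lemma sigma_finite_coord_lborel: "sigma_finite_measure (coord_lborel I)"
proof
  let ?A = "\<lambda>n::nat. {z :: real ^ 'a. \<forall>i\<in>I. - real n < z $ i \<and> z $ i < real n}"
  have "z \<in> (\<Union>n. ?A n)" for z
  proof -
    obtain n :: nat where "norm z < real n" using reals_Archimedean2 by blast
    then have "\<bar>z $ i\<bar> < real n" for i using component_le_norm_cart[of z i] by simp
    then show ?thesis by (auto simp: abs_less_iff intro!: exI[of _ n]) (metis minus_less_iff)
  qed
  moreover have "?A n \<in> sets (coord_lborel I)" for n by simp
  ultimately show "\<exists>A. countable A \<and> A \<subseteq> sets (coord_lborel I) \<and> \<Union> A = space (coord_lborel I) \<and>
      (\<forall>a\<in>A. emeasure (coord_lborel I) a \<noteq> \<infinity>)"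
    by (intro exI[of _ "range ?A"]) (auto simp: emeasure_coord_lborel_cube)
qed

text \<open>Fubini's theorem for the splitting of \<open>real ^ 'n\<close> into complementary coordinate planes; both sides agree on boxes.\<close>

lemma lborel_eq_coord_lborel_pair:
  "lborel = distr (coord_lborel I \<Otimes>\<^sub>M coord_lborel (- I)) borel
     (\<lambda>(u, y). coord_proj I u + coord_proj (- I) y)"
proof (rule lborel_eqI)
  interpret sigma_finite_measure "coord_lborel (- I)" by (rule sigma_finite_coord_lborel)
  fix l u :: "real ^ 'a" assume "\<And>b. b \<in> Basis \<Longrightarrow> l \<bullet> b \<le> u \<bullet> b"
  from this[of "axis _ 1"] have le: "l $ i \<le> u $ i" for i by (simp add: axis_in_Basis_iff inner_axis)
  let ?A = "\<lambda>I. {z :: real ^ 'a. \<forall>i\<in>I. l $ i < z $ i \<and> z $ i < u $ i}"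
  have "emeasure (distr (coord_lborel I \<Otimes>\<^sub>M coord_lborel (- I)) borel
     (\<lambda>(u, y). coord_proj I u + coord_proj (- I) y)) (box l u)
    = emeasure (coord_lborel I \<Otimes>\<^sub>M coord_lborel (- I)) (?A I \<times> ?A (- I))"
    by (subst emeasure_distr)
       (auto intro!: arg_cong[where f="emeasure _"] simp: space_pair_measure mem_box_cart split: if_splits)
  also have "\<dots> = emeasure (coord_lborel I) (?A I) * emeasure (coord_lborel (- I)) (?A (- I))"
    by (rule emeasure_pair_measure_Times) auto
  also have "\<dots> = ennreal ((\<Prod>i\<in>I. u $ i - l $ i) * (\<Prod>i\<in>- I. u $ i - l $ i))"
    using le by (simp add: emeasure_coord_lborel_box ennreal_mult prod_nonneg)
  also have "(\<Prod>i\<in>I. u $ i - l $ i) * (\<Prod>i\<in>- I. u $ i - l $ i) = (\<Prod>i\<in>UNIV. u $ i - l $ i)"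
    by (metis Compl_disjoint Compl_partition finite prod.union_disjoint)
  also have "\<dots> = (\<Prod>b\<in>Basis. (u - l) \<bullet> b)" by (simp add: prod_Basis_cart inner_axis)
  finally show "emeasure (distr (coord_lborel I \<Otimes>\<^sub>M coord_lborel (- I)) borel
     (\<lambda>(u, y). coord_proj I u + coord_proj (- I) y)) (box l u) = ennreal (\<Prod>b\<in>Basis. (u - l) \<bullet> b)" .
qed simp

lemma nn_integral_lborel_coord_split:
  assumes [measurable]: "f \<in> borel_measurable borel"
  shows "(\<integral>\<^sup>+z. f z \<partial>lborel) =
    (\<integral>\<^sup>+u. \<integral>\<^sup>+y. f (coord_proj I u + coord_proj (- I) y) \<partial>coord_lborel (- I) \<partial>coord_lborel I)"
proof -
  interpret sigma_finite_measure "coord_lborel (- I)" by (rule sigma_finite_coord_lborel)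
  show ?thesis
    by (subst lborel_eq_coord_lborel_pair[of I], subst nn_integral_distr, measurable,
        subst nn_integral_fst[symmetric]) auto
qed

lemma nn_integral_coord_lborel_translate:
  assumes [measurable]: "f \<in> borel_measurable borel" and v: "coord_proj I v = v"
  shows "(\<integral>\<^sup>+u. f (u + v) \<partial>coord_lborel I) = (\<integral>\<^sup>+u. f u \<partial>coord_lborel I)"
proof -
  have v0: "v $ i = 0" if "i \<notin> I" for i using v that by (metis coord_proj_nth)
  have "(\<integral>\<^sup>+u. f u \<partial>coord_lborel I) = (\<integral>\<^sup>+z. f (coord_proj I z) * indicator (slab I) z \<partial>lborel)"
    by (rule nn_integral_coord_lborel) fact
  also have "\<dots> = (\<integral>\<^sup>+z. f (coord_proj I z) * indicator (slab I) z \<partial>distr lborel borel ((+) v))"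
    by (simp add: lborel_distr_plus)
  also have "\<dots> = (\<integral>\<^sup>+z. f (coord_proj I (v + z)) * indicator (slab I) (v + z) \<partial>lborel)"
    by (subst nn_integral_distr) auto
  also have "\<dots> = (\<integral>\<^sup>+z. f (coord_proj I z + v) * indicator (slab I) z \<partial>lborel)"
    using v v0 by (intro nn_integral_cong) (auto simp: add.commute slab_def split: split_indicator)
  also have "\<dots> = (\<integral>\<^sup>+u. f (u + v) \<partial>coord_lborel I)"
    by (subst nn_integral_coord_lborel) auto
  finally show ?thesis by simp
qed

lemma nn_integral_coord_lborel_scale:
  assumes [measurable]: "f \<in> borel_measurable borel" and s: "s > 0"
  shows "(\<integral>\<^sup>+u. f u \<partial>coord_lborel I) = ennreal (s ^ card I) * (\<integral>\<^sup>+u. f (s *\<^sub>R u) \<partial>coord_lborel I)"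
proof -
  define c :: "real ^ 'a \<Rightarrow> real" where "c b = (if b \<in> (\<lambda>i. axis i 1) ` I then s else 1)" for b
  have c: "c (axis i 1) = (if i \<in> I then s else 1)" for i by (auto simp: c_def axis_eq_axis)
  define T :: "real ^ 'a \<Rightarrow> real ^ 'a" where "T x = (\<chi> i. (if i \<in> I then s else 1) * x $ i)" for x
  have T: "0 + (\<Sum>j\<in>Basis. (c j * (x \<bullet> j)) *\<^sub>R j) = T x" for x
  proof (rule vec_eq_iff[THEN iffD2], rule allI)
    fix i
    have "(\<Sum>j\<in>Basis. (c j * (x \<bullet> j)) *\<^sub>R j) $ i = (\<Sum>j\<in>Basis. (c j * (x \<bullet> j)) *\<^sub>R j) \<bullet> axis i 1"
      by (simp add: inner_axis)
    also have "\<dots> = c (axis i 1) * (x \<bullet> axis i 1)"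
      by (subst inner_sum_left, subst sum.remove[of _ "axis i 1"])
         (auto simp: axis_in_Basis_iff inner_Basis inner_axis_axis intro!: sum.neutral)
    finally show "(0 + (\<Sum>j\<in>Basis. (c j * (x \<bullet> j)) *\<^sub>R j)) $ i = T x $ i"
      by (simp add: T_def c inner_axis)
  qed
  have Tm [measurable]: "T \<in> borel_measurable borel"
    unfolding T[symmetric, abs_def] by simp
  have "lborel = density (distr lborel borel T) (\<lambda>_. (\<Prod>j\<in>Basis. \<bar>c j\<bar>))"
    using lborel_affine_euclidean[of c 0] s unfolding T by (simp add: c_def)
  also have "(\<Prod>j\<in>Basis. \<bar>c j\<bar>) = s ^ card I"
    using s by (simp add: prod_Basis_cart c if_distrib[of abs] prod.If_cases)
  finally have L: "lborel = density (distr lborel borel T) (\<lambda>_. ennreal (s ^ card I))" .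
  have "(\<integral>\<^sup>+u. f u \<partial>coord_lborel I) = (\<integral>\<^sup>+z. f (coord_proj I z) * indicator (slab I) z \<partial>lborel)"
    by (rule nn_integral_coord_lborel) fact
  also have "\<dots> = (\<integral>\<^sup>+z. ennreal (s ^ card I) * (f (coord_proj I (T z)) * indicator (slab I) (T z)) \<partial>lborel)"
    by (subst L, subst nn_integral_density, simp, simp, subst nn_integral_distr) auto
  also have "\<dots> = ennreal (s ^ card I) * (\<integral>\<^sup>+z. f (coord_proj I (T z)) * indicator (slab I) (T z) \<partial>lborel)"
    by (rule nn_integral_cmult) measurable
  also have "(\<lambda>z. f (coord_proj I (T z)) * indicator (slab I) (T z)) = (\<lambda>z. f (s *\<^sub>R coord_proj I z) * indicator (slab I) z)"
  proof
    fix z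
    have "coord_proj I (T z) = s *\<^sub>R coord_proj I z" by (auto simp: T_def vec_eq_iff)
    moreover have "T z \<in> slab I \<longleftrightarrow> z \<in> slab I" by (auto simp: T_def slab_def)
    ultimately show "f (coord_proj I (T z)) * indicator (slab I) (T z) = f (s *\<^sub>R coord_proj I z) * indicator (slab I) z"
      by (simp add: indicator_def)
  qed
  also have "(\<integral>\<^sup>+z. f (s *\<^sub>R coord_proj I z) * indicator (slab I) z \<partial>lborel) = (\<integral>\<^sup>+u. f (s *\<^sub>R u) \<partial>coord_lborel I)"
    by (subst nn_integral_coord_lborel) auto
  finally show ?thesis .
qed

lemma coord_lborel_UNIV: "coord_lborel UNIV = lborel"
proof (rule measure_eqI)
  fix A :: "(real ^ 'a) set" assume "A \<in> sets (coord_lborel UNIV)"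
  then have A: "A \<in> sets borel" by simp
  have "coord_proj UNIV = (\<lambda>z::real^'a. z)" by (auto simp: coord_proj_def)
  then show "emeasure (coord_lborel UNIV) A = emeasure lborel A"
    using A by (simp add: emeasure_coord_lborel slab_def)
qed simp

text \<open>Uniqueness of Haar measure on a coordinate plane: integrating the indicator of \<open>A\<close> against a translated
  unit cube in both orders over the product of \<open>\<eta>\<close> and Lebesgue measure expresses \<open>\<eta> A\<close> through the \<open>\<eta>\<close>-mass of a (reflected) unit cube.\<close>

lemma translation_invariant_eq_coord_lborel:
  fixes \<eta> :: "(real ^ 'n) measure"
  assumes sf: "sigma_finite_measure \<eta>" and [measurable_cong]: "sets \<eta> = sets borel"
    and conc: "\<And>A. A \<in> sets borel \<Longrightarrow> emeasure \<eta> (coord_proj I -` A) = emeasure \<eta> A"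
    and inv: "\<And>A v. A \<in> sets borel \<Longrightarrow> coord_proj I v = v \<Longrightarrow> emeasure \<eta> ((\<lambda>x. x + v) -` A) = emeasure \<eta> A"
    and A [measurable]: "A \<in> sets borel"
  shows "emeasure \<eta> A = emeasure \<eta> (uminus -` {z. \<forall>i\<in>I. 0 < z $ i \<and> z $ i < 1}) * emeasure (coord_lborel I) A"
proof -
  let ?L = "coord_lborel I" and ?p = "coord_proj I"
  define B :: "(real ^ 'n) set" where "B = {z. \<forall>i\<in>I. 0 < z $ i \<and> z $ i < 1}"
  have [measurable]: "B \<in> sets borel" unfolding B_def by measurable
  interpret E: sigma_finite_measure \<eta> by fact
  interpret L: sigma_finite_measure ?L by (rule sigma_finite_coord_lborel)
  interpret P: pair_sigma_finite \<eta> ?L by unfold_locales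
  have ind: "(\<integral>\<^sup>+x. indicator S (g x) \<partial>\<eta>) = emeasure \<eta> (g -` S)"
    if [measurable]: "S \<in> sets borel" "g \<in> borel_measurable borel" for S :: "(real ^ 'n) set" and g
  proof -
    have "g -` S \<in> sets \<eta>" using measurable_sets[OF that(2,1)] by (simp add: assms(2))
    moreover have "(\<integral>\<^sup>+x. indicator S (g x) \<partial>\<eta>) = (\<integral>\<^sup>+x. indicator (g -` S) x \<partial>\<eta>)"
      by (intro nn_integral_cong) (auto split: split_indicator)
    ultimately show ?thesis by simp
  qed
  have indl: "(\<integral>\<^sup>+y. indicator S (?p y) \<partial>?L) = emeasure ?L S" if [measurable]: "S \<in> sets borel" for S
    by (subst nn_integral_coord_lborel_proj) auto
  have pr: "{x. g (?p x) \<in> S} = ?p -` (g -` S)" for g :: "real ^ 'n \<Rightarrow> real ^ 'n" and S by auto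
  have mv: "g -` S \<in> sets borel" if "S \<in> sets borel" "g \<in> borel_measurable borel"
    for S :: "(real ^ 'n) set" and g :: "real ^ 'n \<Rightarrow> real ^ 'n"
    using measurable_sets[OF that(2,1)] by simp
  have "emeasure \<eta> A * emeasure ?L B = (\<integral>\<^sup>+y. emeasure \<eta> A * indicator B (?p y) \<partial>?L)"
    by (simp add: nn_integral_cmult indl)
  also have "\<dots> = (\<integral>\<^sup>+y. (\<integral>\<^sup>+x. indicator A (?p x + ?p y) \<partial>\<eta>) * indicator B (?p y) \<partial>?L)"
  proof (intro nn_integral_cong arg_cong2[where f="(*)"] refl)
    fix y
    have "(\<integral>\<^sup>+x. indicator A (?p x + ?p y) \<partial>\<eta>) = emeasure \<eta> (?p -` ((\<lambda>x. x + ?p y) -` A))"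
      by (subst ind) (auto intro!: arg_cong[where f="emeasure \<eta>"])
    also have "\<dots> = emeasure \<eta> A"
      by (subst conc) (auto intro!: mv inv)
    finally show "emeasure \<eta> A = (\<integral>\<^sup>+x. indicator A (?p x + ?p y) \<partial>\<eta>)" by simp
  qed
  also have "\<dots> = (\<integral>\<^sup>+y. \<integral>\<^sup>+x. indicator A (?p x + ?p y) * indicator B (?p y) \<partial>\<eta> \<partial>?L)"
    by (intro nn_integral_cong nn_integral_multc[symmetric]) measurable
  also have "\<dots> = (\<integral>\<^sup>+x. \<integral>\<^sup>+y. indicator A (?p x + ?p y) * indicator B (?p y) \<partial>?L \<partial>\<eta>)"
    by (intro P.Fubini') measurable
  also have "\<dots> = (\<integral>\<^sup>+x. \<integral>\<^sup>+y. indicator A (?p y) * indicator B (?p y - ?p x) \<partial>?L \<partial>\<eta>)"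
  proof (rule nn_integral_cong)
    fix x
    show "(\<integral>\<^sup>+y. indicator A (?p x + ?p y) * indicator B (?p y) \<partial>?L)
        = (\<integral>\<^sup>+y. indicator A (?p y) * indicator B (?p y - ?p x) \<partial>?L)"
      using nn_integral_coord_lborel_translate[of "\<lambda>y. indicator A (?p y) * indicator B (?p y - ?p x)" I "?p x"]
      by (simp add: add.commute)
  qed
  also have "\<dots> = (\<integral>\<^sup>+y. \<integral>\<^sup>+x. indicator A (?p y) * indicator B (?p y - ?p x) \<partial>\<eta> \<partial>?L)"
    by (intro P.Fubini'[symmetric]) measurable
  also have "\<dots> = (\<integral>\<^sup>+y. indicator A (?p y) * emeasure \<eta> (uminus -` B) \<partial>?L)"
  proof (intro nn_integral_cong)
    fix y
    have "(\<integral>\<^sup>+x. indicator B (?p y - ?p x) \<partial>\<eta>) = emeasure \<eta> (?p -` ((\<lambda>x. ?p y - x) -` B))"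
      by (subst ind) (auto intro!: arg_cong[where f="emeasure \<eta>"])
    also have "\<dots> = emeasure \<eta> ((\<lambda>x. ?p y - x) -` B)"
      by (rule conc) (auto intro!: mv)
    also have "\<dots> = emeasure \<eta> ((\<lambda>x. x + ?p y) -` ((\<lambda>x. ?p y - x) -` B))"
      by (rule inv[symmetric]) (auto intro!: mv)
    also have "(\<lambda>x. x + ?p y) -` ((\<lambda>x. ?p y - x) -` B) = uminus -` B" by auto
    finally show "(\<integral>\<^sup>+x. indicator A (?p y) * indicator B (?p y - ?p x) \<partial>\<eta>)
        = indicator A (?p y) * emeasure \<eta> (uminus -` B)"
      by (subst nn_integral_cmult) auto
  qed
  also have "\<dots> = emeasure ?L A * emeasure \<eta> (uminus -` B)"
    by (subst nn_integral_multc) (auto simp: indl)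
  finally have "emeasure \<eta> A * emeasure ?L B = emeasure ?L A * emeasure \<eta> (uminus -` B)" .
  moreover have "emeasure ?L B = 1"
    unfolding B_def by (subst emeasure_coord_lborel_box) auto
  ultimately show ?thesis by (simp add: mult.commute B_def)
qed

lemma summable_power_exp_powr:
  assumes "c > 0" "\<beta> > 0"
  shows "summable (\<lambda>k::nat. (real k + 1) ^ n * exp (- c * real k powr \<beta>))"
proof (rule summable_comparison_test_bigo)
  show "summable (\<lambda>k::nat. norm (1 / real k ^ 2))"
    using inverse_power_summable[of 2] by (simp add: field_simps)
  show "(\<lambda>k::nat. (real k + 1) ^ n * exp (- c * real k powr \<beta>)) \<in> O(\<lambda>k. 1 / real k ^ 2)"
    using assms by real_asymp
qed

text \<open>The plane is cut into the shells where \<open>norm y\<close> lies between consecutive integers: the volume of a shell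
  grows polynomially, against the decay of the stretched exponential.\<close>

lemma nn_integral_coord_lborel_power_exp_finite:
  assumes "c > 0" "\<beta> > 0"
  shows "(\<integral>\<^sup>+y. ennreal (norm y ^ n * exp (- c * norm y powr \<beta>)) \<partial>coord_lborel I) < \<infinity>"
proof -
  let ?f = "\<lambda>k::nat. (real k + 1) ^ n * exp (- c * real k powr \<beta>)"
  let ?S = "\<lambda>k::nat. {z :: real ^ 'a. \<forall>i\<in>I. - (real k + 1) < z $ i \<and> z $ i < real k + 1}"
  have "(\<integral>\<^sup>+y. ennreal (norm y ^ n * exp (- c * norm y powr \<beta>)) \<partial>coord_lborel I)
      \<le> (\<integral>\<^sup>+y. (\<Sum>k. ennreal (?f k) * indicator (?S k) y) \<partial>coord_lborel I)"
  proof (intro nn_integral_mono)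
    fix y :: "real ^ 'a"
    define k where "k = nat \<lfloor>norm y\<rfloor>"
    have k: "real k \<le> norm y" "norm y < real k + 1" unfolding k_def by auto
    have "y \<in> ?S k"
    proof safe
      fix i show "- (real k + 1) < y $ i" "y $ i < real k + 1"
        using k(2) component_le_norm_cart[of y i] by (auto simp: abs_le_iff)
    qed
    moreover have "norm y ^ n * exp (- c * norm y powr \<beta>) \<le> ?f k"
      using k assms by (intro mult_mono power_mono) (auto intro!: powr_mono2)
    ultimately have "ennreal (norm y ^ n * exp (- c * norm y powr \<beta>)) \<le> ennreal (?f k) * indicator (?S k) y"
      by (simp add: ennreal_leI)
    also have "\<dots> = (\<Sum>j\<in>{k}. ennreal (?f j) * indicator (?S j) y)"
      by (subst sum.insert) (simp_all only: finite.emptyI empty_iff not_False_eq_True sum.empty add_0_right)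
    also have "\<dots> \<le> (\<Sum>k. ennreal (?f k) * indicator (?S k) y)"
      by (rule sum_le_suminf) auto
    finally show "ennreal (norm y ^ n * exp (- c * norm y powr \<beta>)) \<le> (\<Sum>k. ennreal (?f k) * indicator (?S k) y)" .
  qed
  also have "\<dots> = (\<Sum>k. \<integral>\<^sup>+y. ennreal (?f k) * indicator (?S k) y \<partial>coord_lborel I)"
    by (rule nn_integral_suminf) measurable
  also have "\<dots> = (\<Sum>k. ennreal (?f k) * ennreal ((2 * (real k + 1)) ^ card I))"
  proof (intro suminf_cong)
    fix k :: nat
    have "?S k \<in> sets (coord_lborel I)" by simp
    then show "(\<integral>\<^sup>+y. ennreal (?f k) * indicator (?S k) y \<partial>coord_lborel I) = ennreal (?f k) * ennreal ((2 * (real k + 1)) ^ card I)"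
      using emeasure_coord_lborel_cube[of "real k + 1" I] by (simp only: nn_integral_cmult_indicator)
  qed
  also have "\<dots> = (\<Sum>k. ennreal (2 ^ card I * ((real k + 1) ^ (n + card I) * exp (- c * real k powr \<beta>))))"
    unfolding power_mult_distrib power_add by (intro suminf_cong) (simp add: ennreal_mult'[symmetric] mult_ac)
  also have "\<dots> = ennreal (\<Sum>k. 2 ^ card I * ((real k + 1) ^ (n + card I) * exp (- c * real k powr \<beta>)))"
    by (intro suminf_ennreal2 summable_mult summable_power_exp_powr assms) auto
  also have "\<dots> < \<infinity>" by simp
  finally show ?thesis .
qed

section \<open>Determinants and change of variables\<close>

text \<open>An injection \<open>\<sigma>\<close> of the index types turns a matrix into a larger one which agrees with the identity outside the range of
  \<open>\<sigma>\<close>. The determinant is preserved, which relates determinants over \<open>'p\<close> and \<open>'d\<close>.\<close>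

definition embed_matrix :: "('p \<Rightarrow> 'n) \<Rightarrow> real ^ 'p ^ 'p \<Rightarrow> real ^ 'n ^ 'n" where
  "embed_matrix \<sigma> N = (\<chi> i j. if i \<in> range \<sigma> \<and> j \<in> range \<sigma> then N $ inv \<sigma> i $ inv \<sigma> j else of_bool (i = j))"

lemma embed_matrix_nth:
  assumes "inj \<sigma>"
  shows "embed_matrix \<sigma> N $ \<sigma> a $ \<sigma> b = N $ a $ b"
    and "i \<notin> range \<sigma> \<or> j \<notin> range \<sigma> \<Longrightarrow> embed_matrix \<sigma> N $ i $ j = of_bool (i = j)"
  using assms by (auto simp: embed_matrix_def)

lemma embed_matrix_eqI:
  assumes "inj \<sigma>" "\<And>a b. M $ \<sigma> a $ \<sigma> b = N $ a $ b"
    "\<And>i j. i \<notin> range \<sigma> \<or> j \<notin> range \<sigma> \<Longrightarrow> M $ i $ j = of_bool (i = j)"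
  shows "M = embed_matrix \<sigma> N"
  unfolding vec_eq_iff
proof (intro allI)
  fix i j
  show "M $ i $ j = embed_matrix \<sigma> N $ i $ j"
  proof (cases "i \<in> range \<sigma> \<and> j \<in> range \<sigma>")
    case True
    then obtain a b where "i = \<sigma> a" "j = \<sigma> b" by auto
    then show ?thesis using assms embed_matrix_nth(1) by metis
  next
    case False
    then show ?thesis using assms(3)[of i j] embed_matrix_nth(2)[OF assms(1), of i j N] by auto
  qed
qed

lemma embed_matrix_mult:
  fixes \<sigma> :: "'p::finite \<Rightarrow> 'n::finite"
  assumes inj: "inj \<sigma>"
  shows "embed_matrix \<sigma> A ** embed_matrix \<sigma> B = embed_matrix \<sigma> (A ** B)"
proof (rule embed_matrix_eqI[OF inj])
  fix a b
  have "(\<Sum>k\<in>UNIV. embed_matrix \<sigma> A $ \<sigma> a $ k * embed_matrix \<sigma> B $ k $ \<sigma> b)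
      = (\<Sum>k\<in>range \<sigma>. embed_matrix \<sigma> A $ \<sigma> a $ k * embed_matrix \<sigma> B $ k $ \<sigma> b)"
    by (rule sum.mono_neutral_right) (auto simp: embed_matrix_nth(2)[OF inj])
  also have "\<dots> = (\<Sum>c\<in>UNIV. A $ a $ c * B $ c $ b)"
    using inj by (subst sum.reindex) (auto simp: embed_matrix_nth(1))
  finally show "(embed_matrix \<sigma> A ** embed_matrix \<sigma> B) $ \<sigma> a $ \<sigma> b = (A ** B) $ a $ b"
    by (simp add: matrix_matrix_mult_def)
next
  fix i j assume "i \<notin> range \<sigma> \<or> j \<notin> range \<sigma>"
  then show "(embed_matrix \<sigma> A ** embed_matrix \<sigma> B) $ i $ j = of_bool (i = j)"
  proof
    assume i: "i \<notin> range \<sigma>"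
    have "(embed_matrix \<sigma> A ** embed_matrix \<sigma> B) $ i $ j = (\<Sum>k\<in>UNIV. if k = i then embed_matrix \<sigma> B $ i $ j else 0)"
      using i by (auto simp: matrix_matrix_mult_def embed_matrix_nth(2)[OF inj] intro!: sum.cong)
    then show ?thesis using i by (simp add: embed_matrix_nth(2)[OF inj])
  next
    assume j: "j \<notin> range \<sigma>"
    have "(embed_matrix \<sigma> A ** embed_matrix \<sigma> B) $ i $ j = (\<Sum>k\<in>UNIV. if k = j then embed_matrix \<sigma> A $ i $ j else 0)"
      using j by (auto simp: matrix_matrix_mult_def embed_matrix_nth(2)[OF inj] intro!: sum.cong)
    then show ?thesis using j by (simp add: embed_matrix_nth(2)[OF inj])
  qed
qed

lemma det_elementary_row_matrix:
  assumes "m \<noteq> n"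
  shows "det (\<chi> i j. if i = m \<and> j = n then c else of_bool (i = j) :: real ^ 'n ^ 'n) = 1"
proof -
  have "(\<chi> i j. if i = m \<and> j = n then c else of_bool (i = j) :: real ^ 'n ^ 'n)
      = (\<chi> k. if k = m then row m (mat 1) + c *s row n (mat 1) else row k (mat 1))"
    using assms by (auto simp: vec_eq_iff row_def mat_def)
  then show ?thesis using det_row_operation[OF assms, of "mat 1" c] by simp
qed

text \<open>Embedding commutes with products and maps elementary matrices to elementary matrices, so the claim
  follows by writing \<open>N\<close> as a product of elementary matrices.\<close>

lemma det_embed_matrix:
  fixes \<sigma> :: "'p::finite \<Rightarrow> 'n::finite"
  assumes inj: "inj \<sigma>"
  shows "det (embed_matrix \<sigma> N) = det N"
proof (induction N rule: induct_matrix_elementary)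
  case (1 A B)
  then show ?case by (simp add: embed_matrix_mult[OF inj, symmetric] det_mul)
next
  case (2 A i)
  have "embed_matrix \<sigma> A $ \<sigma> i $ j = 0" for j
  proof (cases "j \<in> range \<sigma>")
    case True
    then show ?thesis using 2 by (auto simp: embed_matrix_nth(1)[OF inj] row_def vec_eq_iff)
  next
    case False
    then show ?thesis using embed_matrix_nth(2)[OF inj, of "\<sigma> i" j A] by auto
  qed
  then have "row (\<sigma> i) (embed_matrix \<sigma> A) = 0" by (simp add: row_def vec_eq_iff)
  then show ?case using 2 by (simp add: det_zero_row)
next
  case (3 A)
  have "embed_matrix \<sigma> A $ i $ j = 0" if "i \<noteq> j" for i j
  proof (cases "i \<in> range \<sigma> \<and> j \<in> range \<sigma>")
    case True
    then obtain a b where "i = \<sigma> a" "j = \<sigma> b" by auto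
    then show ?thesis using 3[of a b] that by (auto simp: embed_matrix_nth(1)[OF inj])
  next
    case False
    then show ?thesis using embed_matrix_nth(2)[OF inj, of i j A] that by auto
  qed
  then have "det (embed_matrix \<sigma> A) = (\<Prod>i\<in>UNIV. embed_matrix \<sigma> A $ i $ i)" by (rule det_diagonal)
  also have "\<dots> = (\<Prod>i\<in>range \<sigma>. embed_matrix \<sigma> A $ i $ i)"
    by (rule prod.mono_neutral_right) (auto simp: embed_matrix_nth(2)[OF inj])
  also have "\<dots> = (\<Prod>a\<in>UNIV. A $ a $ a)"
    using inj by (subst prod.reindex) (auto simp: embed_matrix_nth(1))
  also have "\<dots> = det A" using 3 by (rule det_diagonal[symmetric])
  finally show ?case .
next
  case (4 m n)
  have sw: "det (\<chi> i j. mat 1 $ i $ Transposition.transpose x y j :: real ^ 'k ^ 'k) = -1"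
    if "x \<noteq> y" for x y :: "'k::finite"
    using det_permute_columns[of "Transposition.transpose x y" "mat 1 :: real ^ 'k ^ 'k"] that
    by (simp add: permutes_swap_id sign_swap_id)
  have "\<sigma> m \<noteq> \<sigma> n" using inj 4 by (auto dest: injD)
  moreover have "(\<chi> i j. mat 1 $ i $ Transposition.transpose (\<sigma> m) (\<sigma> n) j)
      = embed_matrix \<sigma> (\<chi> i j. mat 1 $ i $ Transposition.transpose m n j)"
  proof (rule embed_matrix_eqI[OF inj])
    fix a b
    show "(\<chi> i j. mat 1 $ i $ Transposition.transpose (\<sigma> m) (\<sigma> n) j :: real ^ 'n ^ 'n) $ \<sigma> a $ \<sigma> b
        = (\<chi> i j. mat 1 $ i $ Transposition.transpose m n j :: real ^ 'p ^ 'p) $ a $ b"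
      using inj by (simp add: mat_def Transposition.transpose_def inj_eq)
  next
    fix i j assume "i \<notin> range \<sigma> \<or> j \<notin> range \<sigma>"
    then show "(\<chi> i j. mat 1 $ i $ Transposition.transpose (\<sigma> m) (\<sigma> n) j :: real ^ 'n ^ 'n) $ i $ j = of_bool (i = j)"
      by (auto simp: mat_def Transposition.transpose_def)
  qed
  ultimately show ?case using sw[of "\<sigma> m" "\<sigma> n"] sw[of m n] 4 by simp
next
  case (5 m n c)
  have ne: "\<sigma> m \<noteq> \<sigma> n" using inj 5 by (auto dest: injD)
  have "(\<chi> i j. if i = \<sigma> m \<and> j = \<sigma> n then c else of_bool (i = j) :: real ^ 'n ^ 'n)
      = embed_matrix \<sigma> (\<chi> i j. if i = m \<and> j = n then c else of_bool (i = j))"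
    by (rule embed_matrix_eqI[OF inj]) (use inj in \<open>auto simp: inj_eq\<close>)
  then show ?case using det_elementary_row_matrix[OF ne, of c] det_elementary_row_matrix[OF 5, of c] by simp
qed

text \<open>A copy of a finite type, carrying a well-order obtained from an enumeration. The transformation formula for Lebesgue measure
  is proved for vectors over well-ordered index types; reindexing along the copy preserves Lebesgue measure, norms and
  determinants, and thereby removes the order from the formula.\<close>

typedef 'a ranked = "UNIV :: 'a set" morphisms unrank rank by simp

lemma rank_eq_iff: "rank i = j \<longleftrightarrow> i = unrank j"
  by (metis UNIV_I rank_inverse unrank_inverse)

definition rank_index :: "'a::finite ranked \<Rightarrow> nat" where
  "rank_index x = (SOME f :: 'a \<Rightarrow> nat. inj f) (unrank x)"

lemma inj_rank_index: "inj rank_index"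
proof -
  have "\<exists>f :: 'a \<Rightarrow> nat. inj f" using finite_imp_inj_to_nat_seg[of "UNIV :: 'a set"] by auto
  then have "inj (SOME f :: 'a \<Rightarrow> nat. inj f)" by (rule someI_ex)
  then have "inj ((SOME f :: 'a \<Rightarrow> nat. inj f) \<circ> unrank)"
    by (rule inj_compose) (simp add: inj_def unrank_inject)
  then show ?thesis by (simp only: rank_index_def[abs_def] o_def)
qed

instantiation ranked :: (finite) "{finite, wellorder}"
begin

definition less_eq_ranked :: "'a ranked \<Rightarrow> 'a ranked \<Rightarrow> bool" where
  "x \<le> y \<longleftrightarrow> rank_index x \<le> rank_index y"

definition less_ranked :: "'a ranked \<Rightarrow> 'a ranked \<Rightarrow> bool" where
  "x < y \<longleftrightarrow> rank_index x < rank_index y"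

instance
proof
  have "(UNIV :: 'a ranked set) = range rank" by (metis UNIV_eq_I rangeI unrank_inverse)
  then show "finite (UNIV :: 'a ranked set)" by (metis finite finite_imageI)
next
  fix P :: "'a ranked \<Rightarrow> bool" and a assume step: "\<And>x. (\<And>y. y < x \<Longrightarrow> P y) \<Longrightarrow> P x"
  have "\<forall>a. rank_index a = n \<longrightarrow> P a" for n
  proof (induction n rule: less_induct)
    case (less n)
    show ?case
    proof (intro allI impI)
      fix a :: "'a ranked" assume a: "rank_index a = n"
      show "P a"
      proof (rule step)
        fix y assume "y < a"
        then have "rank_index y < n" using a by (simp add: less_ranked_def)
        then show "P y" using less by blast
      qed
    qed
  qed
  then show "P a" by simp
next
  fix x y :: "'a ranked"
  show "x \<le> y \<Longrightarrow> y \<le> x \<Longrightarrow> x = y"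
    by (simp add: less_eq_ranked_def inj_eq[OF inj_rank_index, symmetric])
next
  fix x y z :: "'a ranked"
  show "x < y \<longleftrightarrow> x \<le> y \<and> \<not> y \<le> x" by (auto simp: less_eq_ranked_def less_ranked_def)
  show "x \<le> x" by (simp add: less_eq_ranked_def)
  show "x \<le> y \<or> y \<le> x" by (auto simp: less_eq_ranked_def)
  show "x \<le> y \<Longrightarrow> y \<le> z \<Longrightarrow> x \<le> z" by (auto simp: less_eq_ranked_def)
qed

end

definition reindex_ranked :: "real ^ 'n \<Rightarrow> real ^ 'n ranked" where
  "reindex_ranked x = (\<chi> i. x $ unrank i)"

definition unindex_ranked :: "real ^ 'n ranked \<Rightarrow> real ^ 'n" where
  "unindex_ranked x = (\<chi> i. x $ rank i)"

lemma reindex_ranked_inverse [simp]: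
  "unindex_ranked (reindex_ranked x) = x" "reindex_ranked (unindex_ranked y) = y"
  by (auto simp: reindex_ranked_def unindex_ranked_def vec_eq_iff unrank_inverse rank_inverse)

lemma reindex_ranked_eq_iff [simp]: "reindex_ranked x = reindex_ranked y \<longleftrightarrow> x = y"
  by (metis reindex_ranked_inverse(1))

lemma bounded_linear_reindex_ranked: "bounded_linear reindex_ranked"
  and bounded_linear_unindex_ranked: "bounded_linear unindex_ranked"
  unfolding linear_conv_bounded_linear[symmetric]
  by (auto intro!: linearI simp: reindex_ranked_def unindex_ranked_def vec_eq_iff)

lemma measurable_reindex_ranked [measurable]:
  "reindex_ranked \<in> borel_measurable borel" "unindex_ranked \<in> borel_measurable borel"
  by (intro borel_measurable_continuous_onI linear_continuous_on
      bounded_linear_reindex_ranked bounded_linear_unindex_ranked)+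

lemma distr_reindex_ranked: "lborel = distr lborel borel (reindex_ranked :: real ^ 'n \<Rightarrow> _)"
proof (rule lborel_eqI)
  fix l u :: "real ^ 'n ranked" assume le: "\<And>b. b \<in> Basis \<Longrightarrow> l \<bullet> b \<le> u \<bullet> b"
  have pre: "reindex_ranked -` box l u = box (unindex_ranked l) (unindex_ranked u)"
    unfolding mem_box_cart set_eq_iff vimage_eq reindex_ranked_def unindex_ranked_def
    by (simp) (metis rank_inverse unrank_inverse UNIV_I)
  have bij: "bij_betw (\<lambda>b. reindex_ranked b) (Basis :: (real ^ 'n) set) (Basis :: (real ^ 'n ranked) set)"
  proof (rule bij_betw_byWitness[where f' = unindex_ranked])
    have "reindex_ranked (axis i 1) = axis (rank i) 1" for i :: 'n
      by (auto simp: reindex_ranked_def axis_def vec_eq_iff rank_eq_iff unrank_inverse rank_inverse)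
    then show "reindex_ranked ` (Basis :: (real ^ 'n) set) \<subseteq> Basis" by (auto simp: Basis_vec_def)
    have "unindex_ranked (axis i 1) = axis (unrank i) 1" for i :: "'n ranked"
      by (auto simp: unindex_ranked_def axis_def vec_eq_iff rank_eq_iff unrank_inverse rank_inverse)
    then show "unindex_ranked ` (Basis :: (real ^ 'n ranked) set) \<subseteq> Basis" by (auto simp: Basis_vec_def)
  qed auto
  have inner: "unindex_ranked x \<bullet> b = x \<bullet> reindex_ranked b" for x and b :: "real ^ 'n"
    unfolding inner_vec_def
    by (rule sum.reindex_bij_witness[of _ unrank rank])
       (auto simp: reindex_ranked_def unindex_ranked_def unrank_inverse rank_inverse)
  have "emeasure (distr lborel borel reindex_ranked) (box l u) = emeasure lborel (box (unindex_ranked l) (unindex_ranked u))"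
    by (simp add: emeasure_distr pre)
  also have "\<dots> = (\<Prod>b\<in>Basis. (unindex_ranked u - unindex_ranked l) \<bullet> b)"
    using le bij by (intro emeasure_lborel_box) (auto simp: inner bij_betw_def)
  also have "(\<Prod>b\<in>Basis. (unindex_ranked u - unindex_ranked l) \<bullet> b) = (\<Prod>b\<in>Basis. (u - l) \<bullet> b)"
    by (subst prod.reindex_bij_betw[OF bij, symmetric]) (simp add: inner_diff_left inner)
  finally show "emeasure (distr lborel borel reindex_ranked) (box l u) = (\<Prod>b\<in>Basis. (u - l) \<bullet> b)" .
qed simp

lemma emeasure_image_ranked:
  fixes g :: "real ^ 'n::{finite,wellorder} \<Rightarrow> real ^ 'n::_"
  assumes S: "S \<in> sets borel" and gS: "g ` S \<in> sets borel"
    and der: "\<And>x. x \<in> S \<Longrightarrow> (g has_derivative g' x) (at x within S)"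
    and inj: "inj_on g S"
    and meas [measurable]: "(\<lambda>x. \<bar>det (matrix (g' x))\<bar> * indicator S x) \<in> borel_measurable borel"
    and fin: "(\<integral>\<^sup>+x. ennreal (\<bar>det (matrix (g' x))\<bar> * indicator S x) \<partial>lborel) < \<infinity>"
  shows "emeasure lborel (g ` S) = (\<integral>\<^sup>+x. ennreal (\<bar>det (matrix (g' x))\<bar> * indicator S x) \<partial>lborel)"
proof -
  obtain m where m: "(\<integral>\<^sup>+x. ennreal (\<bar>det (matrix (g' x))\<bar> * indicator S x) \<partial>lborel) = ennreal m" "m \<ge> 0"
    using fin by (cases "\<integral>\<^sup>+x. ennreal (\<bar>det (matrix (g' x))\<bar> * indicator S x) \<partial>lborel" rule: ennreal_cases) auto
  have "((\<lambda>x. \<bar>det (matrix (g' x))\<bar> * indicator S x) has_integral m) UNIV"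
    by (rule nn_integral_has_integral[OF meas _ m(1)]) (auto simp: m)
  then have "((\<lambda>x. \<bar>det (matrix (g' x))\<bar>) has_integral m) S"
    by (subst has_integral_restrict_UNIV[symmetric], elim has_integral_eq[rotated]) (auto simp: indicator_def)
  moreover have "S \<in> sets lebesgue" using S by simp
  ultimately have "g ` S \<in> lmeasurable \<and> measure lebesgue (g ` S) = m"
    using has_measure_differentiable_image[OF _ der inj] by blast
  then have "emeasure lebesgue (g ` S) = ennreal m"
    by (metis emeasure_eq_measure2 fmeasurable_def)
  then show ?thesis using gS m by simp
qed

lemma emeasure_image:
  fixes g :: "real ^ 'n \<Rightarrow> real ^ 'n"
  assumes S: "S \<in> sets borel" and gS: "g ` S \<in> sets borel"
    and der: "\<And>x. x \<in> S \<Longrightarrow> (g has_derivative g' x) (at x within S)"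
    and inj: "inj_on g S"
    and meas [measurable]: "(\<lambda>x. \<bar>det (matrix (g' x))\<bar> * indicator S x) \<in> borel_measurable borel"
    and fin: "(\<integral>\<^sup>+x. ennreal (\<bar>det (matrix (g' x))\<bar> * indicator S x) \<partial>lborel) < \<infinity>"
  shows "emeasure lborel (g ` S) = (\<integral>\<^sup>+x. ennreal (\<bar>det (matrix (g' x))\<bar> * indicator S x) \<partial>lborel)"
proof -
  let ?r = "reindex_ranked :: real ^ 'n \<Rightarrow> real ^ 'n ranked" and ?u = "unindex_ranked"
  have im: "?r ` X = ?u -` X" for X
  proof (rule set_eqI)
    fix y
    have "y \<in> ?r ` X" if "?u y \<in> X" using imageI[OF that, of ?r] by simp
    then show "y \<in> ?r ` X \<longleftrightarrow> y \<in> ?u -` X" by auto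
  qed
  have im_m: "?r ` X \<in> sets borel" if "X \<in> sets borel" for X
    unfolding im using measurable_sets[OF measurable_reindex_ranked(2) that] by simp
  have em: "emeasure lborel (?r ` X) = emeasure lborel X" if "X \<in> sets borel" for X
  proof -
    have "emeasure lborel (?r ` X) = emeasure (distr lborel borel ?r) (?r ` X)"
      using distr_reindex_ranked by metis
    also have "\<dots> = emeasure lborel (?r -` ?r ` X)"
      using im_m[OF that] by (simp add: emeasure_distr)
    also have "?r -` ?r ` X = X" by (simp add: im vimage_def)
    finally show ?thesis .
  qed
  have nn: "(\<integral>\<^sup>+x. f x \<partial>lborel) = (\<integral>\<^sup>+x. f (?r x) \<partial>lborel)" if "f \<in> borel_measurable borel" for f :: "_ \<Rightarrow> ennreal"
    by (subst distr_reindex_ranked, subst nn_integral_distr) (use that in auto)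
  define h where "h = ?r \<circ> g \<circ> ?u"
  define h' where "h' y = ?r \<circ> g' (?u y) \<circ> ?u" for y
  have hS: "h ` ?r ` S = ?r ` g ` S" by (force simp: h_def image_iff)
  have det: "det (matrix (h' (?r x))) = det (matrix (g' x))" if "x \<in> S" for x
  proof -
    have inj_r: "inj (rank :: 'n \<Rightarrow> _)" by (simp add: inj_def rank_inject)
    have ur: "?u (axis j 1) = axis (unrank j) 1" for j
      by (auto simp: unindex_ranked_def axis_def vec_eq_iff rank_eq_iff unrank_inverse rank_inverse)
    have "matrix (h' (?r x)) = embed_matrix rank (matrix (g' x))"
    proof (rule embed_matrix_eqI[OF inj_r])
      show "matrix (h' (?r x)) $ rank a $ rank b = matrix (g' x) $ a $ b" for a b
        by (simp add: matrix_def h'_def ur) (simp add: reindex_ranked_def rank_inverse)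
    next
      fix i j :: "'n ranked" assume "i \<notin> range rank \<or> j \<notin> range rank"
      moreover have "i \<in> range rank" for i :: "'n ranked" by (metis rangeI unrank_inverse)
      ultimately show "matrix (h' (?r x)) $ i $ j = of_bool (i = j)" by blast
    qed
    then show ?thesis using det_embed_matrix[OF inj_r] by simp
  qed
  let ?f = "\<lambda>y. ennreal (\<bar>det (matrix (h' y))\<bar> * indicator (?r ` S) y)"
  have f: "?f y = ennreal (\<bar>det (matrix (g' (?u y)))\<bar> * indicator S (?u y))" for y
  proof (cases "y \<in> ?r ` S")
    case True
    then show ?thesis using det by (auto simp: indicator_def)
  next
    case False
    then have "?u y \<notin> S" by (auto simp: im)
    with False show ?thesis by simp
  qed
  have eq: "(\<integral>\<^sup>+y. ?f y \<partial>lborel) = (\<integral>\<^sup>+x. ennreal (\<bar>det (matrix (g' x))\<bar> * indicator S x) \<partial>lborel)"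
    unfolding f by (subst nn) auto
  have "emeasure lborel (h ` ?r ` S) = (\<integral>\<^sup>+y. ?f y \<partial>lborel)"
  proof (rule emeasure_image_ranked)
    show "?r ` S \<in> sets borel" "h ` ?r ` S \<in> sets borel"
      unfolding hS using S gS im_m by auto
    show "inj_on h (?r ` S)"
      using inj unfolding h_def inj_on_def by auto
    show "(\<integral>\<^sup>+y. ?f y \<partial>lborel) < \<infinity>" using eq fin by simp
    have "(\<lambda>y. \<bar>det (matrix (h' y))\<bar> * indicator (?r ` S) y) = (\<lambda>y. \<bar>det (matrix (g' (?u y)))\<bar> * indicator S (?u y))"
      using f by (auto simp: fun_eq_iff)
    then show "(\<lambda>y. \<bar>det (matrix (h' y))\<bar> * indicator (?r ` S) y) \<in> borel_measurable borel"
      by simp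
    fix y assume "y \<in> ?r ` S"
    then obtain x where x: "x \<in> S" "y = ?r x" by auto
    have "(?u has_derivative ?u) (at y within ?r ` S)"
      by (rule bounded_linear_imp_has_derivative[OF bounded_linear_unindex_ranked])
    moreover have "?u ` ?r ` S = S" by (force simp: image_iff)
    ultimately have "(g \<circ> ?u has_derivative g' (?u y) \<circ> ?u) (at y within ?r ` S)"
      using der[OF x(1)] x by (intro diff_chain_within) auto
    then have "(?r \<circ> (g \<circ> ?u) has_derivative ?r \<circ> (g' (?u y) \<circ> ?u)) (at y within ?r ` S)"
      by (rule diff_chain_within) (rule bounded_linear_imp_has_derivative[OF bounded_linear_reindex_ranked])
    then show "(h has_derivative h' y) (at y within ?r ` S)"
      by (simp add: h_def h'_def o_assoc)
  qed
  then show ?thesis unfolding hS using em[OF gS] eq by simp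
qed

text \<open>Two measures are compared, the image under \<open>H\<close> of Lebesgue measure on \<open>g ` U\<close> and the
  measure with density \<open>\<bar>det g'\<bar>\<close> on \<open>U\<close>. They agree on the sets \<open>C n\<close> on which norm and determinant are at
  most \<open>n\<close>, where the integral is finite, and these exhaust \<open>U\<close>.\<close>

lemma nn_integral_change_of_variables:
  fixes g :: "real ^ 'n \<Rightarrow> real ^ 'n"
  assumes U: "open U" and der: "\<And>x. x \<in> U \<Longrightarrow> (g has_derivative g' x) (at x)"
    and cont: "continuous_on U (\<lambda>x. det (matrix (g' x)))"
    and Hg: "\<And>x. x \<in> U \<Longrightarrow> H (g x) = x"
    and H [measurable]: "H \<in> borel_measurable borel" and gU [measurable]: "g ` U \<in> sets borel"
    and f [measurable]: "f \<in> borel_measurable borel"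
  shows "(\<integral>\<^sup>+z. f (H z) * indicator (g ` U) z \<partial>lborel)
    = (\<integral>\<^sup>+x. f x * ennreal (\<bar>det (matrix (g' x))\<bar> * indicator U x) \<partial>lborel)"
proof -
  let ?d = "\<lambda>x. \<bar>det (matrix (g' x))\<bar> * indicator U x"
  have [measurable]: "U \<in> sets borel" using U by simp
  have [measurable]: "?d \<in> borel_measurable borel"
    using borel_measurable_continuous_on_indicator[of U "\<lambda>x. \<bar>det (matrix (g' x))\<bar>"] cont
    by (simp add: mult.commute continuous_on_rabs)
  have inj: "inj_on g U" using Hg by (metis inj_onI)
  let ?M = "distr (density lborel (indicator (g ` U))) borel H"
  let ?N = "density lborel (\<lambda>x. ennreal (?d x))"
  have MN: "?M = ?N"
  proof (rule measure_eqI)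
    fix A assume "A \<in> sets ?M"
    then have A [measurable]: "A \<in> sets borel" by simp
    define C where "C n = {x \<in> U. ?d x \<le> real n \<and> norm x \<le> real n}" for n
    have [measurable]: "C n \<in> sets borel" for n
    proof -
      have "C n = U \<inter> {x. ?d x \<le> real n} \<inter> {x. norm x \<le> real n}" by (auto simp: C_def)
      then show ?thesis by simp
    qed
    have gC: "g ` (A \<inter> C n) = g ` U \<inter> H -` (A \<inter> C n)" for n
      using Hg by (force simp: C_def)
    have [measurable]: "g ` (A \<inter> C n) \<in> sets borel" for n
      unfolding gC using measurable_sets[OF H, of "A \<inter> C n"] by auto
    have main: "emeasure ?M (A \<inter> C n) = emeasure ?N (A \<inter> C n)" for n
    proof -
      have "emeasure ?M (A \<inter> C n) = emeasure lborel (g ` (A \<inter> C n))"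
      proof -
        have HA: "H -` (A \<inter> C n) \<in> sets borel" using measurable_sets[OF H, of "A \<inter> C n"] by simp
        have "emeasure ?M (A \<inter> C n) = (\<integral>\<^sup>+z. indicator (g ` U) z * indicator (H -` (A \<inter> C n)) z \<partial>lborel)"
          using HA by (simp add: emeasure_distr emeasure_density)
        also have "\<dots> = (\<integral>\<^sup>+z. indicator (g ` (A \<inter> C n)) z \<partial>lborel)"
          unfolding gC indicator_inter_arith ..
        finally show ?thesis by simp
      qed
      also have "\<dots> = (\<integral>\<^sup>+x. ennreal (\<bar>det (matrix (g' x))\<bar> * indicator (A \<inter> C n) x) \<partial>lborel)"
      proof (rule emeasure_image)
        show "A \<inter> C n \<in> sets borel" "g ` (A \<inter> C n) \<in> sets borel" by measurable
        show "inj_on g (A \<inter> C n)" using inj by (rule inj_on_subset) (auto simp: C_def)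
        show "(g has_derivative g' x) (at x within A \<inter> C n)" if "x \<in> A \<inter> C n" for x
          using der[of x] that by (auto simp: C_def intro: has_derivative_at_withinI)
        have eq: "(\<lambda>x. \<bar>det (matrix (g' x))\<bar> * indicator (A \<inter> C n) x) = (\<lambda>x. ?d x * indicator (A \<inter> C n) x)"
          by (auto simp: fun_eq_iff C_def split: split_indicator)
        show "(\<lambda>x. \<bar>det (matrix (g' x))\<bar> * indicator (A \<inter> C n) x) \<in> borel_measurable borel"
          unfolding eq by measurable
        have "(\<integral>\<^sup>+x. ennreal (\<bar>det (matrix (g' x))\<bar> * indicator (A \<inter> C n) x) \<partial>lborel)
            \<le> (\<integral>\<^sup>+x. ennreal (real n) * indicator (cball (0 :: real ^ 'n) (real n)) x \<partial>lborel)"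
          by (rule nn_integral_mono) (auto simp: C_def intro!: ennreal_leI split: split_indicator)
        also have "\<dots> = ennreal (real n) * emeasure lborel (cball (0 :: real ^ 'n) (real n))"
          by (rule nn_integral_cmult_indicator) simp
        also have "\<dots> < \<infinity>" using emeasure_lborel_cball_finite[of "0 :: real ^ 'n" "real n"]
          by (simp add: ennreal_mult_less_top)
        finally show "(\<integral>\<^sup>+x. ennreal (\<bar>det (matrix (g' x))\<bar> * indicator (A \<inter> C n) x) \<partial>lborel) < \<infinity>" .
      qed
      also have "\<dots> = emeasure ?N (A \<inter> C n)"
        by (subst emeasure_density) (auto intro!: nn_integral_cong simp: C_def split: split_indicator)
      finally show ?thesis .
    qed
    have inc: "incseq (\<lambda>n. A \<inter> C n)"
      by (rule incseq_SucI) (auto simp: C_def)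
    have Un: "(\<Union>n. A \<inter> C n) = A \<inter> U"
    proof safe
      fix x assume "x \<in> A" "x \<in> U"
      obtain n :: nat where "max (?d x) (norm x) < real n" using reals_Archimedean2 by blast
      then show "x \<in> (\<Union>n. A \<inter> C n)" using \<open>x \<in> A\<close> \<open>x \<in> U\<close> by (auto simp: C_def intro!: exI[of _ n])
    qed (auto simp: C_def)
    have "emeasure ?M A = emeasure ?M (A \<inter> U)"
    proof -
      have "g ` U \<inter> H -` A = g ` U \<inter> H -` (A \<inter> U)" using Hg by force
      moreover have "H -` A \<in> sets borel" "H -` (A \<inter> U) \<in> sets borel"
        using measurable_sets[OF H, of A] measurable_sets[OF H, of "A \<inter> U"] by auto
      ultimately show ?thesis
        by (simp add: emeasure_distr emeasure_density indicator_inter_arith[symmetric])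
    qed
    also have "\<dots> = (SUP n. emeasure ?M (A \<inter> C n))"
      by (subst Un[symmetric], rule SUP_emeasure_incseq[OF _ inc, symmetric]) auto
    also have "\<dots> = (SUP n. emeasure ?N (A \<inter> C n))" by (simp add: main)
    also have "\<dots> = emeasure ?N (A \<inter> U)"
      by (subst Un[symmetric], rule SUP_emeasure_incseq[OF _ inc]) auto
    also have "\<dots> = emeasure ?N A"
      by (simp add: emeasure_density) (intro nn_integral_cong, auto split: split_indicator)
    finally show "emeasure ?M A = emeasure ?N A" .
  qed simp
  have "(\<integral>\<^sup>+z. f (H z) * indicator (g ` U) z \<partial>lborel) = (\<integral>\<^sup>+x. f x \<partial>?M)"
    by (subst nn_integral_distr, simp, simp, subst nn_integral_density) (auto simp: mult.commute)
  also have "\<dots> = (\<integral>\<^sup>+x. f x * ennreal (?d x) \<partial>lborel)"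
    unfolding MN by (subst nn_integral_density, measurable) (simp add: mult.commute)
  finally show ?thesis .
qed

section \<open>The generalized Jacobian as a determinant\<close>

declare transpose_matrix_vector [simp del]

definition matrix_jacobian :: "real ^ 'd ^ 'p \<Rightarrow> real" where
  "matrix_jacobian M = (if CARD('d) \<ge> CARD('p) then sqrt (det (M ** transpose M))
     else sqrt (det (transpose M ** M)))"

lemma gen_jacobian_eq: "gen_jacobian F x = matrix_jacobian (jacobian F (at x))"
  by (simp add: gen_jacobian_def matrix_jacobian_def Let_def)

text \<open>A square completion \<open>R\<close> of the rectangular matrix \<open>M\<close>: its \<open>J\<close>-coordinates are the values of \<open>M\<close> (embedded
  by \<open>E\<close>), its determinant is the generalized Jacobian, and it is isometric up to an error controlled by \<open>M x\<close>. In
  particular it is an isometry on the kernel of \<open>M\<close>, the tangent space of the level set.\<close>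

definition adapted_frame ::
    "'d set \<Rightarrow> (real ^ 'p \<Rightarrow> real ^ 'd) \<Rightarrow> real ^ 'd ^ 'p \<Rightarrow> (real ^ 'd \<Rightarrow> real ^ 'd) \<Rightarrow> bool" where
  "adapted_frame J E M R \<longleftrightarrow> linear R \<and> (\<forall>x. coord_proj J (R x) = E (M *v x)) \<and>
     \<bar>det (matrix R)\<bar> = matrix_jacobian M \<and>
     (\<exists>C\<ge>0. \<forall>x. \<bar>norm (R x) - norm x\<bar> \<le> C * norm (M *v x))"

lemma linear_le_norm:
  assumes "linear (f :: 'a::euclidean_space \<Rightarrow> 'b::real_normed_vector)"
  obtains K where "K \<ge> 0" "\<And>x. norm (f x) \<le> K * norm x"
proof -
  obtain K where "K > 0" "\<And>x. norm (f x) \<le> norm x * K"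
    using linear_conv_bounded_linear bounded_linear.pos_bounded assms by blast
  then show thesis using that[of K] by (auto simp: mult.commute)
qed

lemma inner_transpose_matrix: "inner (transpose M *v y) x = inner y (M *v (x :: real ^ 'n))"
  using dot_lmul_matrix[of y M x] by (simp add: transpose_matrix_vector)

lemma inner_eq_if_norm_eq:
  assumes lin: "linear f" "linear g" and S: "subspace S"
    and eq: "\<And>x. x \<in> S \<Longrightarrow> norm (f x) = norm (g x)" and xy: "x \<in> S" "y \<in> S"
  shows "inner (f x) (f y) = inner (g x) (g y)"
proof -
  have "norm (f (x + y)) = norm (g (x + y))" using eq S xy by (simp add: subspace_add)
  then have "(norm (f x + f y))\<^sup>2 = (norm (g x + g y))\<^sup>2" using lin by (simp add: linear_add)
  then show ?thesis using eq xy by (simp add: dot_norm)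
qed

lemma dim_coord_subspace: "dim {x :: real ^ 'n. coord_proj I x = x} = card I"
proof -
  have "{x :: real ^ 'n. coord_proj I x = x} = {x. \<forall>i. i \<notin> I \<longrightarrow> x $ i = 0}"
    by (auto simp: vec_eq_iff)
  then show ?thesis using dim_substandard_cart[of I, where 'a=real] by (simp add: dim_vec_eq)
qed

lemma subspace_coord_subspace: "subspace {x. coord_proj I x = x}"
  by (auto simp: subspace_def)

lemma matrix_inv_mult:
  assumes "det (N :: real ^ 'n ^ 'n) \<noteq> 0"
  shows "N *v (matrix_inv N *v x) = x" "matrix_inv N *v (N *v x) = x"
proof -
  have "\<exists>N'. N ** N' = mat 1 \<and> N' ** N = mat 1"
    using assms by (simp add: invertible_det_nz[symmetric] invertible_def)
  then have "N ** matrix_inv N = mat 1 \<and> matrix_inv N ** N = mat 1"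
    unfolding matrix_inv_def by (rule someI_ex)
  then show "N *v (matrix_inv N *v x) = x" "matrix_inv N *v (N *v x) = x"
    by (simp_all add: matrix_vector_mul_assoc)
qed

text \<open>For \<open>M\<close> with at most as many rows as columns, \<open>R\<close> is \<open>E \<circ> M\<close> plus an isometry from the kernel of \<open>M\<close> to the coordinate plane
  complementary to \<open>J\<close>, precomposed with the orthogonal projection \<open>P\<close> to the kernel. Then \<open>R R\<^sup>T\<close> is the block matrix with blocks
  \<open>1\<close> and \<open>M M\<^sup>T\<close>, whence \<open>(det R)\<^sup>2 = det (M M\<^sup>T)\<close>. The set \<open>J\<close> and the embedding \<open>E\<close> are the same for
  all \<open>M\<close>, so that one chart serves at all zeros near its base point.\<close>

lemma adapted_frame_wide:
  assumes le: "CARD('p::finite) \<le> CARD('d::finite)"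
  obtains J :: "'d::finite set" and E :: "real ^ 'p::finite \<Rightarrow> real ^ 'd::finite"
  where "card J = CARD('p)" "linear E" "\<And>v. coord_proj J (E v) = E v" "\<And>v. norm (E v) = norm v"
    "\<And>M. matrix_jacobian M \<noteq> 0 \<Longrightarrow> \<exists>R. adapted_frame J E M R"
proof -
  obtain \<sigma> :: "'p \<Rightarrow> 'd" where inj: "inj \<sigma>"
    using card_le_inj[of "UNIV :: 'p set" "UNIV :: 'd set"] le by auto
  define J where "J = range \<sigma>"
  define E :: "real ^ 'p \<Rightarrow> real ^ 'd" where "E v = (\<chi> i. if i \<in> J then v $ inv \<sigma> i else 0)" for v
  define Et :: "real ^ 'd \<Rightarrow> real ^ 'p" where "Et z = (\<chi> a. z $ \<sigma> a)" for z
  have cJ: "card J = CARD('p)" using inj by (simp add: J_def card_image)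
  have Enth: "E v $ \<sigma> a = v $ a" for v a using inj by (simp add: E_def J_def)
  have linE: "linear E" by (rule linearI) (auto simp: E_def vec_eq_iff)
  have PE: "coord_proj J (E v) = E v" for v by (auto simp: E_def vec_eq_iff)
  have EE: "inner (E v) z = inner v (Et z)" for v z
  proof -
    have "inner (E v) z = (\<Sum>i\<in>J. E v $ i * z $ i)"
      unfolding inner_vec_def by (simp add: E_def if_distrib[of "\<lambda>x. x * _"] sum.If_cases)
    also have "\<dots> = inner v (Et z)"
      unfolding J_def inner_vec_def using inj by (subst sum.reindex) (auto simp: Enth Et_def)
    finally show ?thesis .
  qed
  have EtE: "Et (E v) = v" for v by (simp add: Et_def Enth vec_eq_iff)
  have normE: "norm (E v) = norm v" for v by (simp add: norm_eq_sqrt_inner EE EtE)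
  have "\<exists>R. adapted_frame J E M R" if nz: "matrix_jacobian M \<noteq> 0" for M :: "real ^ 'd ^ 'p"
  proof -
    define N where "N = M ** transpose M"
    have jac: "matrix_jacobian M = sqrt (det N)" using le by (simp add: matrix_jacobian_def N_def)
    then have detN: "det N \<noteq> 0" using nz by auto
    define W where "W = {x. M *v x = 0}"
    define V where "V = {x :: real ^ 'd. coord_proj (- J) x = x}"
    have NM: "M *v (transpose M *v y) = N *v y" for y by (simp add: N_def matrix_vector_mul_assoc)
    have subW: "subspace W" by (auto simp: W_def subspace_def matrix_vector_right_distrib matrix_vector_mult_scaleR)
    have "dim W + CARD('p) = CARD('d)"
    proof -
      let ?A = "range ((*v) (transpose M))"
      have "inj ((*v) (transpose M))"
      proof (rule injI)
        fix x y assume "transpose M *v x = transpose M *v y"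
        then have "N *v x = N *v y" by (metis NM)
        then show "x = y" using matrix_inv_mult(2)[OF detN] by metis
      qed
      then have "dim ?A = CARD('p)" by (simp add: dim_image_eq)
      moreover have "{y \<in> UNIV. \<forall>x\<in>?A. orthogonal x y} = W"
      proof -
        have "(\<forall>x\<in>?A. orthogonal x y) \<longleftrightarrow> (\<forall>v. inner v (M *v y) = 0)" for y
          by (auto simp: orthogonal_def inner_transpose_matrix)
        also have "(\<forall>v. inner v (M *v y) = 0) \<longleftrightarrow> M *v y = 0" for y
          by (metis inner_eq_zero_iff inner_zero_right)
        finally show ?thesis by (auto simp: W_def)
      qed
      moreover have "subspace ?A" by (simp add: linear_subspace_image)
      ultimately show ?thesis using dim_subspace_orthogonal_to_vectors[of ?A UNIV] by simp
    qed
    then have dWV: "dim W = dim V"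
      using cJ unfolding V_def dim_coord_subspace by (simp add: Compl_eq_Diff_UNIV card_Diff_subset)
    have subV: "subspace V" unfolding V_def by (rule subspace_coord_subspace)
    obtain f g where fg: "linear f" "linear g" "f ` W = V" "g ` V = W"
        "\<And>x. x \<in> W \<Longrightarrow> norm (f x) = norm x" "\<And>x. x \<in> V \<Longrightarrow> norm (g x) = norm x"
        "\<And>x. x \<in> W \<Longrightarrow> g (f x) = x" "\<And>x. x \<in> V \<Longrightarrow> f (g x) = x"
      by (rule isometries_subspaces[OF subW subV dWV]) (rule that; assumption)
    define P where "P x = x - transpose M *v (matrix_inv N *v (M *v x))" for x
    have linP: "linear P"
      unfolding P_def by (rule linearI) (auto simp: matrix_vector_right_distrib matrix_vector_mult_scaleR algebra_simps)
    have PW: "P x \<in> W" for x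
      by (simp add: P_def W_def matrix_vector_mult_diff_distrib NM matrix_inv_mult[OF detN])
    have P_id: "P w = w" if "w \<in> W" for w using that by (simp add: P_def W_def)
    have P_orth: "inner (P x) w = inner x w" if "w \<in> W" for x w
      using that by (simp add: P_def inner_diff_left inner_transpose_matrix W_def)
    have P_tr: "P (transpose M *v y) = 0" for y
      by (simp add: P_def NM matrix_inv_mult[OF detN])
    define R where "R x = f (P x) + E (M *v x)" for x
    define Q where "Q z = g (coord_proj (- J) z) + transpose M *v (Et z)" for z
    have linR: "linear R"
      unfolding R_def
      by (intro linear_compose_add linear_compose[unfolded o_def, OF linP fg(1)]
          linear_compose[unfolded o_def, OF _ linE]) simp
    have fV: "f (P x) \<in> V" for x using fg(3) PW by auto
    have pV: "coord_proj (- J) z \<in> V" for z by (simp add: V_def)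
    have inner_f: "inner (f a) (f b) = inner a b" if "a \<in> W" "b \<in> W" for a b
      using inner_eq_if_norm_eq[OF fg(1) linear_id subW _ that] fg(5) by simp
    have adj: "inner x (Q z) = inner (R x) z" for x z
    proof -
      have "inner (f (P x)) z = inner (f (P x)) (coord_proj (- J) z)"
        using fV[of x] unfolding V_def inner_vec_def mem_Collect_eq
        by (intro sum.cong refl) (metis (mono_tags, lifting) coord_proj_nth inner_zero_left)
      also have "\<dots> = inner (f (P x)) (f (g (coord_proj (- J) z)))" using fg(8)[OF pV] by simp
      also have "\<dots> = inner (P x) (g (coord_proj (- J) z))"
        using fg(4) pV PW by (intro inner_f) auto
      also have "\<dots> = inner x (g (coord_proj (- J) z))" using fg(4) pV by (intro P_orth) auto
      finally have 1: "inner (f (P x)) z = inner x (g (coord_proj (- J) z))" .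
      have "inner (E (M *v x)) z = inner x (transpose M *v Et z)"
        using inner_transpose_matrix[of M "Et z" x] by (simp add: EE inner_commute[of x] inner_commute[of "M *v x"])
      with 1 show ?thesis by (simp add: Q_def R_def inner_add_left inner_add_right)
    qed
    have "adjoint R = Q" using adj by (intro adjoint_unique) auto
    then have matQ: "matrix Q = transpose (matrix R)" using matrix_adjoint[OF linR] by simp
    have linQ: "linear Q" using \<open>adjoint R = Q\<close> adjoint_linear[OF linR] by simp
    have RQ: "R (Q z) = coord_proj (- J) z + E (N *v Et z)" for z
    proof -
      have gW: "g (coord_proj (- J) z) \<in> W" using fg(4) pV by auto
      then have "M *v g (coord_proj (- J) z) = 0" by (simp add: W_def)
      then show ?thesis
        using P_id[OF gW] fg(8)[OF pV]
        by (simp add: R_def Q_def linear_add[OF linP] P_tr matrix_vector_right_distrib NM)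
    qed
    (* Q is the adjoint of R; the composition is the identity off J and M M^T on J. *)
    have "matrix R ** transpose (matrix R) = matrix (R \<circ> Q)"
      using matrix_compose[OF linQ linR] matQ by simp
    also have "\<dots> = embed_matrix \<sigma> N"
    proof (rule embed_matrix_eqI[OF inj])
      fix a b
      have "Et (axis (\<sigma> b) 1) = axis b 1" using inj by (auto simp: Et_def axis_def vec_eq_iff inj_eq)
      then show "matrix (R \<circ> Q) $ \<sigma> a $ \<sigma> b = N $ a $ b"
        by (simp add: matrix_def RQ Enth J_def matrix_vector_mult_basis column_def)
    next
      fix i j assume ij: "i \<notin> range \<sigma> \<or> j \<notin> range \<sigma>"
      have "E (N *v Et (axis j 1)) $ i = 0"
      proof (cases "i \<in> J")
        case True
        then have "j \<notin> range \<sigma>" using ij by (simp add: J_def)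
        then have "Et (axis j 1) = 0" by (auto simp: Et_def axis_def vec_eq_iff)
        then show ?thesis using linear_0[OF linE] by simp
      qed (simp add: E_def)
      then show "matrix (R \<circ> Q) $ i $ j = of_bool (i = j)"
        using ij by (auto simp: matrix_def RQ axis_def J_def)
    qed
    finally have "det (matrix R) * det (matrix R) = det N"
      by (metis det_embed_matrix[OF inj] det_mul det_transpose)
    then have "\<bar>det (matrix R)\<bar> = matrix_jacobian M"
      unfolding jac by (metis real_sqrt_abs2)
    moreover have "coord_proj J (R x) = E (M *v x)" for x
    proof -
      have "coord_proj J (f (P x)) = 0"
        using fV[of x] coord_proj_zero_iff[of "- J" "f (P x)"] by (simp add: V_def)
      then show ?thesis by (simp add: R_def PE)
    qed
    moreover have "\<exists>C\<ge>0. \<forall>x. \<bar>norm (R x) - norm x\<bar> \<le> C * norm (M *v x)"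
    proof -
      obtain K where K: "K \<ge> 0" "\<And>y. norm ((transpose M ** matrix_inv N) *v y) \<le> K * norm y"
        using linear_le_norm[of "(*v) (transpose M ** matrix_inv N)"] by auto
      show ?thesis
      proof (intro exI[of _ "1 + K"] conjI allI)
        fix x
        have "norm (f (P x)) = norm (P x)" using fg(5) PW by auto
        moreover have "norm (x - P x) \<le> K * norm (M *v x)"
          using K(2)[of "M *v x"] by (simp add: P_def matrix_vector_mul_assoc[symmetric])
        moreover have "norm (R x) \<le> norm (f (P x)) + norm (M *v x)"
          unfolding R_def using norm_triangle_ineq[of "f (P x)" "E (M *v x)"] by (simp add: normE)
        moreover have "norm (f (P x)) \<le> norm (R x) + norm (M *v x)"
          unfolding R_def using norm_triangle_ineq4[of "f (P x) + E (M *v x)" "E (M *v x)"] by (simp add: normE)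
        moreover have "norm x \<le> norm (P x) + norm (x - P x)" "norm (P x) \<le> norm x + norm (x - P x)"
          using norm_triangle_ineq[of "P x" "x - P x"] norm_triangle_ineq4[of x "x - P x"] by simp_all
        ultimately show "\<bar>norm (R x) - norm x\<bar> \<le> (1 + K) * norm (M *v x)"
          by (simp add: algebra_simps abs_le_iff)
      qed (use K in auto)
    qed
    ultimately show ?thesis using linR unfolding adapted_frame_def by blast
  qed
  with that cJ linE PE normE show thesis by blast
qed

text \<open>For \<open>M\<close> with more rows than columns, the nonvanishing Jacobian makes \<open>M\<close> injective. Its range is mapped isometrically
  onto the whole space by \<open>E\<close>, which vanishes on the orthogonal complement, and \<open>R = E \<circ> M\<close> satisfies \<open>R\<^sup>T R = M\<^sup>T M\<close>.
  Here \<open>E\<close> depends on \<open>M\<close>; the zeros are isolated in this case, so that no second matrix has to be considered.\<close>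

lemma adapted_frame_tall:
  fixes M :: "real ^ 'd ^ 'p"
  assumes gt: "CARD('d) < CARD('p)" and nz: "matrix_jacobian M \<noteq> 0"
  obtains E :: "real ^ 'p \<Rightarrow> real ^ 'd" and R
  where "linear E" "\<And>v. norm (E v) \<le> norm v" "\<And>x. norm (E (M *v x)) = norm (M *v x)"
    "adapted_frame UNIV E M R"
proof -
  define N where "N = transpose M ** M"
  have jac: "matrix_jacobian M = sqrt (det N)" using gt by (simp add: matrix_jacobian_def N_def)
  then have detN: "det N \<noteq> 0" using nz by auto
  have NM: "transpose M *v (M *v x) = N *v x" for x by (simp add: N_def matrix_vector_mul_assoc)
  define W where "W = range ((*v) M)"
  have subW: "subspace W" unfolding W_def by (simp add: linear_subspace_image)
  have "inj ((*v) M)"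
  proof (rule injI)
    fix x y assume "M *v x = M *v y"
    then have "N *v x = N *v y" by (metis NM)
    then show "x = y" using matrix_inv_mult(2)[OF detN] by metis
  qed
  then have dW: "dim W = dim (UNIV :: (real ^ 'd) set)" unfolding W_def by (simp add: dim_image_eq)
  obtain f :: "real ^ 'p \<Rightarrow> real ^ 'd" where f: "linear f" "\<And>x. x \<in> W \<Longrightarrow> norm (f x) = norm x"
    by (rule isometries_subspaces[OF subW subspace_UNIV dW]) auto
  define P where "P v = M *v (matrix_inv N *v (transpose M *v v))" for v
  have linP: "linear P"
    unfolding P_def by (rule linearI) (auto simp: matrix_vector_right_distrib matrix_vector_mult_scaleR algebra_simps)
  have PW: "P v \<in> W" for v by (simp add: P_def W_def)
  have PM: "P (M *v x) = M *v x" for x by (simp add: P_def NM matrix_inv_mult[OF detN])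
  have P_le: "norm (P v) \<le> norm v" for v
  proof -
    have "transpose M *v (v - P v) = 0"
      by (simp add: P_def matrix_vector_mult_diff_distrib NM matrix_inv_mult[OF detN])
    then have "inner (v - P v) (P v) = 0"
      unfolding P_def[of v] by (subst inner_transpose_matrix[symmetric]) (simp add: P_def)
    then have "inner (P v) (P v) = inner v (P v)" by (simp add: inner_diff_left)
    then have "norm (P v) * norm (P v) \<le> norm v * norm (P v)"
      using norm_cauchy_schwarz[of v "P v"] by (simp add: power2_norm_eq_inner[symmetric] power2_eq_square)
    then show ?thesis by (metis mult_le_cancel_right norm_ge_zero norm_le_zero_iff order_trans not_le)
  qed
  define E where "E v = f (P v)" for v
  define R where "R x = E (M *v x)" for x
  have linE: "linear E" unfolding E_def by (rule linear_compose[unfolded o_def, OF linP f(1)])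
  have linR: "linear R" unfolding R_def by (rule linear_compose[unfolded o_def, OF _ linE]) simp
  have normE: "norm (E v) \<le> norm v" "norm (E (M *v x)) = norm (M *v x)" for v x
    using f(2)[OF PW, of v] f(2)[OF PW, of "M *v x"] P_le[of v] PM[of x] by (simp_all add: E_def)
  have inner_R: "inner (R x) (R y) = inner (M *v x) (M *v y)" for x y
    using inner_eq_if_norm_eq[OF linR, of "(*v) M" UNIV x y] normE by (simp add: R_def)
  have "transpose (matrix R) ** matrix R = N"
    unfolding N_def matrix_mult_transpose_dot_column
    using inner_R by (simp add: matrix_def column_def vec_eq_iff[symmetric] vec_lambda_eta matrix_vector_mult_basis[symmetric] del: vec_lambda_beta) (simp add: vec_eq_iff matrix_vector_mult_basis column_def vec_lambda_eta)
  then have "det (matrix R) * det (matrix R) = det N" by (metis det_mul det_transpose)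
  then have "\<bar>det (matrix R)\<bar> = matrix_jacobian M"
    unfolding jac by (metis real_sqrt_abs2)
  moreover have "coord_proj UNIV (R x) = E (M *v x)" for x by (simp add: R_def vec_eq_iff)
  moreover have "\<exists>C\<ge>0. \<forall>x. \<bar>norm (R x) - norm x\<bar> \<le> C * norm (M *v x)"
  proof -
    obtain K where K: "K \<ge> 0" "\<And>y. norm ((matrix_inv N ** transpose M) *v y) \<le> K * norm y"
      using linear_le_norm[of "(*v) (matrix_inv N ** transpose M)"] by auto
    have "norm x \<le> K * norm (M *v x)" for x
      using K(2)[of "M *v x"] by (simp add: matrix_vector_mul_assoc[symmetric] NM matrix_inv_mult[OF detN])
    then have "\<bar>norm (R x) - norm x\<bar> \<le> (1 + K) * norm (M *v x)" for x
      by (simp add: R_def normE algebra_simps abs_le_iff add_increasing2 add_increasing K)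
    then show ?thesis using K by (intro exI[of _ "1 + K"]) auto
  qed
  ultimately have "adapted_frame UNIV E M R" using linR unfolding adapted_frame_def by blast
  with that linE normE show thesis by blast
qed

section \<open>Hausdorff measure on coordinate planes\<close>

lemma hausdorff_premeasure_le_finite:
  assumes K: "finite K" "A \<subseteq> (\<Union>k\<in>K. Q k)" "\<And>k. k \<in> K \<Longrightarrow> bounded (Q k) \<and> diameter (Q k) \<le> \<delta>" and "\<delta> \<ge> 0"
  shows "hausdorff_premeasure r \<delta> A \<le> (\<Sum>k\<in>K. hausdorff_size r (Q k))"
proof -
  obtain h where h: "bij_betw h {0..<card K} K" using ex_bij_betw_nat_finite[OF K(1)] by blast
  define U where "U i = (if i < card K then Q (h i) else {})" for i
  have hK: "h i \<in> K" if "i < card K" for i using h that by (auto simp: bij_betw_def)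
  have "hausdorff_premeasure r \<delta> A \<le> (\<Sum>i. hausdorff_size r (U i))"
  proof (rule hausdorff_premeasure_le)
    show "A \<subseteq> (\<Union>i. U i)"
    proof
      fix x assume "x \<in> A"
      then obtain k where k: "k \<in> K" "x \<in> Q k" using K(2) by auto
      then have "k \<in> h ` {0..<card K}" using h by (simp add: bij_betw_def)
      then obtain i where "i < card K" "h i = k" by auto
      then have "x \<in> U i" using k by (simp add: U_def)
      then show "x \<in> (\<Union>i. U i)" by blast
    qed
    show "bounded (U i)" "diameter (U i) \<le> \<delta>" for i using K(3)[OF hK] assms(4) by (auto simp: U_def)
  qed
  also have "\<dots> = (\<Sum>i<card K. hausdorff_size r (U i))"
    by (rule suminf_finite) (auto simp: U_def)
  also have "\<dots> = (\<Sum>i\<in>{0..<card K}. hausdorff_size r (Q (h i)))"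
    by (auto simp: U_def lessThan_atLeast0)
  also have "\<dots> = (\<Sum>k\<in>K. hausdorff_size r (Q k))" by (rule sum.reindex_bij_betw[OF h])
  finally show ?thesis .
qed

text \<open>The cube is subdivided into \<open>N ^ card I\<close> congruent cubes of diameter of order \<open>1 / N\<close>; the total size of this cover is
  bounded independently of \<open>N\<close>.\<close>

lemma hausdorff_outer_coord_cube_finite:
  fixes I :: "'n::finite set"
  assumes a: "a > 0"
  shows "hausdorff_outer (card I) {x. coord_proj I x = x \<and> (\<forall>i\<in>I. \<bar>x $ i\<bar> \<le> a)} < \<infinity>"
proof -
  let ?r = "card I" and ?B = "{x. coord_proj I x = x \<and> (\<forall>i\<in>I. \<bar>x $ i\<bar> \<le> a)}"
  let ?C = "unit_ball_vol (real ?r) * (real ?r * a) ^ ?r"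
  have "hausdorff_outer ?r ?B \<le> ennreal ?C"
  proof (rule hausdorff_outer_leI)
    fix \<delta> :: real assume \<delta>: "\<delta> > 0"
    obtain N :: nat where N: "real N > max 1 (real ?r * (2 * a) / \<delta>)" using reals_Archimedean2 by blast
    then have N0: "N > 0" "real ?r * (2 * a / real N) \<le> \<delta>" using \<delta> by (auto simp: field_simps)
    define K where "K = PiE I (\<lambda>_. {0..<N})"
    define Q where "Q k = {x. coord_proj I x = x \<and> (\<forall>i\<in>I. 2 * a / real N * real (k i) - a \<le> x $ i \<and> x $ i \<le> 2 * a / real N * (real (k i) + 1) - a)}"
      for k :: "'n \<Rightarrow> nat"
    have K: "finite K" "card K = N ^ ?r" by (auto simp: K_def card_PiE finite_PiE)
    have Qd: "norm (x - y) \<le> real ?r * (2 * a / real N)" if "x \<in> Q k" "y \<in> Q k" for x y k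
    proof -
      have "norm (x - y) \<le> (\<Sum>i\<in>UNIV. \<bar>(x - y) $ i\<bar>)" by (rule norm_le_l1_cart)
      also have "\<dots> = (\<Sum>i\<in>I. \<bar>(x - y) $ i\<bar>)"
      proof (rule sum.mono_neutral_right)
        show "\<forall>i\<in>UNIV - I. \<bar>(x - y) $ i\<bar> = 0"
        proof
          fix i assume "i \<in> UNIV - I"
          then have "coord_proj I x $ i = 0" "coord_proj I y $ i = 0" by auto
          then show "\<bar>(x - y) $ i\<bar> = 0" using that by (simp add: Q_def del: coord_proj_nth)
        qed
      qed auto
      also have "\<dots> \<le> (\<Sum>i\<in>I. 2 * a / real N)"
      proof (rule sum_mono)
        fix i assume "i \<in> I"
        then have "2 * a / real N * real (k i) - a \<le> x $ i" "x $ i \<le> 2 * a / real N * (real (k i) + 1) - a"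
          "2 * a / real N * real (k i) - a \<le> y $ i" "y $ i \<le> 2 * a / real N * (real (k i) + 1) - a"
          using that by (auto simp: Q_def)
        then show "\<bar>(x - y) $ i\<bar> \<le> 2 * a / real N" by (simp add: distrib_left)
      qed
      finally show ?thesis by simp
    qed
    have Qb: "bounded (Q k)" for k
      unfolding bounded_two_points dist_norm using Qd by blast
    have Qdiam: "diameter (Q k) \<le> real ?r * (2 * a / real N)" for k
      using a N0 Qd by (intro diameter_le) auto
    have "hausdorff_premeasure ?r \<delta> ?B \<le> (\<Sum>k\<in>K. hausdorff_size ?r (Q k))"
    proof (rule hausdorff_premeasure_le_finite[OF K(1)])
      show "?B \<subseteq> (\<Union>k\<in>K. Q k)"
      proof
        fix x assume x: "x \<in> ?B"
        have "\<exists>k<N. 2 * a / real N * real k - a \<le> x $ i \<and> x $ i \<le> 2 * a / real N * (real k + 1) - a" if "i \<in> I" for i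
        proof -
          define t where "t = (x $ i + a) * real N / (2 * a)"
          have xa: "0 \<le> x $ i + a" "x $ i + a \<le> 2 * a" using x that by (auto simp: abs_le_iff)
          have t: "0 \<le> t" "t \<le> real N"
            using xa(1) mult_right_mono[OF xa(2), of "real N"] a by (simp_all add: t_def divide_le_eq mult.commute)
          have xt: "x $ i = 2 * a / real N * t - a" using a N0(1) by (simp add: t_def field_simps)
          obtain k where k: "k < N" "real k \<le> t" "t \<le> real k + 1"
          proof (cases "t = real N")
            case True
            then show thesis using N0(1) that[of "N - 1"] by (auto simp: of_nat_diff)
          next
            case False
            then have "t < real N" using t by simp
            then show thesis using t that[of "nat \<lfloor>t\<rfloor>"] by (auto simp: nat_less_iff floor_less_iff)
          qed
          have nn: "2 * a / real N \<ge> 0" using a by simp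
          show ?thesis
            using k(1) mult_left_mono[OF k(2) nn] mult_left_mono[OF k(3) nn] xt by (intro exI[of _ k]) linarith
        qed
        then obtain k where k: "\<And>i. i \<in> I \<Longrightarrow> k i < N \<and> 2 * a / real N * real (k i) - a \<le> x $ i \<and> x $ i \<le> 2 * a / real N * (real (k i) + 1) - a"
          by metis
        have "restrict k I \<in> K" "x \<in> Q (restrict k I)" using k x by (auto simp: K_def Q_def)
        then show "x \<in> (\<Union>k\<in>K. Q k)" by blast
      qed
      show "bounded (Q k) \<and> diameter (Q k) \<le> \<delta>" for k using Qb Qdiam[of k] N0 by simp
    qed (use \<delta> in simp)
    also have "\<dots> \<le> (\<Sum>k\<in>K. ennreal (unit_ball_vol (real ?r) * (real ?r * (2 * a / real N) / 2) ^ ?r))"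
    proof (rule sum_mono)
      fix k
      have "unit_ball_vol (real ?r) * (diameter (Q k) / 2) ^ ?r \<le> unit_ball_vol (real ?r) * (real ?r * (2 * a / real N) / 2) ^ ?r"
        using diameter_ge_0[OF Qb, of k] by (intro mult_left_mono power_mono divide_right_mono Qdiam) auto
      then show "hausdorff_size ?r (Q k) \<le> ennreal (unit_ball_vol (real ?r) * (real ?r * (2 * a / real N) / 2) ^ ?r)"
        unfolding hausdorff_size_def by (cases "Q k = {}") (simp_all add: ennreal_leI)
    qed
    also have "\<dots> = ennreal (real (card K) * (unit_ball_vol (real ?r) * (real ?r * (2 * a / real N) / 2) ^ ?r))"
      using a by (simp add: ennreal_mult ennreal_of_nat_eq_real_of_nat)
    also have "real (card K) * (unit_ball_vol (real ?r) * (real ?r * (2 * a / real N) / 2) ^ ?r) = ?C"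
      using N0 by (simp add: K power_divide power_mult_distrib)
    finally show "hausdorff_premeasure ?r \<delta> ?B \<le> ennreal ?C" .
  qed
  also have "\<dots> < \<infinity>" by simp
  finally show ?thesis .
qed

lemma emeasure_coord_lborel_cbox_le:
  assumes "\<And>i. i \<in> I \<Longrightarrow> a i \<le> b i"
  shows "emeasure (coord_lborel I) {z. \<forall>i\<in>I. a i \<le> z $ i \<and> z $ i \<le> b i} \<le> ennreal (\<Prod>i\<in>I. b i - a i)"
proof -
  let ?l = "(\<chi> i. if i \<in> I then a i else 0) :: real ^ 'a"
  let ?u = "(\<chi> i. if i \<in> I then b i else 1) :: real ^ 'a"
  have "emeasure (coord_lborel I) {z. \<forall>i\<in>I. a i \<le> z $ i \<and> z $ i \<le> b i}
      = emeasure lborel {z \<in> slab I. coord_proj I z \<in> {z. \<forall>i\<in>I. a i \<le> z $ i \<and> z $ i \<le> b i}}"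
    by (rule emeasure_coord_lborel) measurable
  also have "\<dots> \<le> emeasure lborel (cbox ?l ?u)"
  proof (rule emeasure_mono, rule subsetI)
    fix z assume z: "z \<in> {z \<in> slab I. coord_proj I z \<in> {z. \<forall>i\<in>I. a i \<le> z $ i \<and> z $ i \<le> b i}}"
    show "z \<in> cbox ?l ?u"
      unfolding mem_box_cart
    proof
      fix i show "?l $ i \<le> z $ i \<and> z $ i \<le> ?u $ i"
        using z by (cases "i \<in> I") (auto simp: slab_def less_imp_le)
    qed
  qed simp
  also have "\<dots> = ennreal (\<Prod>b\<in>Basis. (?u - ?l) \<bullet> b)"
    using assms by (intro emeasure_lborel_cbox) (auto simp: Basis_vec_def inner_axis)
  also have "(\<Prod>b\<in>Basis. (?u - ?l) \<bullet> b) = (\<Prod>i\<in>UNIV. (?u - ?l) $ i)"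
    by (subst prod_Basis_cart) (simp add: inner_axis)
  also have "(\<Prod>i\<in>UNIV. (?u - ?l) $ i) = (\<Prod>i\<in>I. b i - a i)"
    by (rule prod.mono_neutral_cong_right) auto
  finally show ?thesis .
qed

text \<open>Every set \<open>U\<close> is contained in a cube of side twice its diameter, so its Lebesgue measure is at most a constant
  times its Hausdorff size; covers of the unit cube must have total Lebesgue measure at least \<open>1\<close>.\<close>

lemma hausdorff_outer_coord_cube_pos:
  fixes I :: "'n::finite set"
  shows "hausdorff_outer (card I) {x. coord_proj I x = x \<and> (\<forall>i\<in>I. 0 < x $ i \<and> x $ i < 1)} > 0"
proof -
  let ?r = "card I" and ?B = "{x :: real ^ 'n. coord_proj I x = x \<and> (\<forall>i\<in>I. 0 < x $ i \<and> x $ i < 1)}"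
  (* K is chosen so that K times the size of a set of diameter D is (2 D) ^ r, the volume of a cube of side 2 D. *)
  define K where "K = 4 ^ ?r / unit_ball_vol (real ?r)"
  have K: "K > 0" by (simp add: K_def)
  have "1 \<le> ennreal K * hausdorff_premeasure ?r 1 ?B"
  proof -
    have *: "ennreal (1 / K) \<le> (\<Sum>i. hausdorff_size ?r (U i))"
      if cov: "?B \<subseteq> \<Union> (range U)" and U: "\<forall>i. bounded (U i) \<and> diameter (U i) \<le> 1" for U :: "nat \<Rightarrow> _"
    proof -
      define T where "T k = (if U k = {} then {} else
          {z. \<forall>i\<in>I. (SOME x. x \<in> U k) $ i - diameter (U k) \<le> z $ i \<and> z $ i \<le> (SOME x. x \<in> U k) $ i + diameter (U k)})" for k
      have T: "U k \<subseteq> T k" "T k \<in> sets borel"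
        "emeasure (coord_lborel I) (T k) \<le> ennreal K * hausdorff_size ?r (U k)" for k
      proof -
        define x where "x = (SOME x. x \<in> U k)"
        have "{z. \<forall>i\<in>I. b i \<le> z $ i \<and> z $ i \<le> b' i} \<in> sets borel" for b b' :: "'n \<Rightarrow> real"
          by measurable
        then show "T k \<in> sets borel" unfolding T_def by simp
        show "U k \<subseteq> T k"
        proof
          fix y assume y: "y \<in> U k"
          then have x: "x \<in> U k" unfolding x_def by (rule someI)
          have "\<bar>x $ i - y $ i\<bar> \<le> diameter (U k)" for i
            using diameter_bounded_bound[OF _ x y] U component_le_norm_cart[of "x - y" i]
            by (auto simp: dist_norm intro: order_trans)
          then have "x $ i - diameter (U k) \<le> y $ i \<and> y $ i \<le> x $ i + diameter (U k)" for i
            by (smt (verit))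
          then show "y \<in> T k" using y by (auto simp: T_def x_def[symmetric])
        qed
        show "emeasure (coord_lborel I) (T k) \<le> ennreal K * hausdorff_size ?r (U k)"
        proof (cases "U k = {}")
          case False
          have d: "diameter (U k) \<ge> 0" using U diameter_ge_0 by blast
          have "emeasure (coord_lborel I) (T k) \<le> ennreal (\<Prod>i\<in>I. (x $ i + diameter (U k)) - (x $ i - diameter (U k)))"
            using False d unfolding T_def x_def[symmetric] by (simp only: if_False, intro emeasure_coord_lborel_cbox_le) simp
          also have "(\<Prod>i\<in>I. (x $ i + diameter (U k)) - (x $ i - diameter (U k))) = (2 * diameter (U k)) ^ ?r"
            by (simp add: prod_constant)
          also have "\<dots> = K * (unit_ball_vol (real ?r) * (diameter (U k) / 2) ^ ?r)"
          proof -
            have "(2 * diameter (U k)) ^ ?r = (4 * (diameter (U k) / 2)) ^ ?r" by simp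
            also have "\<dots> = 4 ^ ?r * (diameter (U k) / 2) ^ ?r" by (rule power_mult_distrib)
            finally show ?thesis
              unfolding K_def using unit_ball_vol_pos[of "real ?r"] by (simp add: less_imp_neq[symmetric])
          qed
          also have "ennreal \<dots> = ennreal K * hausdorff_size ?r (U k)"
            using False K d by (simp add: hausdorff_size_def ennreal_mult)
          finally show ?thesis .
        qed (simp add: T_def)
      qed
      have "1 = emeasure (coord_lborel I) {x. \<forall>i\<in>I. 0 < x $ i \<and> x $ i < 1}"
        by (subst emeasure_coord_lborel_box) auto
      also have "\<dots> = emeasure (coord_lborel I) ?B"
      proof -
        have [measurable]: "?B \<in> sets borel"
        proof -
          have "closed {x :: real ^ 'n. coord_proj I x = x}"
            by (intro closed_Collect_eq continuous_intros)
          then have "{x :: real ^ 'n. coord_proj I x = x} \<inter> {x. \<forall>i\<in>I. 0 < x $ i \<and> x $ i < 1} \<in> sets borel"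
            by measurable
          then show ?thesis by (simp add: Collect_conj_eq)
        qed
        have "coord_proj I -` ?B = coord_proj I -` {x. \<forall>i\<in>I. 0 < x $ i \<and> x $ i < 1}" by auto
        then show ?thesis
          using emeasure_coord_lborel_proj[of ?B I] emeasure_coord_lborel_proj[of "{x. \<forall>i\<in>I. 0 < x $ i \<and> x $ i < 1}" I]
          by simp
      qed
      also have "\<dots> \<le> emeasure (coord_lborel I) (\<Union>k. T k)"
        using cov T(1,2) by (intro emeasure_mono) (auto, blast)
      also have "\<dots> \<le> (\<Sum>k. emeasure (coord_lborel I) (T k))"
        using T(2) by (intro emeasure_subadditive_countably) auto
      also have "\<dots> \<le> (\<Sum>k. ennreal K * hausdorff_size ?r (U k))"
        by (intro suminf_le T summableI)
      also have "\<dots> = ennreal K * (\<Sum>k. hausdorff_size ?r (U k))" by simp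
      finally have "ennreal (1 / K) * 1 \<le> ennreal (1 / K) * (ennreal K * (\<Sum>k. hausdorff_size ?r (U k)))"
        by (intro mult_left_mono) auto
      also have "\<dots> = (\<Sum>k. hausdorff_size ?r (U k))"
        using K by (simp add: mult.assoc[symmetric] ennreal_mult'[symmetric])
      finally show ?thesis by simp
    qed
    have "ennreal (1 / K) \<le> hausdorff_premeasure ?r 1 ?B"
      unfolding hausdorff_premeasure_def by (rule INF_greatest) (use * in auto)
    then have "ennreal K * ennreal (1 / K) \<le> ennreal K * hausdorff_premeasure ?r 1 ?B"
      by (rule mult_left_mono) simp
    then show ?thesis using K by (simp add: ennreal_mult'[symmetric])
  qed
  then have "hausdorff_premeasure ?r 1 ?B > 0"
    by (cases "hausdorff_premeasure ?r 1 ?B = 0") (auto simp: zero_less_iff_neq_zero)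
  then show ?thesis using hausdorff_premeasure_le_outer[of 1 ?r ?B] by (simp add: less_le_trans)
qed

text \<open>Hausdorff measure on the plane is invariant under translations of the plane, and gives the unit cube a positive finite mass.\<close>

lemma hausdorff_outer_coord_plane:
  fixes I :: "'n::finite set"
  obtains c where "0 < c" "c < \<infinity>"
    "\<And>A. A \<in> sets borel \<Longrightarrow> (\<And>x. x \<in> A \<Longrightarrow> coord_proj I x = x) \<Longrightarrow>
       hausdorff_outer (card I) A = c * emeasure (coord_lborel I) A"
proof -
  let ?H = "hausdorff_outer (card I)"
  define V where "V = {x :: real ^ 'n. coord_proj I x = x}"
  have "closed V" unfolding V_def by (intro closed_Collect_eq continuous_intros)
  then have V [measurable]: "V \<in> sets borel" by simp
  define \<eta> where "\<eta> = distr (density (hausdorff_measure (card I)) (indicator V)) borel (coord_proj I)"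
  have pm: "coord_proj I -` A \<in> sets borel" if "A \<in> sets borel" for A
    using measurable_sets[OF borel_measurable_coord_proj that, of I] by simp
  have \<eta>: "emeasure \<eta> A = ?H (A \<inter> V)" if A [measurable]: "A \<in> sets borel" for A
  proof -
    have "emeasure \<eta> A = emeasure (density (hausdorff_measure (card I)) (indicator V)) (coord_proj I -` A)"
      unfolding \<eta>_def by (subst emeasure_distr) (auto simp: measurable_def pm)
    also have "\<dots> = emeasure (hausdorff_measure (card I)) (V \<inter> coord_proj I -` A)"
      using pm[OF A] by (subst emeasure_density) (auto simp: indicator_inter_arith[symmetric])
    also have "V \<inter> coord_proj I -` A = A \<inter> V" by (auto simp: V_def)
    finally show ?thesis using A by (simp add: emeasure_hausdorff_measure)
  qed
  have sets: "sets \<eta> = sets borel" by (simp add: \<eta>_def)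
  have inv: "emeasure \<eta> ((\<lambda>x. x + v) -` A) = emeasure \<eta> A" if A: "A \<in> sets borel" and v: "coord_proj I v = v" for A v
  proof -
    have m: "(\<lambda>x. x + v) -` A \<in> sets borel" using measurable_sets[of "\<lambda>x. x + v" borel borel A] A by simp
    have "(\<lambda>x. x + v) ` ((\<lambda>x. x + v) -` A \<inter> V) = A \<inter> V"
    proof (rule set_eqI)
      fix y
      have "y \<in> V \<longleftrightarrow> y - v \<in> V" using v by (simp add: V_def)
      moreover have "y \<in> (\<lambda>x. x + v) ` ((\<lambda>x. x + v) -` A \<inter> V) \<longleftrightarrow> y - v \<in> (\<lambda>x. x + v) -` A \<inter> V"
        by (metis (no_types, lifting) add_diff_cancel diff_add_cancel image_iff)
      ultimately show "y \<in> (\<lambda>x. x + v) ` ((\<lambda>x. x + v) -` A \<inter> V) \<longleftrightarrow> y \<in> A \<inter> V" by simp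
    qed
    then have "?H ((\<lambda>x. x + v) -` A \<inter> V) = ?H (A \<inter> V)"
      using hausdorff_outer_isometric_image[of "(\<lambda>x. x + v) -` A \<inter> V" "\<lambda>x. x + v" "card I"] by simp
    then show ?thesis using A m by (simp add: \<eta>)
  qed
  have fin: "emeasure \<eta> A < \<infinity>" if A: "A \<in> sets borel" "A \<subseteq> {x. \<forall>i\<in>I. \<bar>x $ i\<bar> \<le> a}" and "a > 0" for A a
  proof -
    have "emeasure \<eta> A \<le> ?H {x. coord_proj I x = x \<and> (\<forall>i\<in>I. \<bar>x $ i\<bar> \<le> a)}"
      using A by (simp add: \<eta>) (intro hausdorff_outer_mono, auto simp: V_def)
    also have "\<dots> < \<infinity>" by (rule hausdorff_outer_coord_cube_finite) fact
    finally show ?thesis .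
  qed
  let ?B = "{z :: real ^ 'n. \<forall>i\<in>I. 0 < z $ i \<and> z $ i < 1}"
  have sf: "sigma_finite_measure \<eta>"
  proof
    let ?A = "\<lambda>n::nat. {x :: real ^ 'n. \<forall>i\<in>I. \<bar>x $ i\<bar> \<le> real n + 1}"
    have "z \<in> (\<Union>n. ?A n)" for z
    proof -
      obtain n :: nat where "norm z < real n" using reals_Archimedean2 by blast
      then have "\<bar>z $ i\<bar> \<le> real n + 1" for i using component_le_norm_cart[of z i] by simp
      then show ?thesis by auto
    qed
    moreover have "?A n \<in> sets borel" for n by simp
    ultimately show "\<exists>A. countable A \<and> A \<subseteq> sets \<eta> \<and> \<Union> A = space \<eta> \<and> (\<forall>a\<in>A. emeasure \<eta> a \<noteq> \<infinity>)"
      using fin[of "?A _" "real _ + 1"]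
      by (intro exI[of _ "range ?A"]) (auto simp: sets less_top \<eta>_def)
  qed
  have eq: "emeasure \<eta> A = emeasure \<eta> (uminus -` ?B) * emeasure (coord_lborel I) A" if "A \<in> sets borel" for A
  proof (rule translation_invariant_eq_coord_lborel[OF sf sets _ inv that])
    fix A :: "(real ^ 'n) set" assume A: "A \<in> sets borel"
    have "coord_proj I -` A \<inter> V = A \<inter> V" by (auto simp: V_def)
    then show "emeasure \<eta> (coord_proj I -` A) = emeasure \<eta> A" using A pm by (simp add: \<eta>)
  qed
  have B [measurable]: "?B \<in> sets borel" by measurable
  have Bm: "uminus -` ?B \<in> sets borel" using measurable_sets[of uminus borel borel ?B] B by simp
  show thesis
  proof
    show "emeasure \<eta> (uminus -` ?B) < \<infinity>" by (rule fin[OF Bm, of 1]) auto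
    have "emeasure \<eta> ?B > 0"
      using hausdorff_outer_coord_cube_pos[of I] B by (simp add: \<eta> V_def Collect_conj_eq Int_commute)
    then have "emeasure \<eta> (uminus -` ?B) * emeasure (coord_lborel I) ?B > 0" using eq[OF B] by simp
    then show "emeasure \<eta> (uminus -` ?B) > 0" by (simp only: ennreal_zero_less_mult_iff)
    fix A assume A: "A \<in> sets borel" "\<And>x. x \<in> A \<Longrightarrow> coord_proj I x = x"
    then have "A \<inter> V = A" by (auto simp: V_def)
    then show "?H A = emeasure \<eta> (uminus -` ?B) * emeasure (coord_lborel I) A"
      using eq[OF A(1)] \<eta>[OF A(1)] by simp
  qed
qed

text \<open>A linear map which preserves the coordinates outside \<open>I\<close> maps the plane of the \<open>I\<close>-coordinates to itself. Its determinant
  on the plane equals the one on the whole space, as one sees by applying it to a slab over \<open>E\<close>.\<close>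

lemma emeasure_coord_lborel_shear:
  fixes N N' :: "real ^ 'n \<Rightarrow> real ^ 'n"
  assumes lin: "linear N" "linear N'" and inv: "\<And>x. N' (N x) = x" "\<And>x. N (N' x) = x"
    and pres: "\<And>x. coord_proj (- I) (N x) = coord_proj (- I) x"
    and E: "E \<in> sets borel" "\<And>x. x \<in> E \<Longrightarrow> coord_proj I x = x"
  shows "N ` E \<in> sets borel"
    "emeasure (coord_lborel I) (N ` E) = ennreal \<bar>det (matrix N)\<bar> * emeasure (coord_lborel I) E"
proof -
  have mN' [measurable]: "N' \<in> borel_measurable borel"
    using lin(2) by (intro borel_measurable_continuous_onI linear_continuous_on) (simp add: linear_conv_bounded_linear)
  have NE: "N ` E = N' -` E"
  proof (rule set_eqI)
    fix x show "x \<in> N ` E \<longleftrightarrow> x \<in> N' -` E"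
      using inv by (metis image_iff vimageE vimageI2)
  qed
  show NEm [measurable]: "N ` E \<in> sets borel" unfolding NE using measurable_sets[OF mN' E(1)] by simp
  have [measurable]: "E \<in> sets borel" by fact
  have pres': "coord_proj (- I) (N' x) = coord_proj (- I) x" for x using pres[of "N' x"] inv by simp
  have VI: "coord_proj I (N x) = N x" "coord_proj I (N' x) = N' x" if "coord_proj I x = x" for x
  proof -
    have "coord_proj (- I) x = 0" using that by (simp only: coord_proj_zero_iff)
    then have "coord_proj (- I) (N x) = 0" "coord_proj (- I) (N' x) = 0" by (simp_all only: pres pres')
    then show "coord_proj I (N x) = N x" "coord_proj I (N' x) = N' x" by (simp_all only: coord_proj_zero_iff)
  qed
  have slab_iff: "z \<in> slab I \<longleftrightarrow> z' \<in> slab I" if "coord_proj (- I) z = coord_proj (- I) z'" for z z'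
  proof -
    have "z $ j = z' $ j" if "j \<in> - I" for j
      using arg_cong[OF \<open>coord_proj (- I) z = coord_proj (- I) z'\<close>, of "\<lambda>x. x $ j"] that by simp
    then show ?thesis by (simp add: slab_def)
  qed
  let ?p = "coord_proj I" and ?q = "coord_proj (- I)"
  let ?f = "\<lambda>z. indicator E (?p z) * indicator (slab I) z :: ennreal"
  have "ennreal \<bar>det (matrix N)\<bar> * emeasure (coord_lborel I) E = ennreal \<bar>det (matrix N)\<bar> * (\<integral>\<^sup>+u. indicator E u \<partial>coord_lborel I)"
    by simp
  also have "\<dots> = ennreal \<bar>det (matrix N)\<bar> * (\<integral>\<^sup>+z. ?f z \<partial>lborel)"
    by (subst nn_integral_coord_lborel) auto
  also have "\<dots> = (\<integral>\<^sup>+z. ?f z * ennreal (\<bar>det (matrix N)\<bar> * indicator UNIV z) \<partial>lborel)"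
    by (subst nn_integral_cmult[symmetric]) (auto simp: mult.commute)
  also have "\<dots> = (\<integral>\<^sup>+z. ?f (N' z) * indicator (N ` UNIV) z \<partial>lborel)"
  proof (rule nn_integral_change_of_variables[symmetric])
    show "(N has_derivative N) (at x)" for x
      using lin(1) by (intro bounded_linear_imp_has_derivative) (simp add: linear_conv_bounded_linear)
    have "N ` UNIV = UNIV" using inv by (metis surjI)
    then show "N ` UNIV \<in> sets borel" by simp
  qed (auto simp: inv)
  also have "\<dots> = (\<integral>\<^sup>+z. ?f (N' z) \<partial>lborel)"
  proof -
    have "N ` UNIV = UNIV" using inv by (metis surjI)
    then show ?thesis by simp
  qed
  also have "\<dots> = (\<integral>\<^sup>+y. \<integral>\<^sup>+u. ?f (N' (?q y + ?p u)) \<partial>coord_lborel I \<partial>coord_lborel (- I))"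
    by (subst nn_integral_lborel_coord_split[of _ "- I"]) auto
  also have "\<dots> = (\<integral>\<^sup>+y. emeasure (coord_lborel I) (N ` E) * indicator (slab I) y \<partial>coord_lborel (- I))"
  proof (rule nn_integral_cong)
    fix y :: "real ^ 'n"
    define w where "w = N (?p (N' (?q y)))"
    have w: "?p w = w" unfolding w_def by (rule VI) simp
    have eq: "?f (N' (?q y + ?p u)) = indicator E (N' (?p (u + w))) * indicator (slab I) y" for u
    proof -
      have "?p (N' (?q y + ?p u)) = N' (?p u) + ?p (N' (?q y))"
        using VI(2)[of "?p u"] by (simp add: linear_add[OF lin(2)])
      also have "\<dots> = N' (?p (u + w))"
        using w by (simp add: linear_add[OF lin(2)]) (simp add: w_def inv)
      finally have 1: "?p (N' (?q y + ?p u)) = N' (?p (u + w))" .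
      have "N' (?q y + ?p u) \<in> slab I \<longleftrightarrow> y \<in> slab I"
        by (rule slab_iff) (simp add: pres')
      with 1 show ?thesis by (simp add: indicator_def)
    qed
    have "(\<integral>\<^sup>+u. ?f (N' (?q y + ?p u)) \<partial>coord_lborel I)
      = (\<integral>\<^sup>+u. indicator E (N' (?p (u + w))) \<partial>coord_lborel I) * indicator (slab I) y"
      unfolding eq by (rule nn_integral_multc) measurable
    also have "(\<integral>\<^sup>+u. indicator E (N' (?p (u + w))) \<partial>coord_lborel I) = (\<integral>\<^sup>+u. indicator E (N' (?p u)) \<partial>coord_lborel I)"
      by (rule nn_integral_coord_lborel_translate[OF _ w]) measurable
    also have "\<dots> = (\<integral>\<^sup>+u. indicator E (N' u) \<partial>coord_lborel I)"
      by (rule nn_integral_coord_lborel_proj) measurable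
    also have "\<dots> = (\<integral>\<^sup>+u. indicator (N ` E) u \<partial>coord_lborel I)"
      unfolding NE by (intro nn_integral_cong) (auto split: split_indicator)
    also have "\<dots> = emeasure (coord_lborel I) (N ` E)" by simp
    finally show "(\<integral>\<^sup>+u. ?f (N' (?q y + ?p u)) \<partial>coord_lborel I)
      = emeasure (coord_lborel I) (N ` E) * indicator (slab I) y" .
  qed
  also have "\<dots> = emeasure (coord_lborel I) (N ` E) * emeasure (coord_lborel (- I)) (slab I)"
    by (rule nn_integral_cmult_indicator) simp
  also have "emeasure (coord_lborel (- I)) (slab I) = 1"
    unfolding slab_def by (subst emeasure_coord_lborel_box) auto
  finally show "emeasure (coord_lborel I) (N ` E) = ennreal \<bar>det (matrix N)\<bar> * emeasure (coord_lborel I) E"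
    by simp
qed

text \<open>By Lindelof's theorem countably many of the neighbourhoods cover \<open>S\<close>, and they can be made disjoint.\<close>

lemma emeasure_le_if_locally_le:
  fixes M N :: "'a::{second_countable_topology} measure"
  assumes sets: "sets M = sets borel" "sets N = sets borel"
    and loc: "\<And>x. x \<in> S \<Longrightarrow> \<exists>U. open U \<and> x \<in> U \<and>
      (\<forall>A\<in>sets borel. A \<subseteq> U \<inter> S \<longrightarrow> emeasure M A \<le> K * emeasure N A)"
    and A: "A \<in> sets borel" "A \<subseteq> S"
  shows "emeasure M A \<le> K * emeasure N A"
proof (cases "S = {}")
  case True
  then show ?thesis using A by simp
next
  case False
  obtain U where U: "\<And>x. x \<in> S \<Longrightarrow> open (U x) \<and> x \<in> U x \<and>
      (\<forall>A\<in>sets borel. A \<subseteq> U x \<inter> S \<longrightarrow> emeasure M A \<le> K * emeasure N A)"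
    using loc by metis
  obtain F where F: "F \<subseteq> U ` S" "countable F" "\<Union> F = \<Union> (U ` S)"
    using Lindelof[of "U ` S"] U by blast
  have "F \<noteq> {}" using False U F(3) by blast
  define T where "T = from_nat_into F"
  have T: "T n \<in> U ` S" for n using F(1) from_nat_into[OF \<open>F \<noteq> {}\<close>] unfolding T_def by blast
  have UT: "(\<Union>n. T n) = \<Union> (U ` S)" using F(3) range_from_nat_into[OF \<open>F \<noteq> {}\<close> F(2)] unfolding T_def by simp
  have Tm: "T n \<in> sets borel" for n using T[of n] U by auto
  define D where "D n = A \<inter> disjointed T n" for n
  have dm: "disjointed T n \<in> sets borel" for n
    using sets.range_disjointed_sets[of T borel] Tm by auto
  have Dm: "D n \<in> sets borel" for n unfolding D_def using A(1) dm by simp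
  have Ddisj: "disjoint_family D" using disjoint_family_disjointed[of T] by (auto simp: D_def disjoint_family_on_def)
  have DU: "(\<Union>n. D n) = A"
  proof -
    have "(\<Union>n. D n) = A \<inter> (\<Union>n. disjointed T n)" by (simp add: D_def)
    also have "\<dots> = A \<inter> \<Union> (U ` S)" by (simp only: UN_disjointed_eq UT)
    also have "A \<subseteq> \<Union> (U ` S)" using U A(2) by auto
    then have "A \<inter> \<Union> (U ` S) = A" by (rule Int_absorb2)
    finally show ?thesis .
  qed
  have le: "emeasure M (D n) \<le> K * emeasure N (D n)" for n
  proof -
    obtain x where x: "x \<in> S" "T n = U x" using T[of n] by auto
    have "D n \<subseteq> U x \<inter> S" using disjointed_subset[of T n] A(2) x by (auto simp: D_def)
    then show ?thesis using U[OF x(1)] Dm by blast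
  qed
  have "emeasure M A = (\<Sum>n. emeasure M (D n))"
    unfolding DU[symmetric] using Dm Ddisj by (intro suminf_emeasure[symmetric]) (auto simp: sets)
  also have "\<dots> \<le> (\<Sum>n. K * emeasure N (D n))" by (intro suminf_le le summableI)
  also have "\<dots> = K * (\<Sum>n. emeasure N (D n))" by simp
  also have "(\<Sum>n. emeasure N (D n)) = emeasure N A"
    unfolding DU[symmetric] using Dm Ddisj by (intro suminf_emeasure) (auto simp: sets)
  finally show ?thesis .
qed

section \<open>Charts straightening a level set, and the area formula\<close>

text \<open>Bounded Lipschitz functions form an algebra, in contrast to Lipschitz functions, so that determinants inherit the property from the
  matrix entries.\<close>

definition bounded_lipschitz :: "'a::metric_space set \<Rightarrow> ('a \<Rightarrow> real) \<Rightarrow> bool" where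
  "bounded_lipschitz S f \<longleftrightarrow>
     (\<exists>C\<ge>0. (\<forall>x\<in>S. \<bar>f x\<bar> \<le> C) \<and> (\<forall>x\<in>S. \<forall>y\<in>S. \<bar>f x - f y\<bar> \<le> C * dist x y))"

lemma bounded_lipschitzI:
  assumes "\<And>x. x \<in> S \<Longrightarrow> \<bar>f x\<bar> \<le> C" "\<And>x y. x \<in> S \<Longrightarrow> y \<in> S \<Longrightarrow> \<bar>f x - f y\<bar> \<le> D * dist x y"
  shows "bounded_lipschitz S f"
  unfolding bounded_lipschitz_def
proof (intro exI[of _ "max 0 (max C D)"] conjI ballI)
  fix x y assume "x \<in> S" "y \<in> S"
  then have "\<bar>f x - f y\<bar> \<le> D * dist x y" by (rule assms)
  also have "\<dots> \<le> max 0 (max C D) * dist x y" by (intro mult_right_mono) auto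
  finally show "\<bar>f x - f y\<bar> \<le> max 0 (max C D) * dist x y" .
qed (use assms in \<open>auto simp: le_max_iff_disj\<close>)

lemma bounded_lipschitzE:
  assumes "bounded_lipschitz S f"
  obtains C where "C \<ge> 0" "\<And>x. x \<in> S \<Longrightarrow> \<bar>f x\<bar> \<le> C" "\<And>x y. x \<in> S \<Longrightarrow> y \<in> S \<Longrightarrow> \<bar>f x - f y\<bar> \<le> C * dist x y"
  using assms unfolding bounded_lipschitz_def by blast

lemma bounded_lipschitz_subset: "bounded_lipschitz S f \<Longrightarrow> T \<subseteq> S \<Longrightarrow> bounded_lipschitz T f"
  unfolding bounded_lipschitz_def by blast

lemma bounded_lipschitz_cong:
  "bounded_lipschitz S f \<Longrightarrow> (\<And>x. x \<in> S \<Longrightarrow> f x = g x) \<Longrightarrow> bounded_lipschitz S g"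
  unfolding bounded_lipschitz_def by simp

lemma bounded_lipschitz_const [simp]: "bounded_lipschitz S (\<lambda>_. c)"
  by (rule bounded_lipschitzI[where C="\<bar>c\<bar>" and D=0]) auto

lemma bounded_lipschitz_add:
  assumes "bounded_lipschitz S f" "bounded_lipschitz S g"
  shows "bounded_lipschitz S (\<lambda>x. f x + g x)"
proof -
  obtain A where A: "\<And>x. x \<in> S \<Longrightarrow> \<bar>f x\<bar> \<le> A" "\<And>x y. x \<in> S \<Longrightarrow> y \<in> S \<Longrightarrow> \<bar>f x - f y\<bar> \<le> A * dist x y"
    using bounded_lipschitzE[OF assms(1)] by metis
  obtain B where B: "\<And>x. x \<in> S \<Longrightarrow> \<bar>g x\<bar> \<le> B" "\<And>x y. x \<in> S \<Longrightarrow> y \<in> S \<Longrightarrow> \<bar>g x - g y\<bar> \<le> B * dist x y"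
    using bounded_lipschitzE[OF assms(2)] by metis
  show ?thesis
  proof (rule bounded_lipschitzI[where C="A + B" and D="A + B"])
    fix x assume "x \<in> S" then show "\<bar>f x + g x\<bar> \<le> A + B" using A(1)[of x] B(1)[of x] by linarith
  next
    fix x y assume "x \<in> S" "y \<in> S"
    then show "\<bar>f x + g x - (f y + g y)\<bar> \<le> (A + B) * dist x y"
      using A(2)[of x y] B(2)[of x y] unfolding distrib_right by linarith
  qed
qed

lemma bounded_lipschitz_mult:
  assumes "bounded_lipschitz S f" "bounded_lipschitz S g"
  shows "bounded_lipschitz S (\<lambda>x. f x * g x)"
proof -
  obtain A where A: "A \<ge> 0" "\<And>x. x \<in> S \<Longrightarrow> \<bar>f x\<bar> \<le> A" "\<And>x y. x \<in> S \<Longrightarrow> y \<in> S \<Longrightarrow> \<bar>f x - f y\<bar> \<le> A * dist x y"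
    using bounded_lipschitzE[OF assms(1)] by metis
  obtain B where B: "B \<ge> 0" "\<And>x. x \<in> S \<Longrightarrow> \<bar>g x\<bar> \<le> B" "\<And>x y. x \<in> S \<Longrightarrow> y \<in> S \<Longrightarrow> \<bar>g x - g y\<bar> \<le> B * dist x y"
    using bounded_lipschitzE[OF assms(2)] by metis
  show ?thesis
  proof (rule bounded_lipschitzI[where C="A * B" and D="A * B + A * B"])
    fix x assume "x \<in> S" then show "\<bar>f x * g x\<bar> \<le> A * B"
      using A(1,2) B(1,2) by (simp add: abs_mult mult_mono)
  next
    fix x y assume xy: "x \<in> S" "y \<in> S"
    have "\<bar>f x * g x - f y * g y\<bar> = \<bar>f x * (g x - g y) + (f x - f y) * g y\<bar>" by (simp add: algebra_simps)
    also have "\<dots> \<le> \<bar>f x\<bar> * \<bar>g x - g y\<bar> + \<bar>f x - f y\<bar> * \<bar>g y\<bar>"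
      by (metis abs_mult abs_triangle_ineq)
    also have "\<dots> \<le> A * (B * dist x y) + (A * dist x y) * B"
      using A B xy by (intro add_mono mult_mono) auto
    finally show "\<bar>f x * g x - f y * g y\<bar> \<le> (A * B + A * B) * dist x y" by (simp add: algebra_simps)
  qed
qed

lemma bounded_lipschitz_sum:
  "(\<And>i. i \<in> I \<Longrightarrow> bounded_lipschitz S (f i)) \<Longrightarrow> bounded_lipschitz S (\<lambda>x. \<Sum>i\<in>I. f i x)"
  by (induction I rule: infinite_finite_induct) (auto intro: bounded_lipschitz_add)

lemma bounded_lipschitz_prod:
  "(\<And>i. i \<in> I \<Longrightarrow> bounded_lipschitz S (f i)) \<Longrightarrow> bounded_lipschitz S (\<lambda>x. \<Prod>i\<in>I. f i x)"
  by (induction I rule: infinite_finite_induct) (auto intro: bounded_lipschitz_mult)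

lemma bounded_lipschitz_inverse_abs:
  assumes "bounded_lipschitz S f" and b: "b > 0" "\<And>x. x \<in> S \<Longrightarrow> b \<le> \<bar>f x\<bar>"
  shows "bounded_lipschitz S (\<lambda>x. 1 / \<bar>f x\<bar>)"
proof -
  obtain A where A: "A \<ge> 0" "\<And>x y. x \<in> S \<Longrightarrow> y \<in> S \<Longrightarrow> \<bar>f x - f y\<bar> \<le> A * dist x y"
    using bounded_lipschitzE[OF assms(1)] by metis
  show ?thesis
  proof (rule bounded_lipschitzI[where C="1 / b" and D="A / (b * b)"])
    fix x assume "x \<in> S" then show "\<bar>1 / \<bar>f x\<bar>\<bar> \<le> 1 / b" using b by (simp add: frac_le)
  next
    fix x y assume xy: "x \<in> S" "y \<in> S"
    have pos: "\<bar>f x\<bar> > 0" "\<bar>f y\<bar> > 0" using b xy by (meson less_le_trans)+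
    have "\<bar>1 / \<bar>f x\<bar> - 1 / \<bar>f y\<bar>\<bar> = \<bar>\<bar>f y\<bar> - \<bar>f x\<bar>\<bar> / (\<bar>f x\<bar> * \<bar>f y\<bar>)"
      using pos by (simp add: diff_divide_eq_iff divide_diff_eq_iff abs_mult)
    also have "\<dots> \<le> (A * dist x y) / (b * b)"
      using A(2)[OF xy] b xy pos by (intro frac_le mult_mono) auto
    finally show "\<bar>1 / \<bar>f x\<bar> - 1 / \<bar>f y\<bar>\<bar> \<le> A / (b * b) * dist x y" by simp
  qed
qed

lemma bounded_lipschitz_compose:
  assumes "bounded_lipschitz T f" "\<And>x. x \<in> S \<Longrightarrow> g x \<in> T"
    "\<And>x y. x \<in> S \<Longrightarrow> y \<in> S \<Longrightarrow> dist (g x) (g y) \<le> L * dist x y"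
  shows "bounded_lipschitz S (\<lambda>x. f (g x))"
proof -
  obtain A where A: "A \<ge> 0" "\<And>x. x \<in> T \<Longrightarrow> \<bar>f x\<bar> \<le> A" "\<And>x y. x \<in> T \<Longrightarrow> y \<in> T \<Longrightarrow> \<bar>f x - f y\<bar> \<le> A * dist x y"
    using bounded_lipschitzE[OF assms(1)] by metis
  show ?thesis
  proof (rule bounded_lipschitzI[where C=A and D="A * L"])
    fix x y assume xy: "x \<in> S" "y \<in> S"
    have "\<bar>f (g x) - f (g y)\<bar> \<le> A * dist (g x) (g y)" using A(3) assms(2) xy by blast
    also have "\<dots> \<le> A * (L * dist x y)" using A(1) assms(3)[OF xy] by (rule mult_left_mono[rotated])
    finally show "\<bar>f (g x) - f (g y)\<bar> \<le> A * L * dist x y" by simp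
  qed (use A assms(2) in blast)
qed

lemma bounded_lipschitz_continuous_on:
  assumes "bounded_lipschitz S f" shows "continuous_on S f"
proof -
  obtain A where A: "A \<ge> 0" "\<And>x y. x \<in> S \<Longrightarrow> y \<in> S \<Longrightarrow> \<bar>f x - f y\<bar> \<le> A * dist x y"
    using bounded_lipschitzE[OF assms] by metis
  then have "A-lipschitz_on S f" by (auto simp: lipschitz_on_def dist_real_def)
  then show ?thesis by (rule lipschitz_on_continuous_on)
qed

lemma bounded_lipschitz_det:
  assumes "\<And>i j. bounded_lipschitz S (\<lambda>x. M x $ i $ j)"
  shows "bounded_lipschitz S (\<lambda>x. det (M x :: real ^ 'n ^ 'n))"
  unfolding det_def by (intro bounded_lipschitz_sum bounded_lipschitz_mult bounded_lipschitz_prod assms bounded_lipschitz_const)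

lemma norm_linear_le_sum_Basis:
  fixes f :: "'a::euclidean_space \<Rightarrow> 'b::real_normed_vector"
  assumes "linear f" "\<And>b. b \<in> Basis \<Longrightarrow> norm (f b) \<le> B b"
  shows "norm (f x) \<le> (\<Sum>b\<in>Basis. B b) * norm x"
proof -
  have "f x = f (\<Sum>b\<in>Basis. (x \<bullet> b) *\<^sub>R b)" by (simp add: euclidean_representation)
  also have "\<dots> = (\<Sum>b\<in>Basis. (x \<bullet> b) *\<^sub>R f b)"
    using assms(1) by (simp add: linear_sum linear_cmul)
  finally have "norm (f x) \<le> (\<Sum>b\<in>Basis. norm ((x \<bullet> b) *\<^sub>R f b))" by (simp only: norm_sum)
  also have "\<dots> \<le> (\<Sum>b\<in>Basis. norm x * B b)"
    using assms(2) by (intro sum_mono) (auto intro!: mult_mono Basis_le_norm)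
  finally show ?thesis by (simp add: sum_distrib_left mult.commute)
qed

lemma C1_lipschitz_on_cball:
  fixes f :: "'a::euclidean_space \<Rightarrow> 'b::euclidean_space"
  assumes "Ck_map (Suc 0) f"
  obtains L where "L \<ge> 0" "\<And>x y. x \<in> cball a r \<Longrightarrow> y \<in> cball a r \<Longrightarrow> norm (f x - f y) \<le> L * norm (x - y)"
proof -
  let ?D = "\<lambda>x. frechet_derivative f (at x)"
  have der: "(f has_derivative ?D x) (at x)" for x
    using assms frechet_derivative_works by auto
  have "\<exists>B. \<forall>x\<in>cball a r. norm (?D x b) \<le> B" for b
  proof -
    have "continuous_on (cball a r) (\<lambda>x. ?D x b)" using assms by (auto intro: continuous_on_subset)
    then have "compact ((\<lambda>x. ?D x b) ` cball a r)" by (intro compact_continuous_image) auto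
    then show ?thesis using compact_imp_bounded bounded_iff by (metis (no_types, lifting) imageI)
  qed
  then obtain B where B: "\<And>b x. x \<in> cball a r \<Longrightarrow> norm (?D x b) \<le> B b" by metis
  let ?L = "\<Sum>b\<in>Basis. B b"
  have "norm (f x - f y) \<le> ?L * norm (x - y)" if "x \<in> cball a r" "y \<in> cball a r" for x y
  proof (rule differentiable_bound[where S="cball a r" and f'="?D"])
    show "(f has_derivative ?D x) (at x within cball a r)" for x using der has_derivative_at_withinI by blast
    show "onorm (?D x) \<le> ?L" if "x \<in> cball a r" for x
      using B[OF that] has_derivative_linear[OF der] by (intro onorm_le norm_linear_le_sum_Basis) auto
  qed (use that in auto)
  then have "norm (f x - f y) \<le> max 0 ?L * norm (x - y)" if "x \<in> cball a r" "y \<in> cball a r" for x y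
    using that by (meson max.cobounded2 mult_right_mono norm_ge_zero order_trans)
  then show thesis using that[of "max 0 ?L"] by auto
qed

lemma C2_derivative_lipschitz_on_cball:
  fixes f :: "'a::euclidean_space \<Rightarrow> 'b::euclidean_space"
  assumes "Ck_map (Suc (Suc 0)) f"
  obtains L where "L \<ge> 0" "\<And>x y v. x \<in> cball a r \<Longrightarrow> y \<in> cball a r \<Longrightarrow>
    norm (frechet_derivative f (at x) v - frechet_derivative f (at y) v) \<le> L * norm (x - y) * norm v"
proof -
  let ?D = "\<lambda>x. frechet_derivative f (at x)"
  have lin: "linear (?D x)" for x
    using assms by (intro has_derivative_linear[where F="at x" and f=f]) (simp add: frechet_derivative_works[symmetric])
  have "\<exists>L\<ge>0. \<forall>x\<in>cball a r. \<forall>y\<in>cball a r. norm (?D x b - ?D y b) \<le> L * norm (x - y)" for b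
  proof -
    have "Ck_map (Suc 0) (\<lambda>x. ?D x b)" using assms by simp
    then show ?thesis using C1_lipschitz_on_cball[of "\<lambda>x. ?D x b" a r] by metis
  qed
  then obtain L where L: "\<And>b. L b \<ge> 0"
    "\<And>b x y. x \<in> cball a r \<Longrightarrow> y \<in> cball a r \<Longrightarrow> norm (?D x b - ?D y b) \<le> L b * norm (x - y)"
    by metis
  have "norm (?D x v - ?D y v) \<le> (\<Sum>b\<in>Basis. L b) * norm (x - y) * norm v"
    if "x \<in> cball a r" "y \<in> cball a r" for x y v
    using norm_linear_le_sum_Basis[OF linear_compose_sub[OF lin lin], of x y "\<lambda>b. L b * norm (x - y)" v] L(2)[OF that]
    by (simp add: sum_distrib_right)
  moreover have "(\<Sum>b\<in>Basis. L b) \<ge> 0" by (intro sum_nonneg L)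
  ultimately show thesis using that by blast
qed

definition hausdorff_plane_const :: "'n::finite set \<Rightarrow> ennreal" where
  "hausdorff_plane_const I = (SOME c. 0 < c \<and> c < \<infinity> \<and>
     (\<forall>A\<in>sets borel. (\<forall>x\<in>A. coord_proj I x = x) \<longrightarrow>
        hausdorff_outer (card I) A = c * emeasure (coord_lborel I) A))"

lemma hausdorff_plane_const:
  fixes I :: "'n::finite set"
  shows "0 < hausdorff_plane_const I" "hausdorff_plane_const I < \<infinity>"
    "A \<in> sets borel \<Longrightarrow> (\<And>x. x \<in> A \<Longrightarrow> coord_proj I x = x) \<Longrightarrow>
       hausdorff_outer (card I) A = hausdorff_plane_const I * emeasure (coord_lborel I) A"
proof -
  have "\<exists>c. 0 < c \<and> c < \<infinity> \<and> (\<forall>A\<in>sets borel. (\<forall>x\<in>A. coord_proj I x = x) \<longrightarrow>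
        hausdorff_outer (card I) A = c * emeasure (coord_lborel I) A)"
    using hausdorff_outer_coord_plane[of I] by metis
  from someI_ex[OF this] show "0 < hausdorff_plane_const I" "hausdorff_plane_const I < \<infinity>"
    "A \<in> sets borel \<Longrightarrow> (\<And>x. x \<in> A \<Longrightarrow> coord_proj I x = x) \<Longrightarrow>
       hausdorff_outer (card I) A = hausdorff_plane_const I * emeasure (coord_lborel I) A"
    unfolding hausdorff_plane_const_def by blast+
qed

text \<open>A bilipschitz chart \<open>G\<close> around a zero \<open>x0\<close>, with derivative \<open>G'\<close>, in which the level set is the coordinate plane where the
  \<open>J\<close>-coordinates vanish and the norm of \<open>F\<close> agrees with the norm of the \<open>J\<close>-coordinates to second order. The last clause on \<open>G'\<close> asks at
  every zero \<open>x1\<close> for a frame with the same \<open>J\<close>-coordinates as \<open>G' x1\<close>, with determinant \<open>jac x1\<close> and isometric along the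
  level set: comparing \<open>G' x1\<close> with it yields the ratio of surface measure and coordinate Lebesgue measure.\<close>

locale level_chart =
  fixes F :: "real ^ 'd \<Rightarrow> real ^ 'p" and jac :: "real ^ 'd \<Rightarrow> real" and J :: "'d set"
    and G :: "real ^ 'd \<Rightarrow> real ^ 'd" and G' :: "real ^ 'd \<Rightarrow> real ^ 'd \<Rightarrow> real ^ 'd"
    and x0 :: "real ^ 'd" and \<rho> K :: real
  assumes rho: "\<rho> > 0" and K: "K \<ge> 1" and G_x0: "G x0 = 0"
    and G_deriv: "\<And>x. x \<in> ball x0 \<rho> \<Longrightarrow> (G has_derivative G' x) (at x)"
    and det_nz: "\<And>x. x \<in> ball x0 \<rho> \<Longrightarrow> det (matrix (G' x)) \<noteq> 0"
    and det_lip: "bounded_lipschitz (ball x0 \<rho>) (\<lambda>x. det (matrix (G' x)))"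
    and w_lip: "bounded_lipschitz (ball x0 \<rho>) (\<lambda>x. 1 / \<bar>det (matrix (G' x))\<bar>)"
    and bilip: "\<And>x y. x \<in> ball x0 \<rho> \<Longrightarrow> y \<in> ball x0 \<rho> \<Longrightarrow> dist x y \<le> K * dist (G x) (G y)"
      "\<And>x y. x \<in> ball x0 \<rho> \<Longrightarrow> y \<in> ball x0 \<rho> \<Longrightarrow> dist (G x) (G y) \<le> K * dist x y"
    and strict: "\<And>x1 e. x1 \<in> ball x0 \<rho> \<Longrightarrow> e > 0 \<Longrightarrow>
      \<exists>\<delta>>0. \<forall>x\<in>ball x1 \<delta>. \<forall>y\<in>ball x1 \<delta>. norm (G x - G y - G' x1 (x - y)) \<le> e * norm (x - y)"
    and zero_iff: "\<And>x. x \<in> ball x0 \<rho> \<Longrightarrow> coord_proj J (G x) = 0 \<longleftrightarrow> F x = 0"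
    and F_lower: "\<And>x. x \<in> ball x0 \<rho> \<Longrightarrow> norm (coord_proj J (G x)) \<le> norm (F x)"
    and F_upper: "\<And>x. x \<in> ball x0 \<rho> \<Longrightarrow> norm (F x) \<le> norm (coord_proj J (G x)) + K * (norm (coord_proj J (G x)))\<^sup>2"
    and F_cont: "continuous_on UNIV F"
    and frame: "\<And>x1. x1 \<in> ball x0 \<rho> \<Longrightarrow> F x1 = 0 \<Longrightarrow> \<exists>R. linear R \<and>
      (\<forall>v. coord_proj J (R v) = coord_proj J (G' x1 v)) \<and> \<bar>det (matrix R)\<bar> = jac x1 \<and>
      (\<exists>C\<ge>0. \<forall>v. \<bar>norm (R v) - norm v\<bar> \<le> C * norm (coord_proj J (G' x1 v)))"
    and jac_cont: "continuous_on UNIV jac"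
    and jac_pos: "\<And>x. F x = 0 \<Longrightarrow> jac x > 0"
begin

abbreviation "B \<equiv> ball x0 \<rho>"

definition "w x = 1 / \<bar>det (matrix (G' x))\<bar>"

text \<open>The inverse chart. The default value \<open>x0\<close> keeps it total, Borel measurable and with values in \<open>B\<close>.\<close>

definition "H z = (if z \<in> G ` B then the_inv_into B G z else x0)"

lemma w_pos: "x \<in> B \<Longrightarrow> w x > 0" using det_nz by (simp add: w_def)

lemma w_bounded_lipschitz: "bounded_lipschitz B w" using w_lip by (simp add: w_def[abs_def])

lemma G_inj: "inj_on G B"
  using bilip(1) by (metis dist_eq_0_iff dist_le_zero_iff inj_onI mult_zero_right)

lemma G_cont: "continuous_on B G"
  using G_deriv by (meson continuous_at_imp_continuous_on has_derivative_continuous)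

lemma open_GB: "open (G ` B)"
  by (rule invariance_of_domain[OF G_cont _ G_inj]) simp

lemma HG [simp]: "x \<in> B \<Longrightarrow> H (G x) = x"
  by (simp add: H_def the_inv_into_f_f[OF G_inj])

lemma H_in_B: "H z \<in> B" using rho HG by (cases "z \<in> G ` B") (auto simp: H_def[of z] the_inv_into_f_f[OF G_inj])

lemma GH: "z \<in> G ` B \<Longrightarrow> G (H z) = z" by auto

lemma H_lip: "z \<in> G ` B \<Longrightarrow> z' \<in> G ` B \<Longrightarrow> dist (H z) (H z') \<le> K * dist z z'"
  using bilip(1) by auto

lemma H_cont: "continuous_on (G ` B) H"
proof -
  have "K-lipschitz_on (G ` B) H" using K H_lip by (auto simp: lipschitz_on_def)
  then show ?thesis by (rule lipschitz_on_continuous_on)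
qed

lemma GB_borel [measurable]: "G ` B \<in> sets borel" using open_GB by simp

lemma H_borel [measurable]: "H \<in> borel_measurable borel"
proof -
  have eq: "H = (\<lambda>z. if z \<in> G ` B then H z else x0)" by (auto simp: H_def fun_eq_iff)
  show ?thesis
    by (subst eq, rule borel_measurable_continuous_on_if[OF GB_borel H_cont]) auto
qed

lemma wH_borel [measurable]: "(\<lambda>z. w (H z)) \<in> borel_measurable borel"
proof -
  have "(\<lambda>x. indicator B x *\<^sub>R w x) \<in> borel_measurable borel"
    by (rule borel_measurable_continuous_on_indicator[OF _ bounded_lipschitz_continuous_on[OF w_bounded_lipschitz]]) simp
  then have "(\<lambda>x. indicator B x * w x) \<in> borel_measurable borel" by simp
  from measurable_compose[OF H_borel this] have "(\<lambda>z. indicator B (H z) * w (H z)) \<in> borel_measurable borel" .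
  then show ?thesis using H_in_B by simp
qed

lemma G_image_borel:
  assumes "A \<in> sets borel" "A \<subseteq> B" shows "G ` A \<in> sets borel" "G ` A = G ` B \<inter> H -` A"
proof -
  show eq: "G ` A = G ` B \<inter> H -` A" using assms(2) HG by force
  show "G ` A \<in> sets borel" unfolding eq using measurable_sets[OF H_borel assms(1)] by simp
qed

lemma zero_set_borel [measurable]: "{x. F x = 0} \<in> sets borel"
proof -
  have "closed {x. F x = 0}" by (intro closed_Collect_eq F_cont continuous_on_const)
  then show ?thesis by simp
qed

lemma nn_integral_chart:
  assumes f [measurable]: "f \<in> borel_measurable borel"
  shows "(\<integral>\<^sup>+z. f (H z) * ennreal (w (H z)) * indicator (G ` B) z \<partial>lborel) = (\<integral>\<^sup>+x. f x * indicator B x \<partial>lborel)"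
proof -
  have [measurable]: "(\<lambda>x. indicator B x * w x) \<in> borel_measurable borel"
    using borel_measurable_continuous_on_indicator[OF _ bounded_lipschitz_continuous_on[OF w_bounded_lipschitz]] by simp
  have "(\<integral>\<^sup>+z. f (H z) * ennreal (w (H z)) * indicator (G ` B) z \<partial>lborel)
      = (\<integral>\<^sup>+z. (f (H z) * ennreal (indicator B (H z) * w (H z))) * indicator (G ` B) z \<partial>lborel)"
    using H_in_B by simp
  also have "\<dots> = (\<integral>\<^sup>+x. (f x * ennreal (indicator B x * w x)) * ennreal (\<bar>det (matrix (G' x))\<bar> * indicator B x) \<partial>lborel)"
    by (rule nn_integral_change_of_variables[OF _ G_deriv bounded_lipschitz_continuous_on[OF det_lip] HG]) auto
  also have "\<dots> = (\<integral>\<^sup>+x. f x * indicator B x \<partial>lborel)"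
  proof (rule nn_integral_cong)
    fix x
    show "(f x * ennreal (indicator B x * w x)) * ennreal (\<bar>det (matrix (G' x))\<bar> * indicator B x) = f x * indicator B x"
      using det_nz[of x] by (cases "x \<in> B") (simp_all add: w_def mult.assoc ennreal_mult'[symmetric])
  qed
  finally show ?thesis .
qed

definition "surface_measure = density (hausdorff_measure (card (- J))) (\<lambda>x. ennreal (1 / jac x))"

text \<open>The surface measure as seen in coordinates: the density \<open>w\<close> of Lebesgue measure in the chart, restricted to the plane of the tangential
  coordinates and carried back by \<open>H\<close>.\<close>

definition "chart_measure =
  distr (density (coord_lborel (- J)) (\<lambda>u. ennreal (w (H u)) * indicator (G ` B) u)) borel H"

lemma sets_surface_chart [simp, measurable_cong]:
  "sets surface_measure = sets borel" "sets chart_measure = sets borel"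
  by (simp_all add: surface_measure_def chart_measure_def)

lemma jac_borel [measurable]: "jac \<in> borel_measurable borel"
  using jac_cont by (rule borel_measurable_continuous_onI)

lemma emeasure_surface_measure:
  assumes [measurable]: "A \<in> sets borel"
  shows "emeasure surface_measure A = (\<integral>\<^sup>+x. ennreal (1 / jac x) * indicator A x \<partial>hausdorff_measure (card (- J)))"
  unfolding surface_measure_def by (subst emeasure_density) auto

lemma emeasure_chart_measure:
  assumes A [measurable]: "A \<in> sets borel" and "A \<subseteq> B"
  shows "emeasure chart_measure A = (\<integral>\<^sup>+u. ennreal (w (H u)) * indicator (G ` A) u \<partial>coord_lborel (- J))"
proof -
  have m: "H -` A \<in> sets borel" using measurable_sets[OF H_borel A] by simp
  have "emeasure chart_measure A = (\<integral>\<^sup>+u. ennreal (w (H u)) * indicator (G ` B) u * indicator (H -` A) u \<partial>coord_lborel (- J))"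
    unfolding chart_measure_def using m by (subst emeasure_distr) (auto simp: emeasure_density)
  then show ?thesis
    unfolding G_image_borel(2)[OF assms] indicator_inter_arith by (simp add: mult.assoc)
qed

text \<open>Let \<open>N\<close> be the linear map with \<open>N \<circ> G' x1 = R\<close>. Along the level set \<open>R\<close> is isometric and \<open>G\<close> is
  approximated by its derivative, so \<open>N \<circ> G\<close> distorts distances between nearby zeros by a factor close to \<open>1\<close> only. Hausdorff measure of
  \<open>A\<close> is thus close to that of the flat set \<open>N ` G ` A\<close>, which is a multiple of Lebesgue measure, and passing from
  \<open>N ` G ` A\<close> to \<open>G ` A\<close> contributes \<open>\<bar>det N\<bar> = jac x1 * w x1\<close>.\<close>

lemma hausdorff_image_comparison:
  assumes x1: "x1 \<in> B" "F x1 = 0" and \<theta>: "\<theta> > 0"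
  obtains \<delta> where "\<delta> > 0" "ball x1 \<delta> \<subseteq> B"
    "\<And>A. A \<in> sets borel \<Longrightarrow> A \<subseteq> ball x1 \<delta> \<inter> {x. F x = 0} \<Longrightarrow>
      hausdorff_outer (card (- J)) A \<le> ennreal ((1 + \<theta>) ^ card (- J)) *
        (hausdorff_plane_const (- J) * (ennreal (jac x1 * w x1) * emeasure (coord_lborel (- J)) (G ` A)))"
    "\<And>A. A \<in> sets borel \<Longrightarrow> A \<subseteq> ball x1 \<delta> \<inter> {x. F x = 0} \<Longrightarrow>
      hausdorff_plane_const (- J) * (ennreal (jac x1 * w x1) * emeasure (coord_lborel (- J)) (G ` A))
        \<le> ennreal ((1 + \<theta>) ^ card (- J)) * hausdorff_outer (card (- J)) A"
proof -
  let ?L = "G' x1" and ?r = "card (- J)"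
  obtain R C where R: "linear R" "\<And>v. coord_proj J (R v) = coord_proj J (?L v)" "\<bar>det (matrix R)\<bar> = jac x1"
    and C: "C \<ge> 0" "\<And>v. \<bar>norm (R v) - norm v\<bar> \<le> C * norm (coord_proj J (?L v))"
    using frame[OF x1] by metis
  have linL: "linear ?L" using G_deriv[OF x1(1)] by (rule has_derivative_linear)
  have mat: "matrix f *v x = f x" if "linear f" for f :: "real ^ 'd \<Rightarrow> real ^ 'd" and x
    using that by (simp add: matrix_works)
  define L' where "L' z = matrix_inv (matrix ?L) *v z" for z
  define R' where "R' z = matrix_inv (matrix R) *v z" for z
  have detR: "det (matrix R) \<noteq> 0" using R(3) jac_pos[OF x1(2)] by auto
  have L': "linear L'" "\<And>x. L' (?L x) = x" "\<And>x. ?L (L' x) = x"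
    using matrix_inv_mult[OF det_nz[OF x1(1)]] unfolding L'_def by (auto simp: mat[OF linL])
  have R': "linear R'" "\<And>x. R' (R x) = x" "\<And>x. R (R' x) = x"
    using matrix_inv_mult[OF detR] unfolding R'_def by (auto simp: mat[OF R(1)])
  define N where "N z = R (L' z)" for z
  define N' where "N' z = ?L (R' z)" for z
  have linN: "linear N" "linear N'"
    unfolding N_def N'_def using linear_compose[OF L'(1) R(1)] linear_compose[OF R'(1) linL] by (simp_all add: o_def)
  have NN: "N' (N x) = x" "N (N' x) = x" for x by (simp_all add: N_def N'_def L' R')
  have pres: "coord_proj (- (- J)) (N x) = coord_proj (- (- J)) x" for x by (simp add: N_def R(2) L')
  have detN: "\<bar>det (matrix N)\<bar> = jac x1 * w x1"
  proof -
    have "matrix N ** matrix ?L = matrix R"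
      using matrix_compose[OF linL linN(1)] by (simp add: o_def N_def L')
    then have "\<bar>det (matrix N)\<bar> * \<bar>det (matrix ?L)\<bar> = jac x1" using R(3) by (metis abs_mult det_mul)
    then show ?thesis using det_nz[OF x1(1)] by (simp add: w_def field_simps)
  qed
  obtain Kn where Kn: "Kn \<ge> 0" "\<And>x. norm (N x) \<le> Kn * norm x" using linear_le_norm[OF linN(1)] by blast
  (* With this choice 1 + \<tau> and 1 / (1 - \<tau>) are both at most 1 + \<theta>. *)
  define \<tau> where "\<tau> = \<theta> / (1 + \<theta>)"
  have \<tau>: "0 < \<tau>" "\<tau> \<le> \<theta>" "(1 + \<theta>) * (1 - \<tau>) = 1" using \<theta> by (auto simp: \<tau>_def field_simps)
  define e where "e = \<tau> / (C + Kn + 1)"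
  have e: "e > 0" "(C + Kn) * e \<le> \<tau>" using \<tau> C Kn by (auto simp: e_def field_simps)
  obtain \<delta>1 where \<delta>1: "\<delta>1 > 0" "\<And>x y. x \<in> ball x1 \<delta>1 \<Longrightarrow> y \<in> ball x1 \<delta>1 \<Longrightarrow> norm (G x - G y - ?L (x - y)) \<le> e * norm (x - y)"
    using strict[OF x1(1) e(1)] by blast
  obtain \<delta>2 where \<delta>2: "\<delta>2 > 0" "ball x1 \<delta>2 \<subseteq> B" using x1(1) open_ball openE by metis
  define \<delta> where "\<delta> = min \<delta>1 \<delta>2"
  have \<delta>: "\<delta> > 0" "ball x1 \<delta> \<subseteq> B" "ball x1 \<delta> \<subseteq> ball x1 \<delta>1" using \<delta>1 \<delta>2 by (auto simp: \<delta>_def)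
  have near: "\<bar>dist (N (G x)) (N (G y)) - dist x y\<bar> \<le> \<tau> * dist x y"
    if x: "x \<in> ball x1 \<delta>" "F x = 0" and y: "y \<in> ball x1 \<delta>" "F y = 0" for x y
  proof -
    define E where "E = G x - G y - ?L (x - y)"
    have E: "norm E \<le> e * norm (x - y)" unfolding E_def using \<delta>1(2) \<delta>(3) x y by blast
    have P0: "coord_proj J (G x) = 0" "coord_proj J (G y) = 0" using zero_iff x y \<delta>(2) by auto
    have "coord_proj J (?L (x - y)) = - coord_proj J E" by (simp add: E_def P0)
    then have "norm (coord_proj J (?L (x - y))) \<le> norm E" by (simp add: norm_coord_proj_le)
    then have "\<bar>norm (R (x - y)) - norm (x - y)\<bar> \<le> C * norm E"
      using C(2)[of "x - y"] C(1) by (meson mult_left_mono order_trans)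
    moreover have "N (G x) - N (G y) = R (x - y) + N E"
    proof -
      have "N (G x) - N (G y) = N (?L (x - y) + E)" by (simp add: E_def linear_diff[OF linN(1)])
      also have "\<dots> = N (?L (x - y)) + N E" by (rule linear_add[OF linN(1)])
      finally show ?thesis by (simp add: N_def L')
    qed
    then have "\<bar>norm (N (G x) - N (G y)) - norm (R (x - y))\<bar> \<le> Kn * norm E"
      using norm_triangle_ineq3[of "N (G x) - N (G y)" "R (x - y)"] Kn(2)[of E] by simp
    ultimately have "\<bar>norm (N (G x) - N (G y)) - norm (x - y)\<bar> \<le> (C + Kn) * norm E"
      unfolding distrib_right by linarith
    also have "\<dots> \<le> (C + Kn) * (e * norm (x - y))" using C Kn E by (intro mult_left_mono) auto
    also have "\<dots> \<le> \<tau> * norm (x - y)" using e(2) by (simp add: mult.assoc[symmetric] mult_right_mono)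
    finally show ?thesis by (simp add: dist_norm)
  qed
  have lip: "dist (N (G x)) (N (G y)) \<le> (1 + \<theta>) * dist x y" "dist x y \<le> (1 + \<theta>) * dist (N (G x)) (N (G y))"
    if "x \<in> ball x1 \<delta>" "F x = 0" "y \<in> ball x1 \<delta>" "F y = 0" for x y
  proof -
    have n: "dist (N (G x)) (N (G y)) \<le> (1 + \<tau>) * dist x y" "(1 - \<tau>) * dist x y \<le> dist (N (G x)) (N (G y))"
      using near[OF that] by (auto simp: algebra_simps abs_le_iff)
    have "(1 + \<tau>) * dist x y \<le> (1 + \<theta>) * dist x y" using \<tau> by (intro mult_right_mono) auto
    then show "dist (N (G x)) (N (G y)) \<le> (1 + \<theta>) * dist x y" using n by linarith
    have "dist x y = (1 + \<theta>) * ((1 - \<tau>) * dist x y)" using \<tau>(3) by (simp add: mult.assoc[symmetric])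
    also have "\<dots> \<le> (1 + \<theta>) * dist (N (G x)) (N (G y))" using n(2) \<theta> by (intro mult_left_mono) auto
    finally show "dist x y \<le> (1 + \<theta>) * dist (N (G x)) (N (G y))" .
  qed
  have key: "hausdorff_outer ?r (N ` G ` A) = hausdorff_plane_const (- J) * (ennreal (jac x1 * w x1) * emeasure (coord_lborel (- J)) (G ` A))"
    if A: "A \<in> sets borel" "A \<subseteq> ball x1 \<delta> \<inter> {x. F x = 0}" for A
  proof -
    have GA: "G ` A \<in> sets borel" using G_image_borel(1) A \<delta>(2) by blast
    have P: "coord_proj (- J) z = z" if z: "z \<in> G ` A" for z
    proof -
      obtain x where "x \<in> A" "z = G x" using z by blast
      then have "coord_proj J z = 0" using zero_iff[of x] A \<delta>(2) by blast
      then show ?thesis using coord_proj_zero_iff[of "- J" z] by simp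
    qed
    have NP: "coord_proj (- J) z = z" if z: "z \<in> N ` G ` A" for z
    proof -
      obtain y where y: "y \<in> G ` A" "z = N y" using z by blast
      have "coord_proj (- (- J)) y = 0" using P[OF y(1)] by (simp only: coord_proj_zero_iff)
      then have "coord_proj (- (- J)) z = 0" using pres[of y] y by simp
      then show ?thesis by (simp only: coord_proj_zero_iff)
    qed
    note sh = emeasure_coord_lborel_shear[OF linN NN pres GA P]
    show ?thesis using hausdorff_plane_const(3)[OF sh(1) NP] sh(2) by (simp add: detN)
  qed
  show thesis
  proof
    fix A assume A: "A \<in> sets borel" "A \<subseteq> ball x1 \<delta> \<inter> {x. F x = 0}"
    have inj: "inj_on (N \<circ> G) A"
      using G_inj A(2) \<delta>(2) NN(1) by (intro comp_inj_on) (auto intro: inj_on_subset inj_on_inverseI)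
    have "hausdorff_outer ?r (the_inv_into A (N \<circ> G) ` (N \<circ> G) ` A) \<le> ennreal ((1 + \<theta>) ^ ?r) * hausdorff_outer ?r ((N \<circ> G) ` A)"
    proof (rule hausdorff_outer_lipschitz_image)
      fix x y assume "x \<in> (N \<circ> G) ` A" "y \<in> (N \<circ> G) ` A"
      then obtain a b where ab: "a \<in> A" "b \<in> A" "x = (N \<circ> G) a" "y = (N \<circ> G) b" by blast
      have "the_inv_into A (N \<circ> G) x = a" "the_inv_into A (N \<circ> G) y = b"
        unfolding ab(3,4) by (rule the_inv_into_f_f[OF inj ab(1)], rule the_inv_into_f_f[OF inj ab(2)])
      moreover have "dist a b \<le> (1 + \<theta>) * dist (N (G a)) (N (G b))"
        by (rule lip(2)) (use ab(1,2) A(2) in auto)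
      ultimately show "dist (the_inv_into A (N \<circ> G) x) (the_inv_into A (N \<circ> G) y) \<le> (1 + \<theta>) * dist x y"
        by (simp add: ab(3,4))
    qed (use \<theta> in simp)
    moreover have "the_inv_into A (N \<circ> G) ` (N \<circ> G) ` A = A"
      by (rule the_inv_into_onto[OF inj])
    ultimately show "hausdorff_outer ?r A \<le> ennreal ((1 + \<theta>) ^ ?r) *
        (hausdorff_plane_const (- J) * (ennreal (jac x1 * w x1) * emeasure (coord_lborel (- J)) (G ` A)))"
      using key[OF A] by (simp add: image_comp)
    have "hausdorff_outer ?r ((\<lambda>x. N (G x)) ` A) \<le> ennreal ((1 + \<theta>) ^ ?r) * hausdorff_outer ?r A"
    proof (rule hausdorff_outer_lipschitz_image)
      fix x y assume "x \<in> A" "y \<in> A"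
      then show "dist (N (G x)) (N (G y)) \<le> (1 + \<theta>) * dist x y" using A(2) by (intro lip(1)) auto
    qed (use \<theta> in simp)
    then show "hausdorff_plane_const (- J) * (ennreal (jac x1 * w x1) * emeasure (coord_lborel (- J)) (G ` A))
        \<le> ennreal ((1 + \<theta>) ^ ?r) * hausdorff_outer ?r A"
      using key[OF A] by (simp add: image_image)
  qed (use \<delta> in auto)
qed

text \<open>The densities \<open>jac\<close> and \<open>w\<close> are continuous, so that freezing them at \<open>x1\<close> costs two further factors \<open>1 + \<theta>\<close>.\<close>

lemma surface_chart_comparison:
  assumes x1: "x1 \<in> B" "F x1 = 0" and \<theta>: "\<theta> > 0"
  shows "\<exists>U. open U \<and> x1 \<in> U \<and> (\<forall>A\<in>sets borel. A \<subseteq> U \<inter> (B \<inter> {x. F x = 0}) \<longrightarrow>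
      emeasure surface_measure A \<le> ennreal ((1 + \<theta>) ^ (card (- J) + 2)) * (hausdorff_plane_const (- J) * emeasure chart_measure A) \<and>
      hausdorff_plane_const (- J) * emeasure chart_measure A \<le> ennreal ((1 + \<theta>) ^ (card (- J) + 2)) * emeasure surface_measure A)"
proof -
  let ?r = "card (- J)" and ?hc = "hausdorff_plane_const (- J)"
  have near: "\<exists>\<delta>>0. \<forall>x\<in>ball x1 \<delta>. f x \<le> (1 + \<theta>) * f x1 \<and> f x1 \<le> (1 + \<theta>) * f x"
    if c: "continuous (at x1) f" and pos: "f x1 > 0" for f :: "real ^ 'd \<Rightarrow> real"
  proof -
    define e where "e = f x1 * \<theta> / (1 + \<theta>)"
    have e: "e > 0" "e \<le> \<theta> * f x1" "(1 + \<theta>) * e = \<theta> * f x1" using pos \<theta> by (auto simp: e_def field_simps)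
    obtain \<delta> where \<delta>: "\<delta> > 0" "\<And>x. dist x x1 < \<delta> \<Longrightarrow> dist (f x) (f x1) < e"
      using c e(1) unfolding continuous_at_eps_delta by (metis dist_commute)
    have "f x \<le> (1 + \<theta>) * f x1 \<and> f x1 \<le> (1 + \<theta>) * f x" if "x \<in> ball x1 \<delta>" for x
    proof -
      have "\<bar>f x - f x1\<bar> < e" using \<delta>(2)[of x] that by (simp add: dist_commute dist_real_def)
      then have *: "f x - f x1 \<le> e" "f x1 - e \<le> f x" by auto
      have "(1 + \<theta>) * (f x1 - e) \<le> (1 + \<theta>) * f x" using * \<theta> by (intro mult_left_mono) auto
      then show ?thesis using * e by (simp add: algebra_simps)
    qed
    then show ?thesis using \<delta>(1) by blast
  qed
  have cj: "continuous (at x1) jac" using jac_cont continuous_on_eq_continuous_at open_UNIV by blast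
  have cw: "continuous (at x1) w"
  proof -
    have "\<forall>x\<in>B. isCont w x"
      using bounded_lipschitz_continuous_on[OF w_bounded_lipschitz]
      by (simp only: continuous_on_eq_continuous_at[OF open_ball])
    then show ?thesis using x1(1) by blast
  qed
  obtain \<delta>1 where \<delta>1: "\<delta>1 > 0" "\<And>x. x \<in> ball x1 \<delta>1 \<Longrightarrow> jac x \<le> (1 + \<theta>) * jac x1" "\<And>x. x \<in> ball x1 \<delta>1 \<Longrightarrow> jac x1 \<le> (1 + \<theta>) * jac x"
    using near[OF cj jac_pos[OF x1(2)]] by blast
  obtain \<delta>2 where \<delta>2: "\<delta>2 > 0" "\<And>x. x \<in> ball x1 \<delta>2 \<Longrightarrow> w x \<le> (1 + \<theta>) * w x1" "\<And>x. x \<in> ball x1 \<delta>2 \<Longrightarrow> w x1 \<le> (1 + \<theta>) * w x"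
    using near[OF cw w_pos[OF x1(1)]] by blast
  obtain \<delta>3 where \<delta>3: "\<delta>3 > 0" "ball x1 \<delta>3 \<subseteq> B"
    and h1: "\<And>A. A \<in> sets borel \<Longrightarrow> A \<subseteq> ball x1 \<delta>3 \<inter> {x. F x = 0} \<Longrightarrow>
      hausdorff_outer ?r A \<le> ennreal ((1 + \<theta>) ^ ?r) *
        (?hc * (ennreal (jac x1 * w x1) * emeasure (coord_lborel (- J)) (G ` A)))"
    and h2: "\<And>A. A \<in> sets borel \<Longrightarrow> A \<subseteq> ball x1 \<delta>3 \<inter> {x. F x = 0} \<Longrightarrow>
      ?hc * (ennreal (jac x1 * w x1) * emeasure (coord_lborel (- J)) (G ` A))
        \<le> ennreal ((1 + \<theta>) ^ ?r) * hausdorff_outer ?r A"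
    using hausdorff_image_comparison[OF x1 \<theta>] by blast
  define U where "U = ball x1 (min \<delta>1 (min \<delta>2 \<delta>3))"
  have jp: "jac x1 > 0" and wp: "w x1 > 0" using jac_pos x1 w_pos by auto
  have "emeasure surface_measure A \<le> ennreal ((1 + \<theta>) ^ (?r + 2)) * (?hc * emeasure chart_measure A) \<and>
      ?hc * emeasure chart_measure A \<le> ennreal ((1 + \<theta>) ^ (?r + 2)) * emeasure surface_measure A"
    if A [measurable]: "A \<in> sets borel" and AU: "A \<subseteq> U \<inter> (B \<inter> {x. F x = 0})" for A
  proof -
    let ?HA = "hausdorff_outer ?r A" and ?L = "emeasure (coord_lborel (- J)) (G ` A)"
    let ?ms = "emeasure surface_measure A" and ?mc = "emeasure chart_measure A"
    have AB: "A \<subseteq> B" using AU by blast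
    have GA [measurable]: "G ` A \<in> sets borel" using G_image_borel(1)[OF A AB] .
    have inA: "x \<in> ball x1 \<delta>1" "x \<in> ball x1 \<delta>2" "F x = 0" "x \<in> B" if "x \<in> A" for x
      using AU that by (auto simp: U_def)
    have A3: "A \<subseteq> ball x1 \<delta>3 \<inter> {x. F x = 0}" using AU by (auto simp: U_def)
    have HA: "emeasure (hausdorff_measure ?r) A = ?HA" by (rule emeasure_hausdorff_measure[OF A])
    have s1: "?ms \<le> ennreal ((1 + \<theta>) / jac x1) * ?HA"
    proof -
      have "?ms \<le> (\<integral>\<^sup>+x. ennreal ((1 + \<theta>) / jac x1) * indicator A x \<partial>hausdorff_measure ?r)"
        unfolding emeasure_surface_measure[OF A]
      proof (rule nn_integral_mono)
        fix x show "ennreal (1 / jac x) * indicator A x \<le> ennreal ((1 + \<theta>) / jac x1) * indicator A x"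
          using \<delta>1(3)[OF inA(1)] jac_pos[OF inA(3)] jp
          by (cases "x \<in> A") (auto intro!: ennreal_leI simp: field_simps)
      qed
      also have "\<dots> = ennreal ((1 + \<theta>) / jac x1) * ?HA" by (subst nn_integral_cmult_indicator) (simp_all add: HA)
      finally show ?thesis .
    qed
    have s2: "ennreal (1 / jac x1) * ?HA \<le> ennreal (1 + \<theta>) * ?ms"
    proof -
      have "ennreal (1 / jac x1) * ?HA = (\<integral>\<^sup>+x. ennreal (1 / jac x1) * indicator A x \<partial>hausdorff_measure ?r)"
        by (subst nn_integral_cmult_indicator) (simp_all add: HA)
      also have "\<dots> \<le> (\<integral>\<^sup>+x. ennreal (1 + \<theta>) * (ennreal (1 / jac x) * indicator A x) \<partial>hausdorff_measure ?r)"
      proof (rule nn_integral_mono)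
        fix x show "ennreal (1 / jac x1) * indicator A x \<le> ennreal (1 + \<theta>) * (ennreal (1 / jac x) * indicator A x)"
        proof (cases "x \<in> A")
          case True
          have "1 / jac x1 \<le> (1 + \<theta>) * (1 / jac x)"
            using \<delta>1(2)[OF inA(1)[OF True]] jac_pos[OF inA(3)[OF True]] jp by (simp add: field_simps)
          then have "ennreal (1 / jac x1) \<le> ennreal ((1 + \<theta>) * (1 / jac x))" by (rule ennreal_leI)
          also have "\<dots> = ennreal (1 + \<theta>) * ennreal (1 / jac x)" using \<theta> by (intro ennreal_mult') simp
          finally show ?thesis using True by simp
        qed simp
      qed
      also have "\<dots> = ennreal (1 + \<theta>) * ?ms"
        unfolding emeasure_surface_measure[OF A] by (rule nn_integral_cmult) measurable
      finally show ?thesis .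
    qed
    have c1: "?mc \<le> ennreal ((1 + \<theta>) * w x1) * ?L"
    proof -
      have "?mc \<le> (\<integral>\<^sup>+u. ennreal ((1 + \<theta>) * w x1) * indicator (G ` A) u \<partial>coord_lborel (- J))"
        unfolding emeasure_chart_measure[OF A AB]
      proof (rule nn_integral_mono)
        fix u show "ennreal (w (H u)) * indicator (G ` A) u \<le> ennreal ((1 + \<theta>) * w x1) * indicator (G ` A) u"
          using \<delta>2(2) inA by (cases "u \<in> G ` A") (auto intro!: ennreal_leI)
      qed
      also have "\<dots> = ennreal ((1 + \<theta>) * w x1) * ?L" by (subst nn_integral_cmult_indicator) simp_all
      finally show ?thesis .
    qed
    have c2: "ennreal (w x1) * ?L \<le> ennreal (1 + \<theta>) * ?mc"
    proof -
      have "ennreal (w x1) * ?L = (\<integral>\<^sup>+u. ennreal (w x1) * indicator (G ` A) u \<partial>coord_lborel (- J))"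
        by (subst nn_integral_cmult_indicator) simp_all
      also have "\<dots> \<le> (\<integral>\<^sup>+u. ennreal (1 + \<theta>) * (ennreal (w (H u)) * indicator (G ` A) u) \<partial>coord_lborel (- J))"
      proof (rule nn_integral_mono)
        fix u show "ennreal (w x1) * indicator (G ` A) u \<le> ennreal (1 + \<theta>) * (ennreal (w (H u)) * indicator (G ` A) u)"
        proof (cases "u \<in> G ` A")
          case True
          then obtain x where x: "x \<in> A" "u = G x" by blast
          have "ennreal (w x1) \<le> ennreal ((1 + \<theta>) * w x)" using \<delta>2(3)[OF inA(2)[OF x(1)]] by (rule ennreal_leI)
          also have "\<dots> = ennreal (1 + \<theta>) * ennreal (w x)" using \<theta> by (intro ennreal_mult') simp
          finally show ?thesis using True x(2) HG[OF inA(4)[OF x(1)]] by simp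
        qed simp
      qed
      also have "\<dots> = ennreal (1 + \<theta>) * ?mc"
        unfolding emeasure_chart_measure[OF A AB] by (rule nn_integral_cmult) measurable
      finally show ?thesis .
    qed
    have reassoc: "a * (b * (h * (c * l))) = d * (h * (e * l))" if "a * b * c = d * e" for a b c d e h l :: ennreal
    proof -
      have "a * (b * (h * (c * l))) = (a * b * c) * (h * l)" by (simp only: mult_ac)
      also have "\<dots> = d * (h * (e * l))" unfolding that by (simp only: mult_ac)
      finally show ?thesis .
    qed
    have "?ms \<le> ennreal ((1 + \<theta>) / jac x1) * (ennreal ((1 + \<theta>) ^ ?r) * (?hc * (ennreal (jac x1 * w x1) * ?L)))"
      by (rule order_trans[OF s1 mult_left_mono[OF h1[OF A A3]]]) simp
    also have "\<dots> = ennreal ((1 + \<theta>) ^ (?r + 1)) * (?hc * (ennreal (w x1) * ?L))"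
    proof -
      have "ennreal ((1 + \<theta>) / jac x1) * ennreal ((1 + \<theta>) ^ ?r) * ennreal (jac x1 * w x1) = ennreal ((1 + \<theta>) ^ (?r + 1)) * ennreal (w x1)"
        using jp wp \<theta> by (simp add: ennreal_mult[symmetric])
      then show ?thesis by (rule reassoc)
    qed
    also have "\<dots> \<le> ennreal ((1 + \<theta>) ^ (?r + 1)) * (?hc * (ennreal (1 + \<theta>) * ?mc))"
      by (intro mult_left_mono c2) simp_all
    also have "\<dots> = ennreal ((1 + \<theta>) ^ (?r + 2)) * (?hc * ?mc)"
    proof -
      have "ennreal ((1 + \<theta>) ^ (?r + 1)) * ennreal (1 + \<theta>) = ennreal ((1 + \<theta>) ^ (?r + 2))"
        using \<theta> by (subst ennreal_mult[symmetric]) (simp_all add: mult.commute)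
      then show ?thesis using reassoc[of 1 "ennreal ((1 + \<theta>) ^ (?r + 1))" "ennreal (1 + \<theta>)" "ennreal ((1 + \<theta>) ^ (?r + 2))" 1 ?hc ?mc]
        by (simp only: mult_1 mult_1_right)
    qed
    finally have one: "?ms \<le> ennreal ((1 + \<theta>) ^ (?r + 2)) * (?hc * ?mc)" .
    have "?hc * ?mc \<le> ?hc * (ennreal ((1 + \<theta>) * w x1) * ?L)" by (intro mult_left_mono c1) simp
    also have "\<dots> = ennreal ((1 + \<theta>) / jac x1) * (?hc * (ennreal (jac x1 * w x1) * ?L))"
    proof -
      have "ennreal ((1 + \<theta>) * w x1) = ennreal ((1 + \<theta>) / jac x1) * ennreal (jac x1 * w x1)"
        using jp wp \<theta> by (simp add: ennreal_mult[symmetric])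
      then show ?thesis
        using reassoc[of 1 1 "ennreal ((1 + \<theta>) * w x1)" "ennreal ((1 + \<theta>) / jac x1)" "ennreal (jac x1 * w x1)" ?hc ?L]
        by (simp only: mult_1 mult_1_right)
    qed
    also have "\<dots> \<le> ennreal ((1 + \<theta>) / jac x1) * (ennreal ((1 + \<theta>) ^ ?r) * ?HA)"
      by (intro mult_left_mono h2[OF A A3]) simp
    also have "\<dots> = ennreal ((1 + \<theta>) ^ (?r + 1)) * (ennreal (1 / jac x1) * ?HA)"
    proof -
      have "ennreal ((1 + \<theta>) / jac x1) * ennreal ((1 + \<theta>) ^ ?r) = ennreal ((1 + \<theta>) ^ (?r + 1)) * ennreal (1 / jac x1)"
        using jp \<theta> by (simp add: ennreal_mult[symmetric])
      then show ?thesis by (simp only: mult.assoc[symmetric])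
    qed
    also have "\<dots> \<le> ennreal ((1 + \<theta>) ^ (?r + 1)) * (ennreal (1 + \<theta>) * ?ms)"
      by (intro mult_left_mono s2) simp
    also have "\<dots> = ennreal ((1 + \<theta>) ^ (?r + 2)) * ?ms"
    proof -
      have "ennreal ((1 + \<theta>) ^ (?r + 1)) * ennreal (1 + \<theta>) = ennreal ((1 + \<theta>) ^ (?r + 2))"
        using \<theta> by (subst ennreal_mult[symmetric]) (simp_all add: mult.commute)
      then show ?thesis by (simp only: mult.assoc[symmetric])
    qed
    finally show ?thesis using one by blast
  qed
  moreover have "open U" "x1 \<in> U" using \<delta>1(1) \<delta>2(1) \<delta>3(1) by (auto simp: U_def)
  ultimately show ?thesis by blast
qed

lemma ennreal_le_if_le_mult_near_one:
  fixes X Y :: ennreal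
  assumes "\<And>\<theta>. \<theta> > 0 \<Longrightarrow> X \<le> ennreal ((1 + \<theta>) ^ n) * Y"
  shows "X \<le> Y"
proof (cases Y)
  case (real y)
  have "X \<le> ennreal ((1 + 1) ^ n) * ennreal y" using assms[of 1] real by simp
  then have "X < top" by (metis ennreal_less_top ennreal_mult'' le_less_trans real(1))
  then obtain x where x: "X = ennreal x" "x \<ge> 0" by (cases X) auto
  have "x \<le> (1 + inverse (real (Suc m))) ^ n * y" for m
    using assms[of "inverse (real (Suc m))"] x real by (simp add: ennreal_mult'[symmetric])
  moreover have "(\<lambda>m. (1 + inverse (real (Suc m))) ^ n * y) \<longlonglongrightarrow> (1 + 0) ^ n * y"
    by (intro tendsto_intros LIMSEQ_inverse_real_of_nat)
  ultimately have "x \<le> y" using LIMSEQ_le_const by fastforce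
  then show ?thesis using x real by (simp add: ennreal_leI)
qed simp

text \<open>The area formula. The local comparison constants tend to \<open>1\<close>, and local comparison of measures implies global comparison.\<close>

lemma surface_eq_chart:
  assumes A: "A \<in> sets borel" "A \<subseteq> B \<inter> {x. F x = 0}"
  shows "emeasure surface_measure A = hausdorff_plane_const (- J) * emeasure chart_measure A"
proof (rule antisym; rule ennreal_le_if_le_mult_near_one[where n="card (- J) + 2"])
  fix \<theta> :: real assume \<theta>: "\<theta> > 0"
  let ?hc = "hausdorff_plane_const (- J)" and ?c = "ennreal ((1 + \<theta>) ^ (card (- J) + 2))"
  have "emeasure surface_measure A \<le> (?c * ?hc) * emeasure chart_measure A"
  proof (rule emeasure_le_if_locally_le[OF _ _ _ A])
    fix x assume "x \<in> B \<inter> {x. F x = 0}"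
    then show "\<exists>U. open U \<and> x \<in> U \<and> (\<forall>A\<in>sets borel. A \<subseteq> U \<inter> (B \<inter> {x. F x = 0}) \<longrightarrow>
        emeasure surface_measure A \<le> ?c * ?hc * emeasure chart_measure A)"
      using surface_chart_comparison[of x \<theta>] \<theta> unfolding mult.assoc by blast
  qed simp_all
  then show "emeasure surface_measure A \<le> ?c * (?hc * emeasure chart_measure A)" by (simp add: mult.assoc)
  have sc: "emeasure (scale_measure ?hc chart_measure) A = ?hc * emeasure chart_measure A" for A by simp
  have "emeasure (scale_measure ?hc chart_measure) A \<le> ?c * emeasure surface_measure A"
  proof (rule emeasure_le_if_locally_le[OF _ _ _ A])
    fix x assume "x \<in> B \<inter> {x. F x = 0}"
    then show "\<exists>U. open U \<and> x \<in> U \<and> (\<forall>A\<in>sets borel. A \<subseteq> U \<inter> (B \<inter> {x. F x = 0}) \<longrightarrow>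
        emeasure (scale_measure ?hc chart_measure) A \<le> ?c * emeasure surface_measure A)"
      using surface_chart_comparison[of x \<theta>] \<theta> unfolding sc by blast
  qed simp_all
  then show "?hc * emeasure chart_measure A \<le> ?c * emeasure surface_measure A" by simp
qed

lemma nn_integral_surface:
  assumes f [measurable]: "f \<in> borel_measurable borel" and f0: "\<And>x. x \<notin> B \<Longrightarrow> f x = 0"
  shows "(\<integral>\<^sup>+x. f x * (ennreal (1 / jac x) * indicator {x. F x = 0} x) \<partial>hausdorff_measure (card (- J)))
    = hausdorff_plane_const (- J) * (\<integral>\<^sup>+u. f (H u) * (ennreal (w (H u)) * indicator (G ` B) u) \<partial>coord_lborel (- J))"
proof -
  let ?hc = "hausdorff_plane_const (- J)" and ?Z = "{x. F x = 0}"
  let ?M = "density surface_measure (indicator (B \<inter> ?Z))" and ?N = "scale_measure ?hc chart_measure"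
  have "B \<inter> ?Z \<in> sets surface_measure" by simp
  then have im: "(indicator (B \<inter> ?Z) :: _ \<Rightarrow> ennreal) \<in> borel_measurable surface_measure"
    by (rule borel_measurable_indicator)
  have "?M = ?N"
  proof (rule measure_eqI)
    fix A assume "A \<in> sets ?M"
    then have A [measurable]: "A \<in> sets borel" by simp
    have m: "H -` A \<in> sets borel" using measurable_sets[OF H_borel A] by simp
    have "emeasure ?M A = emeasure surface_measure (B \<inter> ?Z \<inter> A)"
      using A by (subst emeasure_density[OF im]) (simp_all add: indicator_inter_arith[symmetric])
    also have "\<dots> = ?hc * emeasure chart_measure (B \<inter> ?Z \<inter> A)"
      by (rule surface_eq_chart) auto
    also have "emeasure chart_measure (B \<inter> ?Z \<inter> A) = emeasure chart_measure A"
    proof -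
      define D where "D = H -` (B \<inter> ?Z \<inter> A)"
      have m2 [measurable]: "D \<in> sets borel" unfolding D_def using measurable_sets[OF H_borel, of "B \<inter> ?Z \<inter> A"] by simp
      have "emeasure chart_measure A = (\<integral>\<^sup>+u. ennreal (w (H u)) * indicator (G ` B) u * indicator (H -` A) u \<partial>coord_lborel (- J))"
        unfolding chart_measure_def using m by (subst emeasure_distr) (auto simp: emeasure_density)
      also have "\<dots> = (\<integral>\<^sup>+u. (\<lambda>u. ennreal (w (H u)) * indicator (G ` B) u * indicator (H -` A) u) (coord_proj (- J) u) \<partial>coord_lborel (- J))"
        using m by (intro nn_integral_coord_lborel_proj[symmetric]) measurable
      also have "\<dots> = (\<integral>\<^sup>+u. (\<lambda>u. ennreal (w (H u)) * indicator (G ` B) u * indicator D u) (coord_proj (- J) u) \<partial>coord_lborel (- J))"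
      proof (rule nn_integral_cong, goal_cases)
        case (1 u)
        (* Points of the coordinate plane are mapped to zeros of F, so chart_measure is carried by Z. *)
        have "F (H (coord_proj (- J) u)) = 0" if "coord_proj (- J) u \<in> G ` B"
          using zero_iff[OF H_in_B, of "coord_proj (- J) u"] GH[OF that] by simp
        then show ?case using H_in_B by (auto simp: indicator_def D_def)
      qed
      also have "\<dots> = (\<integral>\<^sup>+u. ennreal (w (H u)) * indicator (G ` B) u * indicator D u \<partial>coord_lborel (- J))"
        using m2 by (intro nn_integral_coord_lborel_proj) measurable
      also have "\<dots> = emeasure chart_measure (B \<inter> ?Z \<inter> A)"
        unfolding chart_measure_def using m2 by (subst emeasure_distr) (auto simp: emeasure_density D_def)
      finally show ?thesis by simp
    qed
    finally show "emeasure ?M A = emeasure ?N A" by simp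
  qed simp
  have "(\<integral>\<^sup>+x. f x * (ennreal (1 / jac x) * indicator ?Z x) \<partial>hausdorff_measure (card (- J))) = (\<integral>\<^sup>+x. f x \<partial>?M)"
  proof -
    have "(\<integral>\<^sup>+x. f x \<partial>?M) = (\<integral>\<^sup>+x. ennreal (1 / jac x) * (indicator (B \<inter> ?Z) x * f x) \<partial>hausdorff_measure (card (- J)))"
    proof -
      have "(\<integral>\<^sup>+x. f x \<partial>?M) = (\<integral>\<^sup>+x. indicator (B \<inter> ?Z) x * f x \<partial>surface_measure)"
        by (rule nn_integral_density[OF im]) measurable
      also have "\<dots> = (\<integral>\<^sup>+x. ennreal (1 / jac x) * (indicator (B \<inter> ?Z) x * f x) \<partial>hausdorff_measure (card (- J)))"
        unfolding surface_measure_def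
      proof (rule nn_integral_density)
        have "(\<lambda>x. indicator (B \<inter> ?Z) x * f x) \<in> borel_measurable borel"
          by (intro borel_measurable_times_ennreal borel_measurable_indicator f) simp
        then show "(\<lambda>x. indicator (B \<inter> ?Z) x * f x) \<in> borel_measurable (hausdorff_measure (card (- J)))"
          by (simp only: measurable_cong_sets[OF sets_hausdorff_measure refl])
      qed measurable
      finally show ?thesis .
    qed
    also have "\<dots> = (\<integral>\<^sup>+x. f x * (ennreal (1 / jac x) * indicator ?Z x) \<partial>hausdorff_measure (card (- J)))"
      using f0 by (intro nn_integral_cong) (auto simp: indicator_def mult.commute)
    finally show ?thesis by simp
  qed
  also have "\<dots> = ?hc * (\<integral>\<^sup>+x. f x \<partial>chart_measure)"
    unfolding \<open>?M = ?N\<close> by (rule nn_integral_scale_measure) simp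
  also have "(\<integral>\<^sup>+x. f x \<partial>chart_measure) = (\<integral>\<^sup>+u. f (H u) * (ennreal (w (H u)) * indicator (G ` B) u) \<partial>coord_lborel (- J))"
    unfolding chart_measure_def
    by (subst nn_integral_distr, simp, simp, subst nn_integral_density) (auto simp: mult.commute)
  finally show ?thesis .
qed

end

section \<open>Existence of charts at nondegenerate zeros\<close>

lemma strict_derivative_bound:
  fixes f :: "'a::euclidean_space \<Rightarrow> 'b::euclidean_space"
  assumes S: "convex S" and der: "\<And>x. x \<in> S \<Longrightarrow> (f has_derivative f' x) (at x)"
    and lin: "linear T" and close: "\<And>z v. z \<in> S \<Longrightarrow> norm (f' z v - T v) \<le> c * norm v"
    and xy: "x \<in> S" "y \<in> S"
  shows "norm (f x - f y - T (x - y)) \<le> c * norm (x - y)"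
proof -
  have "norm ((f x - T x) - (f y - T y)) \<le> c * norm (x - y)"
  proof (rule differentiable_bound[where f = "\<lambda>x. f x - T x" and f' = "\<lambda>x v. f' x v - T v", OF S _ _ xy(1,2)])
    fix z assume z: "z \<in> S"
    show "((\<lambda>x. f x - T x) has_derivative (\<lambda>v. f' z v - T v)) (at z within S)"
      using lin
      by (intro has_derivative_diff[OF has_derivative_at_withinI[OF der[OF z]] bounded_linear_imp_has_derivative])
         (simp add: linear_conv_bounded_linear)
    show "onorm (\<lambda>v. f' z v - T v) \<le> c" by (rule onorm_le) (rule close[OF z])
  qed
  then show ?thesis using lin by (simp add: linear_diff algebra_simps)
qed

lemma continuous_on_det:
  assumes "\<And>i j. continuous_on S (\<lambda>x. M x $ i $ j)"
  shows "continuous_on S (\<lambda>x. det (M x :: real ^ 'n ^ 'n))"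
  unfolding det_def by (intro continuous_intros assms)

lemma continuous_on_gen_jacobian:
  fixes F :: "real ^ 'd \<Rightarrow> real ^ 'p"
  assumes "Ck_map (Suc (Suc 0)) F"
  shows "continuous_on UNIV (gen_jacobian F)"
proof -
  have c: "continuous_on UNIV (\<lambda>x. frechet_derivative F (at x) v)" for v
    using assms by (intro differentiable_imp_continuous_on) (auto simp: differentiable_on_def intro: differentiable_at_withinI)
  have e: "continuous_on UNIV (\<lambda>x. jacobian F (at x) $ i $ j)" for i j
    unfolding jacobian_def matrix_def using c by (simp add: continuous_on_component)
  show ?thesis
    unfolding gen_jacobian_eq[abs_def] matrix_jacobian_def
    by (cases "CARD('p) \<le> CARD('d)")
       (auto simp: matrix_matrix_mult_def transpose_def intro!: continuous_intros continuous_on_det e)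
qed

text \<open>The chart is \<open>G x = coord_proj (- J) (R0 (x - x0)) + E (F x)\<close>, whose derivative at \<open>x0\<close> is \<open>R0\<close>. The derivative
  of \<open>F\<close> being locally Lipschitz, \<open>G\<close> is bilipschitz on a small ball with explicit radius. The alternative \<open>alt\<close> separates the cases
  \<open>CARD('p) \<le> CARD('d)\<close>, where \<open>E\<close> is an isometry and one frame exists at each zero, and \<open>CARD('p) > CARD('d)\<close>,
  where \<open>E\<close> is isometric on the tangent space only: then \<open>x0\<close> is the only zero in the ball, and \<open>norm (F x)\<close> exceeds \<open>norm (E (F x))\<close> by a
  quadratic term.\<close>

lemma level_chart_exists:
  fixes F :: "real ^ 'd \<Rightarrow> real ^ 'p"
  assumes C2: "Ck_map (Suc (Suc 0)) F" and Fx0: "F x0 = 0"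
    and E: "linear E" "\<And>v. coord_proj J (E v) = E v" "\<And>v. norm (E v) \<le> norm v"
    and R0: "adapted_frame J E (jacobian F (at x0)) R0"
    and jac_pos: "\<And>x. F x = 0 \<Longrightarrow> gen_jacobian F x > 0"
    and alt: "((\<forall>v. norm (E v) = norm v) \<and> (\<forall>x. F x = 0 \<longrightarrow> (\<exists>R. adapted_frame J E (jacobian F (at x)) R))) \<or>
      (J = UNIV \<and> (\<forall>v. norm (E (jacobian F (at x0) *v v)) = norm (jacobian F (at x0) *v v)))"
  obtains \<rho> K G G' where "level_chart F (gen_jacobian F) J G G' x0 \<rho> K"
proof -
  let ?D = "\<lambda>x. frechet_derivative F (at x)"
  have derF: "(F has_derivative ?D x) (at x)" for x
    using C2 by (simp add: frechet_derivative_works[symmetric])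
  have linD: "linear (?D x)" for x using derF by (rule has_derivative_linear)
  have jac: "jacobian F (at x) *v v = ?D x v" for x v
    unfolding jacobian_def using linD[of x] by (simp add: matrix_works)
  have linR: "linear R0" and R0E: "\<And>v. coord_proj J (R0 v) = E (?D x0 v)"
    and detR: "\<bar>det (matrix R0)\<bar> = gen_jacobian F x0"
    using R0 by (auto simp: adapted_frame_def jac gen_jacobian_eq)
  define G where "G x = coord_proj (- J) (R0 (x - x0)) + E (F x)" for x
  define G' where "G' x v = coord_proj (- J) (R0 v) + E (?D x v)" for x v
  have PG: "coord_proj J (G x) = E (F x)" for x by (simp add: G_def E(2))
  have PG': "coord_proj J (G' x v) = E (?D x v)" for x v by (simp add: G'_def E(2))
  have Gx0: "G x0 = 0" by (simp add: G_def Fx0 linear_0[OF linR] linear_0[OF E(1)])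
  have G'x0: "G' x0 v = R0 v" for v
    unfolding G'_def R0E[symmetric] by simp
  have derG: "(G has_derivative G' x) (at x)" for x
  proof -
    have "bounded_linear R0" "bounded_linear E" using linR E(1) by (simp_all add: linear_conv_bounded_linear)
    note b = this
    have "((\<lambda>x. x - x0) has_derivative (\<lambda>v. v)) (at x)" by (auto intro!: derivative_eq_intros)
    from bounded_linear.has_derivative[OF bounded_linear_coord_proj bounded_linear.has_derivative[OF b(1) this], of "- J"]
    show ?thesis
      unfolding G_def[abs_def] G'_def[abs_def]
      by (intro has_derivative_add bounded_linear.has_derivative[OF b(2) derF])
  qed
  have linG': "linear (G' x)" for x using derG by (rule has_derivative_linear)
  obtain L where L: "L \<ge> 0" "\<And>x y v. x \<in> cball x0 1 \<Longrightarrow> y \<in> cball x0 1 \<Longrightarrow> norm (?D x v - ?D y v) \<le> L * norm (x - y) * norm v"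
    using C2_derivative_lipschitz_on_cball[OF C2] by metis
  have G'_lip: "norm (G' x v - G' y v) \<le> L * norm (x - y) * norm v" if "x \<in> cball x0 1" "y \<in> cball x0 1" for x y v
  proof -
    have "G' x v - G' y v = E (?D x v - ?D y v)" by (simp add: G'_def linear_diff[OF E(1)])
    then show ?thesis using E(3)[of "?D x v - ?D y v"] L(2)[OF that, of v] by simp
  qed
  have "det (matrix R0) \<noteq> 0" using detR jac_pos[OF Fx0] by auto
  then have "inj R0" using det_nz_iff_inj[OF linR] by simp
  then obtain \<beta> where \<beta>: "\<beta> > 0" "\<And>v. \<beta> * norm v \<le> norm (R0 v)"
    using linear_inj_bounded_below_pos[OF linR] by metis
  obtain K0 where K0: "K0 \<ge> 0" "\<And>v. norm (R0 v) \<le> K0 * norm v" using linear_le_norm[OF linR] by blast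
  define \<rho> where "\<rho> = min 1 (\<beta> / (2 * (L + 1)))"
  have \<rho>: "\<rho> > 0" "\<rho> \<le> 1" "L * \<rho> \<le> \<beta> / 2"
  proof -
    show "\<rho> > 0" "\<rho> \<le> 1" using \<beta> L by (auto simp: \<rho>_def)
    have "L * \<rho> \<le> (L + 1) * (\<beta> / (2 * (L + 1)))" using L \<beta> by (intro mult_mono) (auto simp: \<rho>_def)
    also have "(L + 1) * (\<beta> / (2 * (L + 1))) = \<beta> / 2" using L(1) by (simp add: divide_simps)
    finally show "L * \<rho> \<le> \<beta> / 2" .
  qed
  define K where "K = max (max 1 (2 * L * (2 / \<beta>)\<^sup>2)) (max (2 / \<beta>) (K0 + \<beta> / 2))"
  have K: "K \<ge> 1" "2 * L * (2 / \<beta>)\<^sup>2 \<le> K" "2 / \<beta> \<le> K" "K0 + \<beta> / 2 \<le> K" by (auto simp: K_def)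
  have in1: "x \<in> cball x0 1" if "x \<in> cball x0 \<rho>" for x using that \<rho> by auto
  have near: "norm (G' x v - R0 v) \<le> \<beta> / 2 * norm v" if x: "x \<in> cball x0 \<rho>" for x v
  proof -
    have "norm (G' x v - R0 v) \<le> L * norm (x - x0) * norm v"
      using G'_lip[OF in1[OF x], of x0 v] by (simp add: G'x0)
    also have "\<dots> \<le> (L * \<rho>) * norm v"
      using x L by (intro mult_right_mono mult_left_mono) (auto simp: dist_norm norm_minus_commute)
    also have "\<dots> \<le> \<beta> / 2 * norm v" using \<rho> by (intro mult_right_mono) auto
    finally show ?thesis .
  qed
  have main: "norm (G x - G y - R0 (x - y)) \<le> \<beta> / 2 * norm (x - y)" if "x \<in> ball x0 \<rho>" "y \<in> ball x0 \<rho>" for x y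
    by (rule strict_derivative_bound[OF convex_ball derG linR near that]) auto
  have lower: "dist x y \<le> 2 / \<beta> * dist (G x) (G y)" and upper: "dist (G x) (G y) \<le> (K0 + \<beta> / 2) * dist x y"
    if "x \<in> ball x0 \<rho>" "y \<in> ball x0 \<rho>" for x y
  proof -
    have "norm (R0 (x - y)) \<le> norm (G x - G y) + norm (G x - G y - R0 (x - y))"
      using norm_triangle_ineq4[of "G x - G y" "G x - G y - R0 (x - y)"] by simp
    then have "\<beta> * norm (x - y) \<le> norm (G x - G y) + \<beta> / 2 * norm (x - y)"
      using main[OF that] \<beta>(2)[of "x - y"] by linarith
    then show "dist x y \<le> 2 / \<beta> * dist (G x) (G y)" using \<beta>(1) by (simp add: dist_norm field_simps)
    have "norm (G x - G y) \<le> norm (R0 (x - y)) + norm (G x - G y - R0 (x - y))"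
      using norm_triangle_ineq[of "R0 (x - y)" "G x - G y - R0 (x - y)"] by simp
    then show "dist (G x) (G y) \<le> (K0 + \<beta> / 2) * dist x y"
      using main[OF that] K0(2)[of "x - y"] by (simp add: dist_norm distrib_right)
  qed
  have bilip: "dist x y \<le> K * dist (G x) (G y)" "dist (G x) (G y) \<le> K * dist x y"
    if "x \<in> ball x0 \<rho>" "y \<in> ball x0 \<rho>" for x y
    using lower[OF that] upper[OF that] mult_right_mono[OF K(3), of "dist (G x) (G y)"] mult_right_mono[OF K(4), of "dist x y"]
    by auto
  have det_nz: "det (matrix (G' x)) \<noteq> 0" if x: "x \<in> cball x0 \<rho>" for x
  proof -
    have "inj (G' x)"
    proof (rule linear_injective_0[OF linG', THEN iffD2], intro allI impI)
      fix v assume "G' x v = 0"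
      then have "\<beta> * norm v \<le> \<beta> / 2 * norm v" using near[OF x, of v] \<beta>(2)[of v] by simp
      then show "v = 0" using \<beta>(1) by (simp add: mult_le_cancel_right)
    qed
    then show ?thesis using det_nz_iff_inj[OF linG'] by simp
  qed
  have det_lip: "bounded_lipschitz (cball x0 \<rho>) (\<lambda>x. det (matrix (G' x)))"
  proof (rule bounded_lipschitz_det)
    fix i j
    show "bounded_lipschitz (cball x0 \<rho>) (\<lambda>x. matrix (G' x) $ i $ j)"
    proof (rule bounded_lipschitzI[where C="K0 + \<beta> / 2" and D=L])
      fix x assume x: "x \<in> cball x0 \<rho>"
      have "\<bar>matrix (G' x) $ i $ j\<bar> \<le> norm (G' x (axis j 1))" by (simp add: matrix_def component_le_norm_cart)
      also have "\<dots> \<le> norm (R0 (axis j 1)) + norm (G' x (axis j 1) - R0 (axis j 1))"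
        using norm_triangle_ineq[of "R0 (axis j 1)" "G' x (axis j 1) - R0 (axis j 1)"] by simp
      also have "\<dots> \<le> K0 + \<beta> / 2" using near[OF x, of "axis j 1"] K0(2)[of "axis j 1"] by simp
      finally show "\<bar>matrix (G' x) $ i $ j\<bar> \<le> K0 + \<beta> / 2" .
    next
      fix x y assume xy: "x \<in> cball x0 \<rho>" "y \<in> cball x0 \<rho>"
      have "\<bar>matrix (G' x) $ i $ j - matrix (G' y) $ i $ j\<bar> \<le> norm (G' x (axis j 1) - G' y (axis j 1))"
        using component_le_norm_cart[of "G' x (axis j 1) - G' y (axis j 1)" i] by (simp add: matrix_def)
      also have "\<dots> \<le> L * dist x y" using G'_lip[OF in1[OF xy(1)] in1[OF xy(2)], of "axis j 1"] by (simp add: dist_norm)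
      finally show "\<bar>matrix (G' x) $ i $ j - matrix (G' y) $ i $ j\<bar> \<le> L * dist x y" .
    qed
  qed
  obtain b where b: "b > 0" "\<And>x. x \<in> cball x0 \<rho> \<Longrightarrow> b \<le> \<bar>det (matrix (G' x))\<bar>"
  proof -
    have "continuous_on (cball x0 \<rho>) (\<lambda>x. \<bar>det (matrix (G' x))\<bar>)"
      by (intro continuous_on_rabs bounded_lipschitz_continuous_on[OF det_lip])
    then obtain x where x: "x \<in> cball x0 \<rho>" "\<And>y. y \<in> cball x0 \<rho> \<Longrightarrow> \<bar>det (matrix (G' x))\<bar> \<le> \<bar>det (matrix (G' y))\<bar>"
      using continuous_attains_inf[of "cball x0 \<rho>" "\<lambda>x. \<bar>det (matrix (G' x))\<bar>"] \<rho>(1) by auto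
    then show thesis using that[of "\<bar>det (matrix (G' x))\<bar>"] det_nz[OF x(1)] by auto
  qed
  have sub: "ball x0 \<rho> \<subseteq> cball x0 \<rho>" by auto
  have x0B: "x0 \<in> ball x0 \<rho>" using \<rho> by simp
  have isolated: "x = x0" if "J = UNIV" "x \<in> ball x0 \<rho>" "E (F x) = 0" for x
  proof -
    have "G x = 0" using PG[of x] that by (simp add: vec_eq_iff)
    then show ?thesis using bilip(1)[OF that(2) x0B] Gx0 by simp
  qed
  have "level_chart F (gen_jacobian F) J G G' x0 \<rho> K"
  proof
    show "0 < \<rho>" "1 \<le> K" "G x0 = 0" by fact+
    show "(G has_derivative G' x) (at x)" for x by (rule derG)
    show "det (matrix (G' x)) \<noteq> 0" if "x \<in> ball x0 \<rho>" for x using det_nz that sub by blast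
    show "bounded_lipschitz (ball x0 \<rho>) (\<lambda>x. det (matrix (G' x)))"
      by (rule bounded_lipschitz_subset[OF det_lip sub])
    show "bounded_lipschitz (ball x0 \<rho>) (\<lambda>x. 1 / \<bar>det (matrix (G' x))\<bar>)"
      by (rule bounded_lipschitz_subset[OF bounded_lipschitz_inverse_abs[OF det_lip b] sub])
    show "dist x y \<le> K * dist (G x) (G y)" "dist (G x) (G y) \<le> K * dist x y"
      if "x \<in> ball x0 \<rho>" "y \<in> ball x0 \<rho>" for x y by (rule bilip[OF that])+
    show "\<exists>\<delta>>0. \<forall>x\<in>ball x1 \<delta>. \<forall>y\<in>ball x1 \<delta>. norm (G x - G y - G' x1 (x - y)) \<le> e * norm (x - y)"
      if x1: "x1 \<in> ball x0 \<rho>" and e: "e > 0" for x1 e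
    proof -
      obtain d where d: "d > 0" "ball x1 d \<subseteq> ball x0 \<rho>" using x1 open_ball openE by metis
      define \<delta> where "\<delta> = min d (e / (L + 1))"
      have \<delta>: "\<delta> > 0" "ball x1 \<delta> \<subseteq> ball x0 \<rho>" "L * \<delta> \<le> e"
      proof -
        show "\<delta> > 0" "ball x1 \<delta> \<subseteq> ball x0 \<rho>" using d e L by (auto simp: \<delta>_def)
        have "L * \<delta> \<le> (L + 1) * (e / (L + 1))" using L e d by (intro mult_mono) (auto simp: \<delta>_def)
        then show "L * \<delta> \<le> e" using L by simp
      qed
      have cl: "norm (G' z v - G' x1 v) \<le> e * norm v" if z: "z \<in> ball x1 \<delta>" for z v
      proof -
        have "norm (G' z v - G' x1 v) \<le> L * norm (z - x1) * norm v"
          using z \<delta>(2) x1 sub in1 by (intro G'_lip) blast+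
        also have "\<dots> \<le> (L * \<delta>) * norm v"
          using z L by (intro mult_right_mono mult_left_mono) (auto simp: dist_norm norm_minus_commute)
        also have "\<dots> \<le> e * norm v" using \<delta> by (intro mult_right_mono) auto
        finally show ?thesis .
      qed
      show ?thesis
        using \<delta>(1) strict_derivative_bound[OF convex_ball derG linG' cl] by blast
    qed
    show "coord_proj J (G x) = 0 \<longleftrightarrow> F x = 0" if x: "x \<in> ball x0 \<rho>" for x
    proof
      assume "coord_proj J (G x) = 0"
      then have "E (F x) = 0" by (simp add: PG)
      then show "F x = 0" using alt isolated[OF _ x] Fx0 by (metis norm_eq_zero)
    qed (simp add: PG linear_0[OF E(1)])
    show "norm (coord_proj J (G x)) \<le> norm (F x)" for x by (simp add: PG E(3))
    show "norm (F x) \<le> norm (coord_proj J (G x)) + K * (norm (coord_proj J (G x)))\<^sup>2" if x: "x \<in> ball x0 \<rho>" for x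
      using alt
    proof
      assume "(\<forall>v. norm (E v) = norm v) \<and> (\<forall>x. F x = 0 \<longrightarrow> (\<exists>R. adapted_frame J E (jacobian F (at x)) R))"
      then show ?thesis using K by (simp add: PG)
    next
      assume J: "J = UNIV \<and> (\<forall>v. norm (E (jacobian F (at x0) *v v)) = norm (jacobian F (at x0) *v v))"
      define v where "v = x - x0"
      have err: "norm (F x - ?D x0 v) \<le> L * norm v * norm v"
      proof -
        have "norm (F x - F x0 - ?D x0 (x - x0)) \<le> (L * norm v) * norm (x - x0)"
        proof (rule strict_derivative_bound[OF convex_cball[of x0 "norm v"] derF linD])
          fix z u assume z: "z \<in> cball x0 (norm v)"
          then have "z \<in> cball x0 \<rho>" using x by (auto simp: v_def dist_norm norm_minus_commute)
          then have "norm (?D z u - ?D x0 u) \<le> L * norm (z - x0) * norm u" using in1 by (intro L(2)) auto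
          also have "\<dots> \<le> L * norm v * norm u"
            using z L by (intro mult_right_mono mult_left_mono) (auto simp: dist_norm norm_minus_commute)
          finally show "norm (?D z u - ?D x0 u) \<le> L * norm v * norm u" .
        qed (auto simp: v_def dist_norm norm_minus_commute)
        then show ?thesis by (simp add: Fx0 v_def)
      qed
      have "norm (F x) \<le> norm (?D x0 v) + norm (F x - ?D x0 v)"
        using norm_triangle_ineq[of "?D x0 v" "F x - ?D x0 v"] by simp
      moreover have "norm (?D x0 v) \<le> norm (E (F x)) + norm (F x - ?D x0 v)"
      proof -
        have "norm (?D x0 v) = norm (E (?D x0 v))" using J by (simp add: jac)
        also have "E (?D x0 v) = E (F x) - E (F x - ?D x0 v)" by (simp add: linear_diff[OF E(1)])
        also have "norm \<dots> \<le> norm (E (F x)) + norm (E (F x - ?D x0 v))" by (rule norm_triangle_ineq4)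
        finally show ?thesis using E(3)[of "F x - ?D x0 v"] by linarith
      qed
      ultimately have "norm (F x) \<le> norm (E (F x)) + 2 * L * (norm v * norm v)" using err by linarith
      moreover have "norm v \<le> 2 / \<beta> * norm (E (F x))"
      proof -
        have "G x = E (F x)" using PG[of x] J by (simp add: vec_eq_iff)
        then show ?thesis using lower[OF x x0B] Gx0 by (simp add: v_def dist_norm)
      qed
      then have "2 * L * (norm v * norm v) \<le> 2 * L * ((2 / \<beta> * norm (E (F x))) * (2 / \<beta> * norm (E (F x))))"
        using L(1) \<beta>(1) by (intro mult_left_mono mult_mono) auto
      moreover have "2 * L * ((2 / \<beta> * norm (E (F x))) * (2 / \<beta> * norm (E (F x)))) = (2 * L * (2 / \<beta>)\<^sup>2) * (norm (E (F x)))\<^sup>2"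
        by (simp add: power2_eq_square)
      moreover have "(2 * L * (2 / \<beta>)\<^sup>2) * (norm (E (F x)))\<^sup>2 \<le> K * (norm (E (F x)))\<^sup>2"
        using K(2) by (intro mult_right_mono) auto
      ultimately show ?thesis unfolding PG by linarith
    qed
    show "continuous_on UNIV F"
      using derF by (intro continuous_at_imp_continuous_on) (auto dest: has_derivative_continuous)
    show "continuous_on UNIV (gen_jacobian F)" by (rule continuous_on_gen_jacobian[OF C2])
    show "gen_jacobian F x > 0" if "F x = 0" for x by (rule jac_pos[OF that])
    show "\<exists>R. linear R \<and> (\<forall>v. coord_proj J (R v) = coord_proj J (G' x1 v)) \<and> \<bar>det (matrix R)\<bar> = gen_jacobian F x1 \<and>
        (\<exists>C\<ge>0. \<forall>v. \<bar>norm (R v) - norm v\<bar> \<le> C * norm (coord_proj J (G' x1 v)))"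
      if x1: "x1 \<in> ball x0 \<rho>" "F x1 = 0" for x1
    proof -
      have "\<exists>R. adapted_frame J E (jacobian F (at x1)) R \<and> (\<forall>v. norm (E (?D x1 v)) = norm (?D x1 v))"
        using alt
      proof
        assume "J = UNIV \<and> (\<forall>v. norm (E (jacobian F (at x0) *v v)) = norm (jacobian F (at x0) *v v))"
        moreover from this have "x1 = x0" using isolated[OF _ x1(1)] x1(2) by (simp add: linear_0[OF E(1)])
        ultimately show ?thesis using R0 by (auto simp: jac)
      qed (use x1 in auto)
      then obtain R where R: "adapted_frame J E (jacobian F (at x1)) R" "\<And>v. norm (E (?D x1 v)) = norm (?D x1 v)" by blast
      then show ?thesis
        unfolding adapted_frame_def PG' by (intro exI[of _ R]) (auto simp: jac gen_jacobian_eq)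
    qed
  qed
  then show thesis using that by blast
qed

section \<open>Coupling a thin layer with the level set\<close>

lemma sets_vimage_fst_snd:
  assumes "A \<in> sets borel"
  shows "fst -` A \<in> sets (borel \<Otimes>\<^sub>M (borel :: 'b::topological_space measure))"
    "snd -` A \<in> sets ((borel :: 'b::topological_space measure) \<Otimes>\<^sub>M borel)"
proof -
  have eq: "fst -` A = A \<times> UNIV" "snd -` A = UNIV \<times> A" by auto
  show "fst -` A \<in> sets (borel \<Otimes>\<^sub>M (borel :: 'b::topological_space measure))"
    "snd -` A \<in> sets ((borel :: 'b::topological_space measure) \<Otimes>\<^sub>M borel)"
    unfolding eq using assms by auto
qed

lemma nn_integral_lborel_coord_product:
  fixes J :: "'n::finite set"
  assumes [measurable]: "f \<in> borel_measurable borel" "g \<in> borel_measurable borel"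
  shows "(\<integral>\<^sup>+z. f (coord_proj (- J) z) * g (coord_proj J z) \<partial>lborel)
    = (\<integral>\<^sup>+u. f u \<partial>coord_lborel (- J)) * (\<integral>\<^sup>+y. g y \<partial>coord_lborel J)"
proof -
  have "(\<integral>\<^sup>+z. f (coord_proj (- J) z) * g (coord_proj J z) \<partial>lborel)
    = (\<integral>\<^sup>+u. \<integral>\<^sup>+y. f (coord_proj (- J) u) * g (coord_proj J y) \<partial>coord_lborel J \<partial>coord_lborel (- J))"
    using nn_integral_lborel_coord_split[of "\<lambda>z. f (coord_proj (- J) z) * g (coord_proj J z)" "- J"] by simp
  also have "\<dots> = (\<integral>\<^sup>+u. f (coord_proj (- J) u) * (\<integral>\<^sup>+y. g (coord_proj J y) \<partial>coord_lborel J) \<partial>coord_lborel (- J))"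
    by (intro nn_integral_cong nn_integral_cmult) measurable
  also have "\<dots> = (\<integral>\<^sup>+u. f (coord_proj (- J) u) \<partial>coord_lborel (- J)) * (\<integral>\<^sup>+y. g (coord_proj J y) \<partial>coord_lborel J)"
    by (rule nn_integral_multc) measurable
  finally show ?thesis by (simp add: nn_integral_coord_lborel_proj)
qed

definition normal_mass :: "nat \<Rightarrow> 'n::finite set \<Rightarrow> ennreal" where
  "normal_mass k J = (\<integral>\<^sup>+y. ennreal (exp (- (norm y ^ k))) \<partial>coord_lborel J)"

text \<open>The first summand accounts for the variation of a Lipschitz density in the normal direction, the second for the quadratic difference
  between \<open>norm (F x)\<close> and the norm of the normal coordinates (see \<open>exp_neg_power_diff_le\<close>).\<close>

definition normal_moment :: "nat \<Rightarrow> 'n::finite set \<Rightarrow> ennreal" where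
  "normal_moment k J = (\<integral>\<^sup>+y. ennreal ((norm y + norm y * norm y ^ k) * exp (- (norm y ^ k))) \<partial>coord_lborel J)"

lemma nn_integral_power_exp_power_finite:
  assumes "k \<ge> 1"
  shows "(\<integral>\<^sup>+y. ennreal (norm y ^ n * exp (- (norm y ^ k))) \<partial>coord_lborel J) < \<infinity>"
proof -
  have "(\<integral>\<^sup>+y. ennreal (norm y ^ n * exp (- (norm y ^ k))) \<partial>coord_lborel J)
      = (\<integral>\<^sup>+y. ennreal (norm y ^ n * exp (- 1 * norm y powr real k)) \<partial>coord_lborel J)"
  proof (rule nn_integral_cong)
    fix y :: "real ^ 'a"
    have "norm y powr real k = norm y ^ k"
      using assms by (cases "norm y = 0") (simp_all add: powr_realpow zero_power)
    then show "ennreal (norm y ^ n * exp (- (norm y ^ k))) = ennreal (norm y ^ n * exp (- 1 * norm y powr real k))"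
      by simp
  qed
  then show ?thesis using nn_integral_coord_lborel_power_exp_finite[where c=1 and \<beta>="real k" and n=n and I=J] assms by simp
qed

lemma normal_mass_finite: "k \<ge> 1 \<Longrightarrow> normal_mass k J < \<infinity>"
  using nn_integral_power_exp_power_finite[where n=0 and J=J] by (simp add: normal_mass_def)

lemma normal_moment_finite:
  assumes "k \<ge> 1" shows "normal_moment k J < \<infinity>"
proof -
  have "normal_moment k J = (\<integral>\<^sup>+y. ennreal (norm y ^ 1 * exp (- (norm y ^ k))) + ennreal (norm y ^ (k + 1) * exp (- (norm y ^ k))) \<partial>coord_lborel J)"
    unfolding normal_moment_def by (intro nn_integral_cong) (simp add: ennreal_plus[symmetric] algebra_simps del: ennreal_plus)
  also have "\<dots> = (\<integral>\<^sup>+y. ennreal (norm y ^ 1 * exp (- (norm y ^ k))) \<partial>coord_lborel J) + (\<integral>\<^sup>+y. ennreal (norm y ^ (k + 1) * exp (- (norm y ^ k))) \<partial>coord_lborel J)"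
    by (rule nn_integral_add) measurable
  finally show ?thesis
    using nn_integral_power_exp_power_finite[OF assms, where n=1 and J=J] nn_integral_power_exp_power_finite[OF assms, where n="k + 1" and J=J] by simp
qed

lemma normal_mass_pos:
  fixes J :: "'n::finite set"
  shows "normal_mass k J > 0"
proof -
  let ?S = "{z :: real ^ 'n. \<forall>i\<in>J. 0 < z $ i \<and> z $ i < 1}"
  have "(\<integral>\<^sup>+y. ennreal (exp (- (norm y ^ k))) \<partial>coord_lborel J) \<noteq> 0"
  proof
    assume "(\<integral>\<^sup>+y. ennreal (exp (- (norm y ^ k))) \<partial>coord_lborel J) = 0"
    then have "AE y in coord_lborel J. ennreal (exp (- (norm y ^ k))) = 0"
      by (subst (asm) nn_integral_0_iff_AE) auto
    then have "AE y in coord_lborel J. False" by (elim eventually_mono) simp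
    then have "emeasure (coord_lborel J) UNIV = 0" by (simp add: AE_iff_null null_setsD1)
    moreover have "emeasure (coord_lborel J) ?S \<le> emeasure (coord_lborel J) UNIV" by (intro emeasure_mono) auto
    moreover have "emeasure (coord_lborel J) ?S = 1" by (subst emeasure_coord_lborel_box) auto
    ultimately show False by simp
  qed
  then show ?thesis by (simp add: normal_mass_def zero_less_iff_neq_zero)
qed

lemma nn_integral_coord_lborel_rescale:
  assumes "f \<in> borel_measurable borel" and "s > 0"
  shows "(\<integral>\<^sup>+y. f (y /\<^sub>R s) \<partial>coord_lborel J) = ennreal (s ^ card J) * (\<integral>\<^sup>+y. f y \<partial>coord_lborel J)"
proof -
  have [measurable]: "f \<in> borel_measurable borel" by fact
  show ?thesis using nn_integral_coord_lborel_scale[of "\<lambda>y. f (y /\<^sub>R s)" s J] assms(2) by simp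
qed

lemma one_plus_power_le:
  assumes "(x::real) \<ge> 0" shows "(1 + x) ^ k - 1 \<le> real k * x * (1 + x) ^ k"
proof (induction k)
  case (Suc k)
  have "(1 + x) ^ Suc k - 1 = ((1 + x) ^ k - 1) + x * (1 + x) ^ k" by (simp add: algebra_simps)
  also have "\<dots> \<le> real (Suc k) * x * (1 + x) ^ k" using Suc by (simp add: algebra_simps)
  also have "\<dots> \<le> real (Suc k) * x * (1 + x) ^ Suc k"
    using assms by (intro mult_left_mono power_increasing) auto
  finally show ?case .
qed simp

text \<open>A mean value estimate for \<open>exp (- t ^ k)\<close>, with a relative error \<open>x\<close> in \<open>t\<close>: the loss is \<open>x\<close> times a function that is
  still integrable.\<close>

lemma exp_neg_power_diff_le:
  fixes t t' x D :: real
  assumes "0 \<le> t" "t \<le> t'" "t' \<le> t * (1 + x)" "0 \<le> x" "(1 + x) ^ k \<le> D"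
  shows "\<bar>exp (- (t' ^ k)) - exp (- (t ^ k))\<bar> \<le> real k * D * x * (t ^ k * exp (- (t ^ k)))"
proof -
  have "t ^ k \<le> t' ^ k" using assms by (intro power_mono) auto
  have "t' ^ k \<le> t ^ k * (1 + x) ^ k"
    using assms by (metis order_trans power_mono power_mult_distrib)
  then have "t' ^ k - t ^ k \<le> t ^ k * ((1 + x) ^ k - 1)" by (simp add: algebra_simps)
  also have "\<dots> \<le> t ^ k * (real k * x * (1 + x) ^ k)"
    using assms by (intro mult_left_mono one_plus_power_le) auto
  also have "\<dots> \<le> t ^ k * (real k * x * D)" using assms by (intro mult_left_mono) auto
  finally have d: "t' ^ k - t ^ k \<le> real k * D * x * t ^ k" by (simp add: mult_ac)
  have "1 + (t ^ k - t' ^ k) \<le> exp (t ^ k - t' ^ k)" by (rule exp_ge_add_one_self)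
  then have "1 - exp (t ^ k - t' ^ k) \<le> t' ^ k - t ^ k" by linarith
  then have "(1 - exp (t ^ k - t' ^ k)) * exp (- (t ^ k)) \<le> (real k * D * x * t ^ k) * exp (- (t ^ k))"
    using d by (intro mult_right_mono) auto
  moreover have "(1 - exp (t ^ k - t' ^ k)) * exp (- (t ^ k)) = exp (- (t ^ k)) - exp (- (t' ^ k))"
    by (simp add: algebra_simps flip: exp_add)
  moreover have "exp (- (t' ^ k)) \<le> exp (- (t ^ k))" using \<open>t ^ k \<le> t' ^ k\<close> by simp
  ultimately show ?thesis by (simp add: mult.assoc)
qed

text \<open>A partial coupling \<open>\<kappa>\<close> of the weighted Lebesgue measure \<open>h x * exp (- (norm (F x) / s) ^ k)\<close> with the rescaled surface measure of density
  \<open>h / jac\<close>: both marginals are dominated, and the missing masses as well as the transport cost are at most \<open>C * s ^ (card J + 1)\<close>, one order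
  below the total mass. The conditions are stated without division in \<open>ennreal\<close>, with \<open>hausdorff_plane_const\<close> on the other side.\<close>

definition layer_coupling ::
    "(real ^ 'd \<Rightarrow> real ^ 'p) \<Rightarrow> (real ^ 'd \<Rightarrow> real) \<Rightarrow> 'd set \<Rightarrow> nat \<Rightarrow> (real ^ 'd \<Rightarrow> real) \<Rightarrow> real \<Rightarrow> real \<Rightarrow>
     ((real ^ 'd) \<times> (real ^ 'd)) measure \<Rightarrow> bool" where
  "layer_coupling F jac J k h C s \<kappa> \<longleftrightarrow> sets \<kappa> = sets (borel \<Otimes>\<^sub>M borel) \<and>
    (\<forall>A\<in>sets borel. emeasure \<kappa> (fst -` A) \<le> (\<integral>\<^sup>+x. ennreal (h x * exp (- ((norm (F x) / s) ^ k))) * indicator A x \<partial>lborel)) \<and>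
    (\<forall>A\<in>sets borel. hausdorff_plane_const (- J) * emeasure \<kappa> (snd -` A) \<le> ennreal (s ^ card J) * normal_mass k J *
       (\<integral>\<^sup>+x. ennreal (h x) * indicator A x * (ennreal (1 / jac x) * indicator {x. F x = 0} x) \<partial>hausdorff_measure (card (- J)))) \<and>
    (\<integral>\<^sup>+x. ennreal (h x * exp (- ((norm (F x) / s) ^ k))) \<partial>lborel) \<le> emeasure \<kappa> UNIV + ennreal (C * s ^ (card J + 1)) \<and>
    ennreal (s ^ card J) * normal_mass k J *
       (\<integral>\<^sup>+x. ennreal (h x) * (ennreal (1 / jac x) * indicator {x. F x = 0} x) \<partial>hausdorff_measure (card (- J)))
      \<le> hausdorff_plane_const (- J) * (emeasure \<kappa> UNIV + ennreal (C * s ^ (card J + 1))) \<and>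
    (\<integral>\<^sup>+z. ennreal (dist (fst z) (snd z)) \<partial>\<kappa>) \<le> ennreal (C * s ^ (card J + 1))"

context level_chart
begin

text \<open>In the chart the first measure has density \<open>a\<close>, and the second one, spread over the normal directions with the profile
  \<open>exp (- norm (y / s) ^ k)\<close>, has density \<open>b\<close>. The coupling moves the common part \<open>min a b\<close> from \<open>H z\<close> to
  \<open>H (coord_proj (- J) z)\<close>. Both the difference of \<open>a\<close> and \<open>b\<close> and the cost per unit volume are dominated by
  one function \<open>g\<close>, whose integral is of order \<open>s ^ (card J + 1)\<close> by scaling the normal coordinates. The radius \<open>r\<close> keeps the support of
  the density away from the boundary of the chart domain.\<close>

lemma local_coupling:
  assumes k: "k \<ge> 1"
  obtains r where "0 < r" "r \<le> \<rho>"
    "\<And>h. (\<And>x. 0 \<le> h x) \<Longrightarrow> h \<in> borel_measurable borel \<Longrightarrow> bounded_lipschitz B h \<Longrightarrow>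
      (\<And>x. x \<notin> ball x0 r \<Longrightarrow> h x = 0) \<Longrightarrow>
      \<exists>C\<ge>0. \<forall>s\<in>{0<..1}. \<exists>\<kappa>. layer_coupling F jac J k h C s \<kappa>"
proof -
  have "0 \<in> G ` B" using G_x0 rho by force
  then obtain d where d: "d > 0" "ball 0 d \<subseteq> G ` B" using open_GB openE by blast
  define r where "r = min \<rho> (d / (2 * K))"
  have r: "0 < r" "r \<le> \<rho>" "K * r \<le> d / 2"
  proof -
    show "0 < r" "r \<le> \<rho>" using rho K d by (auto simp: r_def)
    have "K * r \<le> K * (d / (2 * K))" using K by (intro mult_left_mono) (auto simp: r_def)
    also have "K * (d / (2 * K)) = d / 2" using K by simp
    finally show "K * r \<le> d / 2" .
  qed
  let ?p = "coord_proj (- J)" and ?q = "coord_proj J" and ?hc = "hausdorff_plane_const (- J)"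
  have pq: "?p z + ?q z = z" for z by (rule coord_proj_add_compl)
  have zp: "z - ?p z = ?q z" for z by (simp add: vec_eq_iff)
  have p_norm: "norm (?p z) \<le> norm z" "norm (?q z) \<le> norm z" for z by (rule norm_coord_proj_le)+
  have claim: "\<exists>C\<ge>0. \<forall>s\<in>{0<..1}. \<exists>\<kappa>. layer_coupling F jac J k h C s \<kappa>"
    if h0: "\<And>x. 0 \<le> h x" and hm [measurable]: "h \<in> borel_measurable borel" and hl: "bounded_lipschitz B h"
      and hs: "\<And>x. x \<notin> ball x0 r \<Longrightarrow> h x = 0" for h
  proof -
    define f where "f z = (if z \<in> G ` B then h (H z) * w (H z) else 0)" for z
    have w0: "w (H z) \<ge> 0" for z using w_pos[OF H_in_B] less_imp_le by blast
    have f0: "f z \<ge> 0" for z using h0 w0 by (simp add: f_def)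
    have fm [measurable]: "f \<in> borel_measurable borel" unfolding f_def[abs_def] by measurable
    have Fm [measurable]: "F \<in> borel_measurable borel" using F_cont by (rule borel_measurable_continuous_onI)
    have f_supp: "norm z < d / 2" "z \<in> G ` B" if "f z \<noteq> 0" for z
    proof -
      show zG: "z \<in> G ` B" using that by (auto simp: f_def split: if_splits)
      then have "h (H z) \<noteq> 0" using that by (auto simp: f_def)
      then have "H z \<in> ball x0 r" using hs by blast
      then have "dist (H z) x0 < r" by (simp add: dist_commute)
      have "norm z = dist (G (H z)) (G x0)" using GH[OF zG] G_x0 by simp
      also have "\<dots> \<le> K * dist (H z) x0" using bilip(2)[OF H_in_B, of x0 z] rho by simp
      also have "\<dots> < K * r" using \<open>dist (H z) x0 < r\<close> K by simp
      finally show "norm z < d / 2" using r(3) by simp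
    qed
    have "bounded_lipschitz (G ` B) (\<lambda>z. h (H z) * w (H z))"
      by (intro bounded_lipschitz_mult bounded_lipschitz_compose[OF hl _ H_lip] bounded_lipschitz_compose[OF w_bounded_lipschitz _ H_lip] H_in_B)
    then have "bounded_lipschitz (G ` B) f" by (rule bounded_lipschitz_cong) (simp add: f_def)
    note bl = this
    obtain Lf where Lf: "Lf \<ge> 0" "\<And>z. z \<in> G ` B \<Longrightarrow> \<bar>f z\<bar> \<le> Lf"
        "\<And>z z'. z \<in> G ` B \<Longrightarrow> z' \<in> G ` B \<Longrightarrow> \<bar>f z - f z'\<bar> \<le> Lf * dist z z'"
      using bounded_lipschitzE[OF bl] by metis
    have f_le: "f z \<le> Lf" for z using Lf(1) Lf(2)[of z] by (cases "z \<in> G ` B") (auto simp: f_def[of z])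
    define L1 where "L1 = Lf + 2 * Lf / d"
    have L1: "L1 \<ge> 0" "Lf \<le> L1" "2 * Lf / d \<le> L1" using Lf(1) d(1) by (auto simp: L1_def)
    (* f vanishes outside the ball of radius d / 2, which makes the bound hold also across the boundary of G ` B:
       if norm z is at least d but f does not vanish at the projection, then the normal part has length at least d / 2. *)
    have f_lip: "\<bar>f z - f (?p z)\<bar> \<le> L1 * norm (?q z)" for z
    proof (cases "norm z < d")
      case True
      then have "z \<in> G ` B" "?p z \<in> G ` B" using d(2) p_norm(1)[of z] by (auto intro: le_less_trans)
      then have "\<bar>f z - f (?p z)\<bar> \<le> Lf * dist z (?p z)" by (rule Lf(3))
      also have "dist z (?p z) = norm (?q z)" by (simp only: dist_norm zp)
      also have "Lf * norm (?q z) \<le> L1 * norm (?q z)" using L1 by (intro mult_right_mono) auto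
      finally show ?thesis .
    next
      case False
      then have fz: "f z = 0" using f_supp(1)[of z] d(1) by force
      show ?thesis
      proof (cases "f (?p z) = 0")
        case False
        then have "norm (?p z) < d / 2" by (rule f_supp)
        moreover have "norm z \<le> norm (?p z) + norm (?q z)" using norm_triangle_ineq[of "?p z" "?q z"] pq[of z] by simp
        ultimately have q: "d / 2 \<le> norm (?q z)" using \<open>\<not> norm z < d\<close> by linarith
        have "f (?p z) \<le> 2 * Lf / d * (d / 2)" using f_le d(1) by simp
        also have "\<dots> \<le> L1 * norm (?q z)" using L1 q d(1) Lf(1) by (intro mult_mono) auto
        finally show ?thesis using fz f0[of "?p z"] by simp
      qed (use fz L1 in simp)
    qed
    define Dk where "Dk = (1 + K * d) ^ k"
    have Dk: "Dk \<ge> 0" using K d by (simp add: Dk_def)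
    define Cg where "Cg = max (L1 + Lf * (real k * Dk * K)) (Lf * K)"
    have Cg: "Cg \<ge> 0" "L1 \<le> Cg" "Lf * (real k * Dk * K) \<le> Cg" "L1 + Lf * (real k * Dk * K) \<le> Cg" "Lf * K \<le> Cg"
      using L1 Lf(1) Dk K by (auto simp: Cg_def le_max_iff_disj)
    define V where "V = emeasure (coord_lborel (- J)) {u. norm (?p u) < d}"
    have Vfin: "V < \<infinity>"
    proof -
      have "V \<le> emeasure (coord_lborel (- J)) {z. \<forall>i\<in>- J. - d < z $ i \<and> z $ i < d}"
        unfolding V_def
      proof (rule emeasure_mono, rule subsetI)
        fix u assume "u \<in> {u. norm (?p u) < d}"
        then have "\<bar>u $ i\<bar> < d" if "i \<in> - J" for i
          using component_le_norm_cart[of "?p u" i] that by simp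
        then show "u \<in> {z. \<forall>i\<in>- J. - d < z $ i \<and> z $ i < d}" by (auto simp: abs_less_iff) (metis ComplI minus_less_iff)
      qed simp
      also have "\<dots> < \<infinity>" using d(1) by (subst emeasure_coord_lborel_cube) auto
      finally show ?thesis .
    qed
    define C where "C = Cg * enn2real (V * normal_moment k J)"
    have VN: "V * normal_moment k J < top" using Vfin normal_moment_finite[OF k, of J] by (simp add: ennreal_mult_less_top)
    have C: "C \<ge> 0" by (simp add: C_def Cg)
    show ?thesis
    proof (intro exI[of _ C] conjI ballI C)
      fix s :: real assume "s \<in> {0<..1}"
      then have s: "0 < s" "s \<le> 1" by auto
      define t where "t z = norm (?q z) / s" for z
      define a where "a z = f z * exp (- ((norm (F (H z)) / s) ^ k))" for z
      define b where "b z = f (?p z) * exp (- (t z ^ k))" for z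
      define g where "g z = Cg * s * ((t z + t z * t z ^ k) * exp (- (t z ^ k))) * indicator {z. norm (?p z) < d} z" for z
      have tm [measurable]: "t \<in> borel_measurable borel" unfolding t_def[abs_def] by measurable
      have am [measurable]: "a \<in> borel_measurable borel" unfolding a_def[abs_def] by measurable
      have bm [measurable]: "b \<in> borel_measurable borel" unfolding b_def[abs_def] by measurable
      have gm [measurable]: "g \<in> borel_measurable borel" unfolding g_def[abs_def] by measurable
      have a0: "a z \<ge> 0" and b0: "b z \<ge> 0" and t0: "t z \<ge> 0" for z using f0 s by (auto simp: a_def b_def t_def)
      have g0: "g z \<ge> 0" for z using Cg s t0 by (auto simp: g_def intro!: mult_nonneg_nonneg add_nonneg_nonneg)
      have qt: "norm (?q z) = s * t z" for z using s by (simp add: t_def)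
      have far: "a z = 0" "b z = 0" if "norm (?p z) \<ge> d" for z
      proof -
        have "f z = 0" using f_supp(1)[of z] that p_norm(1)[of z] d(1) by force
        moreover have "f (?p z) = 0" using f_supp(1)[of "?p z"] that d(1) by force
        ultimately show "a z = 0" "b z = 0" by (simp_all add: a_def b_def)
      qed
      have ab: "\<bar>a z - b z\<bar> \<le> g z" for z
      proof (cases "norm (?p z) < d")
        case True
        let ?e = "exp (- (t z ^ k))" and ?e' = "exp (- ((norm (F (H z)) / s) ^ k))"
        have "f z * \<bar>?e' - ?e\<bar> \<le> Lf * (real k * Dk * K) * (s * (t z * t z ^ k * ?e))"
        proof (cases "f z = 0")
          case True
          then show ?thesis using Lf(1) Dk K s t0[of z] by (auto intro!: mult_nonneg_nonneg)
        next
          case False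
          have zG: "z \<in> G ` B" and zd: "norm z < d / 2" using f_supp[OF False] by auto
          have FH: "norm (?q z) \<le> norm (F (H z))" "norm (F (H z)) \<le> norm (?q z) + K * (norm (?q z))\<^sup>2"
            using F_lower[OF H_in_B, of z] F_upper[OF H_in_B, of z] GH[OF zG] by simp_all
          have "\<bar>?e' - ?e\<bar> \<le> real k * Dk * (K * norm (?q z)) * (t z ^ k * ?e)"
          proof (rule exp_neg_power_diff_le)
            show "t z \<le> norm (F (H z)) / s" using FH(1) s by (simp add: t_def divide_right_mono)
            have "norm (F (H z)) / s \<le> (norm (?q z) + K * (norm (?q z))\<^sup>2) / s" using FH(2) s by (simp add: divide_right_mono)
            also have "\<dots> = t z * (1 + K * norm (?q z))" using s by (simp add: t_def field_simps power2_eq_square)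
            finally show "norm (F (H z)) / s \<le> t z * (1 + K * norm (?q z))" .
            have "norm (?q z) \<le> d" using zd p_norm(2)[of z] d(1) by linarith
            then show "(1 + K * norm (?q z)) ^ k \<le> Dk" unfolding Dk_def using K by (intro power_mono) auto
          qed (use t0 K in auto)
          also have "\<dots> = (real k * Dk * K) * (s * (t z * t z ^ k * ?e))" by (simp add: qt mult_ac)
          finally have "f z * \<bar>?e' - ?e\<bar> \<le> f z * ((real k * Dk * K) * (s * (t z * t z ^ k * ?e)))"
            using f0 by (intro mult_left_mono) auto
          also have "\<dots> \<le> Lf * ((real k * Dk * K) * (s * (t z * t z ^ k * ?e)))"
            using f_le Dk K s t0[of z] by (intro mult_right_mono) auto
          finally show ?thesis by (simp add: mult.assoc)
        qed
        moreover have "\<bar>f z - f (?p z)\<bar> * ?e \<le> L1 * (s * (t z * ?e))"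
          using mult_right_mono[OF f_lip[of z], of ?e] by (simp add: qt mult_ac)
        moreover have "\<bar>a z - b z\<bar> \<le> f z * \<bar>?e' - ?e\<bar> + \<bar>f z - f (?p z)\<bar> * ?e"
        proof -
          have "a z - b z = f z * (?e' - ?e) + (f z - f (?p z)) * ?e" by (simp add: a_def b_def algebra_simps)
          then have "\<bar>a z - b z\<bar> \<le> \<bar>f z * (?e' - ?e)\<bar> + \<bar>(f z - f (?p z)) * ?e\<bar>" by (simp only: abs_triangle_ineq)
          then show ?thesis using f0[of z] by (simp add: abs_mult)
        qed
        moreover have "L1 * (s * (t z * ?e)) \<le> Cg * (s * (t z * ?e))"
          using Cg s t0[of z] by (intro mult_right_mono) auto
        moreover have "Lf * (real k * Dk * K) * (s * (t z * t z ^ k * ?e)) \<le> Cg * (s * (t z * t z ^ k * ?e))"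
          using Cg s t0[of z] by (intro mult_right_mono) auto
        moreover have "g z = Cg * (s * (t z * ?e)) + Cg * (s * (t z * t z ^ k * ?e))"
          using True by (simp add: g_def algebra_simps)
        ultimately show ?thesis by linarith
      qed (use far g0 in simp)
      have cost: "min (a z) (b z) * dist (H z) (H (?p z)) \<le> g z" for z
      proof (cases "a z = 0 \<or> norm (?p z) \<ge> d")
        case True
        then have "min (a z) (b z) = 0" using far[of z] b0[of z] by auto
        then show ?thesis using g0 by simp
      next
        case False
        then have fz: "f z \<noteq> 0" by (auto simp: a_def)
        have zG: "z \<in> G ` B" and zd: "norm z < d / 2" using f_supp[OF fz] by auto
        have pG: "?p z \<in> G ` B" using zd p_norm(1)[of z] d by (intro subsetD[OF d(2)]) auto
        have "dist (H z) (H (?p z)) \<le> K * dist z (?p z)" by (rule H_lip[OF zG pG])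
        also have "dist z (?p z) = norm (?q z)" by (simp only: dist_norm zp)
        finally have 1: "dist (H z) (H (?p z)) \<le> K * (s * t z)" by (simp add: qt)
        have 2: "min (a z) (b z) \<le> Lf * exp (- (t z ^ k))"
        proof -
          have "b z \<le> Lf * exp (- (t z ^ k))" unfolding b_def by (intro mult_right_mono f_le) simp
          then show ?thesis by simp
        qed
        have "min (a z) (b z) * dist (H z) (H (?p z)) \<le> (Lf * exp (- (t z ^ k))) * (K * (s * t z))"
          using 1 2 Lf(1) by (intro mult_mono) auto
        also have "\<dots> = (Lf * K) * (s * (t z * exp (- (t z ^ k))))" by (simp add: mult_ac)
        also have "\<dots> \<le> Cg * (s * (t z * exp (- (t z ^ k))))" using Cg s t0[of z] by (intro mult_right_mono) auto
        also have "\<dots> \<le> Cg * (s * (t z * exp (- (t z ^ k)))) + Cg * (s * (t z * t z ^ k * exp (- (t z ^ k))))"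
          using Cg s t0[of z] by simp
        also have "\<dots> = g z" using False by (simp add: g_def algebra_simps)
        finally show ?thesis .
      qed
      have g_int: "(\<integral>\<^sup>+z. ennreal (g z) \<partial>lborel) \<le> ennreal (C * s ^ (card J + 1))"
      proof -
        let ?m = "\<lambda>y :: real ^ 'd. ennreal ((norm y + norm y * norm y ^ k) * exp (- (norm y ^ k)))"
        have "(\<integral>\<^sup>+z. ennreal (g z) \<partial>lborel)
            = (\<integral>\<^sup>+z. ennreal (Cg * s) * (indicator {u. norm (?p u) < d} (?p z) * ?m (?q z /\<^sub>R s)) \<partial>lborel)"
        proof (rule nn_integral_cong)
          fix z :: "real ^ 'd"
          have "norm (?q z /\<^sub>R s) = t z" using s by (simp add: t_def divide_inverse mult.commute)
          then show "ennreal (g z) = ennreal (Cg * s) * (indicator {u. norm (?p u) < d} (?p z) * ?m (?q z /\<^sub>R s))"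
            using Cg s by (auto simp: g_def ennreal_mult'[symmetric] split: split_indicator)
        qed
        also have "\<dots> = ennreal (Cg * s) * (\<integral>\<^sup>+z. indicator {u. norm (?p u) < d} (?p z) * ?m (?q z /\<^sub>R s) \<partial>lborel)"
          by (rule nn_integral_cmult) measurable
        also have "(\<integral>\<^sup>+z. indicator {u. norm (?p u) < d} (?p z) * ?m (?q z /\<^sub>R s) \<partial>lborel)
            = (\<integral>\<^sup>+u. indicator {u. norm (?p u) < d} u \<partial>coord_lborel (- J)) * (\<integral>\<^sup>+y. ?m (y /\<^sub>R s) \<partial>coord_lborel J)"
          by (rule nn_integral_lborel_coord_product) measurable
        also have "(\<integral>\<^sup>+u. indicator {u. norm (?p u) < d} u \<partial>coord_lborel (- J)) = V"
          unfolding V_def by (rule nn_integral_indicator) measurable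
        also have "(\<integral>\<^sup>+y. ?m (y /\<^sub>R s) \<partial>coord_lborel J) = ennreal (s ^ card J) * normal_moment k J"
          unfolding normal_moment_def by (rule nn_integral_coord_lborel_rescale) (use s in auto)
        also have "ennreal (Cg * s) * (V * (ennreal (s ^ card J) * normal_moment k J))
            = ennreal (Cg * s) * ennreal (s ^ card J) * (V * normal_moment k J)" by (simp only: mult_ac)
        also have "V * normal_moment k J = ennreal (enn2real (V * normal_moment k J))" using VN by simp
        also have "ennreal (Cg * s) * ennreal (s ^ card J) * \<dots> = ennreal (C * s ^ (card J + 1))"
          using Cg s by (simp add: ennreal_mult'[symmetric] C_def mult_ac)
        finally show ?thesis by simp
      qed
      define \<mu> where "\<mu> = density lborel (\<lambda>z. ennreal (min (a z) (b z)))"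
      have mm: "(\<lambda>z. (H z, H (?p z))) \<in> \<mu> \<rightarrow>\<^sub>M borel \<Otimes>\<^sub>M borel"
        unfolding \<mu>_def by measurable
      define \<kappa> where "\<kappa> = distr \<mu> (borel \<Otimes>\<^sub>M borel) (\<lambda>z. (H z, H (?p z)))"
      have \<kappa>sets: "sets \<kappa> = sets (borel \<Otimes>\<^sub>M borel)" by (simp add: \<kappa>_def)
      have sp: "space \<mu> = UNIV" by (simp add: \<mu>_def)
      have pre: "emeasure \<mu> S = (\<integral>\<^sup>+z. ennreal (min (a z) (b z)) * indicator S z \<partial>lborel)" if "S \<in> sets borel" for S
        unfolding \<mu>_def using that by (subst emeasure_density) auto
      note fstm = sets_vimage_fst_snd(1)[where 'a="real ^ 'd" and 'b="real ^ 'd"]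
      note sndm = sets_vimage_fst_snd(2)[where 'a="real ^ 'd" and 'b="real ^ 'd"]
      have Hm: "H -` A \<in> sets borel" "(\<lambda>z. H (?p z)) -` A \<in> sets borel" if "A \<in> sets borel" for A
      proof -
        have "(\<lambda>z. H (?p z)) \<in> borel_measurable borel" by measurable
        from measurable_sets[OF H_borel that] measurable_sets[OF this that]
        show "H -` A \<in> sets borel" "(\<lambda>z. H (?p z)) -` A \<in> sets borel" by simp_all
      qed
      have \<kappa>1: "emeasure \<kappa> (fst -` A) = (\<integral>\<^sup>+z. ennreal (min (a z) (b z)) * indicator A (H z) \<partial>lborel)" if A: "A \<in> sets borel" for A
      proof -
        have "emeasure \<kappa> (fst -` A) = emeasure \<mu> (H -` A)"
          unfolding \<kappa>_def using fstm[OF A] mm by (subst emeasure_distr) (auto simp: sp vimage_def)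
        then show ?thesis using pre[OF Hm(1)[OF A]] by (simp add: indicator_def)
      qed
      have \<kappa>2: "emeasure \<kappa> (snd -` A) = (\<integral>\<^sup>+z. ennreal (min (a z) (b z)) * indicator A (H (?p z)) \<partial>lborel)" if A: "A \<in> sets borel" for A
      proof -
        have "emeasure \<kappa> (snd -` A) = emeasure \<mu> ((\<lambda>z. H (?p z)) -` A)"
          unfolding \<kappa>_def using sndm[OF A] mm by (subst emeasure_distr) (auto simp: sp vimage_def)
        then show ?thesis using pre[OF Hm(2)[OF A]] by (simp add: indicator_def)
      qed
      have \<kappa>U: "emeasure \<kappa> UNIV = (\<integral>\<^sup>+z. ennreal (min (a z) (b z)) \<partial>lborel)" using \<kappa>1[of UNIV] by simp
      have source: "(\<integral>\<^sup>+x. ennreal (h x * exp (- ((norm (F x) / s) ^ k))) * indicator A x \<partial>lborel) = (\<integral>\<^sup>+z. ennreal (a z) * indicator A (H z) \<partial>lborel)"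
        if [measurable]: "A \<in> sets borel" for A
      proof -
        let ?f = "\<lambda>x. ennreal (h x * exp (- ((norm (F x) / s) ^ k))) * indicator A x"
        have "(\<integral>\<^sup>+x. ?f x \<partial>lborel) = (\<integral>\<^sup>+x. ?f x * indicator B x \<partial>lborel)"
        proof (rule nn_integral_cong)
          fix x show "?f x = ?f x * indicator B x" using hs[of x] r(2) by (cases "x \<in> B") auto
        qed
        also have "\<dots> = (\<integral>\<^sup>+z. ?f (H z) * ennreal (w (H z)) * indicator (G ` B) z \<partial>lborel)"
          by (rule nn_integral_chart[symmetric]) measurable
        also have "\<dots> = (\<integral>\<^sup>+z. ennreal (a z) * indicator A (H z) \<partial>lborel)"
        proof (rule nn_integral_cong)
          fix z
          have "a z = (h (H z) * exp (- ((norm (F (H z)) / s) ^ k))) * w (H z)" if "z \<in> G ` B"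
            using that by (simp add: a_def f_def)
          moreover have "a z = 0" if "z \<notin> G ` B" using that by (simp add: a_def f_def)
          ultimately show "?f (H z) * ennreal (w (H z)) * indicator (G ` B) z = ennreal (a z) * indicator A (H z)"
            using w0[of z] by (cases "z \<in> G ` B") (simp_all add: ennreal_mult'' mult_ac)
        qed
        finally show ?thesis .
      qed
      have target: "?hc * (\<integral>\<^sup>+z. ennreal (b z) * indicator A (H (?p z)) \<partial>lborel) = ennreal (s ^ card J) * normal_mass k J *
          (\<integral>\<^sup>+x. ennreal (h x) * indicator A x * (ennreal (1 / jac x) * indicator {x. F x = 0} x) \<partial>hausdorff_measure (card (- J)))"
        if [measurable]: "A \<in> sets borel" for A
      proof -
        let ?m = "\<lambda>y :: real ^ 'd. ennreal (exp (- (norm y ^ k)))"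
        have "(\<integral>\<^sup>+z. ennreal (b z) * indicator A (H (?p z)) \<partial>lborel)
            = (\<integral>\<^sup>+z. (\<lambda>u. ennreal (f u) * indicator A (H u)) (?p z) * ?m (?q z /\<^sub>R s) \<partial>lborel)"
        proof (rule nn_integral_cong)
          fix z :: "real ^ 'd"
          have "norm (?q z /\<^sub>R s) = t z" using s by (simp add: t_def divide_inverse mult.commute)
          then show "ennreal (b z) * indicator A (H (?p z)) = (\<lambda>u. ennreal (f u) * indicator A (H u)) (?p z) * ?m (?q z /\<^sub>R s)"
            by (simp add: b_def ennreal_mult'' mult_ac)
        qed
        also have "\<dots> = (\<integral>\<^sup>+u. ennreal (f u) * indicator A (H u) \<partial>coord_lborel (- J)) * (\<integral>\<^sup>+y. ?m (y /\<^sub>R s) \<partial>coord_lborel J)"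
          by (rule nn_integral_lborel_coord_product) measurable
        also have "(\<integral>\<^sup>+y. ?m (y /\<^sub>R s) \<partial>coord_lborel J) = ennreal (s ^ card J) * normal_mass k J"
          unfolding normal_mass_def by (rule nn_integral_coord_lborel_rescale) (use s in auto)
        finally have 1: "(\<integral>\<^sup>+z. ennreal (b z) * indicator A (H (?p z)) \<partial>lborel)
            = (\<integral>\<^sup>+u. ennreal (f u) * indicator A (H u) \<partial>coord_lborel (- J)) * (ennreal (s ^ card J) * normal_mass k J)" .
        have "(\<integral>\<^sup>+x. ennreal (h x) * indicator A x * (ennreal (1 / jac x) * indicator {x. F x = 0} x) \<partial>hausdorff_measure (card (- J)))
            = ?hc * (\<integral>\<^sup>+u. ennreal (h (H u)) * indicator A (H u) * (ennreal (w (H u)) * indicator (G ` B) u) \<partial>coord_lborel (- J))"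
        proof (rule nn_integral_surface)
          fix x assume "x \<notin> B"
          then have "h x = 0" using hs[of x] r(2) by auto
          then show "ennreal (h x) * indicator A x = 0" by simp
        qed measurable
        also have "(\<integral>\<^sup>+u. ennreal (h (H u)) * indicator A (H u) * (ennreal (w (H u)) * indicator (G ` B) u) \<partial>coord_lborel (- J))
            = (\<integral>\<^sup>+u. ennreal (f u) * indicator A (H u) \<partial>coord_lborel (- J))"
        proof (rule nn_integral_cong)
          fix u
          show "ennreal (h (H u)) * indicator A (H u) * (ennreal (w (H u)) * indicator (G ` B) u) = ennreal (f u) * indicator A (H u)"
            using w0[of u] by (cases "u \<in> G ` B") (simp_all add: f_def ennreal_mult'' mult_ac)
        qed
        finally show ?thesis unfolding 1 by (simp only: mult_ac)
      qed
      have min1: "ennreal (min (a z) (b z)) \<le> ennreal (a z)" "ennreal (min (a z) (b z)) \<le> ennreal (b z)" for z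
        by (auto intro: ennreal_leI)
      have defect: "ennreal (a z) \<le> ennreal (min (a z) (b z)) + ennreal (g z)" "ennreal (b z) \<le> ennreal (min (a z) (b z)) + ennreal (g z)" for z
        using ab[of z] a0[of z] b0[of z] g0[of z] by (auto simp: ennreal_plus[symmetric] min_def simp del: ennreal_plus intro!: ennreal_leI)
      have sum_int: "(\<integral>\<^sup>+z. ennreal (min (a z) (b z)) + ennreal (g z) \<partial>lborel) \<le> emeasure \<kappa> UNIV + ennreal (C * s ^ (card J + 1))"
        using g_int by (subst nn_integral_add) (auto simp: \<kappa>U intro: add_left_mono)
      show "\<exists>\<kappa>. layer_coupling F jac J k h C s \<kappa>"
        unfolding layer_coupling_def
      proof (intro exI[of _ \<kappa>] conjI ballI)
        show "sets \<kappa> = sets (borel \<Otimes>\<^sub>M borel)" by (rule \<kappa>sets)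
        fix A :: "(real ^ 'd) set" assume A: "A \<in> sets borel"
        show "emeasure \<kappa> (fst -` A) \<le> (\<integral>\<^sup>+x. ennreal (h x * exp (- ((norm (F x) / s) ^ k))) * indicator A x \<partial>lborel)"
          unfolding \<kappa>1[OF A] source[OF A] by (intro nn_integral_mono mult_right_mono min1) simp
        show "?hc * emeasure \<kappa> (snd -` A) \<le> ennreal (s ^ card J) * normal_mass k J *
           (\<integral>\<^sup>+x. ennreal (h x) * indicator A x * (ennreal (1 / jac x) * indicator {x. F x = 0} x) \<partial>hausdorff_measure (card (- J)))"
          unfolding \<kappa>2[OF A] target[OF A, symmetric] by (intro mult_left_mono nn_integral_mono mult_right_mono min1) simp_all
      next
        have "(\<integral>\<^sup>+x. ennreal (h x * exp (- ((norm (F x) / s) ^ k))) \<partial>lborel) = (\<integral>\<^sup>+z. ennreal (a z) \<partial>lborel)"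
          using source[of UNIV] by simp
        also have "\<dots> \<le> (\<integral>\<^sup>+z. ennreal (min (a z) (b z)) + ennreal (g z) \<partial>lborel)" by (intro nn_integral_mono defect)
        also note sum_int
        finally show "(\<integral>\<^sup>+x. ennreal (h x * exp (- ((norm (F x) / s) ^ k))) \<partial>lborel) \<le> emeasure \<kappa> UNIV + ennreal (C * s ^ (card J + 1))" .
        have "ennreal (s ^ card J) * normal_mass k J *
           (\<integral>\<^sup>+x. ennreal (h x) * (ennreal (1 / jac x) * indicator {x. F x = 0} x) \<partial>hausdorff_measure (card (- J)))
          = ?hc * (\<integral>\<^sup>+z. ennreal (b z) \<partial>lborel)"
          using target[of UNIV] by simp
        also have "\<dots> \<le> ?hc * (\<integral>\<^sup>+z. ennreal (min (a z) (b z)) + ennreal (g z) \<partial>lborel)"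
          by (intro mult_left_mono nn_integral_mono defect) simp
        also have "\<dots> \<le> ?hc * (emeasure \<kappa> UNIV + ennreal (C * s ^ (card J + 1)))"
          by (intro mult_left_mono sum_int) simp
        finally show "ennreal (s ^ card J) * normal_mass k J *
           (\<integral>\<^sup>+x. ennreal (h x) * (ennreal (1 / jac x) * indicator {x. F x = 0} x) \<partial>hausdorff_measure (card (- J)))
          \<le> ?hc * (emeasure \<kappa> UNIV + ennreal (C * s ^ (card J + 1)))" .
        have "(\<integral>\<^sup>+z. ennreal (dist (fst z) (snd z)) \<partial>\<kappa>) = (\<integral>\<^sup>+z. ennreal (dist (H z) (H (?p z))) \<partial>\<mu>)"
          unfolding \<kappa>_def by (subst nn_integral_distr[OF mm]) auto
        also have "\<dots> = (\<integral>\<^sup>+z. ennreal (min (a z) (b z)) * ennreal (dist (H z) (H (?p z))) \<partial>lborel)"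
          unfolding \<mu>_def by (rule nn_integral_density) measurable
        also have "\<dots> \<le> (\<integral>\<^sup>+z. ennreal (g z) \<partial>lborel)"
          using cost by (intro nn_integral_mono) (simp add: ennreal_mult''[symmetric] ennreal_leI)
        also note g_int
        finally show "(\<integral>\<^sup>+z. ennreal (dist (fst z) (snd z)) \<partial>\<kappa>) \<le> ennreal (C * s ^ (card J + 1))" .
      qed
    qed
  qed
  show thesis by (rule that[OF r(1,2) claim])
qed

end

section \<open>Partial couplings and the Wasserstein distance\<close>

definition add_measure :: "'a measure \<Rightarrow> 'a measure \<Rightarrow> 'a measure" where
  "add_measure M N = measure_of (space M) (sets M) (\<lambda>A. emeasure M A + emeasure N A)"

lemma sets_add_measure [simp, measurable_cong]: "sets (add_measure M N) = sets M"
  and space_add_measure [simp]: "space (add_measure M N) = space M"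
  by (auto simp: add_measure_def)

lemma emeasure_add_measure:
  assumes sets: "sets N = sets M" and A: "A \<in> sets M"
  shows "emeasure (add_measure M N) A = emeasure M A + emeasure N A"
proof (rule emeasure_measure_of[OF add_measure_def])
  show "positive (sets (add_measure M N)) (\<lambda>A. emeasure M A + emeasure N A)" by (simp add: positive_def)
  show "countably_additive (sets (add_measure M N)) (\<lambda>A. emeasure M A + emeasure N A)"
  proof (rule countably_additiveI)
    fix A :: "nat \<Rightarrow> _" assume A: "range A \<subseteq> sets (add_measure M N)" "disjoint_family A"
    have "(\<Sum>i. emeasure M (A i) + emeasure N (A i)) = (\<Sum>i. emeasure M (A i)) + (\<Sum>i. emeasure N (A i))"
      by (intro suminf_add[symmetric] summableI)
    then show "(\<Sum>i. emeasure M (A i) + emeasure N (A i)) = emeasure M (\<Union>i. A i) + emeasure N (\<Union>i. A i)"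
      using A by (simp add: suminf_emeasure sets)
  qed
qed (use A sets.sets_into_space in auto)

lemma nn_integral_add_measure:
  assumes sets: "sets N = sets M" and f: "f \<in> borel_measurable M"
  shows "(\<integral>\<^sup>+x. f x \<partial>add_measure M N) = (\<integral>\<^sup>+x. f x \<partial>M) + (\<integral>\<^sup>+x. f x \<partial>N)"
  using f
proof (induction rule: borel_measurable_induct)
  case (cong f g)
  have "space N = space M" using sets by (rule sets_eq_imp_space_eq)
  then have "(\<integral>\<^sup>+x. f x \<partial>M) = (\<integral>\<^sup>+x. g x \<partial>M)" "(\<integral>\<^sup>+x. f x \<partial>N) = (\<integral>\<^sup>+x. g x \<partial>N)"
    "(\<integral>\<^sup>+x. f x \<partial>add_measure M N) = (\<integral>\<^sup>+x. g x \<partial>add_measure M N)"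
    using cong(3) by (auto intro!: nn_integral_cong)
  then show ?case using cong(4) by simp
next
  case (set A)
  then show ?case by (simp add: emeasure_add_measure sets)
next
  case (mult u c)
  have "u \<in> borel_measurable N" "u \<in> borel_measurable (add_measure M N)"
    using mult(2) by (simp_all add: measurable_cong_sets[OF sets refl] measurable_cong_sets[OF sets_add_measure refl])
  with mult show ?case by (simp add: nn_integral_cmult distrib_left)
next
  case (add u v)
  have "u \<in> borel_measurable N" "u \<in> borel_measurable (add_measure M N)" "v \<in> borel_measurable N" "v \<in> borel_measurable (add_measure M N)"
    using add by (simp_all add: measurable_cong_sets[OF sets refl] measurable_cong_sets[OF sets_add_measure refl])
  with add show ?case by (simp add: nn_integral_add ac_simps)
next
  case (seq U)
  have m: "U i \<in> borel_measurable N" "U i \<in> borel_measurable (add_measure M N)" for i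
    using seq(1) by (simp_all add: measurable_cong_sets[OF sets refl] measurable_cong_sets[OF sets_add_measure refl])
  have inc: "incseq (\<lambda>i. \<integral>\<^sup>+x. U i x \<partial>M)" "incseq (\<lambda>i. \<integral>\<^sup>+x. U i x \<partial>N)"
    using \<open>incseq U\<close> by (auto simp: mono_def le_fun_def intro!: nn_integral_mono)
  have S: "(SUP i. U i) = (\<lambda>x. SUP i. U i x)" by (simp add: fun_eq_iff SUP_apply image_image)
  show ?case
    unfolding S using seq m inc
    by (simp add: nn_integral_monotone_convergence_SUP ennreal_SUP_add)
qed

lemma nn_integral_mono_of_emeasure_mono:
  assumes "sets M = sets N" "\<And>A. A \<in> sets M \<Longrightarrow> emeasure M A \<le> emeasure N A"
  shows "(\<integral>\<^sup>+x. f x \<partial>M) \<le> (\<integral>\<^sup>+x. f x \<partial>N)"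
  using assms by (intro nn_integral_mono_measure) (auto simp: le_measure)

text \<open>Dividing \<open>\<kappa>\<close> by the larger of the two total masses makes it a partial coupling of the normalized measures. The residuals have the
  same mass, and are coupled independently; the cost of this is at most the sum of their first moments. A residual is small in first moment
  because the moment lost by \<open>\<kappa>\<close>, and the change of the normalizing factor, are both of order \<open>\<tau> / \<beta>\<close>.\<close>

lemma wasserstein1_le_of_subcoupling:
  fixes \<mu> \<nu> :: "'a::euclidean_space measure" and \<kappa> :: "('a \<times> 'a) measure"
  assumes sets: "sets \<mu> = sets borel" "sets \<nu> = sets borel" "sets \<kappa> = sets (borel \<Otimes>\<^sub>M borel)"
    and marg: "\<And>A. A \<in> sets borel \<Longrightarrow> emeasure \<kappa> (fst -` A) \<le> emeasure \<mu> A"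
      "\<And>A. A \<in> sets borel \<Longrightarrow> emeasure \<kappa> (snd -` A) \<le> emeasure \<nu> A"
    and mass: "emeasure \<mu> UNIV \<le> emeasure \<kappa> UNIV + ennreal \<tau>" "emeasure \<nu> UNIV \<le> emeasure \<kappa> UNIV + ennreal \<tau>"
    and moment: "(\<integral>\<^sup>+x. ennreal (1 + norm x) \<partial>\<mu>) \<le> (\<integral>\<^sup>+z. ennreal (1 + norm (fst z)) \<partial>\<kappa>) + ennreal \<tau>"
      "(\<integral>\<^sup>+x. ennreal (1 + norm x) \<partial>\<nu>) \<le> (\<integral>\<^sup>+z. ennreal (1 + norm (snd z)) \<partial>\<kappa>) + ennreal \<tau>"
    and cost: "(\<integral>\<^sup>+z. ennreal (dist (fst z) (snd z)) \<partial>\<kappa>) \<le> ennreal \<tau>"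
    and lower: "ennreal \<beta> \<le> emeasure \<mu> UNIV" "ennreal \<beta> \<le> emeasure \<nu> UNIV"
    and upper: "(\<integral>\<^sup>+x. ennreal (1 + norm x) \<partial>\<mu>) \<le> ennreal (K * \<beta>)" "(\<integral>\<^sup>+x. ennreal (1 + norm x) \<partial>\<nu>) \<le> ennreal (K * \<beta>)"
    and pos: "\<beta> > 0" "\<tau> \<ge> 0" "K \<ge> 0"
  shows "wasserstein1 (scale_measure (1 / emeasure \<mu> UNIV) \<mu>) (scale_measure (1 / emeasure \<nu> UNIV) \<nu>)
    \<le> ennreal ((2 * K + 3) * \<tau> / \<beta>)"
proof -
  note [measurable_cong] = sets
  have sp: "space \<mu> = UNIV" "space \<nu> = UNIV" "space \<kappa> = UNIV"
    using sets_eq_imp_space_eq[OF sets(1)] sets_eq_imp_space_eq[OF sets(2)] sets_eq_imp_space_eq[OF sets(3)]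
    by (simp_all add: space_pair_measure)
  have mass_le_moment: "emeasure M UNIV \<le> (\<integral>\<^sup>+x. ennreal (1 + norm x) \<partial>M)" if "sets M = sets borel" for M :: "'a measure"
  proof -
    have "space M = UNIV" using sets_eq_imp_space_eq[OF that] by simp
    then have "emeasure M UNIV = (\<integral>\<^sup>+x. 1 \<partial>M)" by simp
    also have "\<dots> \<le> (\<integral>\<^sup>+x. ennreal (1 + norm x) \<partial>M)" by (intro nn_integral_mono) simp
    finally show ?thesis .
  qed
  have fin: "emeasure \<mu> UNIV < top" "emeasure \<nu> UNIV < top"
    by (rule le_less_trans[OF order_trans[OF mass_le_moment[OF sets(1)] upper(1)] ennreal_less_top],
        rule le_less_trans[OF order_trans[OF mass_le_moment[OF sets(2)] upper(2)] ennreal_less_top])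
  define a where "a = enn2real (emeasure \<mu> UNIV)"
  define b where "b = enn2real (emeasure \<nu> UNIV)"
  have a: "emeasure \<mu> UNIV = ennreal a" and b: "emeasure \<nu> UNIV = ennreal b" using fin by (simp_all add: a_def b_def)
  have ab: "\<beta> \<le> a" "\<beta> \<le> b" using lower pos fin unfolding a b by (auto simp: a_def b_def ennreal_le_iff2 enn2real_nonneg)
  have ab0: "a > 0" "b > 0" using ab pos by auto
  define X where "X = max a b"
  have X: "a \<le> X" "b \<le> X" "\<beta> \<le> X" "X > 0" using ab ab0 by (auto simp: X_def)
  have \<kappa>le: "emeasure \<kappa> UNIV \<le> ennreal a" "emeasure \<kappa> UNIV \<le> ennreal b"
    using marg(1)[of UNIV] marg(2)[of UNIV] a b by simp_all
  have \<kappa>fin: "emeasure \<kappa> UNIV < top" by (rule le_less_trans[OF \<kappa>le(1) ennreal_less_top])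
  define m where "m = enn2real (emeasure \<kappa> UNIV)"
  have m: "emeasure \<kappa> UNIV = ennreal m" "m \<ge> 0" using \<kappa>fin by (simp_all add: m_def)
  have mab: "m \<le> a" "m \<le> b" "a \<le> m + \<tau>" "b \<le> m + \<tau>"
    using \<kappa>le mass ab0 pos m(2) unfolding m(1) a b by (simp_all add: ennreal_plus[symmetric] del: ennreal_plus)
  have Xa: "X - a \<le> \<tau>" "X - b \<le> \<tau>" using mab by (auto simp: X_def)
  define \<kappa>' where "\<kappa>' = scale_measure (ennreal (1 / X)) \<kappa>"
  have \<kappa>'[measurable_cong]: "sets \<kappa>' = sets (borel \<Otimes>\<^sub>M borel)" by (simp add: \<kappa>'_def sets)
  have sp\<kappa>': "space \<kappa>' = UNIV" by (simp add: \<kappa>'_def space_scale_measure sp)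
  have t0: "m / X \<le> 1" using mab X by (simp add: field_simps)
  define t where "t = 1 - m / X"
  have t: "t \<ge> 0" using t0 by (simp add: t_def)
  (* The residual of one marginal, treated for both coordinates at once. *)
  have half: "\<exists>\<rho>. sets \<rho> = sets borel \<and> emeasure \<rho> UNIV = ennreal t \<and>
      (\<forall>A\<in>sets borel. emeasure \<kappa>' (\<pi> -` A) + emeasure \<rho> A = emeasure (scale_measure (1 / ennreal c) M) A) \<and>
      (\<integral>\<^sup>+x. ennreal (norm x) \<partial>\<rho>) \<le> ennreal ((K + 1) * \<tau> / \<beta>)"
    if \<pi>m: "\<pi> \<in> borel \<Otimes>\<^sub>M borel \<rightarrow>\<^sub>M borel" and M: "sets M = sets borel" "emeasure M UNIV = ennreal c"
      and c: "\<beta> \<le> c" "c \<le> X" "X - c \<le> \<tau>"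
      and mg: "\<And>A. A \<in> sets borel \<Longrightarrow> emeasure \<kappa> (\<pi> -` A) \<le> emeasure M A"
      and mo: "(\<integral>\<^sup>+x. ennreal (1 + norm x) \<partial>M) \<le> (\<integral>\<^sup>+z. ennreal (1 + norm (\<pi> z)) \<partial>\<kappa>) + ennreal \<tau>"
      and up: "(\<integral>\<^sup>+x. ennreal (1 + norm x) \<partial>M) \<le> ennreal (K * \<beta>)"
    for \<pi> :: "'a \<times> 'a \<Rightarrow> 'a" and M :: "'a measure" and c :: real
  proof -
    note [measurable] = \<pi>m
    have c0: "c > 0" using c pos by simp
    have spM: "space M = UNIV" using sets_eq_imp_space_eq[OF M(1)] by simp
    have pim: "\<pi> -` A \<in> sets (borel \<Otimes>\<^sub>M borel)" if "A \<in> sets borel" for A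
      using measurable_sets[OF \<pi>m that] by (simp add: space_pair_measure)
    define M' where "M' = scale_measure (1 / ennreal c) M"
    have sM': "sets M' = sets borel" by (simp add: M'_def M)
    have inv_c: "1 / ennreal c = ennreal (1 / c)" using c0 by (simp add: divide_ennreal[symmetric])
    define N where "N = distr \<kappa>' borel \<pi>"
    have sN: "sets N = sets borel" by (simp add: N_def)
    have N: "emeasure N A = emeasure \<kappa>' (\<pi> -` A)" if "A \<in> sets borel" for A
      unfolding N_def using that by (subst emeasure_distr) (simp_all add: sp\<kappa>')
    have N_le: "emeasure N A \<le> emeasure M' A" if A: "A \<in> sets borel" for A
    proof -
      have "emeasure N A = ennreal (1 / X) * emeasure \<kappa> (\<pi> -` A)" by (simp add: N[OF A] \<kappa>'_def)
      also have "\<dots> \<le> ennreal (1 / c) * emeasure M A"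
        using mg[OF A] c c0 by (intro mult_mono ennreal_leI) (simp_all add: frac_le)
      finally show ?thesis by (simp add: M'_def inv_c)
    qed
    have M'U: "emeasure M' UNIV = 1" using c0 by (simp add: M'_def inv_c M ennreal_mult'[symmetric])
    have NU: "emeasure N UNIV = ennreal (m / X)"
      using X m(2) by (simp add: N \<kappa>'_def m(1) ennreal_mult'[symmetric])
    have spMN: "space M' = UNIV" "space N = UNIV" by (simp_all add: M'_def N_def space_scale_measure spM)
    have fM: "finite_measure M'" by (rule finite_measureI) (simp add: spMN M'U)
    have fN: "finite_measure N" by (rule finite_measureI) (simp add: spMN NU)
    define \<rho> where "\<rho> = diff_measure M' N"
    have s\<rho>: "sets \<rho> = sets borel" by (simp add: \<rho>_def sM')
    have \<rho>: "emeasure \<rho> A = emeasure M' A - emeasure N A" if "A \<in> sets borel" for A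
      unfolding \<rho>_def using that N_le by (intro emeasure_diff_measure fM fN) (auto simp: sM' sN)
    have add: "emeasure N A + emeasure \<rho> A = emeasure M' A" if A: "A \<in> sets borel" for A
    proof -
      have "emeasure N A < top" using finite_measure.emeasure_finite[OF fN, of A] by (simp add: less_top)
      then show ?thesis unfolding \<rho>[OF A] using N_le[OF A] by (simp add: add_diff_inverse_ennreal)
    qed
    have "emeasure \<rho> UNIV = ennreal 1 - ennreal (m / X)" using \<rho>[of UNIV] M'U NU by simp
    also have "\<dots> = ennreal t" using X m(2) by (subst ennreal_minus) (auto simp: t_def)
    finally have \<rho>U: "emeasure \<rho> UNIV = ennreal t" .
    let ?W = "\<lambda>x :: 'a. ennreal (1 + norm x)"
    have Wm [measurable]: "?W \<in> borel_measurable borel" by measurable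
    have "add_measure N \<rho> = M'"
      by (rule measure_eqI) (auto simp: sN sM' s\<rho> emeasure_add_measure add)
    then have int_add: "(\<integral>\<^sup>+x. ?W x \<partial>N) + (\<integral>\<^sup>+x. ?W x \<partial>\<rho>) = (\<integral>\<^sup>+x. ?W x \<partial>M')"
      using nn_integral_add_measure[of \<rho> N ?W] by (simp add: s\<rho> sN measurable_cong_sets[OF sN refl])
    define w where "w = enn2real (\<integral>\<^sup>+x. ?W x \<partial>M)"
    have w: "(\<integral>\<^sup>+x. ?W x \<partial>M) = ennreal w" "w \<ge> 0" using le_less_trans[OF up ennreal_less_top] by (simp_all add: w_def)
    have wK: "w \<le> K * \<beta>" using up pos w by simp
    have "(\<integral>\<^sup>+z. ?W (\<pi> z) \<partial>\<kappa>) \<le> (\<integral>\<^sup>+x. ?W x \<partial>M)"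
    proof -
      have "(\<integral>\<^sup>+z. ?W (\<pi> z) \<partial>\<kappa>) = (\<integral>\<^sup>+x. ?W x \<partial>distr \<kappa> borel \<pi>)"
        by (subst nn_integral_distr) auto
      also have "\<dots> \<le> (\<integral>\<^sup>+x. ?W x \<partial>M)"
        using mg by (intro nn_integral_mono_of_emeasure_mono) (auto simp: M emeasure_distr sp)
      finally show ?thesis .
    qed
    define v where "v = enn2real (\<integral>\<^sup>+z. ?W (\<pi> z) \<partial>\<kappa>)"
    have v: "(\<integral>\<^sup>+z. ?W (\<pi> z) \<partial>\<kappa>) = ennreal v" "v \<ge> 0"
      using le_less_trans[OF \<open>(\<integral>\<^sup>+z. ?W (\<pi> z) \<partial>\<kappa>) \<le> (\<integral>\<^sup>+x. ?W x \<partial>M)\<close>[unfolded w(1)] ennreal_less_top]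
      by (simp_all add: v_def)
    have vw: "w \<le> v + \<tau>" using mo pos v(2) unfolding w(1) v(1) by (simp add: ennreal_plus[symmetric] del: ennreal_plus)
    have NW: "(\<integral>\<^sup>+x. ?W x \<partial>N) = ennreal (v / X)"
    proof -
      have "(\<integral>\<^sup>+x. ?W x \<partial>N) = (\<integral>\<^sup>+z. ?W (\<pi> z) \<partial>\<kappa>')" unfolding N_def by (subst nn_integral_distr) auto
      also have "\<dots> = ennreal (1 / X) * ennreal v"
        unfolding \<kappa>'_def v(1)[symmetric] by (rule nn_integral_scale_measure) measurable
      finally show ?thesis using X v(2) by (simp add: ennreal_mult'[symmetric])
    qed
    have MW: "(\<integral>\<^sup>+x. ?W x \<partial>M') = ennreal (w / c)"
    proof -
      have "(\<integral>\<^sup>+x. ?W x \<partial>M') = ennreal (1 / c) * ennreal w"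
        unfolding M'_def inv_c w(1)[symmetric]
        by (rule nn_integral_scale_measure) (simp only: measurable_cong_sets[OF M(1) refl] Wm)
      then show ?thesis using c0 w(2) by (simp add: ennreal_mult'[symmetric])
    qed
    have \<rho>W: "(\<integral>\<^sup>+x. ?W x \<partial>\<rho>) = ennreal (w / c) - ennreal (v / X)"
      using int_add unfolding NW MW by (metis ennreal_add_diff_cancel_left ennreal_neq_top)
    also have "\<dots> = ennreal (w / c - v / X)" using X v(2) by (subst ennreal_minus) auto
    also have "\<dots> \<le> ennreal ((K + 1) * \<tau> / \<beta>)"
    proof (rule ennreal_leI)
      have "w / c - v / X \<le> w / c - (w - \<tau>) / X" using vw X by (simp add: divide_right_mono)
      also have "\<dots> = w * (X - c) / (c * X) + \<tau> / X" using X c0 by (simp add: field_simps)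
      also have "\<dots> \<le> (K * \<beta>) * \<tau> / (\<beta> * \<beta>) + \<tau> / \<beta>"
        using w wK c X pos by (intro add_mono frac_le mult_mono) auto
      also have "\<dots> = (K + 1) * \<tau> / \<beta>" using pos by (simp add: field_simps)
      finally show "w / c - v / X \<le> (K + 1) * \<tau> / \<beta>" .
    qed
    finally have "(\<integral>\<^sup>+x. ?W x \<partial>\<rho>) \<le> ennreal ((K + 1) * \<tau> / \<beta>)" .
    moreover have "(\<integral>\<^sup>+x. ennreal (norm x) \<partial>\<rho>) \<le> (\<integral>\<^sup>+x. ?W x \<partial>\<rho>)" by (intro nn_integral_mono ennreal_leI) simp
    ultimately have "(\<integral>\<^sup>+x. ennreal (norm x) \<partial>\<rho>) \<le> ennreal ((K + 1) * \<tau> / \<beta>)" by (rule order_trans[rotated])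
    then show ?thesis using s\<rho> \<rho>U add N unfolding M'_def by (intro exI[of _ \<rho>]) simp
  qed
  obtain \<rho>1 where \<rho>1: "sets \<rho>1 = sets borel" "emeasure \<rho>1 UNIV = ennreal t"
      "\<And>A. A \<in> sets borel \<Longrightarrow> emeasure \<kappa>' (fst -` A) + emeasure \<rho>1 A = emeasure (scale_measure (1 / ennreal a) \<mu>) A"
      "(\<integral>\<^sup>+x. ennreal (norm x) \<partial>\<rho>1) \<le> ennreal ((K + 1) * \<tau> / \<beta>)"
    using half[OF measurable_fst sets(1) a ab(1) X(1) Xa(1) marg(1) moment(1) upper(1)] by blast
  obtain \<rho>2 where \<rho>2: "sets \<rho>2 = sets borel" "emeasure \<rho>2 UNIV = ennreal t"
      "\<And>A. A \<in> sets borel \<Longrightarrow> emeasure \<kappa>' (snd -` A) + emeasure \<rho>2 A = emeasure (scale_measure (1 / ennreal b) \<nu>) A"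
      "(\<integral>\<^sup>+x. ennreal (norm x) \<partial>\<rho>2) \<le> ennreal ((K + 1) * \<tau> / \<beta>)"
    using half[OF measurable_snd sets(2) b ab(2) X(2) Xa(2) marg(2) moment(2) upper(2)] by blast
  note [measurable_cong] = \<rho>1(1) \<rho>2(1)
  have sp\<rho>: "space \<rho>1 = UNIV" "space \<rho>2 = UNIV"
    using sets_eq_imp_space_eq[OF \<rho>1(1)] sets_eq_imp_space_eq[OF \<rho>2(1)] by simp_all
  interpret \<rho>1: finite_measure \<rho>1 by (rule finite_measureI) (simp add: sp\<rho> \<rho>1)
  interpret \<rho>2: finite_measure \<rho>2 by (rule finite_measureI) (simp add: sp\<rho> \<rho>2)
  interpret P: pair_sigma_finite \<rho>1 \<rho>2 by unfold_locales
  have sP: "sets (\<rho>1 \<Otimes>\<^sub>M \<rho>2) = sets (borel \<Otimes>\<^sub>M borel)" by (rule sets_pair_measure_cong[OF \<rho>1(1) \<rho>2(1)])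
  define \<gamma> where "\<gamma> = add_measure \<kappa>' (scale_measure (1 / ennreal t) (\<rho>1 \<Otimes>\<^sub>M \<rho>2))"
  have s\<gamma>: "sets \<gamma> = sets (borel \<Otimes>\<^sub>M borel)" by (simp add: \<gamma>_def \<kappa>')
  have sp\<gamma>: "space \<gamma> = UNIV" by (simp add: \<gamma>_def sp\<kappa>')
  have em\<gamma>: "emeasure \<gamma> S = emeasure \<kappa>' S + 1 / ennreal t * emeasure (\<rho>1 \<Otimes>\<^sub>M \<rho>2) S" if "S \<in> sets (borel \<Otimes>\<^sub>M borel)" for S
    unfolding \<gamma>_def using that by (subst emeasure_add_measure) (simp_all add: \<kappa>' sP)
  have cancel: "1 / ennreal t * (y * ennreal t) = y" if "y \<le> ennreal t" for y
  proof (cases "t = 0")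
    case True then show ?thesis using that by simp
  next
    case False
    then have "1 / ennreal t = ennreal (1 / t)" using t by (simp add: divide_ennreal[symmetric])
    then show ?thesis using False t by (simp add: mult.left_commute[of _ y] ennreal_mult'[symmetric])
  qed
  have \<rho>1_le: "emeasure \<rho>1 A \<le> ennreal t" for A using emeasure_mono[of A UNIV \<rho>1] \<rho>1 by simp
  have \<rho>2_le: "emeasure \<rho>2 A \<le> ennreal t" for A using emeasure_mono[of A UNIV \<rho>2] \<rho>2 by simp
  have fst\<gamma>: "emeasure \<gamma> (fst -` A) = emeasure (scale_measure (1 / ennreal a) \<mu>) A" if A: "A \<in> sets borel" for A
  proof -
    have "fst -` A = A \<times> (UNIV :: 'a set)" by auto
    then have "emeasure (\<rho>1 \<Otimes>\<^sub>M \<rho>2) (fst -` A) = emeasure \<rho>1 A * ennreal t"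
      using A by (simp add: \<rho>2.emeasure_pair_measure_Times \<rho>1(1) \<rho>2(1,2))
    then show ?thesis
      using em\<gamma>[OF sets_vimage_fst_snd(1)[OF A]] cancel[OF \<rho>1_le] \<rho>1(3)[OF A] by simp
  qed
  have snd\<gamma>: "emeasure \<gamma> (snd -` A) = emeasure (scale_measure (1 / ennreal b) \<nu>) A" if A: "A \<in> sets borel" for A
  proof -
    have "snd -` A = (UNIV :: 'a set) \<times> A" by auto
    then have "emeasure (\<rho>1 \<Otimes>\<^sub>M \<rho>2) (snd -` A) = emeasure \<rho>2 A * ennreal t"
      using A by (simp add: \<rho>2.emeasure_pair_measure_Times \<rho>1(1,2) \<rho>2(1) mult.commute)
    then show ?thesis
      using em\<gamma>[OF sets_vimage_fst_snd(2)[OF A]] cancel[OF \<rho>2_le] \<rho>2(3)[OF A] by simp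
  qed
  have "\<gamma> \<in> couplings (scale_measure (1 / ennreal a) \<mu>) (scale_measure (1 / ennreal b) \<nu>)"
    unfolding couplings_def mem_Collect_eq
  proof (intro conjI)
    have "emeasure \<gamma> UNIV = emeasure (scale_measure (1 / ennreal a) \<mu>) UNIV" using fst\<gamma>[of UNIV] by simp
    also have "\<dots> = 1 / ennreal a * ennreal a" by (simp add: a)
    also have "1 / ennreal a = ennreal (1 / a)" using ab0 by (simp add: divide_ennreal[symmetric])
    also have "ennreal (1 / a) * ennreal a = 1" using ab0 by (simp add: ennreal_mult'[symmetric])
    finally show "prob_space \<gamma>" by (intro prob_spaceI) (simp add: sp\<gamma>)
    show "sets \<gamma> = sets (scale_measure (1 / ennreal a) \<mu> \<Otimes>\<^sub>M scale_measure (1 / ennreal b) \<nu>)"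
      unfolding s\<gamma> by (intro sets_pair_measure_cong[symmetric]) (simp_all add: sets)
    show "distr \<gamma> (scale_measure (1 / ennreal a) \<mu>) fst = scale_measure (1 / ennreal a) \<mu>"
    proof (rule measure_eqI)
      fix A assume "A \<in> sets (distr \<gamma> (scale_measure (1 / ennreal a) \<mu>) fst)"
      then have A: "A \<in> sets borel" by (simp add: sets)
      have "fst \<in> \<gamma> \<rightarrow>\<^sub>M scale_measure (1 / ennreal a) \<mu>"
        using measurable_fst by (simp add: measurable_cong_sets[OF s\<gamma>] sets cong: measurable_cong_sets)
      then show "emeasure (distr \<gamma> (scale_measure (1 / ennreal a) \<mu>) fst) A = emeasure (scale_measure (1 / ennreal a) \<mu>) A"
        using A fst\<gamma>[OF A] by (subst emeasure_distr) (simp_all add: sets sp\<gamma>)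
    qed simp
    show "distr \<gamma> (scale_measure (1 / ennreal b) \<nu>) snd = scale_measure (1 / ennreal b) \<nu>"
    proof (rule measure_eqI)
      fix A assume "A \<in> sets (distr \<gamma> (scale_measure (1 / ennreal b) \<nu>) snd)"
      then have A: "A \<in> sets borel" by (simp add: sets)
      have "snd \<in> \<gamma> \<rightarrow>\<^sub>M scale_measure (1 / ennreal b) \<nu>"
        using measurable_snd by (simp add: measurable_cong_sets[OF s\<gamma>] sets cong: measurable_cong_sets)
      then show "emeasure (distr \<gamma> (scale_measure (1 / ennreal b) \<nu>) snd) A = emeasure (scale_measure (1 / ennreal b) \<nu>) A"
        using A snd\<gamma>[OF A] by (subst emeasure_distr) (simp_all add: sets sp\<gamma>)
    qed simp
  qed
  then have "wasserstein1 (scale_measure (1 / ennreal a) \<mu>) (scale_measure (1 / ennreal b) \<nu>)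
      \<le> (\<integral>\<^sup>+z. ennreal (dist (fst z) (snd z)) \<partial>\<gamma>)"
    unfolding wasserstein1_def by (rule INF_lower)
  also have "\<dots> = (\<integral>\<^sup>+z. ennreal (dist (fst z) (snd z)) \<partial>\<kappa>')
      + 1 / ennreal t * (\<integral>\<^sup>+z. ennreal (dist (fst z) (snd z)) \<partial>(\<rho>1 \<Otimes>\<^sub>M \<rho>2))"
    unfolding \<gamma>_def
    by (subst nn_integral_add_measure) (simp_all add: \<kappa>' sP nn_integral_scale_measure)
  also have "\<dots> \<le> ennreal (\<tau> / \<beta>) + (ennreal ((K + 1) * \<tau> / \<beta>) + ennreal ((K + 1) * \<tau> / \<beta>))"
  proof (rule add_mono)
    have "(\<integral>\<^sup>+z. ennreal (dist (fst z) (snd z)) \<partial>\<kappa>') = ennreal (1 / X) * (\<integral>\<^sup>+z. ennreal (dist (fst z) (snd z)) \<partial>\<kappa>)"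
      unfolding \<kappa>'_def by (rule nn_integral_scale_measure) measurable
    also have "\<dots> \<le> ennreal (1 / \<beta>) * ennreal \<tau>"
      using X pos by (intro mult_mono ennreal_leI cost) (simp_all add: frac_le)
    finally show "(\<integral>\<^sup>+z. ennreal (dist (fst z) (snd z)) \<partial>\<kappa>') \<le> ennreal (\<tau> / \<beta>)"
      using pos by (simp add: ennreal_mult'[symmetric])
    let ?n1 = "\<integral>\<^sup>+x. ennreal (norm x) \<partial>\<rho>1" and ?n2 = "\<integral>\<^sup>+x. ennreal (norm x) \<partial>\<rho>2"
    have "(\<integral>\<^sup>+z. ennreal (dist (fst z) (snd z)) \<partial>(\<rho>1 \<Otimes>\<^sub>M \<rho>2))
        \<le> (\<integral>\<^sup>+z. ennreal (norm (fst z)) + ennreal (norm (snd z)) \<partial>(\<rho>1 \<Otimes>\<^sub>M \<rho>2))"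
      by (intro nn_integral_mono) (simp add: ennreal_plus[symmetric] dist_norm norm_triangle_ineq4 del: ennreal_plus)
    also have "\<dots> = (\<integral>\<^sup>+z. ennreal (norm (fst z)) \<partial>(\<rho>1 \<Otimes>\<^sub>M \<rho>2)) + (\<integral>\<^sup>+z. ennreal (norm (snd z)) \<partial>(\<rho>1 \<Otimes>\<^sub>M \<rho>2))"
      by (rule nn_integral_add) measurable
    also have "(\<integral>\<^sup>+z. ennreal (norm (fst z)) \<partial>(\<rho>1 \<Otimes>\<^sub>M \<rho>2)) = (\<integral>\<^sup>+x. \<integral>\<^sup>+y. ennreal (norm x) \<partial>\<rho>2 \<partial>\<rho>1)"
      by (subst \<rho>2.nn_integral_fst[symmetric]) auto
    also have "\<dots> = ?n1 * ennreal t"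
      by (simp add: sp\<rho> \<rho>2(2) nn_integral_multc)
    also have "(\<integral>\<^sup>+z. ennreal (norm (snd z)) \<partial>(\<rho>1 \<Otimes>\<^sub>M \<rho>2)) = (\<integral>\<^sup>+x. \<integral>\<^sup>+y. ennreal (norm y) \<partial>\<rho>2 \<partial>\<rho>1)"
      by (subst \<rho>2.nn_integral_fst[symmetric]) auto
    also have "\<dots> = ?n2 * ennreal t" by (simp add: sp\<rho> \<rho>1(2))
    finally have "1 / ennreal t * (\<integral>\<^sup>+z. ennreal (dist (fst z) (snd z)) \<partial>(\<rho>1 \<Otimes>\<^sub>M \<rho>2))
        \<le> 1 / ennreal t * ((?n1 + ?n2) * ennreal t)"
      by (intro mult_left_mono) (simp_all add: distrib_right)
    also have "\<dots> \<le> ?n1 + ?n2"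
    proof (cases "t = 0")
      case False
      then have "1 / ennreal t = ennreal (1 / t)" using t by (simp add: divide_ennreal[symmetric])
      then show ?thesis using False t by (simp add: mult.left_commute[of _ "?n1 + ?n2"] ennreal_mult'[symmetric])
    qed simp
    also have "\<dots> \<le> ennreal ((K + 1) * \<tau> / \<beta>) + ennreal ((K + 1) * \<tau> / \<beta>)"
      by (intro add_mono \<rho>1 \<rho>2)
    finally show "1 / ennreal t * (\<integral>\<^sup>+z. ennreal (dist (fst z) (snd z)) \<partial>(\<rho>1 \<Otimes>\<^sub>M \<rho>2))
        \<le> ennreal ((K + 1) * \<tau> / \<beta>) + ennreal ((K + 1) * \<tau> / \<beta>)" .
  qed
  also have "\<dots> = ennreal ((2 * K + 3) * \<tau> / \<beta>)"
    using pos by (simp add: ennreal_plus[symmetric] add_divide_distrib[symmetric] algebra_simps del: ennreal_plus)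
  finally show ?thesis unfolding a b .
qed

section \<open>Globalization along a compact level set\<close>

text \<open>Sums of partial couplings couple sums of densities, so that densities may be cut into pieces.\<close>

lemma layer_coupling_add:
  fixes F :: "real ^ 'd \<Rightarrow> real ^ 'p"
  assumes c1: "layer_coupling F jac J k h1 C1 s \<kappa>1" and c2: "layer_coupling F jac J k h2 C2 s \<kappa>2"
    and nonneg: "\<And>x. 0 \<le> h1 x" "\<And>x. 0 \<le> h2 x" "C1 \<ge> 0" "C2 \<ge> 0" "s > 0"
    and [measurable]: "h1 \<in> borel_measurable borel" "h2 \<in> borel_measurable borel" "F \<in> borel_measurable borel" "jac \<in> borel_measurable borel"
  shows "layer_coupling F jac J k (\<lambda>x. h1 x + h2 x) (C1 + C2) s (add_measure \<kappa>1 \<kappa>2)"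
proof -
  let ?e = "\<lambda>x. exp (- ((norm (F x) / s) ^ k))" and ?r = "card (- J)" and ?Z = "{x. F x = 0}"
  let ?S = "\<lambda>h A. \<integral>\<^sup>+x. ennreal (h x) * indicator A x * (ennreal (1 / jac x) * indicator ?Z x) \<partial>hausdorff_measure ?r"
  let ?V = "\<lambda>h A. \<integral>\<^sup>+x. ennreal (h x * ?e x) * indicator A x \<partial>lborel"
  let ?hc = "hausdorff_plane_const (- J)" and ?n = "ennreal (s ^ card J) * normal_mass k J"
  let ?h = "\<lambda>x. h1 x + h2 x" and ?E = "\<lambda>C. ennreal (C * s ^ (card J + 1))"
  have s1: "sets \<kappa>1 = sets (borel \<Otimes>\<^sub>M borel)" and s2: "sets \<kappa>2 = sets (borel \<Otimes>\<^sub>M borel)"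
    using c1 c2 by (simp_all add: layer_coupling_def)
  have s12: "sets \<kappa>2 = sets \<kappa>1" by (simp add: s1 s2)
  have em: "emeasure (add_measure \<kappa>1 \<kappa>2) A = emeasure \<kappa>1 A + emeasure \<kappa>2 A" if "A \<in> sets (borel \<Otimes>\<^sub>M borel)" for A
    using that by (intro emeasure_add_measure s12) (simp add: s1)
  have U: "UNIV \<in> sets (borel \<Otimes>\<^sub>M (borel :: (real ^ 'd) measure))"
    using sets.top[of "borel \<Otimes>\<^sub>M (borel :: (real ^ 'd) measure)"] by (simp add: space_pair_measure)
  have V: "?V ?h A = ?V h1 A + ?V h2 A" if [measurable]: "A \<in> sets borel" for A
  proof -
    have "?V ?h A = (\<integral>\<^sup>+x. ennreal (h1 x * ?e x) * indicator A x + ennreal (h2 x * ?e x) * indicator A x \<partial>lborel)"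
      using nonneg by (intro nn_integral_cong) (simp add: distrib_right)
    also have "\<dots> = ?V h1 A + ?V h2 A" by (rule nn_integral_add) measurable
    finally show ?thesis .
  qed
  have Zm [measurable]: "?Z \<in> sets borel" by measurable
  have S: "?S ?h A = ?S h1 A + ?S h2 A" if [measurable]: "A \<in> sets borel" for A
  proof -
    have "?S ?h A = (\<integral>\<^sup>+x. ennreal (h1 x) * indicator A x * (ennreal (1 / jac x) * indicator ?Z x)
        + ennreal (h2 x) * indicator A x * (ennreal (1 / jac x) * indicator ?Z x) \<partial>hausdorff_measure ?r)"
      using nonneg by (intro nn_integral_cong) (simp add: distrib_right)
    also have "\<dots> = ?S h1 A + ?S h2 A" by (rule nn_integral_add) measurable
    finally show ?thesis .
  qed
  have E: "?E (C1 + C2) = ?E C1 + ?E C2" using nonneg by (simp add: distrib_right ennreal_plus)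
  show ?thesis
    unfolding layer_coupling_def
  proof (intro conjI ballI)
    show "sets (add_measure \<kappa>1 \<kappa>2) = sets (borel \<Otimes>\<^sub>M borel)" by (simp add: s1)
    fix A :: "(real ^ 'd) set" assume A: "A \<in> sets borel"
    show "emeasure (add_measure \<kappa>1 \<kappa>2) (fst -` A) \<le> ?V ?h A"
      using c1 c2 A unfolding V[OF A] em[OF sets_vimage_fst_snd(1)[OF A]] layer_coupling_def by (intro add_mono) auto
    show "?hc * emeasure (add_measure \<kappa>1 \<kappa>2) (snd -` A) \<le> ?n * ?S ?h A"
      using c1 c2 A unfolding S[OF A] em[OF sets_vimage_fst_snd(2)[OF A]] layer_coupling_def distrib_left
      by (intro add_mono) auto
  next
    have "?V ?h UNIV \<le> (emeasure \<kappa>1 UNIV + ?E C1) + (emeasure \<kappa>2 UNIV + ?E C2)"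
      using c1 c2 unfolding V[OF sets.top[of borel, unfolded space_borel]] layer_coupling_def by (intro add_mono) simp_all
    then show "(\<integral>\<^sup>+x. ennreal (?h x * ?e x) \<partial>lborel) \<le> emeasure (add_measure \<kappa>1 \<kappa>2) UNIV + ?E (C1 + C2)"
      unfolding em[OF U] E by (simp add: ac_simps)
    have "?n * ?S ?h UNIV \<le> ?hc * (emeasure \<kappa>1 UNIV + ?E C1) + ?hc * (emeasure \<kappa>2 UNIV + ?E C2)"
      using c1 c2 unfolding S[OF sets.top[of borel, unfolded space_borel]] layer_coupling_def distrib_left[of ?n]
      by (intro add_mono) simp_all
    also have "\<dots> = ?hc * (emeasure (add_measure \<kappa>1 \<kappa>2) UNIV + ?E (C1 + C2))"
      unfolding em[OF U] E by (simp only: distrib_left[symmetric] add_ac)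
    finally show "?n * (\<integral>\<^sup>+x. ennreal (?h x) * (ennreal (1 / jac x) * indicator ?Z x) \<partial>hausdorff_measure ?r)
        \<le> ?hc * (emeasure (add_measure \<kappa>1 \<kappa>2) UNIV + ?E (C1 + C2))" by simp
    have dm: "(\<lambda>z. ennreal (dist (fst z) (snd z))) \<in> borel_measurable (borel \<Otimes>\<^sub>M (borel :: (real ^ 'd) measure))"
      by measurable
    have "(\<integral>\<^sup>+z. ennreal (dist (fst z) (snd z)) \<partial>add_measure \<kappa>1 \<kappa>2)
        = (\<integral>\<^sup>+z. ennreal (dist (fst z) (snd z)) \<partial>\<kappa>1) + (\<integral>\<^sup>+z. ennreal (dist (fst z) (snd z)) \<partial>\<kappa>2)"
      using dm by (intro nn_integral_add_measure s12) (simp add: measurable_cong_sets[OF s1 refl])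
    also have "\<dots> \<le> ?E C1 + ?E C2" using c1 c2 unfolding layer_coupling_def by (intro add_mono) auto
    finally show "(\<integral>\<^sup>+z. ennreal (dist (fst z) (snd z)) \<partial>add_measure \<kappa>1 \<kappa>2) \<le> ?E (C1 + C2)" unfolding E .
  qed
qed

definition locally_lipschitz :: "('a::metric_space \<Rightarrow> real) \<Rightarrow> bool" where
  "locally_lipschitz f \<longleftrightarrow> (\<forall>a R. bounded_lipschitz (ball a R) f)"

lemma locally_lipschitz_continuous:
  assumes "locally_lipschitz f" shows "continuous_on UNIV f"
proof -
  have "isCont f x" for x
  proof -
    have "continuous_on (ball x 1) f"
      using assms by (intro bounded_lipschitz_continuous_on) (simp add: locally_lipschitz_def)
    then have "\<forall>y\<in>ball x 1. isCont f y" by (simp only: continuous_on_eq_continuous_at[OF open_ball])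
    then show ?thesis by simp
  qed
  then show ?thesis by (simp add: continuous_at_imp_continuous_on)
qed

lemma locally_lipschitz_borel: "locally_lipschitz f \<Longrightarrow> f \<in> borel_measurable borel"
  using borel_measurable_continuous_onI locally_lipschitz_continuous by blast

lemma locally_lipschitz_add: "locally_lipschitz f \<Longrightarrow> locally_lipschitz g \<Longrightarrow> locally_lipschitz (\<lambda>x. f x + g x)"
  by (simp add: locally_lipschitz_def bounded_lipschitz_add)

lemma locally_lipschitz_mult: "locally_lipschitz f \<Longrightarrow> locally_lipschitz g \<Longrightarrow> locally_lipschitz (\<lambda>x. f x * g x)"
  by (simp add: locally_lipschitz_def bounded_lipschitz_mult)

lemma locally_lipschitz_const: "locally_lipschitz (\<lambda>_. c)" by (simp add: locally_lipschitz_def)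

lemma lipschitz_imp_locally_lipschitz:
  fixes f :: "'a::metric_space \<Rightarrow> real"
  assumes "L-lipschitz_on UNIV f" shows "locally_lipschitz f"
  unfolding locally_lipschitz_def
proof (intro allI)
  fix a :: 'a and R :: real
  have L: "L \<ge> 0" "\<bar>f x - f y\<bar> \<le> L * dist x y" for x y
    using lipschitz_onD[OF assms] lipschitz_on_nonneg[OF assms] by (auto simp: dist_real_def)
  show "bounded_lipschitz (ball a R) f"
  proof (rule bounded_lipschitzI[where C="\<bar>f a\<bar> + L * R" and D=L])
    fix x assume "x \<in> ball a R"
    then have "L * dist x a \<le> L * R" using L(1) by (intro mult_left_mono) (auto simp: dist_commute)
    then show "\<bar>f x\<bar> \<le> \<bar>f a\<bar> + L * R" using L(2)[of x a] by linarith
  qed (rule L)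
qed

text \<open>A Lipschitz cutoff, equal to \<open>1\<close> on the ball of half the radius.\<close>

definition bump :: "'a::metric_space \<Rightarrow> real \<Rightarrow> 'a \<Rightarrow> real" where
  "bump a r x = max 0 (min 1 (2 - 2 * dist a x / r))"

lemma bump_bounds: "0 \<le> bump a r x" "bump a r x \<le> 1" by (auto simp: bump_def)

lemma bump_eq_1: "r > 0 \<Longrightarrow> x \<in> ball a (r / 2) \<Longrightarrow> bump a r x = 1" by (auto simp: bump_def field_simps)

lemma bump_eq_0: "r > 0 \<Longrightarrow> x \<notin> ball a r \<Longrightarrow> bump a r x = 0" by (auto simp: bump_def field_simps)

lemma bump_locally_lipschitz:
  assumes "r > 0" shows "locally_lipschitz (bump a r)"
proof (rule lipschitz_imp_locally_lipschitz[where L="2 / r"], rule lipschitz_onI)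
  fix x y
  have clamp: "\<bar>max 0 (min 1 (2 - p)) - max 0 (min 1 (2 - q))\<bar> \<le> \<bar>p - q\<bar>" for p q :: real
    by linarith
  have "\<bar>bump a r x - bump a r y\<bar> \<le> \<bar>2 * dist a x / r - 2 * dist a y / r\<bar>"
    unfolding bump_def by (rule clamp)
  also have "2 * dist a x / r - 2 * dist a y / r = 2 / r * (dist a x - dist a y)"
    unfolding right_diff_distrib by simp
  also have "\<bar>2 / r * (dist a x - dist a y)\<bar> = 2 / r * \<bar>dist a x - dist a y\<bar>"
    unfolding abs_mult using assms by simp
  also have "\<dots> \<le> 2 / r * dist x y"
    using assms dist_triangle[of a x y] dist_triangle[of a y x] by (intro mult_left_mono) (auto simp: dist_commute abs_le_iff)
  finally show "dist (bump a r x) (bump a r y) \<le> 2 / r * dist x y" by (simp add: dist_real_def)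
qed (use assms in simp)

text \<open>The geometric input to the asymptotics: a compact zero set, all of whose points have charts with the same index set \<open>J\<close>.\<close>

locale charted_zero_set =
  fixes F :: "real ^ 'd \<Rightarrow> real ^ 'p" and jac :: "real ^ 'd \<Rightarrow> real" and J :: "'d set"
  assumes charts: "\<And>x. F x = 0 \<Longrightarrow> \<exists>G G' \<rho> K. level_chart F jac J G G' x \<rho> K"
    and F_0: "F 0 = 0" and compact_Z: "compact {x. F x = 0}"
    and cont_F: "continuous_on UNIV F" and cont_jac: "continuous_on UNIV jac"
    and jac_pos: "\<And>x. F x = 0 \<Longrightarrow> jac x > 0"
begin

abbreviation "Z \<equiv> {x. F x = 0}"

lemma F_borel [measurable]: "F \<in> borel_measurable borel" using cont_F by (rule borel_measurable_continuous_onI)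

lemma jac_borel [measurable]: "jac \<in> borel_measurable borel" using cont_jac by (rule borel_measurable_continuous_onI)

lemma Z_borel [measurable]: "Z \<in> sets borel" by measurable

lemma surface_density_borel: "(\<lambda>x. ennreal (1 / jac x) * indicator Z x) \<in> borel_measurable borel"
  by (intro borel_measurable_times_ennreal borel_measurable_indicator Z_borel) simp

lemma ball_surface_density_borel:
  "(\<lambda>x. indicator (ball a r) x * (ennreal (1 / jac x) * indicator Z x)) \<in> borel_measurable (hausdorff_measure d)"
  unfolding measurable_cong_sets[OF sets_hausdorff_measure refl]
  by (intro borel_measurable_times_ennreal surface_density_borel borel_measurable_indicator) simp

text \<open>In a chart, the surface measure of a small ball around a zero is a weighted Lebesgue measure of a bounded open set in the tangential
  coordinates; it is finite, and positive because the set contains a box.\<close>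

lemma surface_measure_ball_finite:
  assumes "F x0 = 0"
  shows "\<exists>r>0. (\<integral>\<^sup>+x. indicator (ball x0 r) x * (ennreal (1 / jac x) * indicator Z x) \<partial>hausdorff_measure (card (- J))) < \<infinity> \<and>
    (\<integral>\<^sup>+x. indicator (ball x0 r) x * (ennreal (1 / jac x) * indicator Z x) \<partial>hausdorff_measure (card (- J))) > 0"
proof -
  obtain G G' \<rho> K where "level_chart F jac J G G' x0 \<rho> K" using charts[OF assms] by blast
  then interpret level_chart F jac J G G' x0 \<rho> K .
  let ?f = "\<lambda>u. ennreal (w (H u)) * indicator (G ` B) u"
  have eq: "(\<integral>\<^sup>+x. indicator B x * (ennreal (1 / jac x) * indicator Z x) \<partial>hausdorff_measure (card (- J)))
      = hausdorff_plane_const (- J) * (\<integral>\<^sup>+u. ?f u \<partial>coord_lborel (- J))"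
  proof -
    have "indicator B \<in> borel_measurable borel" by (rule borel_measurable_indicator) simp
    from nn_integral_surface[OF this] show ?thesis using H_in_B by simp
  qed
  obtain Cw where Cw: "Cw \<ge> 0" "\<And>x. x \<in> B \<Longrightarrow> \<bar>w x\<bar> \<le> Cw" using bounded_lipschitzE[OF w_bounded_lipschitz] by metis
  let ?S = "{z :: real ^ 'd. \<forall>i\<in>- J. - (K * \<rho>) < z $ i \<and> z $ i < K * \<rho>}"
  have GS: "u \<in> ?S" if u: "u \<in> G ` B" for u
  proof -
    have "norm u = dist (G (H u)) (G x0)" using GH[OF u] G_x0 by simp
    also have "\<dots> \<le> K * dist (H u) x0" using bilip(2)[OF H_in_B, of x0 u] rho by simp
    also have "\<dots> < K * \<rho>" using H_in_B[of u] K by (simp add: dist_commute)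
    finally have "norm u < K * \<rho>" .
    then have "\<bar>u $ i\<bar> < K * \<rho>" for i using component_le_norm_cart[of u i] by simp
    then show ?thesis by (simp add: abs_less_iff minus_less_iff)
  qed
  have "(\<integral>\<^sup>+u. ?f u \<partial>coord_lborel (- J)) \<le> (\<integral>\<^sup>+u. ennreal Cw * indicator ?S u \<partial>coord_lborel (- J))"
  proof (rule nn_integral_mono)
    fix u
    show "?f u \<le> ennreal Cw * indicator ?S u"
    proof (cases "u \<in> G ` B")
      case True
      then show ?thesis using GS[OF True] Cw(2)[OF H_in_B, of u] by (auto intro!: ennreal_leI split: split_indicator)
    qed simp
  qed
  also have "\<dots> = ennreal Cw * ennreal ((2 * (K * \<rho>)) ^ card (- J))"
    using K rho by (subst nn_integral_cmult_indicator) (simp, subst emeasure_coord_lborel_cube, simp_all)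
  also have "\<dots> < \<infinity>" by (simp add: ennreal_mult_less_top)
  finally have fin: "(\<integral>\<^sup>+u. ?f u \<partial>coord_lborel (- J)) < \<infinity>" .
  have pos: "(\<integral>\<^sup>+u. ?f u \<partial>coord_lborel (- J)) \<noteq> 0"
  proof
    assume "(\<integral>\<^sup>+u. ?f u \<partial>coord_lborel (- J)) = 0"
    then have "AE u in coord_lborel (- J). ?f u = 0" by (subst (asm) nn_integral_0_iff_AE) auto
    then have ae: "AE u in coord_lborel (- J). u \<notin> G ` B"
    proof (rule AE_mp, intro AE_I2 impI)
      fix u assume "?f u = 0"
      then show "u \<notin> G ` B" using w_pos[OF H_in_B, of u] by (auto simp: indicator_def split: if_splits)
    qed
    have null: "emeasure (coord_lborel (- J)) (G ` B) = 0"
      using ae by (subst (asm) AE_iff_measurable[OF _ refl]) auto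
    have "0 \<in> G ` B" using G_x0 rho by force
    then obtain d where d: "d > 0" "ball 0 d \<subseteq> G ` B" using open_GB openE by blast
    define e where "e = d / (2 * real CARD('d))"
    have e: "e > 0" using d by (simp add: e_def)
    let ?T = "{z :: real ^ 'd. \<forall>i\<in>- J. 0 < z $ i \<and> z $ i < e}"
    have T: "coord_proj (- J) -` ?T \<subseteq> coord_proj (- J) -` (G ` B)"
    proof
      fix z assume z: "z \<in> coord_proj (- J) -` ?T"
      have "norm (coord_proj (- J) z) \<le> (\<Sum>i\<in>UNIV. \<bar>coord_proj (- J) z $ i\<bar>)" by (rule norm_le_l1_cart)
      also have "\<dots> \<le> (\<Sum>i\<in>(UNIV :: 'd set). e)"
      proof (rule sum_mono)
        fix i show "\<bar>coord_proj (- J) z $ i\<bar> \<le> e"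
        proof (cases "i \<in> - J")
          case True
          then have "0 < z $ i \<and> z $ i < e" using z by simp
          with True show ?thesis by simp
        qed (use e in simp)
      qed
      also have "\<dots> = d / 2" by (simp add: e_def)
      finally show "z \<in> coord_proj (- J) -` (G ` B)" using d by (intro vimageI2 subsetD[OF d(2)]) simp
    qed
    have pm: "coord_proj (- J) -` A \<in> sets (coord_lborel (- J))" if "A \<in> sets borel" for A
      using measurable_sets[OF borel_measurable_coord_proj that] by simp
    have "emeasure (coord_lborel (- J)) (coord_proj (- J) -` ?T) \<le> emeasure (coord_lborel (- J)) (coord_proj (- J) -` (G ` B))"
      by (rule emeasure_mono[OF T pm[OF GB_borel]])
    then have "emeasure (coord_lborel (- J)) ?T \<le> 0"
      using null by (simp add: emeasure_coord_lborel_proj)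
    moreover have "emeasure (coord_lborel (- J)) ?T = ennreal (e ^ card (- J))"
      using e by (subst emeasure_coord_lborel_box) auto
    ultimately show False using zero_less_power[OF e, of "card (- J)"] e by (simp add: ennreal_eq_0_iff not_le)
  qed
  show ?thesis
    using rho fin pos hausdorff_plane_const(1,2)[of "- J"] unfolding eq[symmetric]
    by (intro exI[of _ \<rho>]) (simp add: eq ennreal_mult_less_top ennreal_zero_less_mult_iff zero_less_iff_neq_zero)
qed

lemma surface_integral_finite: "(\<integral>\<^sup>+x. ennreal (1 / jac x) * indicator Z x \<partial>hausdorff_measure (card (- J))) < \<infinity>"
proof -
  let ?H = "hausdorff_measure (card (- J)) :: (real ^ 'd) measure"
  let ?I = "\<lambda>x r. \<integral>\<^sup>+y. indicator (ball x r) y * (ennreal (1 / jac y) * indicator Z y) \<partial>?H"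
  have "\<forall>x\<in>Z. \<exists>r. r > 0 \<and> ?I x r < \<infinity>"
  proof
    fix x assume "x \<in> Z"
    then have "F x = 0" by simp
    from surface_measure_ball_finite[OF this] obtain r where "r > 0" "?I x r < \<infinity>" by (elim exE conjE)
    then show "\<exists>r. r > 0 \<and> ?I x r < \<infinity>" by (intro exI conjI)
  qed
  from bchoice[OF this] obtain r where r': "\<forall>x\<in>Z. r x > 0 \<and> ?I x (r x) < \<infinity>" ..
  then have r: "r x > 0" "?I x (r x) < \<infinity>" if "F x = 0" for x using that by simp_all
  have "Z \<subseteq> (\<Union>x\<in>Z. ball x (r x))" using r(1) by auto
  then obtain X where X: "X \<subseteq> Z" "finite X" "Z \<subseteq> (\<Union>x\<in>X. ball x (r x))"
    using compactE_image[OF compact_Z, of Z "\<lambda>x. ball x (r x)"] by auto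
  have "(\<integral>\<^sup>+y. ennreal (1 / jac y) * indicator Z y \<partial>?H)
      \<le> (\<integral>\<^sup>+y. (\<Sum>x\<in>X. indicator (ball x (r x)) y * (ennreal (1 / jac y) * indicator Z y)) \<partial>?H)"
  proof (rule nn_integral_mono)
    fix y
    show "ennreal (1 / jac y) * indicator Z y \<le> (\<Sum>x\<in>X. indicator (ball x (r x)) y * (ennreal (1 / jac y) * indicator Z y))"
    proof (cases "y \<in> Z")
      case True
      then obtain x where x: "x \<in> X" "y \<in> ball x (r x)" using X(3) by blast
      then have "ennreal (1 / jac y) * indicator Z y = indicator (ball x (r x)) y * (ennreal (1 / jac y) * indicator Z y)" by simp
      also have "\<dots> \<le> (\<Sum>x\<in>X. indicator (ball x (r x)) y * (ennreal (1 / jac y) * indicator Z y))"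
        using X(2) x(1) by (intro member_le_sum) auto
      finally show ?thesis .
    qed simp
  qed
  also have "\<dots> = (\<Sum>x\<in>X. \<integral>\<^sup>+y. indicator (ball x (r x)) y * (ennreal (1 / jac y) * indicator Z y) \<partial>?H)"
    by (rule nn_integral_sum) (rule ball_surface_density_borel)
  also have "\<dots> < \<infinity>" using X r(2) by (subst infinity_ennreal_def, subst ennreal_sum_less_top) auto
  finally show ?thesis .
qed

text \<open>Finiteness: \<open>\<Psi>\<close> is bounded on the compact set \<open>Z\<close>. Positivity: the integrand is positive on \<open>Z\<close>,
  and \<open>Z\<close> has positive measure near its point \<open>0\<close>.\<close>

lemma surface_integral_weight:
  assumes c: "continuous_on UNIV \<Psi>" and nn: "\<And>x. 0 \<le> \<Psi> x" and pos: "\<And>x. F x = 0 \<Longrightarrow> \<Psi> x > 0"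
  shows "0 < (\<integral>\<^sup>+x. ennreal (\<Psi> x) * (ennreal (1 / jac x) * indicator Z x) \<partial>hausdorff_measure (card (- J)))"
    "(\<integral>\<^sup>+x. ennreal (\<Psi> x) * (ennreal (1 / jac x) * indicator Z x) \<partial>hausdorff_measure (card (- J))) < \<infinity>"
proof -
  let ?H = "hausdorff_measure (card (- J)) :: (real ^ 'd) measure"
  have [measurable]: "\<Psi> \<in> borel_measurable borel" using c by (rule borel_measurable_continuous_onI)
  have "Z \<noteq> {}" using F_0 by auto
  then obtain M where M: "M \<in> Z" "\<And>x. x \<in> Z \<Longrightarrow> \<Psi> x \<le> \<Psi> M"
    using continuous_attains_sup[OF compact_Z, of \<Psi>] continuous_on_subset[OF c] by auto
  have "(\<integral>\<^sup>+x. ennreal (\<Psi> x) * (ennreal (1 / jac x) * indicator Z x) \<partial>?H) \<le> (\<integral>\<^sup>+x. ennreal (\<Psi> M) * (ennreal (1 / jac x) * indicator Z x) \<partial>?H)"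
  proof (rule nn_integral_mono)
    fix x show "ennreal (\<Psi> x) * (ennreal (1 / jac x) * indicator Z x) \<le> ennreal (\<Psi> M) * (ennreal (1 / jac x) * indicator Z x)"
      using M(2)[of x] by (cases "x \<in> Z") (auto intro!: mult_right_mono ennreal_leI)
  qed
  also have "\<dots> = ennreal (\<Psi> M) * (\<integral>\<^sup>+x. ennreal (1 / jac x) * indicator Z x \<partial>?H)" by (rule nn_integral_cmult) measurable
  also have "\<dots> < \<infinity>" using surface_integral_finite by (simp add: ennreal_mult_less_top)
  finally show "(\<integral>\<^sup>+x. ennreal (\<Psi> x) * (ennreal (1 / jac x) * indicator Z x) \<partial>?H) < \<infinity>" .
  have "(\<integral>\<^sup>+x. ennreal (\<Psi> x) * (ennreal (1 / jac x) * indicator Z x) \<partial>?H) \<noteq> 0"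
  proof
    assume "(\<integral>\<^sup>+x. ennreal (\<Psi> x) * (ennreal (1 / jac x) * indicator Z x) \<partial>?H) = 0"
    then have "AE x in ?H. ennreal (\<Psi> x) * (ennreal (1 / jac x) * indicator Z x) = 0"
      by (subst (asm) nn_integral_0_iff_AE) auto
    then have ae: "AE x in ?H. x \<notin> Z"
    proof (rule AE_mp, intro AE_I2 impI)
      fix x assume 0: "ennreal (\<Psi> x) * (ennreal (1 / jac x) * indicator Z x) = 0"
      show "x \<notin> Z"
      proof
        assume x: "x \<in> Z"
        then show False using 0 pos[of x] jac_pos[of x] by (auto simp: ennreal_eq_0_iff)
      qed
    qed
    obtain r where r: "(\<integral>\<^sup>+x. indicator (ball 0 r) x * (ennreal (1 / jac x) * indicator Z x) \<partial>?H) > 0"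
      using surface_measure_ball_finite[OF F_0] by blast
    have "(\<integral>\<^sup>+x. indicator (ball 0 r) x * (ennreal (1 / jac x) * indicator Z x) \<partial>?H) = 0"
      using ae by (subst nn_integral_0_iff_AE[OF ball_surface_density_borel]) auto
    then show False using r by simp
  qed
  then show "0 < (\<integral>\<^sup>+x. ennreal (\<Psi> x) * (ennreal (1 / jac x) * indicator Z x) \<partial>?H)" by (simp add: zero_less_iff_neq_zero)
qed

definition couplable :: "nat \<Rightarrow> (real ^ 'd \<Rightarrow> real) \<Rightarrow> bool" where
  "couplable k h \<longleftrightarrow> (\<exists>C\<ge>0. \<forall>s\<in>{0<..1}. \<exists>\<kappa>. layer_coupling F jac J k h C s \<kappa>)"

lemma couplable_0: "couplable k (\<lambda>_. 0)"
proof -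
  have "layer_coupling F jac J k (\<lambda>_. 0) 0 s (null_measure (borel \<Otimes>\<^sub>M borel))" for s
    by (simp add: layer_coupling_def)
  then show ?thesis unfolding couplable_def by (intro exI[of _ 0]) auto
qed

lemma couplable_add:
  assumes "couplable k h1" "couplable k h2" "\<And>x. 0 \<le> h1 x" "\<And>x. 0 \<le> h2 x"
    "h1 \<in> borel_measurable borel" "h2 \<in> borel_measurable borel"
  shows "couplable k (\<lambda>x. h1 x + h2 x)"
proof -
  obtain C1 where C1: "C1 \<ge> 0" "\<And>s. s \<in> {0<..1} \<Longrightarrow> \<exists>\<kappa>. layer_coupling F jac J k h1 C1 s \<kappa>"
    using assms(1) unfolding couplable_def by blast
  obtain C2 where C2: "C2 \<ge> 0" "\<And>s. s \<in> {0<..1} \<Longrightarrow> \<exists>\<kappa>. layer_coupling F jac J k h2 C2 s \<kappa>"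
    using assms(2) unfolding couplable_def by blast
  have "\<exists>\<kappa>. layer_coupling F jac J k (\<lambda>x. h1 x + h2 x) (C1 + C2) s \<kappa>" if s: "s \<in> {0<..1}" for s
  proof -
    obtain \<kappa>1 \<kappa>2 where "layer_coupling F jac J k h1 C1 s \<kappa>1" "layer_coupling F jac J k h2 C2 s \<kappa>2"
      using C1(2)[OF s] C2(2)[OF s] by blast
    then have "layer_coupling F jac J k (\<lambda>x. h1 x + h2 x) (C1 + C2) s (add_measure \<kappa>1 \<kappa>2)"
      using s assms C1(1) C2(1) by (intro layer_coupling_add) auto
    then show ?thesis by blast
  qed
  then show ?thesis unfolding couplable_def using C1(1) C2(1) by (intro exI[of _ "C1 + C2"]) auto
qed

lemma couplable_local:
  assumes k: "k \<ge> 1" and x: "F x = 0"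
  shows "\<exists>r>0. \<forall>h. (\<forall>y. 0 \<le> h y) \<longrightarrow> locally_lipschitz h \<longrightarrow> (\<forall>y. y \<notin> ball x r \<longrightarrow> h y = 0) \<longrightarrow> couplable k h"
proof -
  obtain G G' \<rho> K where lc: "level_chart F jac J G G' x \<rho> K" using charts[OF x] by blast
  show ?thesis
  proof (rule level_chart.local_coupling[OF lc k])
    fix r assume r: "0 < r" "r \<le> \<rho>"
      and *: "\<And>h. (\<And>x. 0 \<le> h x) \<Longrightarrow> h \<in> borel_measurable borel \<Longrightarrow> bounded_lipschitz (ball x \<rho>) h \<Longrightarrow>
        (\<And>y. y \<notin> ball x r \<Longrightarrow> h y = 0) \<Longrightarrow> \<exists>C\<ge>0. \<forall>s\<in>{0<..1}. \<exists>\<kappa>. layer_coupling F jac J k h C s \<kappa>"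
    show ?thesis
    proof (intro exI[of _ r] conjI allI impI r(1))
      fix h assume h: "\<forall>y. 0 \<le> h y" "locally_lipschitz h" "\<forall>y. y \<notin> ball x r \<longrightarrow> h y = 0"
      show "couplable k h"
        unfolding couplable_def by (rule *) (use h locally_lipschitz_borel in \<open>auto simp: locally_lipschitz_def\<close>)
    qed
  qed
qed

text \<open>Finitely many chart balls cover \<open>Z\<close>. With the bump functions \<open>b i\<close> of these balls, the product of all
  \<open>1 - b i\<close> vanishes near \<open>Z\<close>, and expanding \<open>\<phi> = 1 - (\<Prod>i. 1 - b i)\<close> one factor at a time decomposes \<open>\<phi> * \<Psi>\<close> into pieces
  supported in a single ball each.\<close>

lemma couplable_near_zero_set:
  assumes k: "k \<ge> 1" and \<Psi>: "\<And>x. 0 \<le> \<Psi> x" "locally_lipschitz \<Psi>"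
  obtains \<phi> U R where "open U" "Z \<subseteq> U" "locally_lipschitz \<phi>" "\<And>x. 0 \<le> \<phi> x" "\<And>x. \<phi> x \<le> 1"
    "\<And>x. x \<in> U \<Longrightarrow> \<phi> x = 1" "R \<ge> 0" "\<And>x. R \<le> norm x \<Longrightarrow> \<phi> x = 0" "couplable k (\<lambda>x. \<phi> x * \<Psi> x)"
proof -
  have "\<forall>x\<in>Z. \<exists>r>0. \<forall>h. (\<forall>y. 0 \<le> h y) \<longrightarrow> locally_lipschitz h \<longrightarrow> (\<forall>y. y \<notin> ball x r \<longrightarrow> h y = 0) \<longrightarrow> couplable k h"
    using couplable_local[OF k] by simp
  from bchoice[OF this] obtain r where r': "\<forall>x\<in>Z. r x > 0 \<and> (\<forall>h. (\<forall>y. 0 \<le> h y) \<longrightarrow> locally_lipschitz h \<longrightarrow>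
      (\<forall>y. y \<notin> ball x (r x) \<longrightarrow> h y = 0) \<longrightarrow> couplable k h)" ..
  then have r: "r x > 0" "(\<And>y. 0 \<le> h y) \<Longrightarrow> locally_lipschitz h \<Longrightarrow> (\<And>y. y \<notin> ball x (r x) \<Longrightarrow> h y = 0) \<Longrightarrow> couplable k h"
    if "F x = 0" for x h using that by simp_all
  have "\<exists>\<phi> R. locally_lipschitz \<phi> \<and> (\<forall>x. 0 \<le> \<phi> x \<and> \<phi> x \<le> 1) \<and> (\<forall>x\<in>X. \<forall>y\<in>ball x (r x / 2). \<phi> y = 1) \<and>
      R \<ge> 0 \<and> (\<forall>x. R \<le> norm x \<longrightarrow> \<phi> x = 0) \<and> couplable k (\<lambda>x. \<phi> x * \<Psi> x)" if "finite X" "X \<subseteq> Z" for X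
    using that
  proof (induction X rule: finite_induct)
    case empty
    show ?case using couplable_0 by (intro exI[of _ "\<lambda>_. 0"] exI[of _ 0]) (auto simp: locally_lipschitz_const)
  next
    case (insert a X)
    then obtain \<phi> R where \<phi>: "locally_lipschitz \<phi>" "\<And>x. 0 \<le> \<phi> x" "\<And>x. \<phi> x \<le> 1"
        "\<And>x y. x \<in> X \<Longrightarrow> y \<in> ball x (r x / 2) \<Longrightarrow> \<phi> y = 1" "R \<ge> 0" "\<And>x. R \<le> norm x \<Longrightarrow> \<phi> x = 0"
        "couplable k (\<lambda>x. \<phi> x * \<Psi> x)" by auto
    have a: "F a = 0" using insert.prems by auto
    have ra: "r a > 0" using r(1)[OF a] .
    define \<theta> where "\<theta> y = (1 + (- 1) * \<phi> y) * bump a (r a) y" for y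
    have \<theta>ll: "locally_lipschitz \<theta>"
      unfolding \<theta>_def by (intro locally_lipschitz_mult locally_lipschitz_add locally_lipschitz_const \<phi>(1) bump_locally_lipschitz ra)
    have \<theta>0: "0 \<le> \<theta> y" for y using \<phi>(3)[of y] bump_bounds[of a "r a" y] by (simp add: \<theta>_def)
    have \<theta>1: "\<phi> y + \<theta> y \<le> 1" for y
      using mult_left_mono[OF bump_bounds(2)[of a "r a" y], of "1 - \<phi> y"] \<phi>(3)[of y] by (simp add: \<theta>_def)
    have "couplable k (\<lambda>y. \<theta> y * \<Psi> y)"
      using \<theta>0 \<Psi>(1) bump_eq_0[OF ra]
      by (intro r(2)[OF a] locally_lipschitz_mult \<theta>ll \<Psi>(2)) (auto simp: \<theta>_def)
    then have "couplable k (\<lambda>y. \<phi> y * \<Psi> y + \<theta> y * \<Psi> y)"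
      using \<phi> \<theta>0 \<Psi> \<theta>ll by (intro couplable_add locally_lipschitz_borel locally_lipschitz_mult) auto
    then have c: "couplable k (\<lambda>y. (\<phi> y + \<theta> y) * \<Psi> y)" by (simp add: distrib_right)
    show ?case
    proof (intro exI[of _ "\<lambda>y. \<phi> y + \<theta> y"] exI[of _ "max R (norm a + r a)"] conjI allI ballI impI c)
      show "locally_lipschitz (\<lambda>y. \<phi> y + \<theta> y)" by (intro locally_lipschitz_add \<phi>(1) \<theta>ll)
      show "0 \<le> \<phi> y + \<theta> y" "\<phi> y + \<theta> y \<le> 1" for y using \<phi>(2)[of y] \<theta>0[of y] \<theta>1[of y] by simp_all
      show "\<phi> y + \<theta> y = 1" if "x \<in> insert a X" "y \<in> ball x (r x / 2)" for x y
      proof (cases "x = a")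
        case True
        then show ?thesis using that bump_eq_1[OF ra, of y a] by (simp add: \<theta>_def)
      next
        case False
        then show ?thesis using \<phi>(4)[of x y] that by (simp add: \<theta>_def)
      qed
      show "0 \<le> max R (norm a + r a)" using \<phi>(5) by simp
      show "\<phi> y + \<theta> y = 0" if "max R (norm a + r a) \<le> norm y" for y
      proof -
        have "norm y \<le> norm a + dist a y" by (metis dist_norm norm_minus_commute norm_triangle_sub)
        then have "y \<notin> ball a (r a)" using that by auto
        then show ?thesis using \<phi>(6)[of y] bump_eq_0[OF ra, of y a] that by (simp add: \<theta>_def)
      qed
    qed
  qed
  note ex = this
  have "Z \<subseteq> (\<Union>x\<in>Z. ball x (r x / 2))" using r(1) by auto
  then obtain X where X: "X \<subseteq> Z" "finite X" "Z \<subseteq> (\<Union>x\<in>X. ball x (r x / 2))"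
    using compactE_image[OF compact_Z, of Z "\<lambda>x. ball x (r x / 2)"] by auto
  obtain \<phi> R where \<phi>: "locally_lipschitz \<phi>" "\<And>x. 0 \<le> \<phi> x" "\<And>x. \<phi> x \<le> 1"
        "\<And>x y. x \<in> X \<Longrightarrow> y \<in> ball x (r x / 2) \<Longrightarrow> \<phi> y = 1" "R \<ge> 0" "\<And>x. R \<le> norm x \<Longrightarrow> \<phi> x = 0"
        "couplable k (\<lambda>x. \<phi> x * \<Psi> x)" using ex[OF X(2,1)] by blast
  show thesis
  proof (rule that[of "\<Union>x\<in>X. ball x (r x / 2)" \<phi> R])
    show "\<phi> x = 1" if "x \<in> (\<Union>x\<in>X. ball x (r x / 2))" for x using that \<phi>(4) by blast
  qed (use X \<phi> in auto)
qed

end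

section \<open>Rate of convergence\<close>

lemma nn_integral_finite_if_exp_tail:
  fixes g :: "real ^ 'd \<Rightarrow> real"
  assumes A: "A \<ge> 0" and c: "c > 0" and \<beta>: "\<beta> > 0"
    and near: "\<And>x. norm x \<le> R \<Longrightarrow> g x \<le> A"
    and far: "\<And>x. R \<le> norm x \<Longrightarrow> g x \<le> A * ((1 + (norm x)\<^sup>2) * exp (- c * norm x powr \<beta>))"
  shows "(\<integral>\<^sup>+x. ennreal (g x) \<partial>lborel) < \<infinity>"
proof -
  let ?e = "\<lambda>n x :: real ^ 'd. ennreal (norm x ^ n * exp (- c * norm x powr \<beta>))"
  have fin: "(\<integral>\<^sup>+x. ?e n x \<partial>lborel) < \<infinity>" for n
    using nn_integral_coord_lborel_power_exp_finite[OF c \<beta>, of "UNIV :: 'd set" n] by (simp add: coord_lborel_UNIV)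
  have "(\<integral>\<^sup>+x. ennreal (g x) \<partial>lborel)
      \<le> (\<integral>\<^sup>+x. ennreal A * indicator (cball 0 R) x + (ennreal A * ?e 0 x + ennreal A * ?e 2 x) \<partial>lborel)"
  proof (rule nn_integral_mono)
    fix x :: "real ^ 'd"
    show "ennreal (g x) \<le> ennreal A * indicator (cball 0 R) x + (ennreal A * ?e 0 x + ennreal A * ?e 2 x)"
    proof (cases "norm x \<le> R")
      case True
      then have "ennreal (g x) \<le> ennreal A * indicator (cball 0 R) x" using near by (simp add: ennreal_leI)
      then show ?thesis by (simp add: add_increasing2)
    next
      case False
      then have "ennreal (g x) \<le> ennreal (A * ((1 + (norm x)\<^sup>2) * exp (- c * norm x powr \<beta>)))"
        using far by (intro ennreal_leI) simp
      also have "A * ((1 + (norm x)\<^sup>2) * exp (- c * norm x powr \<beta>))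
          = A * (norm x ^ 0 * exp (- c * norm x powr \<beta>)) + A * (norm x ^ 2 * exp (- c * norm x powr \<beta>))"
        by (simp add: algebra_simps)
      also have "ennreal \<dots> = ennreal A * ?e 0 x + ennreal A * ?e 2 x"
        using A by (subst ennreal_plus) (simp_all add: ennreal_mult)
      finally show ?thesis by (simp add: add_increasing)
    qed
  qed
  also have "\<dots> = (\<integral>\<^sup>+x. ennreal A * indicator (cball (0 :: real ^ 'd) R) x \<partial>lborel) + ((\<integral>\<^sup>+x. ennreal A * ?e 0 x \<partial>lborel) + (\<integral>\<^sup>+x. ennreal A * ?e 2 x \<partial>lborel))"
  proof -
    have m0: "(\<lambda>x :: real ^ 'd. ennreal A * indicator (cball 0 R) x) \<in> borel_measurable lborel"
      by (intro borel_measurable_times_ennreal borel_measurable_indicator) simp_all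
    have m: "(\<lambda>x. ennreal A * ?e n x) \<in> borel_measurable lborel" for n by measurable
    show ?thesis by (subst nn_integral_add[OF m0 borel_measurable_add[OF m m]], subst nn_integral_add[OF m m]) (rule refl)
  qed
  also have "\<dots> < \<infinity>"
  proof -
    have "(\<integral>\<^sup>+x. ennreal A * indicator (cball (0 :: real ^ 'd) R) x \<partial>lborel) = ennreal A * emeasure lborel (cball (0 :: real ^ 'd) R)"
      by (rule nn_integral_cmult_indicator) simp
    moreover have "\<dots> < \<infinity>" using emeasure_lborel_cball_finite[of "0 :: real ^ 'd" R] by (simp add: ennreal_mult_less_top)
    moreover have fin': "(\<integral>\<^sup>+x. ennreal A * ?e n x \<partial>lborel) < \<infinity>" for n
      using fin[of n] by (subst nn_integral_cmult) (simp_all add: ennreal_mult_less_top)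
    ultimately show ?thesis using fin'[of 0] fin'[of 2] by (simp add: ennreal_add_less_top)
  qed
  finally show ?thesis .
qed

lemma power_over_fact_le_exp:
  assumes "(x::real) \<ge> 0" shows "x ^ n / fact n \<le> exp x"
proof -
  have s: "(\<lambda>i. x ^ i / fact i) sums exp x" using exp_converges[of x] by (simp add: divide_inverse mult.commute)
  have "(\<Sum>i\<in>{n}. x ^ i / fact i) \<le> (\<Sum>i. x ^ i / fact i)"
    using assms by (intro sum_le_suminf sums_summable[OF s]) auto
  then show ?thesis using sums_unique[OF s] by simp
qed

lemma exp_neg_inverse_power_le:
  fixes \<eta> :: real
  assumes \<eta>: "\<eta> > 0" and k: "k \<ge> 1"
  obtains C where "C \<ge> 0" "\<And>s. s \<in> {0<..1} \<Longrightarrow> exp (- ((\<eta> / s) ^ k)) \<le> C * s ^ n"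
proof
  show "0 \<le> fact n / (\<eta> ^ k) ^ n" using \<eta> by simp
  fix s :: real assume s: "s \<in> {0<..1}"
  have "s ^ k \<le> s ^ 1" using s k by (intro power_decreasing) auto
  then have "\<eta> ^ k / s \<le> (\<eta> / s) ^ k" using s \<eta> by (simp add: power_divide frac_le)
  then have "exp (- ((\<eta> / s) ^ k)) \<le> exp (- (\<eta> ^ k / s))" by simp
  also have "\<dots> = 1 / exp (\<eta> ^ k / s)" by (simp add: exp_minus divide_inverse)
  also have "\<dots> \<le> 1 / ((\<eta> ^ k / s) ^ n / fact n)"
    using s \<eta> power_over_fact_le_exp[of "\<eta> ^ k / s" n] by (intro divide_left_mono) auto
  also have "\<dots> = fact n / (\<eta> ^ k) ^ n * s ^ n" using s \<eta> by (simp add: power_divide)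
  finally show "exp (- ((\<eta> / s) ^ k)) \<le> fact n / (\<eta> ^ k) ^ n * s ^ n" .
qed

text \<open>Apply monotonicity to the nonnegative function \<open>b - f\<close> instead of \<open>f\<close>.\<close>

lemma nn_integral_le_of_dominated:
  fixes f :: "'a \<Rightarrow> real"
  assumes sets: "sets N = sets M" and le: "\<And>A. A \<in> sets M \<Longrightarrow> emeasure N A \<le> emeasure M A"
    and mass: "emeasure M (space M) \<le> emeasure N (space M) + ennreal \<tau>" and fin: "emeasure N (space M) < \<infinity>"
    and f: "f \<in> borel_measurable M" "\<And>x. 0 \<le> f x" "\<And>x. f x \<le> b" and b: "b \<ge> 0" and \<tau>: "\<tau> \<ge> 0"
  shows "(\<integral>\<^sup>+x. ennreal (f x) \<partial>M) \<le> (\<integral>\<^sup>+x. ennreal (f x) \<partial>N) + ennreal (b * \<tau>)"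
proof -
  have sp: "space N = space M" using sets by (rule sets_eq_imp_space_eq)
  have fN: "f \<in> borel_measurable N" using f(1) by (simp add: measurable_cong_sets[OF sets refl])
  have split: "(\<integral>\<^sup>+x. ennreal (f x) \<partial>L) + (\<integral>\<^sup>+x. ennreal (b - f x) \<partial>L) = ennreal b * emeasure L (space L)"
    if [measurable]: "f \<in> borel_measurable L" for L
  proof -
    have "(\<integral>\<^sup>+x. ennreal (f x) \<partial>L) + (\<integral>\<^sup>+x. ennreal (b - f x) \<partial>L) = (\<integral>\<^sup>+x. ennreal (f x) + ennreal (b - f x) \<partial>L)"
      by (rule nn_integral_add[symmetric]) measurable
    also have "\<dots> = (\<integral>\<^sup>+x. ennreal b \<partial>L)"
      using f by (intro nn_integral_cong) (simp add: ennreal_plus[symmetric] del: ennreal_plus)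
    finally show ?thesis by simp
  qed
  let ?D = "\<integral>\<^sup>+x. ennreal (b - f x) \<partial>N"
  have "?D \<le> ennreal b * emeasure N (space N)" unfolding split[OF fN, symmetric] by (simp add: add_increasing)
  also have "\<dots> < \<infinity>" using fin by (simp add: sp ennreal_mult_less_top)
  finally have D: "?D < top" by simp
  have "?D + (\<integral>\<^sup>+x. ennreal (f x) \<partial>M) \<le> (\<integral>\<^sup>+x. ennreal (b - f x) \<partial>M) + (\<integral>\<^sup>+x. ennreal (f x) \<partial>M)"
    using sets le by (intro add_right_mono nn_integral_mono_of_emeasure_mono) auto
  also have "\<dots> = ennreal b * emeasure M (space M)" unfolding split[OF f(1), symmetric] by (simp add: add.commute)
  also have "\<dots> \<le> ennreal b * (emeasure N (space N) + ennreal \<tau>)" using mass by (intro mult_left_mono) (simp_all add: sp)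
  also have "\<dots> = ?D + ((\<integral>\<^sup>+x. ennreal (f x) \<partial>N) + ennreal (b * \<tau>))"
    unfolding distrib_left split[OF fN, symmetric] using b \<tau> by (simp add: ennreal_mult ac_simps)
  finally show ?thesis using D by (auto simp: ennreal_add_left_cancel_le)
qed

context charted_zero_set
begin

text \<open>The norm of \<open>F\<close> attains a positive minimum on the compact part of the complement of \<open>U\<close>, and the growth condition takes care of the rest.\<close>

lemma norm_F_bounded_below_off_zero_set:
  assumes U: "open U" "Z \<subseteq> U" and m: "m > 0" and \<alpha>: "\<alpha> > 0"
    and growth: "\<And>x. norm x \<ge> R \<Longrightarrow> norm (F x) \<ge> m * norm x powr \<alpha>"
  obtains \<eta> where "\<eta> > 0" "\<And>x. x \<notin> U \<Longrightarrow> \<eta> \<le> norm (F x)"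
proof -
  define R1 where "R1 = max R 1"
  have out: "m \<le> norm (F x)" if "R1 \<le> norm x" for x
  proof -
    have "1 \<le> norm x powr \<alpha>" using that \<alpha> by (intro ge_one_powr_ge_zero) (auto simp: R1_def)
    then have "m * 1 \<le> m * norm x powr \<alpha>" using m by (intro mult_left_mono) auto
    also have "\<dots> \<le> norm (F x)" using that by (intro growth) (simp add: R1_def)
    finally show ?thesis by simp
  qed
  let ?T = "cball 0 R1 \<inter> - U"
  have T: "compact ?T" using U(1) by (intro compact_Int_closed) auto
  show thesis
  proof (cases "?T = {}")
    case True
    show thesis
    proof
      show "m \<le> norm (F x)" if "x \<notin> U" for x
      proof -
        have "x \<notin> cball 0 R1" using True that by blast
        then show ?thesis using out[of x] by simp
      qed
    qed (rule m)
  next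
    case False
    have "continuous_on ?T (\<lambda>x. norm (F x))" by (intro continuous_on_norm continuous_on_subset[OF cont_F]) auto
    then obtain x0 where x0: "x0 \<in> ?T" "\<And>x. x \<in> ?T \<Longrightarrow> norm (F x0) \<le> norm (F x)"
      using continuous_attains_inf[OF T False] by blast
    have "F x0 \<noteq> 0" using x0(1) U(2) by auto
    show thesis
    proof
      show "min m (norm (F x0)) > 0" using m \<open>F x0 \<noteq> 0\<close> by simp
      show "min m (norm (F x0)) \<le> norm (F x)" if "x \<notin> U" for x
        using out[of x] x0(2)[of x] that by (cases "R1 \<le> norm x") (auto simp: min_le_iff_disj not_le)
    qed
  qed
qed

text \<open>The cutoff \<open>\<phi>\<close> splits \<open>\<Psi>\<close> into a part near \<open>Z\<close>, for which there is a partial coupling \<open>\<kappa>\<close>, and a remainder of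
  exponentially small mass and moment. Thus \<open>\<kappa>\<close> partially couples \<open>\<mu>\<close> with the multiple \<open>\<nu>\<close> of the surface measure,
  both of mass at least \<open>\<beta>\<close> of order \<open>s ^ card J\<close>, with defects at most \<open>\<tau>\<close> of order \<open>s ^ (card J + 1)\<close>.\<close>

lemma wasserstein_rate:
  assumes k: "k \<ge> 1" and m: "m > 0" and \<alpha>: "\<alpha> > 0"
    and growth: "\<And>x. norm x \<ge> R \<Longrightarrow> norm (F x) \<ge> m * norm x powr \<alpha>"
    and lip: "L-lipschitz_on UNIV \<Psi>" and nn: "\<And>x. 0 \<le> \<Psi> x" and pos: "\<And>x. F x = 0 \<Longrightarrow> \<Psi> x > 0"
    and mom: "(\<integral>\<^sup>+x. ennreal ((1 + norm x) * (\<Psi> x * exp (- (norm (F x) ^ k)))) \<partial>lborel) < \<infinity>"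
  shows "\<exists>A\<ge>0. \<exists>s0>0. \<forall>s\<in>{0<..<s0}.
    wasserstein1 (normalized lborel (\<lambda>x. ennreal (\<Psi> x * exp (- ((norm (F x) / s) ^ k)))))
      (normalized (hausdorff_measure (card (- J))) (\<lambda>x. ennreal (\<Psi> x) * (ennreal (1 / jac x) * indicator Z x)))
    \<le> ennreal (A * s)"
proof -
  have ll: "locally_lipschitz \<Psi>" using lip by (rule lipschitz_imp_locally_lipschitz)
  have \<Psi>m [measurable]: "\<Psi> \<in> borel_measurable borel" by (rule locally_lipschitz_borel[OF ll])
  obtain \<phi> U R1 where U: "open U" "Z \<subseteq> U" and \<phi>ll: "locally_lipschitz \<phi>" and \<phi>: "\<And>x. 0 \<le> \<phi> x" "\<And>x. \<phi> x \<le> 1"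
    "\<And>x. x \<in> U \<Longrightarrow> \<phi> x = 1" and R1: "R1 \<ge> 0" "\<And>x. R1 \<le> norm x \<Longrightarrow> \<phi> x = 0" and coup: "couplable k (\<lambda>x. \<phi> x * \<Psi> x)"
    by (rule couplable_near_zero_set[OF k nn ll]) (rule that)
  have \<phi>m [measurable]: "\<phi> \<in> borel_measurable borel" by (rule locally_lipschitz_borel[OF \<phi>ll])
  obtain C where C: "C \<ge> 0" "\<And>s. s \<in> {0<..1} \<Longrightarrow> \<exists>\<kappa>. layer_coupling F jac J k (\<lambda>x. \<phi> x * \<Psi> x) C s \<kappa>"
    using coup[unfolded couplable_def] by blast
  let ?H = "hausdorff_measure (card (- J)) :: (real ^ 'd) measure" and ?q = "card J"
  let ?w0 = "\<lambda>x. ennreal (\<Psi> x) * (ennreal (1 / jac x) * indicator Z x)"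
  have w0m: "?w0 \<in> borel_measurable borel" by (intro borel_measurable_times_ennreal surface_density_borel) measurable
  note [measurable] = w0m
  obtain \<eta> where \<eta>: "\<eta> > 0" "\<And>x. x \<notin> U \<Longrightarrow> \<eta> \<le> norm (F x)"
    by (rule norm_F_bounded_below_off_zero_set[where R = R, OF U m \<alpha> growth]) (assumption, rule that)
  obtain Ce where Ce: "Ce \<ge> 0" "\<And>s. s \<in> {0<..1} \<Longrightarrow> exp (- ((\<eta> / s) ^ k)) \<le> Ce * s ^ (?q + 1)"
    by (rule exp_neg_inverse_power_le[OF \<eta>(1) k]) (rule that)
  define i1 where "i1 = enn2real (\<integral>\<^sup>+x. ennreal ((1 + norm x) * (\<Psi> x * exp (- (norm (F x) ^ k)))) \<partial>lborel)"
  have i1: "(\<integral>\<^sup>+x. ennreal ((1 + norm x) * (\<Psi> x * exp (- (norm (F x) ^ k)))) \<partial>lborel) = ennreal i1" "i1 \<ge> 0"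
    using mom by (simp_all add: i1_def)
  define Cf where "Cf = exp (\<eta> ^ k) * Ce * i1"
  have Cf: "Cf \<ge> 0" using Ce i1 by (simp add: Cf_def)
  have far: "(\<integral>\<^sup>+x. ennreal ((1 + norm x) * ((1 - \<phi> x) * \<Psi> x * exp (- ((norm (F x) / s) ^ k)))) \<partial>lborel) \<le> ennreal (Cf * s ^ (?q + 1))"
    if s: "s \<in> {0<..1}" for s
  proof -
    let ?c = "exp (\<eta> ^ k) * exp (- ((\<eta> / s) ^ k))"
    have "(\<integral>\<^sup>+x. ennreal ((1 + norm x) * ((1 - \<phi> x) * \<Psi> x * exp (- ((norm (F x) / s) ^ k)))) \<partial>lborel)
        \<le> (\<integral>\<^sup>+x. ennreal ?c * ennreal ((1 + norm x) * (\<Psi> x * exp (- (norm (F x) ^ k)))) \<partial>lborel)"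
    proof (rule nn_integral_mono)
      fix x
      have "(1 + norm x) * ((1 - \<phi> x) * \<Psi> x * exp (- ((norm (F x) / s) ^ k))) \<le> ?c * ((1 + norm x) * (\<Psi> x * exp (- (norm (F x) ^ k))))"
      proof (cases "x \<in> U")
        case True
        then show ?thesis using \<phi>(3) nn[of x] by simp
      next
        case False
        have "\<eta> ^ k \<le> norm (F x) ^ k" using \<eta>(1) \<eta>(2)[OF False] by (intro power_mono) auto
        moreover have "1 \<le> 1 / s ^ k" using s by (simp add: power_le_one)
        (* One factor exp (- norm (F x) ^ k) is kept for integrability; the remaining factor is largest where norm (F x) = \<eta>. *)
        ultimately have "0 \<le> (norm (F x) ^ k - \<eta> ^ k) * (1 / s ^ k - 1)" by (intro mult_nonneg_nonneg) auto
        then have "- ((norm (F x) / s) ^ k) \<le> \<eta> ^ k + - ((\<eta> / s) ^ k) + - (norm (F x) ^ k)"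
          by (simp add: power_divide algebra_simps)
        then have "exp (- ((norm (F x) / s) ^ k)) \<le> exp (\<eta> ^ k + - ((\<eta> / s) ^ k) + - (norm (F x) ^ k))" by simp
        also have "\<dots> = ?c * exp (- (norm (F x) ^ k))" by (simp only: exp_add)
        finally have ee: "exp (- ((norm (F x) / s) ^ k)) \<le> ?c * exp (- (norm (F x) ^ k))" .
        have "(1 + norm x) * ((1 - \<phi> x) * \<Psi> x * exp (- ((norm (F x) / s) ^ k))) \<le> (1 + norm x) * (1 * \<Psi> x * (?c * exp (- (norm (F x) ^ k))))"
          using ee \<phi> nn by (intro mult_left_mono mult_mono) auto
        then show ?thesis by (simp add: mult_ac)
      qed
      then show "ennreal ((1 + norm x) * ((1 - \<phi> x) * \<Psi> x * exp (- ((norm (F x) / s) ^ k)))) \<le> ennreal ?c * ennreal ((1 + norm x) * (\<Psi> x * exp (- (norm (F x) ^ k))))"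
        using nn[of x] by (simp add: ennreal_mult'[symmetric] ennreal_leI)
    qed
    also have "\<dots> = ennreal ?c * ennreal i1" unfolding i1(1)[symmetric] by (rule nn_integral_cmult) measurable
    also have "\<dots> = ennreal (?c * i1)" by (simp add: ennreal_mult')
    also have "\<dots> \<le> ennreal (Cf * s ^ (?q + 1))"
    proof (rule ennreal_leI)
      have "exp (\<eta> ^ k) * exp (- ((\<eta> / s) ^ k)) * i1 \<le> exp (\<eta> ^ k) * (Ce * s ^ (?q + 1)) * i1"
        using Ce(2)[OF s] i1(2) by (intro mult_right_mono mult_left_mono) auto
      then show "?c * i1 \<le> Cf * s ^ (?q + 1)" by (simp add: Cf_def mult_ac)
    qed
    finally show ?thesis .
  qed
  define nm where "nm = enn2real (normal_mass k J)"
  have nm: "normal_mass k J = ennreal nm" "nm > 0"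
    using normal_mass_finite[OF k, of J] normal_mass_pos[of k J] by (simp_all add: nm_def enn2real_positive_iff)
  define c0 where "c0 = enn2real (hausdorff_plane_const (- J))"
  have c0: "hausdorff_plane_const (- J) = ennreal c0" "c0 > 0"
    using hausdorff_plane_const(1,2)[of "- J"] by (simp_all add: c0_def enn2real_positive_iff)
  have Psi_cont: "continuous_on UNIV \<Psi>" using ll by (rule locally_lipschitz_continuous)
  note Sf = surface_integral_weight[OF Psi_cont nn pos]
  define S where "S = enn2real (\<integral>\<^sup>+x. ?w0 x \<partial>?H)"
  have S: "(\<integral>\<^sup>+x. ?w0 x \<partial>?H) = ennreal S" "S > 0" using Sf by (simp_all add: S_def enn2real_positive_iff)
  define g where "g = nm / c0"
  have g: "g > 0" using nm c0 by (simp add: g_def)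
  define T where "T = (1 + R1) * C + Cf + C"
  have T: "T \<ge> 0" "C \<le> T" "Cf \<le> T" "C + Cf \<le> T" "(1 + R1) * C + Cf \<le> T" "(1 + R1) * C \<le> T"
    using C(1) Cf R1(1) by (auto simp: T_def)
  (* 2 * \<beta> will be the mass of \<nu>; below s0 the defect \<tau> is at most \<beta>, so that \<mu> has mass at least \<beta> as well. *)
  define s0 where "s0 = min 1 (g * S / (2 * (T + 1)))"
  have s0: "s0 > 0" using g S T by (simp add: s0_def)
  define K where "K = 3 * (1 + R1) + 1"
  have K: "K \<ge> 0" using R1 by (simp add: K_def)
  have main: "wasserstein1 (normalized lborel (\<lambda>x. ennreal (\<Psi> x * exp (- ((norm (F x) / s) ^ k))))) (normalized ?H ?w0)
      \<le> ennreal ((2 * K + 3) * T / (g * S / 2) * s)" if s': "s \<in> {0<..<s0}" for s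
  proof -
    have s: "0 < s" "s \<le> 1" "s \<in> {0<..1}" using s' by (auto simp: s0_def)
    have sT: "T * s \<le> g * S / 2"
    proof -
      have "T * s \<le> (T + 1) * (g * S / (2 * (T + 1)))" using s' T by (intro mult_mono) (auto simp: s0_def)
      also have "\<dots> = g * S / 2" using T(1) by (simp add: divide_simps)
      finally show ?thesis .
    qed
    obtain \<kappa> where lc: "layer_coupling F jac J k (\<lambda>x. \<phi> x * \<Psi> x) C s \<kappa>" using C(2)[OF s(3)] by blast
    let ?e = "\<lambda>x. exp (- ((norm (F x) / s) ^ k))"
    define \<tau> where "\<tau> = T * s ^ (?q + 1)"
    define \<beta> where "\<beta> = g * S / 2 * s ^ ?q"
    have \<tau>0: "\<tau> \<ge> 0" using T s by (simp add: \<tau>_def)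
    have \<beta>0: "\<beta> > 0" using g S s by (simp add: \<beta>_def)
    have \<tau>\<beta>: "\<tau> \<le> \<beta>" using mult_right_mono[OF sT, of "s ^ ?q"] s by (simp add: \<tau>_def \<beta>_def mult_ac)
    have Cs: "D * s ^ (?q + 1) \<le> \<tau>" if "D \<le> T" for D using that s by (simp add: \<tau>_def mult_right_mono)
    note lcD = lc[unfolded layer_coupling_def]
    note lc1 = bspec[OF lcD[THEN conjunct2, THEN conjunct1]]
      and lc2 = bspec[OF lcD[THEN conjunct2, THEN conjunct2, THEN conjunct1]]
      and lc3 = lcD[THEN conjunct2, THEN conjunct2, THEN conjunct2, THEN conjunct1]
      and lc4 = lcD[THEN conjunct2, THEN conjunct2, THEN conjunct2, THEN conjunct2, THEN conjunct1]
      and lc5 = lcD[THEN conjunct2, THEN conjunct2, THEN conjunct2, THEN conjunct2, THEN conjunct2]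
    have \<kappa>s: "sets \<kappa> = sets (borel \<Otimes>\<^sub>M borel)" by (rule lcD[THEN conjunct1])
    note [measurable_cong] = \<kappa>s
    have sp\<kappa>: "space \<kappa> = UNIV" using sets_eq_imp_space_eq[OF \<kappa>s] by (simp add: space_pair_measure)
    define \<mu> where "\<mu> = density lborel (\<lambda>x. ennreal (\<Psi> x * ?e x))"
    define \<mu>1 where "\<mu>1 = density lborel (\<lambda>x. ennreal (\<phi> x * \<Psi> x * ?e x))"
    define \<nu> where "\<nu> = density ?H (\<lambda>x. ennreal (g * s ^ ?q) * ?w0 x)"
    have sets: "sets \<mu> = sets borel" "sets \<mu>1 = sets borel" "sets \<nu> = sets borel" by (simp_all add: \<mu>_def \<mu>1_def \<nu>_def)
    have sp: "space \<mu> = UNIV" "space \<mu>1 = UNIV" "space \<nu> = UNIV" by (simp_all add: \<mu>_def \<mu>1_def \<nu>_def)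
    have w0A: "(\<lambda>x. ?w0 x * indicator A x) \<in> borel_measurable ?H" if "A \<in> sets borel" for A
      unfolding measurable_cong_sets[OF sets_hausdorff_measure refl]
      using that by (intro borel_measurable_times_ennreal w0m borel_measurable_indicator)
    have \<nu>A: "emeasure \<nu> A = ennreal (g * s ^ ?q) * (\<integral>\<^sup>+x. ?w0 x * indicator A x \<partial>?H)" if A: "A \<in> sets borel" for A
    proof -
      have "(\<lambda>x. ennreal (g * s ^ ?q) * ?w0 x) \<in> borel_measurable ?H"
        unfolding measurable_cong_sets[OF sets_hausdorff_measure refl]
        by (intro borel_measurable_times_ennreal w0m) simp
      then have "emeasure \<nu> A = (\<integral>\<^sup>+x. ennreal (g * s ^ ?q) * (?w0 x * indicator A x) \<partial>?H)"
        unfolding \<nu>_def using A by (subst emeasure_density) (simp_all add: mult.assoc)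
      then show ?thesis using nn_integral_cmult[OF w0A[OF A]] by simp
    qed
    have \<nu>U: "emeasure \<nu> UNIV = ennreal (2 * \<beta>)"
      using \<nu>A[of UNIV] S g s by (simp add: ennreal_mult'[symmetric] \<beta>_def mult_ac)
    have \<phi>w0: "ennreal (\<phi> x * \<Psi> x) * indicator A x * (ennreal (1 / jac x) * indicator Z x) = ?w0 x * indicator A x" for x A
      using \<phi>(3)[of x] U(2) by (cases "x \<in> Z") (auto simp: mult_ac)
    have \<phi>w0': "ennreal (\<phi> x * \<Psi> x) * (ennreal (1 / jac x) * indicator Z x) = ?w0 x" for x
      using \<phi>w0[of x UNIV] by simp
    have hc_cancel: "ennreal (1 / c0) * (ennreal c0 * y) = y" for y
      using c0 by (simp add: mult.assoc[symmetric] ennreal_mult'[symmetric])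
    have gs: "ennreal (1 / c0) * (ennreal (s ^ ?q) * ennreal nm * y) = ennreal (g * s ^ ?q) * y" for y
    proof -
      have "ennreal (1 / c0) * (ennreal (s ^ ?q) * ennreal nm) = ennreal (g * s ^ ?q)"
        using c0 nm s by (simp add: ennreal_mult'[symmetric] g_def)
      then show ?thesis by (simp only: mult.assoc[symmetric])
    qed
    have marg1: "emeasure \<kappa> (fst -` A) \<le> emeasure \<mu>1 A" if A: "A \<in> sets borel" for A
      unfolding \<mu>1_def using A lc1[OF A] by (subst emeasure_density) (simp_all add: A)
    have \<mu>1\<mu>: "emeasure \<mu>1 A \<le> emeasure \<mu> A" if A [measurable]: "A \<in> sets borel" for A
      unfolding \<mu>_def \<mu>1_def using \<phi> nn
      by (subst (1 2) emeasure_density)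
         (auto intro!: nn_integral_mono mult_right_mono ennreal_leI mult_left_le_one_le)
    have marg2: "emeasure \<kappa> (snd -` A) \<le> emeasure \<nu> A" if A: "A \<in> sets borel" for A
    proof -
      have "ennreal c0 * emeasure \<kappa> (snd -` A) \<le> ennreal (s ^ ?q) * ennreal nm * (\<integral>\<^sup>+x. ?w0 x * indicator A x \<partial>?H)"
        using lc2[OF A] unfolding \<phi>w0 c0(1) nm(1) .
      then have "ennreal (1 / c0) * (ennreal c0 * emeasure \<kappa> (snd -` A)) \<le> ennreal (1 / c0) * (ennreal (s ^ ?q) * ennreal nm * (\<integral>\<^sup>+x. ?w0 x * indicator A x \<partial>?H))"
        by (rule mult_left_mono) simp
      then show ?thesis unfolding hc_cancel gs \<nu>A[OF A] .
    qed
    have \<mu>1U: "emeasure \<mu>1 UNIV \<le> emeasure \<kappa> UNIV + ennreal (C * s ^ (?q + 1))"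
      unfolding \<mu>1_def using lc3 by (subst emeasure_density) simp_all
    have \<nu>U': "emeasure \<nu> UNIV \<le> emeasure \<kappa> UNIV + ennreal (C * s ^ (?q + 1))"
    proof -
      have "ennreal (s ^ ?q) * ennreal nm * (\<integral>\<^sup>+x. ?w0 x \<partial>?H) \<le> ennreal c0 * (emeasure \<kappa> UNIV + ennreal (C * s ^ (?q + 1)))"
        using lc4 unfolding \<phi>w0' c0(1) nm(1) .
      then have "ennreal (1 / c0) * (ennreal (s ^ ?q) * ennreal nm * (\<integral>\<^sup>+x. ?w0 x \<partial>?H))
          \<le> ennreal (1 / c0) * (ennreal c0 * (emeasure \<kappa> UNIV + ennreal (C * s ^ (?q + 1))))"
        by (rule mult_left_mono) simp
      then show ?thesis unfolding hc_cancel gs using \<nu>A[of UNIV] by simp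
    qed
    have \<kappa>U: "emeasure \<kappa> UNIV \<le> ennreal (2 * \<beta>)" using marg2[of UNIV] \<nu>U by simp
    then have \<kappa>fin: "emeasure \<kappa> UNIV < \<infinity>" by (rule le_less_trans) simp
    have Wm [measurable]: "(\<lambda>x :: real ^ 'd. 1 + norm x) \<in> borel_measurable borel" by measurable
    let ?W = "\<lambda>x :: real ^ 'd. 1 + norm x"
    (* On the support of \<phi> the truncated weight agrees with 1 + norm x; being bounded, it turns a defect of mass into a defect of moment. *)
    let ?WB = "\<lambda>x :: real ^ 'd. min (1 + R1) (1 + norm x)"
    have WBm: "?WB \<in> borel_measurable borel" by measurable
    have split: "(\<integral>\<^sup>+x. ennreal (f x) \<partial>\<mu>) \<le> (\<integral>\<^sup>+x. ennreal (f x) \<partial>\<mu>1) + ennreal (Cf * s ^ (?q + 1))"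
      if fm [measurable]: "f \<in> borel_measurable borel" and f: "\<And>x. 0 \<le> f x" "\<And>x. f x \<le> ?W x" for f
    proof -
      have "(\<integral>\<^sup>+x. ennreal (f x) \<partial>\<mu>) = (\<integral>\<^sup>+x. ennreal (\<Psi> x * ?e x) * ennreal (f x) \<partial>lborel)"
        unfolding \<mu>_def by (rule nn_integral_density) measurable
      also have "\<dots> \<le> (\<integral>\<^sup>+x. ennreal (\<phi> x * \<Psi> x * ?e x) * ennreal (f x) + ennreal (?W x * ((1 - \<phi> x) * \<Psi> x * ?e x)) \<partial>lborel)"
      proof (rule nn_integral_mono)
        fix x
        have "\<Psi> x * ?e x * f x = \<phi> x * \<Psi> x * ?e x * f x + f x * ((1 - \<phi> x) * \<Psi> x * ?e x)" by (simp add: algebra_simps)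
        also have "\<dots> \<le> \<phi> x * \<Psi> x * ?e x * f x + ?W x * ((1 - \<phi> x) * \<Psi> x * ?e x)"
          using f(2)[of x] \<phi>(2)[of x] nn[of x] by (intro add_left_mono mult_right_mono) auto
        finally have "ennreal (\<Psi> x * ?e x * f x) \<le> ennreal (\<phi> x * \<Psi> x * ?e x * f x + ?W x * ((1 - \<phi> x) * \<Psi> x * ?e x))"
          by (rule ennreal_leI)
        then show "ennreal (\<Psi> x * ?e x) * ennreal (f x) \<le> ennreal (\<phi> x * \<Psi> x * ?e x) * ennreal (f x) + ennreal (?W x * ((1 - \<phi> x) * \<Psi> x * ?e x))"
          using f(1)[of x] \<phi>(1,2)[of x] nn[of x] by (simp add: ennreal_mult'' ennreal_plus)
      qed
      also have "\<dots> = (\<integral>\<^sup>+x. ennreal (\<phi> x * \<Psi> x * ?e x) * ennreal (f x) \<partial>lborel) + (\<integral>\<^sup>+x. ennreal (?W x * ((1 - \<phi> x) * \<Psi> x * ?e x)) \<partial>lborel)"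
        by (rule nn_integral_add) measurable
      also have "(\<integral>\<^sup>+x. ennreal (\<phi> x * \<Psi> x * ?e x) * ennreal (f x) \<partial>lborel) = (\<integral>\<^sup>+x. ennreal (f x) \<partial>\<mu>1)"
        unfolding \<mu>1_def by (rule nn_integral_density[symmetric]) measurable
      finally show ?thesis using far[OF s(3)] by (auto intro: order_trans[OF _ add_left_mono])
    qed
    have dom: "(\<integral>\<^sup>+x. ennreal (?WB x) \<partial>M) \<le> (\<integral>\<^sup>+z. ennreal (?W (\<pi> z)) \<partial>\<kappa>) + ennreal ((1 + R1) * (C * s ^ (?q + 1)))"
      if M: "sets M = sets borel" and \<pi> [measurable]: "\<pi> \<in> borel \<Otimes>\<^sub>M borel \<rightarrow>\<^sub>M borel"
        and le: "\<And>A. A \<in> sets borel \<Longrightarrow> emeasure \<kappa> (\<pi> -` A) \<le> emeasure M A"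
        and ms: "emeasure M UNIV \<le> emeasure \<kappa> UNIV + ennreal (C * s ^ (?q + 1))" for M and \<pi> :: "_ \<Rightarrow> real ^ 'd"
    proof -
      have spM: "space M = UNIV" using sets_eq_imp_space_eq[OF M] by simp
      define N where "N = distr \<kappa> borel \<pi>"
      have NA: "emeasure N A = emeasure \<kappa> (\<pi> -` A)" if "A \<in> sets borel" for A
        unfolding N_def using that by (subst emeasure_distr) (simp_all add: sp\<kappa>)
      have "(\<integral>\<^sup>+x. ennreal (?WB x) \<partial>M) \<le> (\<integral>\<^sup>+x. ennreal (?WB x) \<partial>N) + ennreal ((1 + R1) * (C * s ^ (?q + 1)))"
      proof (rule nn_integral_le_of_dominated)
        show "sets N = sets M" by (simp add: N_def M)
        show "emeasure N A \<le> emeasure M A" if "A \<in> sets M" for A using that le NA by (simp add: M)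
        show "emeasure M (space M) \<le> emeasure N (space M) + ennreal (C * s ^ (?q + 1))" using ms by (simp add: spM NA)
        show "emeasure N (space M) < \<infinity>" using \<kappa>fin by (simp add: spM NA)
        show "?WB \<in> borel_measurable M" using WBm by (simp add: measurable_cong_sets[OF M refl])
      qed (use R1 C s in auto)
      also have "(\<integral>\<^sup>+x. ennreal (?WB x) \<partial>N) = (\<integral>\<^sup>+z. ennreal (?WB (\<pi> z)) \<partial>\<kappa>)"
        unfolding N_def by (subst nn_integral_distr) auto
      also have "\<dots> \<le> (\<integral>\<^sup>+z. ennreal (?W (\<pi> z)) \<partial>\<kappa>)" by (intro nn_integral_mono ennreal_leI) simp
      finally show ?thesis by (simp add: add_right_mono)
    qed
    have WWB1: "(\<integral>\<^sup>+x. ennreal (?W x) \<partial>\<mu>1) = (\<integral>\<^sup>+x. ennreal (?WB x) \<partial>\<mu>1)"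
    proof -
      have "(\<integral>\<^sup>+x. ennreal (?W x) \<partial>\<mu>1) = (\<integral>\<^sup>+x. ennreal (\<phi> x * \<Psi> x * ?e x) * ennreal (?W x) \<partial>lborel)"
        unfolding \<mu>1_def by (rule nn_integral_density) measurable
      also have "\<dots> = (\<integral>\<^sup>+x. ennreal (\<phi> x * \<Psi> x * ?e x) * ennreal (?WB x) \<partial>lborel)"
      proof (rule nn_integral_cong)
        fix x show "ennreal (\<phi> x * \<Psi> x * ?e x) * ennreal (?W x) = ennreal (\<phi> x * \<Psi> x * ?e x) * ennreal (?WB x)"
          using R1(2)[of x] by (cases "R1 \<le> norm x") (simp_all add: min_def)
      qed
      also have "\<dots> = (\<integral>\<^sup>+x. ennreal (?WB x) \<partial>\<mu>1)"
        unfolding \<mu>1_def using WBm by (intro nn_integral_density[symmetric]) measurable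
      finally show ?thesis .
    qed
    have WWB2: "(\<integral>\<^sup>+x. ennreal (?W x) \<partial>\<nu>) = (\<integral>\<^sup>+x. ennreal (?WB x) \<partial>\<nu>)"
    proof -
      have dm: "(\<lambda>x. ennreal (g * s ^ ?q) * ?w0 x) \<in> borel_measurable ?H"
        unfolding measurable_cong_sets[OF sets_hausdorff_measure refl]
        by (intro borel_measurable_times_ennreal w0m) simp
      have fm: "(\<lambda>x. ennreal (f x)) \<in> borel_measurable ?H" if "f \<in> borel_measurable borel" for f
        using that by (simp add: measurable_cong_sets[OF sets_hausdorff_measure refl])
      have "(\<integral>\<^sup>+x. ennreal (?W x) \<partial>\<nu>) = (\<integral>\<^sup>+x. ennreal (g * s ^ ?q) * ?w0 x * ennreal (?W x) \<partial>?H)"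
        unfolding \<nu>_def by (rule nn_integral_density[OF dm fm[OF Wm]])
      also have "\<dots> = (\<integral>\<^sup>+x. ennreal (g * s ^ ?q) * ?w0 x * ennreal (?WB x) \<partial>?H)"
      proof (rule nn_integral_cong)
        fix x
        have "norm x < R1" if "x \<in> Z" using R1(2)[of x] \<phi>(3)[of x] U(2) that by force
        then show "ennreal (g * s ^ ?q) * ?w0 x * ennreal (?W x) = ennreal (g * s ^ ?q) * ?w0 x * ennreal (?WB x)"
          by (cases "x \<in> Z") (simp_all add: min_def)
      qed
      also have "\<dots> = (\<integral>\<^sup>+x. ennreal (?WB x) \<partial>\<nu>)"
        unfolding \<nu>_def by (rule nn_integral_density[OF dm fm[OF WBm], symmetric])
      finally show ?thesis .
    qed
    have mass1: "emeasure \<mu> UNIV \<le> emeasure \<kappa> UNIV + ennreal \<tau>"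
    proof -
      have "emeasure \<mu> UNIV \<le> emeasure \<mu>1 UNIV + ennreal (Cf * s ^ (?q + 1))"
        using split[of "\<lambda>_. 1"] by (simp add: sp)
      also have "\<dots> \<le> emeasure \<kappa> UNIV + ennreal (C * s ^ (?q + 1)) + ennreal (Cf * s ^ (?q + 1))"
        by (intro add_right_mono \<mu>1U)
      also have "\<dots> = emeasure \<kappa> UNIV + ennreal ((C + Cf) * s ^ (?q + 1))"
        using C Cf s by (simp add: distrib_right ennreal_plus add.assoc)
      also have "\<dots> \<le> emeasure \<kappa> UNIV + ennreal \<tau>" by (intro add_left_mono ennreal_leI Cs T)
      finally show ?thesis .
    qed
    have mass2: "emeasure \<nu> UNIV \<le> emeasure \<kappa> UNIV + ennreal \<tau>"
      by (rule order_trans[OF \<nu>U' add_left_mono[OF ennreal_leI[OF Cs[OF T(2)]]]])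
    have moment1: "(\<integral>\<^sup>+x. ennreal (?W x) \<partial>\<mu>) \<le> (\<integral>\<^sup>+z. ennreal (?W (fst z)) \<partial>\<kappa>) + ennreal \<tau>"
    proof -
      have "(\<integral>\<^sup>+x. ennreal (?W x) \<partial>\<mu>) \<le> (\<integral>\<^sup>+x. ennreal (?WB x) \<partial>\<mu>1) + ennreal (Cf * s ^ (?q + 1))"
        unfolding WWB1[symmetric] by (rule split) auto
      also have "\<dots> \<le> (\<integral>\<^sup>+z. ennreal (?W (fst z)) \<partial>\<kappa>) + ennreal ((1 + R1) * (C * s ^ (?q + 1))) + ennreal (Cf * s ^ (?q + 1))"
        by (intro add_right_mono dom sets measurable_fst marg1 \<mu>1U)
      also have "\<dots> = (\<integral>\<^sup>+z. ennreal (?W (fst z)) \<partial>\<kappa>) + ennreal (((1 + R1) * C + Cf) * s ^ (?q + 1))"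
        using C Cf R1 s by (simp add: distrib_right[of _ Cf] ennreal_plus[symmetric] add.assoc mult.assoc del: ennreal_plus)
      also have "\<dots> \<le> (\<integral>\<^sup>+z. ennreal (?W (fst z)) \<partial>\<kappa>) + ennreal \<tau>" by (intro add_left_mono ennreal_leI Cs T)
      finally show ?thesis .
    qed
    have moment2: "(\<integral>\<^sup>+x. ennreal (?W x) \<partial>\<nu>) \<le> (\<integral>\<^sup>+z. ennreal (?W (snd z)) \<partial>\<kappa>) + ennreal \<tau>"
    proof -
      have "(\<integral>\<^sup>+x. ennreal (?W x) \<partial>\<nu>) \<le> (\<integral>\<^sup>+z. ennreal (?W (snd z)) \<partial>\<kappa>) + ennreal ((1 + R1) * (C * s ^ (?q + 1)))"
        unfolding WWB2 by (intro dom sets measurable_snd marg2 \<nu>U')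
      also have "(1 + R1) * (C * s ^ (?q + 1)) \<le> \<tau>" using Cs[OF T(6)] by (simp add: mult.assoc)
      then have "(\<integral>\<^sup>+z. ennreal (?W (snd z)) \<partial>\<kappa>) + ennreal ((1 + R1) * (C * s ^ (?q + 1))) \<le> (\<integral>\<^sup>+z. ennreal (?W (snd z)) \<partial>\<kappa>) + ennreal \<tau>"
        by (intro add_left_mono ennreal_leI)
      finally show ?thesis .
    qed
    have bounded: "(\<integral>\<^sup>+x. ennreal (?WB x) \<partial>M) \<le> ennreal (1 + R1) * emeasure M UNIV" if "sets M = sets borel" for M
    proof -
      have "space M = UNIV" using sets_eq_imp_space_eq[OF that] by simp
      moreover have "(\<integral>\<^sup>+x. ennreal (?WB x) \<partial>M) \<le> (\<integral>\<^sup>+x. ennreal (1 + R1) \<partial>M)" by (intro nn_integral_mono ennreal_leI) simp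
      ultimately show ?thesis by simp
    qed
    have upper2: "(\<integral>\<^sup>+x. ennreal (?W x) \<partial>\<nu>) \<le> ennreal (K * \<beta>)"
    proof -
      have "(\<integral>\<^sup>+x. ennreal (?W x) \<partial>\<nu>) \<le> ennreal (1 + R1) * ennreal (2 * \<beta>)"
        unfolding WWB2 \<nu>U[symmetric] by (rule bounded[OF sets(3)])
      also have "\<dots> = ennreal ((1 + R1) * (2 * \<beta>))" using R1 by (intro ennreal_mult'[symmetric]) simp
      also have "(1 + R1) * (2 * \<beta>) \<le> K * \<beta>" using R1 \<beta>0 by (simp add: K_def algebra_simps)
      then have "ennreal ((1 + R1) * (2 * \<beta>)) \<le> ennreal (K * \<beta>)" by (rule ennreal_leI)
      finally show ?thesis .
    qed
    have upper1: "(\<integral>\<^sup>+x. ennreal (?W x) \<partial>\<mu>) \<le> ennreal (K * \<beta>)"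
    proof -
      have "emeasure \<mu>1 UNIV \<le> ennreal (2 * \<beta>) + ennreal \<beta>"
        using Cs[OF T(2)] \<tau>\<beta> by (intro order_trans[OF \<mu>1U] add_mono \<kappa>U ennreal_leI) simp
      then have m3: "emeasure \<mu>1 UNIV \<le> ennreal (3 * \<beta>)" using \<beta>0 by (simp add: ennreal_plus[symmetric] del: ennreal_plus)
      have "(\<integral>\<^sup>+x. ennreal (?W x) \<partial>\<mu>) \<le> (\<integral>\<^sup>+x. ennreal (?WB x) \<partial>\<mu>1) + ennreal (Cf * s ^ (?q + 1))"
        unfolding WWB1[symmetric] by (rule split) auto
      also have "\<dots> \<le> ennreal (1 + R1) * ennreal (3 * \<beta>) + ennreal \<beta>"
        using Cs[OF T(3)] \<tau>\<beta> m3 by (intro add_mono order_trans[OF bounded[OF sets(2)]] mult_left_mono ennreal_leI) simp_all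
      also have "\<dots> = ennreal ((1 + R1) * (3 * \<beta>)) + ennreal \<beta>" using R1 by (subst ennreal_mult') simp_all
      also have "\<dots> = ennreal ((1 + R1) * (3 * \<beta>) + \<beta>)" using R1 \<beta>0 by (intro ennreal_plus[symmetric]) auto
      also have "(1 + R1) * (3 * \<beta>) + \<beta> = K * \<beta>" by (simp add: K_def algebra_simps)
      finally show ?thesis .
    qed
    have lower2: "ennreal \<beta> \<le> emeasure \<nu> UNIV" unfolding \<nu>U using \<beta>0 by (intro ennreal_leI) simp
    have lower1: "ennreal \<beta> \<le> emeasure \<mu> UNIV"
    proof -
      have "ennreal \<beta> + ennreal \<beta> \<le> emeasure \<kappa> UNIV + ennreal \<tau>"
        using mass2 \<beta>0 unfolding \<nu>U by (simp add: ennreal_plus[symmetric] del: ennreal_plus)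
      also have "\<dots> \<le> emeasure \<kappa> UNIV + ennreal \<beta>" by (intro add_left_mono ennreal_leI \<tau>\<beta>)
      finally have "ennreal \<beta> \<le> emeasure \<kappa> UNIV" by (simp add: add.commute[of "emeasure \<kappa> UNIV"] ennreal_add_left_cancel_le)
      also have "\<dots> \<le> emeasure \<mu> UNIV" using marg1[of UNIV] \<mu>1\<mu>[of UNIV] by simp
      finally show ?thesis .
    qed
    have cost: "(\<integral>\<^sup>+z. ennreal (dist (fst z) (snd z)) \<partial>\<kappa>) \<le> ennreal \<tau>"
    proof -
      have "(\<integral>\<^sup>+z. ennreal (dist (fst z) (snd z)) \<partial>\<kappa>) \<le> ennreal (C * s ^ (?q + 1))"
        by (rule lc5)
      also have "\<dots> \<le> ennreal \<tau>" by (intro ennreal_leI Cs T)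
      finally show ?thesis .
    qed
    have W: "wasserstein1 (scale_measure (1 / emeasure \<mu> UNIV) \<mu>) (scale_measure (1 / emeasure \<nu> UNIV) \<nu>)
        \<le> ennreal ((2 * K + 3) * \<tau> / \<beta>)"
      by (rule wasserstein1_le_of_subcoupling[OF sets(1,3) \<kappa>s order_trans[OF marg1 \<mu>1\<mu>] marg2 mass1 mass2 moment1 moment2 cost
            lower1 lower2 upper1 upper2 \<beta>0 \<tau>0 K])
    have n1: "normalized lborel (\<lambda>x. ennreal (\<Psi> x * ?e x)) = scale_measure (1 / emeasure \<mu> UNIV) \<mu>"
    proof -
      have "emeasure \<mu> UNIV = (\<integral>\<^sup>+x. ennreal (\<Psi> x * ?e x) \<partial>lborel)"
        unfolding \<mu>_def by (subst emeasure_density) auto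
      then show ?thesis by (simp add: normalized_def \<mu>_def)
    qed
    have n2: "normalized ?H ?w0 = scale_measure (1 / emeasure \<nu> UNIV) \<nu>"
    proof (rule measure_eqI)
      show "sets (normalized ?H ?w0) = sets (scale_measure (1 / emeasure \<nu> UNIV) \<nu>)" by (simp add: normalized_def \<nu>_def)
      fix A assume "A \<in> sets (normalized ?H ?w0)"
      then have A: "A \<in> sets borel" by (simp add: normalized_def)
      have w0H: "?w0 \<in> borel_measurable ?H" using w0m by (simp only: measurable_cong_sets[OF sets_hausdorff_measure refl])
      have gS: "g * s ^ ?q * S = 2 * \<beta>" by (simp add: \<beta>_def)
      have "emeasure (normalized ?H ?w0) A = ennreal (1 / S) * (\<integral>\<^sup>+x. ?w0 x * indicator A x \<partial>?H)"
        unfolding normalized_def S(1) using S(2) A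
        by (simp add: emeasure_density[OF w0H] divide_ennreal[symmetric])
      also have "ennreal (1 / S) = ennreal (1 / (2 * \<beta>)) * ennreal (g * s ^ ?q)"
        using g s S(2) \<beta>0 by (simp add: ennreal_mult'[symmetric] gS[symmetric])
      also have "ennreal (1 / (2 * \<beta>)) = 1 / emeasure \<nu> UNIV"
        unfolding \<nu>U using \<beta>0 by (simp add: divide_ennreal[symmetric])
      finally show "emeasure (normalized ?H ?w0) A = emeasure (scale_measure (1 / emeasure \<nu> UNIV) \<nu>) A"
        by (simp add: \<nu>A[OF A] mult.assoc)
    qed
    have "(2 * K + 3) * \<tau> / \<beta> = (2 * K + 3) * T / (g * S / 2) * s"
      using s by (simp add: \<tau>_def \<beta>_def)
    then show ?thesis using W unfolding n1 n2 by simp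
  qed
  have "(2 * K + 3) * T / (g * S / 2) \<ge> 0" using K T g S by simp
  then show ?thesis using main s0 by (intro exI[of _ "(2 * K + 3) * T / (g * S / 2)"] conjI exI[of _ s0] ballI) auto
qed

end

section \<open>The Laplace measures\<close>

text \<open>The two shapes of the Jacobian matrix lead to the same geometric situation, with \<open>J = UNIV\<close> and a finite zero set if there are more
  equations than unknowns.\<close>

lemma charted_zero_set_gen_jacobian:
  fixes F :: "real ^ 'd \<Rightarrow> real ^ 'p"
  assumes C2: "Ck_map (Suc (Suc 0)) F" and F0: "F 0 = 0" and comp: "compact {x. F x = 0}"
    and nz: "\<And>x. F x = 0 \<Longrightarrow> gen_jacobian F x \<noteq> 0"
  obtains J where "card (- J) = CARD('d) - min CARD('d) CARD('p)" "charted_zero_set F (gen_jacobian F) J"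
proof -
  have cF: "continuous_on UNIV F"
    using C2 by (intro differentiable_imp_continuous_on) (auto simp: differentiable_on_def intro: differentiable_at_withinI)
  have cJ: "continuous_on UNIV (gen_jacobian F)" by (rule continuous_on_gen_jacobian[OF C2])
  have pos: "gen_jacobian F x > 0" if "adapted_frame J E (jacobian F (at x)) R" "F x = 0" for J E R x
  proof -
    have "gen_jacobian F x = \<bar>det (matrix R)\<bar>" using that(1) by (simp add: adapted_frame_def gen_jacobian_eq)
    then show ?thesis using nz[OF that(2)] by simp
  qed
  show thesis
  proof (cases "CARD('p) \<le> CARD('d)")
    case True
    obtain J :: "'d set" and E :: "real ^ 'p \<Rightarrow> real ^ 'd"
      where J: "card J = CARD('p)" and E: "linear E" "\<And>v. coord_proj J (E v) = E v" "\<And>v. norm (E v) = norm v"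
        and fr: "\<And>M. matrix_jacobian M \<noteq> 0 \<Longrightarrow> \<exists>R. adapted_frame J E M R"
      by (rule adapted_frame_wide[OF True]) (rule that)
    have frx: "\<exists>R. adapted_frame J E (jacobian F (at x)) R" if "F x = 0" for x
      using nz[OF that] by (intro fr) (simp add: gen_jacobian_eq)
    have jp: "gen_jacobian F x > 0" if z: "F x = 0" for x
    proof -
      obtain R where "adapted_frame J E (jacobian F (at x)) R" using frx[OF z] ..
      from pos[OF this z] show ?thesis .
    qed
    have "\<exists>G G' \<rho> K. level_chart F (gen_jacobian F) J G G' x \<rho> K" if x: "F x = 0" for x
    proof -
      obtain R0 where R0: "adapted_frame J E (jacobian F (at x)) R0" using frx[OF x] ..
      have le: "norm (E v) \<le> norm v" for v by (simp add: E(3))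
      have "(\<forall>v. norm (E v) = norm v) \<and> (\<forall>x. F x = 0 \<longrightarrow> (\<exists>R. adapted_frame J E (jacobian F (at x)) R))"
        using E(3) frx by simp
      from level_chart_exists[OF C2 x E(1,2) le R0 jp disjI1[OF this]] obtain \<rho> K G G' where "level_chart F (gen_jacobian F) J G G' x \<rho> K" by this
      then show ?thesis by (intro exI)
    qed
    then have "charted_zero_set F (gen_jacobian F) J"
      by unfold_locales (use F0 comp cF cJ jp in simp_all)
    moreover have "card (- J) = CARD('d) - min CARD('d) CARD('p)"
      using J True by (simp add: Compl_eq_Diff_UNIV card_Diff_subset)
    ultimately show thesis by (rule that[rotated])
  next
    case False
    then have gt: "CARD('d) < CARD('p)" by simp
    have chart: "(\<exists>G G' \<rho> K. level_chart F (gen_jacobian F) UNIV G G' x \<rho> K)" and jp: "gen_jacobian F x > 0" if x: "F x = 0" for x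
    proof -
      have frame: "\<exists>(E :: real ^ 'p \<Rightarrow> real ^ 'd) R. linear E \<and> (\<forall>v. norm (E v) \<le> norm v) \<and>
          (\<forall>v. norm (E (jacobian F (at x) *v v)) = norm (jacobian F (at x) *v v)) \<and> adapted_frame UNIV E (jacobian F (at x)) R"
        if "F x = 0" for x
      proof -
        have mj: "matrix_jacobian (jacobian F (at x)) \<noteq> 0" using nz[OF that] by (simp add: gen_jacobian_eq)
        obtain E :: "real ^ 'p \<Rightarrow> real ^ 'd" and R where "linear E" "\<And>v. norm (E v) \<le> norm v"
          "\<And>v. norm (E (jacobian F (at x) *v v)) = norm (jacobian F (at x) *v v)" "adapted_frame UNIV E (jacobian F (at x)) R" by (rule adapted_frame_tall[OF gt mj]) (rule that)
        then show ?thesis by (intro exI[of _ E] exI[of _ R] conjI allI)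
      qed
      have jp': "gen_jacobian F x > 0" if z: "F x = 0" for x
      proof -
        obtain E :: "real ^ 'p \<Rightarrow> real ^ 'd" and R where "adapted_frame UNIV E (jacobian F (at x)) R"
          using frame[OF z] by (elim exE conjE)
        from pos[OF this z] show ?thesis .
      qed
      show "gen_jacobian F x > 0" by (rule jp'[OF x])
      obtain E :: "real ^ 'p \<Rightarrow> real ^ 'd" and R where E: "linear E" and le: "\<forall>v. norm (E v) \<le> norm v"
        and eq: "\<forall>v. norm (E (jacobian F (at x) *v v)) = norm (jacobian F (at x) *v v)"
        and R: "adapted_frame UNIV E (jacobian F (at x)) R" using frame[OF x] by (elim exE conjE)
      have PU: "coord_proj UNIV (E v) = E v" for v by (simp add: coord_proj_def vec_eq_iff)
      from eq have "(UNIV :: 'd set) = UNIV \<and> (\<forall>v. norm (E (jacobian F (at x) *v v)) = norm (jacobian F (at x) *v v))" by simp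
      from level_chart_exists[OF C2 x E PU le[rule_format] R jp' disjI2[OF this]]
      obtain \<rho> K G G' where "level_chart F (gen_jacobian F) UNIV G G' x \<rho> K" by this
      then show "\<exists>G G' \<rho> K. level_chart F (gen_jacobian F) UNIV G G' x \<rho> K" by (intro exI)
    qed
    then have "charted_zero_set F (gen_jacobian F) UNIV"
      by unfold_locales (use F0 comp cF cJ jp in simp_all)
    moreover have "card (- (UNIV :: 'd set)) = CARD('d) - min CARD('d) CARD('p)" using gt by simp
    ultimately show thesis by (rule that[rotated])
  qed
qed

lemma compact_zero_set:
  fixes F :: "real ^ 'd \<Rightarrow> real ^ 'p"
  assumes c: "continuous_on UNIV F" and m: "m > 0"
    and growth: "\<And>x. norm x \<ge> R \<Longrightarrow> norm (F x) \<ge> m * norm x powr \<alpha>"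
  shows "compact {x. F x = 0}"
proof -
  have "norm x \<le> max R 0" if "F x = 0" for x
  proof (rule ccontr)
    assume "\<not> norm x \<le> max R 0"
    then have "norm x \<ge> R" "norm x > 0" by auto
    then have "m * norm x powr \<alpha> > 0" "m * norm x powr \<alpha> \<le> 0" using m growth[of x] that by auto
    then show False by simp
  qed
  then have "bounded {x. F x = 0}" by (intro boundedI[of _ "max R 0"]) auto
  moreover have "closed {x. F x = 0}" using c by (intro closed_Collect_eq continuous_intros)
  ultimately show ?thesis by (simp add: compact_eq_bounded_closed)
qed

text \<open>The growth of \<open>F\<close> gives the decay \<open>exp (- m ^ k / \<epsilon> * norm x powr (\<alpha> * k))\<close>, which the condition on \<open>c\<close> makes stronger than the
  growth of \<open>g\<close>.\<close>

lemma laplace_integral_finite: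
  fixes F :: "real ^ 'd \<Rightarrow> real ^ 'p"
  assumes k: "k \<ge> 1" and m: "m > 0" and \<alpha>: "\<alpha> > 0" and R: "R \<ge> 0"
    and growth: "\<And>x. norm x \<ge> R \<Longrightarrow> norm (F x) \<ge> m * norm x powr \<alpha>"
    and \<epsilon>: "\<epsilon> > 0" and c: "c \<ge> 0" "\<epsilon> * c < m ^ k" and A: "A \<ge> 0"
    and g: "\<And>x. 0 \<le> g x" "\<And>x. g x \<le> A * ((1 + (norm x)\<^sup>2) * exp (c * norm x powr (\<alpha> * real k)))"
  shows "(\<integral>\<^sup>+x. ennreal (g x * exp (- (norm (F x) ^ k / \<epsilon>))) \<partial>lborel) < \<infinity>"
proof -
  define B where "B = (1 + R\<^sup>2) * exp (c * R powr (\<alpha> * real k))"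
  have "1 * 1 \<le> B" unfolding B_def using c by (intro mult_mono) auto
  then have AB: "A \<le> A * B" "0 \<le> A * B" using A mult_left_mono[of 1 B A] by auto
  show ?thesis
  proof (rule nn_integral_finite_if_exp_tail)
    show "0 \<le> A * B" by (rule AB)
    show "m ^ k / \<epsilon> - c > 0" using c \<epsilon> by (simp add: field_simps)
    show "\<alpha> * real k > 0" using \<alpha> k by simp
  next
    fix x :: "real ^ 'd" assume x: "norm x \<le> R"
    have "g x * exp (- (norm (F x) ^ k / \<epsilon>)) \<le> g x * 1" using g(1)[of x] \<epsilon> by (intro mult_left_mono) auto
    also have "g x * 1 \<le> A * ((1 + (norm x)\<^sup>2) * exp (c * norm x powr (\<alpha> * real k)))" using g(2)[of x] by simp
    also have "\<dots> \<le> A * B"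
    proof -
      have "c * norm x powr (\<alpha> * real k) \<le> c * R powr (\<alpha> * real k)"
        using x c \<alpha> by (intro mult_left_mono powr_mono2) auto
      then show ?thesis
        unfolding B_def using x A by (intro mult_left_mono mult_mono add_mono power_mono) auto
    qed
    finally show "g x * exp (- (norm (F x) ^ k / \<epsilon>)) \<le> A * B" .
  next
    fix x :: "real ^ 'd" assume x: "R \<le> norm x"
    let ?t = "norm x powr (\<alpha> * real k)"
    have "(m * norm x powr \<alpha>) ^ k \<le> norm (F x) ^ k" using growth[OF x] m by (intro power_mono) auto
    moreover have "(norm x powr \<alpha>) ^ k = ?t"
      using k by (cases "x = 0") (simp_all add: powr_power mult.commute power_0_left)
    ultimately have "m ^ k * ?t \<le> norm (F x) ^ k" by (simp add: power_mult_distrib)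
    then have "m ^ k / \<epsilon> * ?t \<le> norm (F x) ^ k / \<epsilon>" using \<epsilon> by (simp add: divide_right_mono)
    then have e: "exp (- (norm (F x) ^ k / \<epsilon>)) \<le> exp (- (m ^ k / \<epsilon> * ?t))" by simp
    have "g x * exp (- (norm (F x) ^ k / \<epsilon>)) \<le> A * ((1 + (norm x)\<^sup>2) * exp (c * ?t)) * exp (- (m ^ k / \<epsilon> * ?t))"
      using e g A by (intro mult_mono) auto
    also have "\<dots> = A * ((1 + (norm x)\<^sup>2) * (exp (c * ?t) * exp (- (m ^ k / \<epsilon> * ?t))))" by (simp only: mult.assoc)
    also have "exp (c * ?t) * exp (- (m ^ k / \<epsilon> * ?t)) = exp (- (m ^ k / \<epsilon> - c) * ?t)"
      by (simp only: exp_add[symmetric]) (simp add: algebra_simps)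
    also have "A * ((1 + (norm x)\<^sup>2) * exp (- (m ^ k / \<epsilon> - c) * ?t)) \<le> A * B * ((1 + (norm x)\<^sup>2) * exp (- (m ^ k / \<epsilon> - c) * ?t))"
      by (intro mult_right_mono AB) simp
    finally show "g x * exp (- (norm (F x) ^ k / \<epsilon>)) \<le> A * B * ((1 + (norm x)\<^sup>2) * exp (- (m ^ k / \<epsilon> - c) * ?t))" .
  qed
qed

lemma nn_integral_continuous_pos:
  fixes f :: "'a::euclidean_space \<Rightarrow> real"
  assumes c: "continuous_on UNIV f" and pos: "f a > 0"
  shows "0 < (\<integral>\<^sup>+x. ennreal (f x) \<partial>lborel)"
proof (rule ccontr)
  assume "\<not> ?thesis"
  then have z: "(\<integral>\<^sup>+x. ennreal (f x) \<partial>lborel) = 0" by (simp add: not_less)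
  have [measurable]: "f \<in> borel_measurable borel" using c by (rule borel_measurable_continuous_onI)
  have "open {x. 0 < f x}" using c by (intro open_Collect_less continuous_intros)
  then have nn: "\<not> negligible {x. 0 < f x}" using pos by (intro open_not_negligible) auto
  have "AE x in lborel. ennreal (f x) = 0"
    using z by (subst (asm) nn_integral_0_iff_AE) auto
  then have "AE x in lborel. \<not> 0 < f x" by (rule AE_mp) (auto simp: ennreal_eq_0_iff)
  then have "{x \<in> space lborel. \<not> \<not> 0 < f x} \<in> null_sets lborel"
    by (subst (asm) AE_iff_null) auto
  then have "{x. 0 < f x} \<in> null_sets (completion lborel)" by (intro null_sets_completionI) simp
  then show False using nn by (simp add: negligible_iff_null_sets)
qed

theorem corollary4:
  fixes F :: "real ^ 'd \<Rightarrow> real ^ 'p"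
    and \<Psi> :: "real ^ 'd \<Rightarrow> real"
    and k :: nat
    and m \<alpha> R C\<^sub>\<Psi> :: real
  assumes "k \<ge> 1"
    and "smooth_map F"
    and "F 0 = 0"
    and "\<And>x. x \<in> F -` {0} \<Longrightarrow> gen_jacobian F x \<noteq> 0"
    and "m > 0" and "\<alpha> > 0" and "R \<ge> 0"
    and "\<And>x. norm x \<ge> R \<Longrightarrow> norm (F x) \<ge> m * norm x powr \<alpha>"
    and "continuous_on UNIV \<Psi>"
    and "\<And>x. \<Psi> x \<ge> 0"
    and "C\<^sub>\<Psi> \<ge> 0"
    and "\<And>x. \<Psi> x \<le> C\<^sub>\<Psi> * exp (C\<^sub>\<Psi> * norm x powr (\<alpha> * real k))"
    and "\<And>x. x \<in> F -` {0} \<Longrightarrow> \<Psi> x > 0"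
  shows "(\<forall>\<epsilon>\<ge>0. \<epsilon> * C\<^sub>\<Psi> < m ^ k \<longrightarrow> laplace_well_defined F \<Psi> k \<epsilon>) \<and>
    ((\<exists>L. L-lipschitz_on UNIV \<Psi>) \<longrightarrow>
      (\<forall>\<epsilon>\<ge>0. laplace_well_defined F \<Psi> k \<epsilon>) \<and>
      (\<exists>A\<^sub>2\<ge>0. \<exists>\<epsilon>0>0. \<forall>\<epsilon>\<in>{0<..<\<epsilon>0}.
         wasserstein1 (laplace_measure F \<Psi> k \<epsilon>) (laplace_measure F \<Psi> k 0)
           \<le> ennreal (A\<^sub>2 * \<epsilon> powr (1 / real k))))"
proof -
  note k = assms(1) and F0 = assms(3) and m = assms(5) and \<alpha> = assms(6) and R = assms(7) and growth = assms(8)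
    and c\<Psi> = assms(9) and nn = assms(10) and C\<Psi> = assms(11,12)
  have C2: "Ck_map (Suc (Suc 0)) F" using assms(2) by (simp only: smooth_map_def)
  have nz: "gen_jacobian F x \<noteq> 0" and pos: "\<Psi> x > 0" if "F x = 0" for x
    using that assms(4)[of x] assms(13)[of x] by simp_all
  have cF: "continuous_on UNIV F"
    using C2 by (intro differentiable_imp_continuous_on) (auto simp: differentiable_on_def intro: differentiable_at_withinI)
  obtain J where J: "card (- J) = CARD('d) - min CARD('d) CARD('p)" and ch: "charted_zero_set F (gen_jacobian F) J"
    by (rule charted_zero_set_gen_jacobian[OF C2 F0 compact_zero_set[OF cF m growth] nz]) (assumption | rule that)+
  interpret charted_zero_set F "gen_jacobian F" J by (rule ch)
  have w0: "laplace_weight F \<Psi> k 0 = (\<lambda>x. ennreal (\<Psi> x) * (ennreal (1 / gen_jacobian F x) * indicator {x. F x = 0} x))"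
    using nn by (intro ext) (simp add: laplace_weight_def indicator_def ennreal_mult'[symmetric])
  have ref0: "laplace_reference F 0 = hausdorff_measure (card (- J))" by (simp add: laplace_reference_def J)
  have wd0: "laplace_well_defined F \<Psi> k 0"
    unfolding laplace_well_defined_def normalizable_def w0 ref0
  proof (intro conjI surface_integral_weight[OF c\<Psi> nn pos])
    show "(\<lambda>x. ennreal (\<Psi> x) * (ennreal (1 / gen_jacobian F x) * indicator {x. F x = 0} x)) \<in> borel_measurable (hausdorff_measure (card (- J)))"
      unfolding measurable_cong_sets[OF sets_hausdorff_measure refl]
      using borel_measurable_continuous_onI[OF c\<Psi>] by (intro borel_measurable_times_ennreal surface_density_borel) simp
  qed
  have wd: "laplace_well_defined F \<Psi> k \<epsilon>"
    if \<epsilon>: "\<epsilon> > 0" and fin: "(\<integral>\<^sup>+x. ennreal (\<Psi> x * exp (- (norm (F x) ^ k / \<epsilon>))) \<partial>lborel) < \<infinity>" for \<epsilon>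
  proof -
    have cont: "continuous_on UNIV (\<lambda>x. \<Psi> x * exp (- (norm (F x) ^ k / \<epsilon>)))"
      using \<epsilon> by (intro continuous_intros c\<Psi> cF) simp
    have "\<Psi> 0 * exp (- (norm (F 0) ^ k / \<epsilon>)) > 0" using pos[OF F0] by simp
    from nn_integral_continuous_pos[OF cont this] show ?thesis
      using fin \<epsilon> borel_measurable_continuous_onI[OF cont]
      by (simp add: laplace_well_defined_def normalizable_def laplace_weight_def[abs_def] laplace_reference_def)
  qed
  have general: "laplace_well_defined F \<Psi> k \<epsilon>" if e: "\<epsilon> \<ge> 0" "\<epsilon> * C\<^sub>\<Psi> < m ^ k" for \<epsilon>
  proof (cases "\<epsilon> = 0")
    case False
    then have \<epsilon>: "\<epsilon> > 0" using e by simp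
    have "\<Psi> x \<le> C\<^sub>\<Psi> * ((1 + (norm x)\<^sup>2) * exp (C\<^sub>\<Psi> * norm x powr (\<alpha> * real k)))" for x
    proof -
      have "1 * exp (C\<^sub>\<Psi> * norm x powr (\<alpha> * real k)) \<le> (1 + (norm x)\<^sup>2) * exp (C\<^sub>\<Psi> * norm x powr (\<alpha> * real k))"
        by (intro mult_right_mono) auto
      from mult_left_mono[OF this C\<Psi>(1)] C\<Psi>(2)[of x] show ?thesis by simp
    qed
    then show ?thesis
      by (intro wd[OF \<epsilon>] laplace_integral_finite[OF k m \<alpha> R growth \<epsilon> C\<Psi>(1) e(2) C\<Psi>(1) nn])
  qed (use wd0 in simp)
  have lipschitz: "(\<forall>\<epsilon>\<ge>0. laplace_well_defined F \<Psi> k \<epsilon>) \<and>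
      (\<exists>A\<^sub>2\<ge>0. \<exists>\<epsilon>0>0. \<forall>\<epsilon>\<in>{0<..<\<epsilon>0}.
         wasserstein1 (laplace_measure F \<Psi> k \<epsilon>) (laplace_measure F \<Psi> k 0) \<le> ennreal (A\<^sub>2 * \<epsilon> powr (1 / real k)))"
    if L: "L-lipschitz_on UNIV \<Psi>" for L
  proof -
    have L0: "L \<ge> 0" using L by (rule lipschitz_on_nonneg)
    define A where "A = 2 * (\<Psi> 0 + L)"
    have A0: "A \<ge> 0" using L0 nn[of 0] by (simp add: A_def)
    have bound: "(1 + norm x) * \<Psi> x \<le> A * ((1 + (norm x)\<^sup>2) * exp (0 * norm x powr (\<alpha> * real k)))" for x
    proof -
      have "\<bar>\<Psi> x - \<Psi> 0\<bar> \<le> L * norm x" using lipschitz_onD[OF L, of x 0] by (simp add: dist_real_def dist_norm)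
      then have "\<Psi> x \<le> \<Psi> 0 + L * norm x" by simp
      also have "\<dots> \<le> (\<Psi> 0 + L) * (1 + norm x)" using L0 nn[of 0] by (simp add: algebra_simps)
      finally have "(1 + norm x) * \<Psi> x \<le> (1 + norm x) * ((\<Psi> 0 + L) * (1 + norm x))" by (intro mult_left_mono) auto
      also have "\<dots> = (\<Psi> 0 + L) * (1 + norm x)\<^sup>2" by (simp add: power2_eq_square)
      also have "\<dots> \<le> (\<Psi> 0 + L) * (2 * (1 + (norm x)\<^sup>2))"
      proof (rule mult_left_mono)
        show "(1 + norm x)\<^sup>2 \<le> 2 * (1 + (norm x)\<^sup>2)" using zero_le_power2[of "norm x - 1"] by (simp add: power2_eq_square algebra_simps)
      qed (use L0 nn[of 0] in simp)
      also have "\<dots> = A * ((1 + (norm x)\<^sup>2) * exp (0 * norm x powr (\<alpha> * real k)))" by (simp add: A_def algebra_simps)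
      finally show ?thesis .
    qed
    (* A Lipschitz \<Psi> grows at most linearly, so the exponential bound is used with exponent 0, for every \<epsilon>. *)
    have mom: "(\<integral>\<^sup>+x. ennreal ((1 + norm x) * \<Psi> x * exp (- (norm (F x) ^ k / \<epsilon>))) \<partial>lborel) < \<infinity>" if \<epsilon>: "\<epsilon> > 0" for \<epsilon>
      using m nn by (intro laplace_integral_finite[OF k m \<alpha> R growth \<epsilon> order_refl _ A0 _ bound]) auto
    have wdL: "laplace_well_defined F \<Psi> k \<epsilon>" if "\<epsilon> \<ge> 0" for \<epsilon>
    proof (cases "\<epsilon> = 0")
      case False
      then have \<epsilon>: "\<epsilon> > 0" using that by simp
      have "(\<integral>\<^sup>+x. ennreal (\<Psi> x * exp (- (norm (F x) ^ k / \<epsilon>))) \<partial>lborel)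
          \<le> (\<integral>\<^sup>+x. ennreal ((1 + norm x) * \<Psi> x * exp (- (norm (F x) ^ k / \<epsilon>))) \<partial>lborel)"
        using nn by (intro nn_integral_mono ennreal_leI mult_right_mono) (simp_all add: distrib_right)
      from le_less_trans[OF this mom[OF \<epsilon>]] show ?thesis by (rule wd[OF \<epsilon>])
    qed (use wd0 in simp)
    have mom1: "(\<integral>\<^sup>+x. ennreal ((1 + norm x) * (\<Psi> x * exp (- (norm (F x) ^ k)))) \<partial>lborel) < \<infinity>"
      using mom[of 1] by (simp add: mult.assoc)
    have "\<exists>A2\<ge>0. \<exists>s0>0. \<forall>s\<in>{0<..<s0}.
        wasserstein1 (normalized lborel (\<lambda>x. ennreal (\<Psi> x * exp (- ((norm (F x) / s) ^ k)))))
          (normalized (hausdorff_measure (card (- J))) (\<lambda>x. ennreal (\<Psi> x) * (ennreal (1 / gen_jacobian F x) * indicator {x. F x = 0} x)))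
        \<le> ennreal (A2 * s)"
      by (rule wasserstein_rate[where R = R, OF k m \<alpha> _ L nn _ mom1]) (erule growth, erule pos)
    then obtain A2 s0 where A2: "A2 \<ge> 0" and s0: "s0 > 0" and rate: "\<forall>s\<in>{0<..<s0}.
        wasserstein1 (normalized lborel (\<lambda>x. ennreal (\<Psi> x * exp (- ((norm (F x) / s) ^ k)))))
          (normalized (hausdorff_measure (card (- J))) (\<lambda>x. ennreal (\<Psi> x) * (ennreal (1 / gen_jacobian F x) * indicator {x. F x = 0} x)))
        \<le> ennreal (A2 * s)"
      by (elim exE conjE)
    have "wasserstein1 (laplace_measure F \<Psi> k \<epsilon>) (laplace_measure F \<Psi> k 0) \<le> ennreal (A2 * \<epsilon> powr (1 / real k))"
      if \<epsilon>: "\<epsilon> \<in> {0<..<s0 ^ k}" for \<epsilon>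
    proof -
      (* The width of the layer: (norm (F x) / s) ^ k = norm (F x) ^ k / \<epsilon>. *)
      define s where "s = \<epsilon> powr (1 / real k)"
      have s: "s > 0" using \<epsilon> by (simp add: s_def)
      have sk: "s ^ k = \<epsilon>" using \<epsilon> k by (simp add: s_def powr_power)
      have "s < s0" using \<epsilon> s0 unfolding sk[symmetric] by (intro power_less_imp_less_base[of s k s0]) auto
      then have r: "s \<in> {0<..<s0}" using s by simp
      have "laplace_measure F \<Psi> k \<epsilon> = normalized lborel (\<lambda>x. ennreal (\<Psi> x * exp (- ((norm (F x) / s) ^ k))))"
        using \<epsilon> by (simp add: laplace_measure_def laplace_reference_def laplace_weight_def[abs_def] power_divide sk)
      then show ?thesis using bspec[OF rate r] by (simp only: laplace_measure_def[of F \<Psi> k 0] w0 ref0 s_def)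
    qed
    then show ?thesis using wdL A2 s0 by (intro conjI allI impI exI[of _ A2] exI[of _ "s0 ^ k"] ballI) simp_all
  qed
  show ?thesis using general lipschitz by blast
qed

end
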